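(* Let $S$ be a $0$-reduced simplicial set with $S_0=\{x\}$. There is an isomorphism of differential graded algebras $\Lambda(S)(x,x)\cong\Omega Q_{\Delta}(S)$.
   Context: $k$ is a fixed commutative unital ring; all chains are over $k$. A simplicial set $S$ is $0$-reduced if $S_0$ is a singleton. Category $\square_c$: let $\mathbf 1$ be the category with objects $0,1$ and one non-identity morphism $0\to1$; $\mathbf 1^n$ is its $n$-fold product ($\mathbf 1^0$ is the terminal category). $\square_c$ is the subcategory of small categories with objects $\mathbf 1^n$, $n\ge0$, and morphisms generated by: co-faces $\delta^\epsilon_{j,n}:\mathbf 1^n\to\mathbf 1^{n+1}$ ($1\le j\le n+1$, $\epsilon\in\{0,1\}$) inserting $\epsilon$ in position $j$; co-degeneracies $\varepsilon_{j,n}:\mathbf 1^n\to\mathbf 1^{n-1}$ ($1\le j\le n$) deleting the $j$-th coordinate; co-connections $\gamma_{j,n}:\mathbf 1^n\to\mathbf 1^{n-1}$ ($1\le j\le n-1$) replacing $(s_j,s_{j+1})$ by $\max(s_j,s_{j+1})$. $Set_{\square_c}$ is the category of presheaves of sets on $\square_c$ (cubical sets with connections), $\square_c^n$ the presheaf represented by $\mathbf 1^n$, with (non-symmetric) monoidal structure $K\otimes K'=\mathrm{colim}_{\square^n_c\to K,\,\square^m_c\to K'}\square_c^{n+m}$. For $K\in Set_{\square_c}$ write $K_n=K(\mathbf 1^n)$ and $\partial^\epsilon_j=K(\delta^\epsilon_{j,n-1})$. The normalized chains $Q_{\square_c}(K)$ are the quotient of the complex of free $k$-modules $k[K_n]$,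 with $\partial(\sigma)=\sum_{j=1}^n(-1)^j(\partial^1_j\sigma-\partial^0_j\sigma)$, by the subcomplex generated by cells in the image of a degeneracy or a connection $K_{n-1}\to K_n$. It is monoidal: $Q_{\square_c}(K)\otimes Q_{\square_c}(K')\cong Q_{\square_c}(K\otimes K')$. Necklaces: a necklace is a simplicial set $T=\Delta^{n_1}\vee\dots\vee\Delta^{n_k}$, where the final vertex of each bead $\Delta^{n_i}$ is glued to the initial vertex of $\Delta^{n_{i+1}}$; it is in preferred form if $k=0$ (so $T=\Delta^0$) or all $n_i\ge1$. $V_T$ is its set of vertices, totally ordered by $a\preceq b$ if there is a directed path from $a$ to $b$; $\alpha_T,\omega_T$ are the first and last vertices; $J_T\subseteq V_T$ is the set of joints, i.e. initial or final vertices of beads (for $T=\Delta^0$ the unique vertex). $Nec$ is the category of necklaces in preferred form and simplicial maps preserving first and last vertices. $P(T)$ is the poset, regarded as a category, of subsets $X$ with $J_T\subseteq X\subseteq V_T$, and $P(f)(X)=f(X)$. Writing $V_T-J_T=\{y_1\prec\dots\prec y_N\}$, let $\phi_T:P(T)\cong\mathbf 1^N$ be the isomorphism whose $i$-th coordinate at $X$ is $1$ if $y_i\in X$ and $0$ otherwise; set $P_{\mathbf 1}(T)=\mathbf 1^N$ and $P_{\mathbf 1}(f)=\phi_{T'}\circ P(f)\circ\phi_T^{-1}$. This takes values in $\square_c$, and $C_{\square_c}:Nec\to Set_{\square_c}$ is $P_{\mathbf 1}$ followed by the Yoneda embedding; thus $C_{\square_c}(T)=\square_c^{|V_T-J_T|}$.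 For a simplicial set $S$ and vertices $x,y$, $\mathfrak C_{\square_c}(S)(x,y)=\mathrm{colim}_{T\to S\in(Nec\downarrow S)_{x,y}}C_{\square_c}(T)$, where $(Nec\downarrow S)_{x,y}$ is the category of maps $f:T\to S$ with $T\in Nec$, $f(\alpha_T)=x$, $f(\omega_T)=y$. Composition $\mathfrak C_{\square_c}(S)(x,y)\otimes\mathfrak C_{\square_c}(S)(y,z)\to\mathfrak C_{\square_c}(S)(x,z)$ is induced on colimits by $C_{\square_c}(T)\otimes C_{\square_c}(U)\cong C_{\square_c}(T\vee U)$. $\Lambda(S)(x,y)=Q_{\square_c}(\mathfrak C_{\square_c}(S)(x,y))$; $\Lambda(S)(x,x)$ is a dga with the product induced by composition $\Lambda(S)(x,x)\otimes\Lambda(S)(x,x)\to\Lambda(S)(x,x)$, in this (path) order. $Q_\Delta(S)$ is the dg coalgebra of normalized simplicial chains with the Alexander-Whitney coproduct $\Delta(\sigma)=\sum_{p+q=n}f^p(\sigma)\otimes l^q(\sigma)$, $\sigma\in S_n$, where $f^p$ is the front $p$-face ($[p]\to[p+q]$, $i\mapsto i$) and $l^q$ the last $q$-face ($[q]\to[p+q]$, $i\mapsto i+p$). For $S$ $0$-reduced it is counital and connected (degree $0$ part equal to $k$). Cobar construction of a connected dg coalgebra $(C,\partial,\Delta)$, free over $k$ in each degree: let $\overline C_i=C_i$ for $i>0$, $\overline C_0=0$, $(s\overline C)_i=\overline C_{i+1}$, and $\Delta(c)=c\otimes1+1\otimes c+\sum c'\otimes c''$ for $c\in\overline C$. Then $\Omega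 C$ is the tensor algebra $k\oplus s\overline C\oplus(s\overline C)^{\otimes2}\oplus\cdots$ with differential the derivation extending $D(sc)=-s\partial c+\sum(-1)^{\deg c'}sc'\otimes sc''$. *)

theory Defs
  imports "HOL-Library.FuncSet" "HOL-Library.Poly_Mapping" "HOL.Hull"
begin

section \<open>Presheaves on small concrete categories\<close>

text \<open>
  Both \<open>\<Delta>\<close> and \<open>\<square>\<^sub>c\<close> have one object for each natural number, and their morphisms are functions
  between the underlying sets of points of the objects. A category of this kind is given by the points of
  each object and the hom-sets; morphisms are extensional functions, so that equality of morphisms is
  equality in HOL, and composition is \<^const>\<open>compose\<close>.
\<close>

record 'p ccat =
  pts :: "nat \<Rightarrow> 'p set"
  hom :: "nat \<Rightarrow> nat \<Rightarrow> ('p \<Rightarrow> 'p) set"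

abbreviation idm :: "'p ccat \<Rightarrow> nat \<Rightarrow> 'p \<Rightarrow> 'p" where
  "idm C n \<equiv> restrict id (pts C n)"

text \<open>\<open>act X m n f : cells X n \<rightarrow> cells X m\<close> is the value of the presheaf \<open>X\<close> at \<open>f : m \<rightarrow> n\<close>.\<close>

record ('p, 'a) psh =
  cells :: "nat \<Rightarrow> 'a set"
  act :: "nat \<Rightarrow> nat \<Rightarrow> ('p \<Rightarrow> 'p) \<Rightarrow> 'a \<Rightarrow> 'a"

definition presheaf :: "'p ccat \<Rightarrow> ('p, 'a) psh \<Rightarrow> bool" where
  "presheaf C X \<longleftrightarrow>
    (\<forall>m n. \<forall>f\<in>hom C m n. act X m n f \<in> cells X n \<rightarrow> cells X m) \<and>
    (\<forall>n. \<forall>x\<in>cells X n. act X n n (idm C n) x = x) \<and>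
    (\<forall>l m n. \<forall>f\<in>hom C l m. \<forall>g\<in>hom C m n. \<forall>x\<in>cells X n.
      act X l n (compose (pts C l) g f) x = act X l m f (act X m n g x))"

definition psh_hom ::
    "'p ccat \<Rightarrow> ('p, 'a) psh \<Rightarrow> ('p, 'b) psh \<Rightarrow> (nat \<Rightarrow> 'a \<Rightarrow> 'b) set" where
  "psh_hom C X Y = {\<phi>. (\<forall>n. \<phi> n \<in> cells X n \<rightarrow>\<^sub>E cells Y n) \<and>
    (\<forall>m n. \<forall>f\<in>hom C m n. \<forall>x\<in>cells X n. \<phi> m (act X m n f x) = act Y m n f (\<phi> n x))}"

definition yoneda :: "'p ccat \<Rightarrow> nat \<Rightarrow> ('p, 'p \<Rightarrow> 'p) psh" where
  "yoneda C n = \<lparr>cells = (\<lambda>m. hom C m n), act = (\<lambda>l m f u. compose (pts C l) u f)\<rparr>"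

text \<open>
  The colimit, computed cellwise in sets, of a diagram of presheaves: \<open>I\<close> are the objects of the index
  category, \<open>H i j\<close> its morphisms, \<open>D i\<close> the value at \<open>i\<close> and \<open>Dm i j h n\<close> the map
  \<open>cells (D i) n \<rightarrow> cells (D j) n\<close> induced by \<open>h \<in> H i j\<close>.
\<close>

definition colim_rel ::
    "'i set \<Rightarrow> ('i \<Rightarrow> 'i \<Rightarrow> 'h set) \<Rightarrow> ('i \<Rightarrow> ('p, 'a) psh) \<Rightarrow>
     ('i \<Rightarrow> 'i \<Rightarrow> 'h \<Rightarrow> nat \<Rightarrow> 'a \<Rightarrow> 'a) \<Rightarrow> nat \<Rightarrow> (('i \<times> 'a) \<times> ('i \<times> 'a)) set" where
  "colim_rel I H D Dm n =
    {(s, t). s \<in> Sigma I (\<lambda>i. cells (D i) n) \<and> t \<in> Sigma I (\<lambda>i. cells (D i) n) \<and>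
      equivclp (\<lambda>s t. \<exists>i\<in>I. \<exists>j\<in>I. \<exists>h\<in>H i j. \<exists>a\<in>cells (D i) n.
        s = (i, a) \<and> t = (j, Dm i j h n a)) s t}"

definition colim ::
    "'i set \<Rightarrow> ('i \<Rightarrow> 'i \<Rightarrow> 'h set) \<Rightarrow> ('i \<Rightarrow> ('p, 'a) psh) \<Rightarrow>
     ('i \<Rightarrow> 'i \<Rightarrow> 'h \<Rightarrow> nat \<Rightarrow> 'a \<Rightarrow> 'a) \<Rightarrow> ('p, ('i \<times> 'a) set) psh" where
  "colim I H D Dm = \<lparr>
    cells = (\<lambda>n. Sigma I (\<lambda>i. cells (D i) n) // colim_rel I H D Dm n),
    act = (\<lambda>m n f A. \<Union>(i, a)\<in>A. colim_rel I H D Dm m `` {(i, act (D i) m n f a)})\<rparr>"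

section \<open>Simplicial sets\<close>

definition Simplex :: "nat ccat" where
  "Simplex = \<lparr>pts = (\<lambda>n. {..n}), hom = (\<lambda>m n. {f \<in> {..m} \<rightarrow>\<^sub>E {..n}. mono_on {..m} f})\<rparr>"

abbreviation simplicial_set :: "(nat, 'a) psh \<Rightarrow> bool" where
  "simplicial_set \<equiv> presheaf Simplex"

definition coface :: "nat \<Rightarrow> nat \<Rightarrow> nat \<Rightarrow> nat" where
  "coface n i = (\<lambda>v\<in>{..n - 1}. if v < i then v else Suc v)"

definition codegen :: "nat \<Rightarrow> nat \<Rightarrow> nat \<Rightarrow> nat" where
  "codegen n i = (\<lambda>v\<in>{..Suc n}. if v \<le> i then v else v - 1)"

definition vertex_cell :: "nat \<Rightarrow> nat \<Rightarrow> nat" where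
  "vertex_cell v = (\<lambda>_\<in>{..0}. v)"

section \<open>Cubical sets with connections\<close>

text \<open>
  The objects of \<open>\<one>\<^sup>n\<close> are bool lists of length \<open>n\<close>, the \<open>j\<close>-th coordinate being entry \<open>j - 1\<close> of
  the list. A functor between the posets \<open>\<one>\<^sup>m\<close>, \<open>\<one>\<^sup>n\<close> is determined by its effect on objects.
\<close>

definition cube :: "nat \<Rightarrow> bool list set" where
  "cube n = {v. length v = n}"

definition box_face :: "nat \<Rightarrow> nat \<Rightarrow> bool \<Rightarrow> bool list \<Rightarrow> bool list" where
  "box_face n j e = (\<lambda>v\<in>cube n. take (j - 1) v @ e # drop (j - 1) v)"

definition box_degen :: "nat \<Rightarrow> nat \<Rightarrow> bool list \<Rightarrow> bool list" where
  "box_degen n j = (\<lambda>v\<in>cube n. take (j - 1) v @ drop j v)"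

definition box_conn :: "nat \<Rightarrow> nat \<Rightarrow> bool list \<Rightarrow> bool list" where
  "box_conn n j = (\<lambda>v\<in>cube n. take (j - 1) v @ max (v ! (j - 1)) (v ! j) # drop (j + 1) v)"

inductive box_hom :: "nat \<Rightarrow> nat \<Rightarrow> (bool list \<Rightarrow> bool list) \<Rightarrow> bool" where
  ident: "box_hom n n (restrict id (cube n))"
| face: "1 \<le> j \<Longrightarrow> j \<le> n + 1 \<Longrightarrow> box_hom n (n + 1) (box_face n j e)"
| degen: "1 \<le> j \<Longrightarrow> j \<le> n \<Longrightarrow> box_hom n (n - 1) (box_degen n j)"
| conn: "1 \<le> j \<Longrightarrow> j \<le> n - 1 \<Longrightarrow> box_hom n (n - 1) (box_conn n j)"
| comp: "box_hom l m f \<Longrightarrow> box_hom m n g \<Longrightarrow> box_hom l n (compose (cube l) g f)"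

definition Box :: "bool list ccat" where
  "Box = \<lparr>pts = cube, hom = (\<lambda>m n. {f. box_hom m n f})\<rparr>"

text \<open>
  The monoidal structure. By the Yoneda lemma, a map \<open>\<square>\<^sub>c\<^sup>n \<rightarrow> K\<close> is given by a cell of \<open>K\<close> of
  dimension \<open>n\<close>, and a morphism from \<open>\<sigma>\<close> to \<open>\<sigma>'\<close> over \<open>K\<close> by \<open>a : \<one>\<^sup>n \<rightarrow> \<one>\<^sup>n'\<close> with \<open>K(a) \<sigma>' = \<sigma>\<close>.
\<close>

definition box_elts :: "(bool list, 'a) psh \<Rightarrow> (nat \<times> 'a) set" where
  "box_elts K = Sigma UNIV (cells K)"

definition box_elts_hom ::
    "(bool list, 'a) psh \<Rightarrow> nat \<times> 'a \<Rightarrow> nat \<times> 'a \<Rightarrow> (bool list \<Rightarrow> bool list) set" where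
  "box_elts_hom K = (\<lambda>(n, \<sigma>) (n', \<sigma>'). {a \<in> hom Box n n'. act K n n' a \<sigma>' = \<sigma>})"

text \<open>\<open>box_prod n m a b : \<one>\<^sup>n\<^sup>+\<^sup>m \<rightarrow> \<one>\<^sup>n'\<^sup>+\<^sup>m'\<close> for \<open>a : \<one>\<^sup>n \<rightarrow> \<one>\<^sup>n'\<close> and \<open>b : \<one>\<^sup>m \<rightarrow> \<one>\<^sup>m'\<close>.\<close>

definition box_prod ::
    "nat \<Rightarrow> nat \<Rightarrow> (bool list \<Rightarrow> bool list) \<Rightarrow> (bool list \<Rightarrow> bool list) \<Rightarrow> bool list \<Rightarrow> bool list" where
  "box_prod n m a b = (\<lambda>v\<in>cube (n + m). a (take n v) @ b (drop n v))"

type_synonym ('a, 'b) tensor_rep = "((nat \<times> 'a) \<times> (nat \<times> 'b)) \<times> (bool list \<Rightarrow> bool list)"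

definition tensor_obj :: "(nat \<times> 'a) \<times> (nat \<times> 'b) \<Rightarrow> (bool list, bool list \<Rightarrow> bool list) psh" where
  "tensor_obj = (\<lambda>((n, \<sigma>), (m, \<tau>)). yoneda Box (n + m))"

definition tensor_hom ::
    "(bool list, 'a) psh \<Rightarrow> (bool list, 'b) psh \<Rightarrow>
     (nat \<times> 'a) \<times> (nat \<times> 'b) \<Rightarrow> (nat \<times> 'a) \<times> (nat \<times> 'b) \<Rightarrow>
     ((bool list \<Rightarrow> bool list) \<times> (bool list \<Rightarrow> bool list)) set" where
  "tensor_hom K K' = (\<lambda>(s, t) (s', t'). box_elts_hom K s s' \<times> box_elts_hom K' t t')"

definition tensor_map ::
    "(nat \<times> 'a) \<times> (nat \<times> 'b) \<Rightarrow> (nat \<times> 'a) \<times> (nat \<times> 'b) \<Rightarrow>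
     (bool list \<Rightarrow> bool list) \<times> (bool list \<Rightarrow> bool list) \<Rightarrow>
     nat \<Rightarrow> (bool list \<Rightarrow> bool list) \<Rightarrow> bool list \<Rightarrow> bool list" where
  "tensor_map = (\<lambda>((n, _), (m, _)) _ (a, b) d w. compose (cube d) (box_prod n m a b) w)"

definition tensor ::
    "(bool list, 'a) psh \<Rightarrow> (bool list, 'b) psh \<Rightarrow> (bool list, ('a, 'b) tensor_rep set) psh" where
  "tensor K K' = colim (box_elts K \<times> box_elts K') (tensor_hom K K') tensor_obj tensor_map"

text \<open>The cell \<open>\<sigma> \<otimes> \<tau>\<close> of dimension \<open>n + m\<close>, for cells \<open>\<sigma>\<close>, \<open>\<tau>\<close> of dimensions \<open>n\<close>, \<open>m\<close>.\<close>

definition tensor_cell ::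
    "(bool list, 'a) psh \<Rightarrow> (bool list, 'b) psh \<Rightarrow> nat \<Rightarrow> nat \<Rightarrow> 'a \<Rightarrow> 'b \<Rightarrow>
     ('a, 'b) tensor_rep set" where
  "tensor_cell K K' n m \<sigma> \<tau> =
    colim_rel (box_elts K \<times> box_elts K') (tensor_hom K K') tensor_obj tensor_map (n + m)
      `` {(((n, \<sigma>), (m, \<tau>)), idm Box (n + m))}"

section \<open>Necklaces\<close>

text \<open>
  The necklace \<open>\<Delta>\<^sup>n\<^sup>1 \<or> \<dots> \<or> \<Delta>\<^sup>n\<^sup>k\<close> in preferred form is encoded by the list \<open>[n1, \<dots>, nk]\<close> of positive
  numbers. The iterated pushout is realised as a subcomplex of \<open>\<Delta>\<^sup>N\<close>, \<open>N = n1 + \<dots> + nk\<close>: the vertices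
  are numbered \<open>0, \<dots>, N\<close> along the necklace, the joints are the partial sums of the list, and a
  simplex of \<open>\<Delta>\<^sup>N\<close> belongs to the necklace if its vertices lie in a common bead, i.e. in the
  interval between two consecutive joints. With this numbering, \<open>\<preceq>\<close> is the order of \<open>nat\<close>, and
  \<open>\<alpha> = 0\<close>, \<open>\<omega> = N\<close>. The empty list encodes \<open>\<Delta>\<^sup>0\<close>.
\<close>

type_synonym necklace = "nat list"

definition necklaces :: "necklace set" where
  "necklaces = {T. \<forall>n\<in>set T. 1 \<le> n}"

definition beads :: "necklace \<Rightarrow> nat set set" where
  "beads T = (if T = [] then {{0}}
    else {{sum_list (take i T)..sum_list (take (Suc i) T)} | i. i < length T})"

definition neck :: "necklace \<Rightarrow> (nat, nat \<Rightarrow> nat) psh" where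
  "neck T = \<lparr>
    cells = (\<lambda>m. {u \<in> hom Simplex m (sum_list T). \<exists>B\<in>beads T. u ` {..m} \<subseteq> B}),
    act = act (yoneda Simplex (sum_list T))\<rparr>"

lemma beads_append:
  assumes "T \<noteq> []" "U \<noteq> []"
  shows "beads (T @ U) = beads T \<union> (\<lambda>B. (\<lambda>v. v + sum_list T) ` B) ` beads U"
proof -
  define bead where "bead V i = {sum_list (take i V)..sum_list (take (Suc i) V)}" for V :: necklace and i
  have beads: "beads V = bead V ` {..<length V}" if "V \<noteq> []" for V
    using that by (auto simp: beads_def bead_def)
  have "{..<length (T @ U)} = {..<length T} \<union> {length T..<length T + length U}"
    by auto
  also have "{length T..<length T + length U} = (\<lambda>i. i + length T) ` {..<length U}"
    by (simp add: lessThan_atLeast0 image_add_atLeastLessThan' add.commute)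
  finally have "beads (T @ U) =
      bead (T @ U) ` {..<length T} \<union> bead (T @ U) ` (\<lambda>i. i + length T) ` {..<length U}"
    using assms by (simp only: beads append_is_Nil_conv image_Un simp_thms)
  moreover have "bead (T @ U) ` {..<length T} = beads T"
    unfolding beads[OF assms(1)] by (rule image_cong) (simp_all add: bead_def)
  moreover have "bead (T @ U) (i + length T) = (\<lambda>v. v + sum_list T) ` bead U i" for i
    by (simp add: bead_def Suc_diff_le add.commute)
  then have "bead (T @ U) ` (\<lambda>i. i + length T) ` {..<length U} =
      (\<lambda>B. (\<lambda>v. v + sum_list T) ` B) ` beads U"
    unfolding beads[OF assms(2)] image_image by simp
  ultimately show ?thesis by simp
qed

lemma beads_bound: "B \<in> beads T \<Longrightarrow> v \<in> B \<Longrightarrow> v \<le> sum_list T"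
  by (auto simp: beads_def split: if_splits)
     (metis append_take_drop_id le_add1 sum_list_append order_trans)

lemma beads_cover: "\<exists>B\<in>beads T. 0 \<in> B" "\<exists>B\<in>beads T. sum_list T \<in> B"
proof -
  show "\<exists>B\<in>beads T. 0 \<in> B"
    by (cases "T = []") (force simp: beads_def)+
  show "\<exists>B\<in>beads T. sum_list T \<in> B"
  proof (cases "T = []")
    case False
    then obtain n where n: "length T = Suc n" by (cases "length T") auto
    then have "{sum_list (take n T)..sum_list (take (Suc n) T)} \<in> beads T"
      using False by (auto simp: beads_def)
    moreover have "sum_list (take n T) \<le> sum_list T" 
      by (metis append_take_drop_id le_add1 sum_list_append)
    ultimately show ?thesis using n by (intro bexI) auto
  qed (auto simp: beads_def)
qed

lemma neck_cells_iff: "u \<in> cells (neck T) m \<longleftrightarrow>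
    u \<in> extensional {..m} \<and> mono_on {..m} u \<and> (\<exists>B\<in>beads T. u ` {..m} \<subseteq> B)"
proof -
  have "u \<in> {..m} \<rightarrow> {..sum_list T}" if "B \<in> beads T" "u ` {..m} \<subseteq> B" for B
    using that beads_bound[OF that(1)] by (simp add: image_subset_iff Pi_iff)
  then show ?thesis
    unfolding neck_def Simplex_def PiE_def by simp metis
qed

text \<open>
  \<open>neck (T @ U)\<close> is the union of \<open>neck T\<close> and a shifted copy of \<open>neck U\<close>, which intersect exactly in
  the final vertex of \<open>T\<close>; that is, it is the pushout \<open>T \<or> U\<close>.
\<close>

lemma neck_wedge:
  fixes T U :: necklace and m :: nat
  defines "shift \<equiv> \<lambda>w. \<lambda>i\<in>{..m}. w i + sum_list T"
  shows "cells (neck (T @ U)) m = cells (neck T) m \<union> shift ` cells (neck U) m"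
    and "cells (neck T) m \<inter> shift ` cells (neck U) m = {\<lambda>i\<in>{..m}. sum_list T}"
proof -
  have shift: "u \<in> shift ` cells (neck U) m \<longleftrightarrow> u \<in> extensional {..m} \<and> mono_on {..m} u \<and>
      (\<exists>B\<in>beads U. u ` {..m} \<subseteq> (\<lambda>v. v + sum_list T) ` B)" (is "?l \<longleftrightarrow> ?r") for u
  proof
    assume ?l
    then obtain w B where w: "u = shift w" "mono_on {..m} w" "B \<in> beads U" "w ` {..m} \<subseteq> B"
      by (auto simp: neck_cells_iff)
    have "u ` {..m} \<subseteq> (\<lambda>v. v + sum_list T) ` B" using w(1,4) by (auto simp: shift_def)
    then show ?r using w(1-3) by (auto simp: shift_def monotone_on_def)
  next
    assume r: ?r
    then have ge: "sum_list T \<le> u i" if "i \<le> m" for i using that by auto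
    define w where "w = (\<lambda>i\<in>{..m}. u i - sum_list T)"
    have "u = shift w" using r ge
      by (auto simp: shift_def w_def fun_eq_iff extensional_def)
    moreover have "w \<in> cells (neck U) m"
    proof -
      obtain B where "B \<in> beads U" and B: "u ` {..m} \<subseteq> (\<lambda>v. v + sum_list T) ` B" using r by blast
      moreover have "w i \<in> B" if i: "i \<le> m" for i
      proof -
        have "u i \<in> (\<lambda>v. v + sum_list T) ` B" using B i by auto
        then show ?thesis using i by (auto simp: w_def)
      qed
      moreover have "mono_on {..m} w"
        using r by (auto simp: w_def monotone_on_def intro!: diff_le_mono)
      ultimately show ?thesis by (auto simp: neck_cells_iff w_def)
    qed
    ultimately show ?l by blast
  qed
  have const: "(\<lambda>i\<in>{..m}. c) ` {..m} = {c}" for c :: nat by auto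
  have mono: "mono_on {..m} (\<lambda>i\<in>{..m}. c)" for c :: nat by (auto simp: monotone_on_def)
  show inter: "cells (neck T) m \<inter> shift ` cells (neck U) m = {\<lambda>i\<in>{..m}. sum_list T}" (is "?A = ?B")
  proof
    show "?A \<subseteq> ?B"
    proof
      fix u assume u: "u \<in> ?A"
      then have "u i = sum_list T" if "i \<le> m" for i
      proof (intro antisym)
        show "u i \<le> sum_list T" using u that beads_bound by (auto simp: neck_cells_iff)
        show "sum_list T \<le> u i" using u that unfolding Int_iff shift by auto
      qed
      then show "u \<in> ?B" using u by (auto simp: neck_cells_iff extensional_def fun_eq_iff)
    qed
    obtain B where "B \<in> beads U" "0 \<in> B" using beads_cover(1) by blast
    moreover from this have "{sum_list T} \<subseteq> (\<lambda>v. v + sum_list T) ` B" by force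
    ultimately have "(\<lambda>i\<in>{..m}. sum_list T) \<in> shift ` cells (neck U) m"
      unfolding shift const using mono by (intro conjI bexI restrict_extensional)
    moreover have "\<exists>B\<in>beads T. {sum_list T} \<subseteq> B" using beads_cover(2) by simp
    then have "(\<lambda>i\<in>{..m}. sum_list T) \<in> cells (neck T) m"
      unfolding neck_cells_iff const using mono by (intro conjI restrict_extensional)
    ultimately show "?B \<subseteq> ?A" by simp
  qed
  show "cells (neck (T @ U)) m = cells (neck T) m \<union> shift ` cells (neck U) m"
  proof (cases "T = [] \<or> U = []")
    case False
    then have "beads (T @ U) = beads T \<union> (\<lambda>B. (\<lambda>v. v + sum_list T) ` B) ` beads U"
      using beads_append by simp
    then have "(\<exists>B\<in>beads (T @ U). V \<subseteq> B) \<longleftrightarrow>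
        (\<exists>B\<in>beads T. V \<subseteq> B) \<or> (\<exists>B\<in>beads U. V \<subseteq> (\<lambda>v. v + sum_list T) ` B)" for V
      by (simp only: bex_Un bex_simps)
    then show ?thesis
      by (intro set_eqI) (simp only: Un_iff shift neck_cells_iff conj_disj_distribL)
  next
    case True
    have Nil: "cells (neck []) m = {\<lambda>i\<in>{..m}. 0}"
    proof (intro set_eqI iffI)
      fix u assume "u \<in> cells (neck []) m"
      then show "u \<in> {\<lambda>i\<in>{..m}. 0}"
        by (auto simp: neck_cells_iff beads_def extensional_def fun_eq_iff)
    qed (auto simp: neck_cells_iff beads_def monotone_on_def)
    from True show ?thesis
    proof
      assume T: "T = []"
      have "shift ` cells (neck U) m = cells (neck U) m"
        by (intro set_eqI) (simp add: shift neck_cells_iff T)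
      then show ?thesis using inter by (auto simp: T Nil)
    next
      assume U: "U = []"
      have "shift ` cells (neck U) m = {\<lambda>i\<in>{..m}. sum_list T}"
        by (auto simp: U Nil shift_def)
      then show ?thesis using inter by (auto simp: U)
    qed
  qed
qed

definition neck_verts :: "necklace \<Rightarrow> nat set" where
  "neck_verts T = {..sum_list T}"

definition joints :: "necklace \<Rightarrow> nat set" where
  "joints T = (\<lambda>i. sum_list (take i T)) ` {..length T}"

definition on_verts :: "(nat \<Rightarrow> (nat \<Rightarrow> nat) \<Rightarrow> (nat \<Rightarrow> nat)) \<Rightarrow> nat \<Rightarrow> nat" where
  "on_verts h v = h 0 (vertex_cell v) 0"

definition nec_hom :: "necklace \<Rightarrow> necklace \<Rightarrow> (nat \<Rightarrow> (nat \<Rightarrow> nat) \<Rightarrow> (nat \<Rightarrow> nat)) set" where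
  "nec_hom T U = {h \<in> psh_hom Simplex (neck T) (neck U).
    on_verts h 0 = 0 \<and> on_verts h (sum_list T) = sum_list U}"

definition neck_dim :: "necklace \<Rightarrow> nat" where
  "neck_dim T = card (neck_verts T - joints T)"

definition neck_poset :: "necklace \<Rightarrow> nat set set" where
  "neck_poset T = {X. joints T \<subseteq> X \<and> X \<subseteq> neck_verts T}"

definition neck_coords :: "necklace \<Rightarrow> nat set \<Rightarrow> bool list" where
  "neck_coords T X = map (\<lambda>y. y \<in> X) (sorted_list_of_set (neck_verts T - joints T))"

definition neck_cube_map ::
    "necklace \<Rightarrow> necklace \<Rightarrow> (nat \<Rightarrow> (nat \<Rightarrow> nat) \<Rightarrow> (nat \<Rightarrow> nat)) \<Rightarrow> bool list \<Rightarrow> bool list" where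
  "neck_cube_map T U h = (\<lambda>v\<in>cube (neck_dim T).
    neck_coords U (on_verts h ` inv_into (neck_poset T) (neck_coords T) v))"

section \<open>The cubical rigidification and its composition\<close>

type_synonym 'a neck_over = "necklace \<times> (nat \<Rightarrow> (nat \<Rightarrow> nat) \<Rightarrow> 'a)"

definition nec_over :: "(nat, 'a) psh \<Rightarrow> 'a \<Rightarrow> 'a \<Rightarrow> 'a neck_over set" where
  "nec_over S x y = {(T, f). T \<in> necklaces \<and> f \<in> psh_hom Simplex (neck T) S \<and>
    f 0 (vertex_cell 0) = x \<and> f 0 (vertex_cell (sum_list T)) = y}"

definition nec_over_hom ::
    "'a neck_over \<Rightarrow> 'a neck_over \<Rightarrow> (nat \<Rightarrow> (nat \<Rightarrow> nat) \<Rightarrow> (nat \<Rightarrow> nat)) set" where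
  "nec_over_hom = (\<lambda>(T, f) (U, g).
    {h \<in> nec_hom T U. \<forall>n. \<forall>u\<in>cells (neck T) n. g n (h n u) = f n u})"

definition nec_obj :: "'a neck_over \<Rightarrow> (bool list, bool list \<Rightarrow> bool list) psh" where
  "nec_obj = (\<lambda>(T, f). yoneda Box (neck_dim T))"

definition nec_map ::
    "'a neck_over \<Rightarrow> 'a neck_over \<Rightarrow> (nat \<Rightarrow> (nat \<Rightarrow> nat) \<Rightarrow> (nat \<Rightarrow> nat)) \<Rightarrow>
     nat \<Rightarrow> (bool list \<Rightarrow> bool list) \<Rightarrow> bool list \<Rightarrow> bool list" where
  "nec_map = (\<lambda>(T, f) (U, g) h d u. compose (cube d) (neck_cube_map T U h) u)"

type_synonym 'a rig_cell = "('a neck_over \<times> (bool list \<Rightarrow> bool list)) set"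

definition rig :: "(nat, 'a) psh \<Rightarrow> 'a \<Rightarrow> 'a \<Rightarrow> (bool list, 'a rig_cell) psh" where
  "rig S x y = colim (nec_over S x y) nec_over_hom nec_obj nec_map"

definition rig_class ::
    "(nat, 'a) psh \<Rightarrow> 'a \<Rightarrow> 'a \<Rightarrow> nat \<Rightarrow> 'a neck_over \<Rightarrow> (bool list \<Rightarrow> bool list) \<Rightarrow> 'a rig_cell" where
  "rig_class S x y d Tf u = colim_rel (nec_over S x y) nec_over_hom nec_obj nec_map d `` {(Tf, u)}"

text \<open>The wedge \<open>T \<or> U\<close> is the list \<open>T @ U\<close>; the vertices of \<open>U\<close> are shifted by \<open>sum_list T\<close>.\<close>

definition wedge_map ::
    "necklace \<Rightarrow> necklace \<Rightarrow> (nat \<Rightarrow> (nat \<Rightarrow> nat) \<Rightarrow> 'a) \<Rightarrow> (nat \<Rightarrow> (nat \<Rightarrow> nat) \<Rightarrow> 'a) \<Rightarrow>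
     nat \<Rightarrow> (nat \<Rightarrow> nat) \<Rightarrow> 'a" where
  "wedge_map T U f g = (\<lambda>n. \<lambda>u\<in>cells (neck (T @ U)) n.
    if u ` {..n} \<subseteq> {..sum_list T} then f n u else g n (\<lambda>i\<in>{..n}. u i - sum_list T))"

text \<open>
  Composition \<open>rig S x y \<otimes> rig S y z \<rightarrow> rig S x z\<close> on cells of dimension \<open>d\<close>. Under
  \<open>\<square>\<^sub>c\<^sup>N \<otimes> \<square>\<^sub>c\<^sup>M \<cong> \<square>\<^sub>c\<^sup>N\<^sup>+\<^sup>M\<close> the cells \<open>u\<close>, \<open>v\<close> and \<open>w : \<one>\<^sup>d \<rightarrow> \<one>\<^sup>n\<^sup>+\<^sup>m\<close> give \<open>(u \<otimes> v) \<circ> w\<close>. The union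
  runs over all representatives, which yield one and the same class.
\<close>

definition rig_comp ::
    "(nat, 'a) psh \<Rightarrow> 'a \<Rightarrow> 'a \<Rightarrow> 'a \<Rightarrow> nat \<Rightarrow> ('a rig_cell, 'a rig_cell) tensor_rep set \<Rightarrow>
     'a rig_cell" where
  "rig_comp S x y z d c =
    (\<Union>(((n, A), (m, B)), w)\<in>c. \<Union>((T, f), u)\<in>A. \<Union>((U, g), v)\<in>B.
      rig_class S x z d (T @ U, wedge_map T U f g) (compose (cube d) (box_prod n m u v) w))"

text \<open>The map \<open>\<Delta>\<^sup>0 \<rightarrow> S\<close> corresponding to the vertex \<open>x\<close>.\<close>

definition const_neck :: "(nat, 'a) psh \<Rightarrow> 'a \<Rightarrow> 'a neck_over" where
  "const_neck S x = ([], \<lambda>n. \<lambda>u\<in>cells (neck []) n. act S n 0 u x)"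

section \<open>Chains\<close>

text \<open>
  Scalars are a type of sort \<open>{comm_ring, comm_monoid_mult}\<close>: commutative rings with unit, without the
  requirement \<open>0 \<noteq> 1\<close> that \<open>comm_ring_1\<close> would add.
\<close>

definition cscale :: "'k::{comm_ring,comm_monoid_mult} \<Rightarrow> ('x \<Rightarrow>\<^sub>0 'k) \<Rightarrow> ('x \<Rightarrow>\<^sub>0 'k)" where
  "cscale c p = Poly_Mapping.map ((*) c) p"

abbreviation gen :: "'x \<Rightarrow> ('x \<Rightarrow>\<^sub>0 'k::{comm_ring,comm_monoid_mult})" where
  "gen x \<equiv> Poly_Mapping.single x 1"

definition free :: "'x set \<Rightarrow> ('x \<Rightarrow>\<^sub>0 'k::{comm_ring,comm_monoid_mult}) set" where
  "free X = {p. Poly_Mapping.keys p \<subseteq> X}"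

definition lin ::
    "('x \<Rightarrow> ('y \<Rightarrow>\<^sub>0 'k::{comm_ring,comm_monoid_mult})) \<Rightarrow> ('x \<Rightarrow>\<^sub>0 'k) \<Rightarrow> ('y \<Rightarrow>\<^sub>0 'k)" where
  "lin f p = (\<Sum>x\<in>Poly_Mapping.keys p. cscale (Poly_Mapping.lookup p x) (f x))"

definition bilin ::
    "('x \<Rightarrow> 'y \<Rightarrow> ('z \<Rightarrow>\<^sub>0 'k::{comm_ring,comm_monoid_mult})) \<Rightarrow>
     ('x \<Rightarrow>\<^sub>0 'k) \<Rightarrow> ('y \<Rightarrow>\<^sub>0 'k) \<Rightarrow> ('z \<Rightarrow>\<^sub>0 'k)" where
  "bilin f p q = lin (\<lambda>x. lin (f x) q) p"

definition submod :: "('x \<Rightarrow>\<^sub>0 'k::{comm_ring,comm_monoid_mult}) set \<Rightarrow> bool" where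
  "submod M \<longleftrightarrow> 0 \<in> M \<and> (\<forall>p\<in>M. \<forall>q\<in>M. p + q \<in> M) \<and> (\<forall>c. \<forall>p\<in>M. cscale c p \<in> M)"

definition coset ::
    "('x \<Rightarrow>\<^sub>0 'k::{comm_ring,comm_monoid_mult}) set \<Rightarrow> ('x \<Rightarrow>\<^sub>0 'k) \<Rightarrow> ('x \<Rightarrow>\<^sub>0 'k) set" where
  "coset M p = {q. q - p \<in> M}"

section \<open>Graded modules, differential graded algebras\<close>

record ('k, 'm) gmod =
  gr :: "nat \<Rightarrow> 'm set"
  gzero :: "nat \<Rightarrow> 'm"
  gadd :: "nat \<Rightarrow> 'm \<Rightarrow> 'm \<Rightarrow> 'm"
  gscale :: "nat \<Rightarrow> 'k \<Rightarrow> 'm \<Rightarrow> 'm"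

text \<open>
  \<open>bd A n : A\<^sub>n \<rightarrow> A\<^sub>n\<^sub>-\<^sub>1\<close> is relevant for \<open>n > 0\<close> only: complexes vanish in negative degrees.
  \<open>mult A m n : A\<^sub>m \<times> A\<^sub>n \<rightarrow> A\<^sub>m\<^sub>+\<^sub>n\<close>.
\<close>

record ('k, 'm) cplx = "('k, 'm) gmod" +
  bd :: "nat \<Rightarrow> 'm \<Rightarrow> 'm"

record ('k, 'm) dga = "('k, 'm) cplx" +
  mult :: "nat \<Rightarrow> nat \<Rightarrow> 'm \<Rightarrow> 'm \<Rightarrow> 'm"
  unit :: 'm

definition graded_module ::
    "('k::{comm_ring,comm_monoid_mult}, 'm, 'z) gmod_scheme \<Rightarrow> bool" where
  "graded_module A \<longleftrightarrow> (\<forall>n.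
    gzero A n \<in> gr A n \<and>
    (\<forall>a\<in>gr A n. \<forall>b\<in>gr A n. gadd A n a b \<in> gr A n \<and> gadd A n a b = gadd A n b a) \<and>
    (\<forall>a\<in>gr A n. \<forall>b\<in>gr A n. \<forall>c\<in>gr A n.
      gadd A n (gadd A n a b) c = gadd A n a (gadd A n b c)) \<and>
    (\<forall>a\<in>gr A n. gadd A n (gzero A n) a = a \<and> (\<exists>b\<in>gr A n. gadd A n a b = gzero A n)) \<and>
    (\<forall>a\<in>gr A n. gscale A n 1 a = a \<and> (\<forall>r. gscale A n r a \<in> gr A n) \<and>
      (\<forall>r s. gscale A n (r * s) a = gscale A n r (gscale A n s a) \<and>
        gscale A n (r + s) a = gadd A n (gscale A n r a) (gscale A n s a))) \<and>
    (\<forall>r. \<forall>a\<in>gr A n. \<forall>b\<in>gr A n.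
      gscale A n r (gadd A n a b) = gadd A n (gscale A n r a) (gscale A n r b)))"

definition chain_complex ::
    "('k::{comm_ring,comm_monoid_mult}, 'm, 'z) cplx_scheme \<Rightarrow> bool" where
  "chain_complex A \<longleftrightarrow> graded_module A \<and>
    (\<forall>n>0. \<forall>a\<in>gr A n. bd A n a \<in> gr A (n - 1) \<and>
      (\<forall>b\<in>gr A n. bd A n (gadd A n a b) = gadd A (n - 1) (bd A n a) (bd A n b)) \<and>
      (\<forall>r. bd A n (gscale A n r a) = gscale A (n - 1) r (bd A n a))) \<and>
    (\<forall>n>1. \<forall>a\<in>gr A n. bd A (n - 1) (bd A n a) = gzero A (n - 2))"

definition dg_algebra ::
    "('k::{comm_ring,comm_monoid_mult}, 'm, 'z) dga_scheme \<Rightarrow> bool" where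
  "dg_algebra A \<longleftrightarrow> chain_complex A \<and>
    (\<forall>m n. \<forall>a\<in>gr A m. \<forall>b\<in>gr A n. mult A m n a b \<in> gr A (m + n) \<and>
      (\<forall>a'\<in>gr A m.
        mult A m n (gadd A m a a') b = gadd A (m + n) (mult A m n a b) (mult A m n a' b)) \<and>
      (\<forall>b'\<in>gr A n.
        mult A m n a (gadd A n b b') = gadd A (m + n) (mult A m n a b) (mult A m n a b')) \<and>
      (\<forall>r. mult A m n (gscale A m r a) b = gscale A (m + n) r (mult A m n a b) \<and>
        mult A m n a (gscale A n r b) = gscale A (m + n) r (mult A m n a b))) \<and>
    (\<forall>l m n. \<forall>a\<in>gr A l. \<forall>b\<in>gr A m. \<forall>c\<in>gr A n.
      mult A (l + m) n (mult A l m a b) c = mult A l (m + n) a (mult A m n b c)) \<and>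
    unit A \<in> gr A 0 \<and>
    (\<forall>n. \<forall>a\<in>gr A n. mult A 0 n (unit A) a = a \<and> mult A n 0 a (unit A) = a) \<and>
    (\<forall>m n. 0 < m + n \<longrightarrow> (\<forall>a\<in>gr A m. \<forall>b\<in>gr A n.
      bd A (m + n) (mult A m n a b) = gadd A (m + n - 1)
        (if m = 0 then gzero A (m + n - 1) else mult A (m - 1) n (bd A m a) b)
        (if n = 0 then gzero A (m + n - 1)
         else gscale A (m + n - 1) ((-1) ^ m) (mult A m (n - 1) a (bd A n b)))))"

definition dga_iso ::
    "('k::{comm_ring,comm_monoid_mult}, 'a) dga \<Rightarrow> ('k, 'b) dga \<Rightarrow> (nat \<Rightarrow> 'a \<Rightarrow> 'b) \<Rightarrow> bool" where
  "dga_iso A B \<phi> \<longleftrightarrow>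
    (\<forall>n. bij_betw (\<phi> n) (gr A n) (gr B n) \<and>
      (\<forall>a\<in>gr A n.
        (\<forall>b\<in>gr A n. \<phi> n (gadd A n a b) = gadd B n (\<phi> n a) (\<phi> n b)) \<and>
        (\<forall>r. \<phi> n (gscale A n r a) = gscale B n r (\<phi> n a)) \<and>
        (0 < n \<longrightarrow> \<phi> (n - 1) (bd A n a) = bd B n (\<phi> n a)))) \<and>
    (\<forall>m n. \<forall>a\<in>gr A m. \<forall>b\<in>gr A n.
      \<phi> (m + n) (mult A m n a b) = mult B m n (\<phi> m a) (\<phi> n b)) \<and>
    \<phi> 0 (unit A) = unit B"

definition dga_isomorphic ::
    "('k::{comm_ring,comm_monoid_mult}, 'a) dga \<Rightarrow> ('k, 'b) dga \<Rightarrow> bool" where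
  "dga_isomorphic A B \<longleftrightarrow> dg_algebra A \<and> dg_algebra B \<and> (\<exists>\<phi>. dga_iso A B \<phi>)"

text \<open>
  Graded quotients of free modules. An element of the quotient is a coset, i.e. a set of chains; the
  operations are defined by taking the union over all representatives.
\<close>

definition quot_mod ::
    "(nat \<Rightarrow> 'x set) \<Rightarrow> (nat \<Rightarrow> ('x \<Rightarrow>\<^sub>0 'k::{comm_ring,comm_monoid_mult}) set) \<Rightarrow>
     ('k, ('x \<Rightarrow>\<^sub>0 'k) set) gmod" where
  "quot_mod X M = \<lparr>
    gr = (\<lambda>n. coset (M n) ` free (X n)),
    gzero = (\<lambda>n. coset (M n) 0),
    gadd = (\<lambda>n a b. \<Union>p\<in>a. \<Union>q\<in>b. coset (M n) (p + q)),
    gscale = (\<lambda>n r a. \<Union>p\<in>a. coset (M n) (cscale r p))\<rparr>"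

definition quot_cplx ::
    "(nat \<Rightarrow> 'x set) \<Rightarrow> (nat \<Rightarrow> ('x \<Rightarrow>\<^sub>0 'k::{comm_ring,comm_monoid_mult}) set) \<Rightarrow>
     (nat \<Rightarrow> 'x \<Rightarrow> ('x \<Rightarrow>\<^sub>0 'k)) \<Rightarrow> ('k, ('x \<Rightarrow>\<^sub>0 'k) set) cplx" where
  "quot_cplx X M d = gmod.extend (quot_mod X M)
    \<lparr>bd = (\<lambda>n a. \<Union>p\<in>a. coset (M (n - 1)) (lin (d n) p))\<rparr>"

text \<open>
  The subcomplex generated by the sets of generators \<open>G n\<close>; it is spanned by these generators
  together with their boundaries.
\<close>

definition gen_subcplx ::
    "(nat \<Rightarrow> 'x set) \<Rightarrow> (nat \<Rightarrow> 'x \<Rightarrow> ('x \<Rightarrow>\<^sub>0 'k::{comm_ring,comm_monoid_mult})) \<Rightarrow>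
     nat \<Rightarrow> ('x \<Rightarrow>\<^sub>0 'k) set" where
  "gen_subcplx G d n = submod hull (gen ` G n \<union> d (Suc n) ` G (Suc n))"

section \<open>Normalized cubical chains\<close>

definition box_boundary ::
    "(bool list, 'a) psh \<Rightarrow> nat \<Rightarrow> 'a \<Rightarrow> ('a \<Rightarrow>\<^sub>0 'k::{comm_ring,comm_monoid_mult})" where
  "box_boundary K n \<sigma> = (\<Sum>j=1..n. cscale ((-1) ^ j)
    (gen (act K (n - 1) n (box_face (n - 1) j True) \<sigma>) -
     gen (act K (n - 1) n (box_face (n - 1) j False) \<sigma>)))"

definition box_degenerate :: "(bool list, 'a) psh \<Rightarrow> nat \<Rightarrow> 'a set" where
  "box_degenerate K n =
    (\<Union>j\<in>{1..n}. act K n (n - 1) (box_degen n j) ` cells K (n - 1)) \<union>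
    (\<Union>j\<in>{1..n - 1}. act K n (n - 1) (box_conn n j) ` cells K (n - 1))"

abbreviation box_null ::
    "(bool list, 'a) psh \<Rightarrow> nat \<Rightarrow> ('a \<Rightarrow>\<^sub>0 'k::{comm_ring,comm_monoid_mult}) set" where
  "box_null K \<equiv> gen_subcplx (box_degenerate K) (box_boundary K)"

definition Q_box ::
    "(bool list, 'a) psh \<Rightarrow> ('k::{comm_ring,comm_monoid_mult}, ('a \<Rightarrow>\<^sub>0 'k) set) cplx" where
  "Q_box K = quot_cplx (cells K) (box_null K) (box_boundary K)"

text \<open>
  The product is the composite \<open>Q(K) \<otimes> Q(K) \<cong> Q(K \<otimes> K) \<rightarrow> Q(K)\<close> with \<open>K = rig S x x\<close>, where the first map
  sends the tensor product of the classes of \<open>\<sigma>\<close> and \<open>\<tau>\<close> to the class of the cell \<open>\<sigma> \<otimes> \<tau>\<close>.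
\<close>

definition Lambda_mult ::
    "(nat, 'a) psh \<Rightarrow> 'a \<Rightarrow> nat \<Rightarrow> nat \<Rightarrow>
     ('a rig_cell \<Rightarrow>\<^sub>0 'k::{comm_ring,comm_monoid_mult}) set \<Rightarrow> ('a rig_cell \<Rightarrow>\<^sub>0 'k) set \<Rightarrow>
     ('a rig_cell \<Rightarrow>\<^sub>0 'k) set" where
  "Lambda_mult S x m n a b = (\<Union>p\<in>a. \<Union>q\<in>b. coset (box_null (rig S x x) (m + n))
    (lin (\<lambda>c. gen (rig_comp S x x x (m + n) c))
      (bilin (\<lambda>\<sigma> \<tau>. gen (tensor_cell (rig S x x) (rig S x x) m n \<sigma> \<tau>)) p q)))"

definition Lambda ::
    "(nat, 'a) psh \<Rightarrow> 'a \<Rightarrow>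
     ('k::{comm_ring,comm_monoid_mult}, ('a rig_cell \<Rightarrow>\<^sub>0 'k) set) dga" where
  "Lambda S x = cplx.extend (Q_box (rig S x x))
    \<lparr>mult = Lambda_mult S x,
     unit = coset (box_null (rig S x x) 0)
       (gen (rig_class S x x 0 (const_neck S x) (idm Box 0)))\<rparr>"

section \<open>Tensor powers, dg coalgebras\<close>

text \<open>
  The tensor algebra of a graded module \<open>M\<close> is the quotient of the free module on words of homogeneous
  elements of \<open>M\<close> by the multilinearity relations; words of length \<open>r\<close> span the \<open>r\<close>-fold tensor
  power. Letters are tagged with their degree. \<open>multilin M W\<close> is the submodule of relations between words
  in \<open>W\<close>, where \<open>W\<close> prescribes total degree and possibly length.
\<close>

type_synonym 'm word = "(nat \<times> 'm) list"

definition words :: "('k, 'm, 'z) gmod_scheme \<Rightarrow> nat \<Rightarrow> 'm word set" where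
  "words M n = {w. set w \<subseteq> Sigma UNIV (gr M) \<and> sum_list (map fst w) = n}"

definition words2 :: "('k, 'm, 'z) gmod_scheme \<Rightarrow> nat \<Rightarrow> 'm word set" where
  "words2 M n = {w \<in> words M n. length w = 2}"

definition multilin ::
    "('k::{comm_ring,comm_monoid_mult}, 'm, 'z) gmod_scheme \<Rightarrow> 'm word set \<Rightarrow> ('m word \<Rightarrow>\<^sub>0 'k) set" where
  "multilin M W = submod hull
    ({gen (u @ (p, gadd M p a b) # v) - gen (u @ (p, a) # v) - gen (u @ (p, b) # v) | u v p a b.
        u @ (p, a) # v \<in> W \<and> u @ (p, b) # v \<in> W} \<union>
     {gen (u @ (p, gscale M p r a) # v) - cscale r (gen (u @ (p, a) # v)) | u v p r a.
        u @ (p, a) # v \<in> W})"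

text \<open>
  \<open>comult C n\<close> maps \<open>C\<^sub>n\<close> to \<open>(C \<otimes> C)\<^sub>n\<close>, the free module on \<open>words2 C n\<close> modulo
  \<open>multilin C (words2 C n)\<close>; \<open>counit_dual C \<in> C\<^sub>0\<close> is the element denoted \<open>1\<close>.
\<close>

record (overloaded) ('k::zero, 'm) dgc = "('k, 'm) cplx" +
  comult :: "nat \<Rightarrow> 'm \<Rightarrow> ('m word \<Rightarrow>\<^sub>0 'k) set"
  counit_dual :: 'm

section \<open>Normalized simplicial chains\<close>

definition simp_boundary ::
    "(nat, 'a) psh \<Rightarrow> nat \<Rightarrow> 'a \<Rightarrow> ('a \<Rightarrow>\<^sub>0 'k::{comm_ring,comm_monoid_mult})" where
  "simp_boundary S n \<sigma> = (if n = 0 then 0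
    else (\<Sum>i=0..n. cscale ((-1) ^ i) (gen (act S (n - 1) n (coface n i) \<sigma>))))"

definition simp_degenerate :: "(nat, 'a) psh \<Rightarrow> nat \<Rightarrow> 'a set" where
  "simp_degenerate S n = (if n = 0 then {}
    else (\<Union>i\<in>{..n - 1}. act S n (n - 1) (codegen (n - 1) i) ` cells S (n - 1)))"

abbreviation simp_null ::
    "(nat, 'a) psh \<Rightarrow> nat \<Rightarrow> ('a \<Rightarrow>\<^sub>0 'k::{comm_ring,comm_monoid_mult}) set" where
  "simp_null S \<equiv> gen_subcplx (simp_degenerate S) (simp_boundary S)"

definition Q_simp_cplx ::
    "(nat, 'a) psh \<Rightarrow> ('k::{comm_ring,comm_monoid_mult}, ('a \<Rightarrow>\<^sub>0 'k) set) cplx" where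
  "Q_simp_cplx S = quot_cplx (cells S) (simp_null S) (simp_boundary S)"

definition front_face :: "(nat, 'a) psh \<Rightarrow> nat \<Rightarrow> nat \<Rightarrow> 'a \<Rightarrow> 'a" where
  "front_face S p q \<sigma> = act S p (p + q) (\<lambda>i\<in>{..p}. i) \<sigma>"

definition last_face :: "(nat, 'a) psh \<Rightarrow> nat \<Rightarrow> nat \<Rightarrow> 'a \<Rightarrow> 'a" where
  "last_face S p q \<sigma> = act S q (p + q) (\<lambda>i\<in>{..q}. i + p) \<sigma>"

definition alexander_whitney ::
    "(nat, 'a) psh \<Rightarrow> nat \<Rightarrow> 'a \<Rightarrow>
     (('a \<Rightarrow>\<^sub>0 'k::{comm_ring,comm_monoid_mult}) set word \<Rightarrow>\<^sub>0 'k)" where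
  "alexander_whitney S n \<sigma> = (\<Sum>p=0..n.
    gen [(p, coset (simp_null S p) (gen (front_face S p (n - p) \<sigma>))),
         (n - p, coset (simp_null S (n - p)) (gen (last_face S p (n - p) \<sigma>)))])"

text \<open>For a 0-reduced \<open>S\<close>, the element \<open>1\<close> of degree 0 is the class of the unique vertex.\<close>

definition Q_simp ::
    "(nat, 'a) psh \<Rightarrow> ('k::{comm_ring,comm_monoid_mult}, ('a \<Rightarrow>\<^sub>0 'k) set) dgc" where
  "Q_simp S = cplx.extend (Q_simp_cplx S)
    \<lparr>comult = (\<lambda>n a. \<Union>p\<in>a. coset (multilin (Q_simp_cplx S) (words2 (Q_simp_cplx S) n))
       (lin (alexander_whitney S n) p)),
     counit_dual = coset (simp_null S 0) (gen (the_elem (cells S 0)))\<rparr>"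

section \<open>The cobar construction\<close>

text \<open>\<open>(s C)\<^sub>i = C\<^sub>i\<^sub>+\<^sub>1\<close> for \<open>i \<ge> 0\<close>; the component of degree \<open>-1\<close> vanishes because \<open>C\<close> is reduced in degree 0.\<close>

definition desusp :: "('k, 'm, 'z) gmod_scheme \<Rightarrow> ('k, 'm) gmod" where
  "desusp C = \<lparr>gr = (\<lambda>i. gr C (Suc i)), gzero = (\<lambda>i. gzero C (Suc i)),
    gadd = (\<lambda>i. gadd C (Suc i)), gscale = (\<lambda>i. gscale C (Suc i))\<rparr>"

text \<open>
  The representatives of \<open>\<Sum> c' \<otimes> c'' = \<Delta>(c) - c \<otimes> 1 - 1 \<otimes> c\<close>, for \<open>c \<in> C\<^sub>n\<close> with \<open>n > 0\<close>, by
  combinations of words of two letters of positive degree.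
\<close>

definition reduced_comult ::
    "('k::{comm_ring,comm_monoid_mult}, 'm) dgc \<Rightarrow> nat \<Rightarrow> 'm \<Rightarrow> ('m word \<Rightarrow>\<^sub>0 'k) set" where
  "reduced_comult C n c = {r \<in> free {w \<in> words2 C n. \<forall>(p, b)\<in>set w. 0 < p}.
    r + gen [(n, c), (0, counit_dual C)] + gen [(0, counit_dual C), (n, c)] \<in> comult C n c}"

text \<open>
  \<open>D(sc) = - s \<partial>c + \<Sum> (-1)\<^sup>d\<^sup>e\<^sup>g \<^sup>c\<^sup>' sc' \<otimes> sc''\<close> for \<open>c \<in> C\<^sub>i\<^sub>+\<^sub>1\<close>, as a combination of words in \<open>sC\<close>. Its
  class in the tensor algebra does not depend on the representative chosen by \<open>SOME\<close>. If \<open>i = 0\<close>,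
  both terms vanish.
\<close>

definition cobar_gen ::
    "('k::{comm_ring,comm_monoid_mult}, 'm) dgc \<Rightarrow> nat \<Rightarrow> 'm \<Rightarrow> ('m word \<Rightarrow>\<^sub>0 'k)" where
  "cobar_gen C i c = (if i = 0 then 0 else
    - gen [(i - 1, bd C (Suc i) c)] +
    lin (\<lambda>w. cscale ((-1) ^ fst (w ! 0)) (gen (map (\<lambda>(p, b). (p - 1, b)) w)))
      (SOME r. r \<in> reduced_comult C (Suc i) c))"

abbreviation word_mult ::
    "('m word \<Rightarrow>\<^sub>0 'k::{comm_ring,comm_monoid_mult}) \<Rightarrow> ('m word \<Rightarrow>\<^sub>0 'k) \<Rightarrow> ('m word \<Rightarrow>\<^sub>0 'k)" where
  "word_mult \<equiv> bilin (\<lambda>u v. gen (u @ v))"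

fun cobar_word :: "('k::{comm_ring,comm_monoid_mult}, 'm) dgc \<Rightarrow> 'm word \<Rightarrow> ('m word \<Rightarrow>\<^sub>0 'k)" where
  "cobar_word C [] = 0"
| "cobar_word C ((i, c) # w) =
    word_mult (cobar_gen C i c) (gen w) +
    cscale ((-1) ^ i) (word_mult (gen [(i, c)]) (cobar_word C w))"

abbreviation tens_null ::
    "('k::{comm_ring,comm_monoid_mult}, 'm, 'z) gmod_scheme \<Rightarrow> nat \<Rightarrow> ('m word \<Rightarrow>\<^sub>0 'k) set" where
  "tens_null M n \<equiv> multilin M (words M n)"

definition cobar ::
    "('k::{comm_ring,comm_monoid_mult}, 'm) dgc \<Rightarrow> ('k, ('m word \<Rightarrow>\<^sub>0 'k) set) dga" where
  "cobar C = cplx.extend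
    (quot_cplx (words (desusp C)) (tens_null (desusp C)) (\<lambda>_. cobar_word C))
    \<lparr>mult = (\<lambda>m n a b. \<Union>p\<in>a. \<Union>q\<in>b. coset (tens_null (desusp C) (m + n)) (word_mult p q)),
     unit = coset (tens_null (desusp C) 0) (gen [])\<rparr>"

end

theory Submission imports Defs begin

text \<open>
  Both dg algebras are isomorphic to a third one, \<open>bead_dga\<close>: the free module on the words of
  nondegenerate simplices of positive dimension, where a simplex of dimension \<open>i + 1\<close> is a letter of
  degree \<open>i\<close>, with concatenation as product and the derivation given on letters by \<open>letter_deriv\<close>.

  A cell of the rigidification is represented by a necklace over \<open>S\<close> and a morphism of cubes into the
  cube of this necklace. If the morphism loses a coordinate, then it factors through a codegeneracy or a
  coconnection and the cell is degenerate. Otherwise it is the inclusion of a face, and a face of the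
  cube of a necklace is the cube of a subnecklace; so the cell is the top cell of a necklace, that is, a
  product of beads (\<open>cell_normal_form\<close>). A bead carrying a degenerate simplex of dimension at least 2 is
  a degenerate cell, because a codegeneracy of simplices induces a codegeneracy or a coconnection of
  cubes; a bead carrying a degenerate edge is the unit and disappears. Hence the words of nondegenerate
  simplices span the normalized chains. They are linearly independent because the word can be read off
  from an arbitrary representative of a cell: \<open>val\<close> computes it from the least and the greatest vertex
  of the morphism of cubes, and it does not change along maps of necklaces over \<open>S\<close> (\<open>val_step\<close>). The
  two faces of a bead in direction \<open>j\<close> are the product of a front and a last face, when the \<open>j\<close>-th
  vertex becomes a joint, and the \<open>j\<close>-th face of the simplex, when it is removed; this is the formula
  for \<open>letter_deriv\<close>, in which the outer faces of the simplex do not occur.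

  In the cobar construction a degenerate edge is 0, not 1. So the generator of an edge corresponds to
  the letter minus 1, and the generator of a simplex of higher dimension to its letter
  (\<open>reduced_letter\<close>). Under this substitution, the summand 1 in the factors that are edges turns the
  first and the last product in \<open>letter_deriv\<close> into the two outer faces, and the cobar differential
  appears (\<open>letter_deriv_reduced\<close>).

  Both algebras are quotients of free modules, with operations defined on cosets. The lemma
  \<open>quot_dga_iso_word_dga\<close> reduces everything to a linear map from generators to words that has the
  right kernel and respects differential, product and unit. The axioms of a dg algebra are transported
  from \<open>bead_dga\<close>; there, the square of the differential vanishes because every word is the value of a
  cell and the cubical boundary has square zero.
\<close>

section \<open>Linear algebra of chains\<close>

lemma lookup_cscale [simp]: "Poly_Mapping.lookup (cscale c p) x = c * Poly_Mapping.lookup p x"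
  by (simp add: cscale_def Poly_Mapping.map.rep_eq when_def)

lemma cscale_one [simp]: "cscale 1 p = p"
  by (rule poly_mapping_eqI) simp

lemma cscale_zero_left [simp]: "cscale 0 p = 0"
  by (rule poly_mapping_eqI) simp

lemma cscale_zero_right [simp]: "cscale c 0 = 0"
  by (rule poly_mapping_eqI) simp

lemma cscale_cscale [simp]: "cscale a (cscale b p) = cscale (a * b) p"
  by (rule poly_mapping_eqI) (simp add: mult.assoc)

lemma cscale_add_right: "cscale c (p + q) = cscale c p + cscale c q"
  by (rule poly_mapping_eqI) (simp add: lookup_add distrib_left)

lemma cscale_add_left: "cscale (a + b) p = cscale a p + cscale b p"
  by (rule poly_mapping_eqI) (simp add: lookup_add distrib_right)

lemma cscale_minus_left [simp]: "cscale (- c) p = - cscale c p"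
  by (rule poly_mapping_eqI) simp

lemma cscale_minus_right [simp]: "cscale c (- p) = - cscale c p"
  by (rule poly_mapping_eqI) simp

lemma cscale_diff_right: "cscale c (p - q) = cscale c p - cscale c q"
  by (simp only: diff_conv_add_uminus cscale_add_right cscale_minus_right)

lemma cscale_sum: "cscale c (\<Sum>i\<in>A. f i) = (\<Sum>i\<in>A. cscale c (f i))"
  by (induction A rule: infinite_finite_induct) (simp_all add: cscale_add_right)

definition linear_map ::
    "(('x \<Rightarrow>\<^sub>0 'k::{comm_ring,comm_monoid_mult}) \<Rightarrow> ('y \<Rightarrow>\<^sub>0 'k)) \<Rightarrow> bool" where
  "linear_map g \<longleftrightarrow> (\<forall>p q. g (p + q) = g p + g q) \<and> (\<forall>c p. g (cscale c p) = cscale c (g p))"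

lemma linear_mapI:
  "(\<And>p q. g (p + q) = g p + g q) \<Longrightarrow> (\<And>c p. g (cscale c p) = cscale c (g p)) \<Longrightarrow> linear_map g"
  by (simp add: linear_map_def)

context
  fixes g :: "('x \<Rightarrow>\<^sub>0 'k::{comm_ring,comm_monoid_mult}) \<Rightarrow> ('y \<Rightarrow>\<^sub>0 'k)"
  assumes g: "linear_map g"
begin

lemma linear_map_add: "g (p + q) = g p + g q" using g by (simp add: linear_map_def)

lemma linear_map_cscale: "g (cscale c p) = cscale c (g p)" using g by (simp add: linear_map_def)

lemma linear_map_zero: "g 0 = 0" using linear_map_add[of 0 0] by simp

lemma linear_map_minus: "g (- p) = - g p"
  using linear_map_add[of p "- p"] by (simp add: linear_map_zero eq_neg_iff_add_eq_0 add.commute)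

lemma linear_map_diff: "g (p - q) = g p - g q"
  by (simp only: diff_conv_add_uminus linear_map_add linear_map_minus)

lemma linear_map_sum: "g (\<Sum>i\<in>A. f i) = (\<Sum>i\<in>A. g (f i))"
  by (induction A rule: infinite_finite_induct) (simp_all add: linear_map_add linear_map_zero)

end

lemmas linear_map_simps =
  linear_map_add linear_map_cscale linear_map_zero linear_map_minus linear_map_diff linear_map_sum

lemma lin_superset:
  assumes "finite A" "Poly_Mapping.keys p \<subseteq> A"
  shows "lin f p = (\<Sum>x\<in>A. cscale (Poly_Mapping.lookup p x) (f x))"
  unfolding lin_def using assms
  by (intro sum.mono_neutral_left) (auto simp: in_keys_iff)

lemma linear_map_lin [simp]: "linear_map (lin f)"
proof (rule linear_mapI)
  fix p q :: "'a \<Rightarrow>\<^sub>0 'b"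
  let ?A = "Poly_Mapping.keys p \<union> Poly_Mapping.keys q \<union> Poly_Mapping.keys (p + q)"
  show "lin f (p + q) = lin f p + lin f q"
    using lin_superset[of ?A p f] lin_superset[of ?A q f] lin_superset[of ?A "p + q" f]
    by (simp add: sum.distrib lookup_add cscale_add_left subset_iff)
next
  fix c and p :: "'a \<Rightarrow>\<^sub>0 'b"
  let ?A = "Poly_Mapping.keys p \<union> Poly_Mapping.keys (cscale c p)"
  show "lin f (cscale c p) = cscale c (lin f p)"
    using lin_superset[of ?A p f] lin_superset[of ?A "cscale c p" f] by (simp add: cscale_sum)
qed

lemmas lin_simps = linear_map_simps[OF linear_map_lin]

lemma lin_gen [simp]: "lin f (gen x) = f x"
  by (subst lin_superset[of "{x}"]) simp_all

lemma chain_expansion: "p = (\<Sum>x\<in>Poly_Mapping.keys p. cscale (Poly_Mapping.lookup p x) (gen x))"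
  by (rule poly_mapping_eqI)
     (simp add: lookup_sum lookup_single when_def in_keys_iff if_distrib cong: if_cong)

lemma linear_map_eq_on_free:
  assumes "linear_map f" "linear_map g" "\<And>x. x \<in> X \<Longrightarrow> f (gen x) = g (gen x)" "p \<in> free X"
  shows "f p = g p"
proof -
  have "f p = (\<Sum>x\<in>Poly_Mapping.keys p. cscale (Poly_Mapping.lookup p x) (f (gen x)))"
    by (subst chain_expansion) (simp add: linear_map_simps[OF assms(1)])
  also have "\<dots> = (\<Sum>x\<in>Poly_Mapping.keys p. cscale (Poly_Mapping.lookup p x) (g (gen x)))"
    using assms(3,4) by (intro sum.cong) (auto simp: free_def)
  also have "\<dots> = g p"
    by (subst (3) chain_expansion) (simp add: linear_map_simps[OF assms(2)])
  finally show ?thesis .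
qed

lemma linear_map_ext:
  assumes "linear_map f" "linear_map g" "\<And>x. f (gen x) = g (gen x)"
  shows "f p = g p"
  by (rule linear_map_eq_on_free[where X = UNIV, OF assms]) (simp add: free_def)

lemma linear_map_comp: "linear_map f \<Longrightarrow> linear_map g \<Longrightarrow> linear_map (\<lambda>p. f (g p))"
  by (simp add: linear_map_def)

lemma linear_map_plus: "linear_map f \<Longrightarrow> linear_map g \<Longrightarrow> linear_map (\<lambda>p. f p + g p)"
  by (simp add: linear_map_def cscale_add_right algebra_simps)

lemma linear_map_difference: "linear_map f \<Longrightarrow> linear_map g \<Longrightarrow> linear_map (\<lambda>p. f p - g p)"
  by (simp add: linear_map_def cscale_diff_right algebra_simps)

lemma linear_map_scaled: "linear_map f \<Longrightarrow> linear_map (\<lambda>p. cscale c (f p))"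
  by (simp add: linear_map_def cscale_add_right mult.commute)

lemma linear_map_ident [simp]: "linear_map (\<lambda>p. p)" by (simp add: linear_map_def)

lemma linear_map_cscale_self [simp]: "linear_map (cscale c)"
  by (rule linear_map_scaled[OF linear_map_ident])

lemma linear_map_zero_map [simp]: "linear_map (\<lambda>p. 0)" by (simp add: linear_map_def)

lemma submodI:
  "0 \<in> M \<Longrightarrow> (\<And>p q. p \<in> M \<Longrightarrow> q \<in> M \<Longrightarrow> p + q \<in> M) \<Longrightarrow> (\<And>c p. p \<in> M \<Longrightarrow> cscale c p \<in> M) \<Longrightarrow> submod M"
  by (auto simp: submod_def)

lemma submod_zero: "submod M \<Longrightarrow> 0 \<in> M"
  and submod_add: "submod M \<Longrightarrow> p \<in> M \<Longrightarrow> q \<in> M \<Longrightarrow> p + q \<in> M"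
  and submod_cscale: "submod M \<Longrightarrow> p \<in> M \<Longrightarrow> cscale c p \<in> M"
  by (auto simp: submod_def)

lemma submod_minus: "submod M \<Longrightarrow> p \<in> M \<Longrightarrow> - p \<in> M"
  using submod_cscale[of M p "- 1"] by simp

lemma submod_diff: "submod M \<Longrightarrow> p \<in> M \<Longrightarrow> q \<in> M \<Longrightarrow> p - q \<in> M"
  by (simp only: diff_conv_add_uminus submod_add submod_minus)

lemma submod_sum: "submod M \<Longrightarrow> (\<And>i. i \<in> A \<Longrightarrow> f i \<in> M) \<Longrightarrow> (\<Sum>i\<in>A. f i) \<in> M"
  by (induction A rule: infinite_finite_induct) (simp_all add: submod_add submod_zero)

lemmas submod_closed = submod_zero submod_add submod_cscale submod_minus submod_diff submod_sum

lemma submod_free [simp]: "submod (free X)"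
proof (rule submodI)
  fix p q :: "'a \<Rightarrow>\<^sub>0 'b" assume "p \<in> free X" "q \<in> free X"
  then show "p + q \<in> free X"
    using Poly_Mapping.keys_add[of p q] by (auto simp: free_def)
next
  fix c and p :: "'a \<Rightarrow>\<^sub>0 'b" assume p: "p \<in> free X"
  have "Poly_Mapping.keys (cscale c p) \<subseteq> Poly_Mapping.keys p"
    by (auto simp: in_keys_iff)
  then show "cscale c p \<in> free X" using p by (auto simp: free_def)
qed (simp add: free_def)

lemma gen_in_free: "x \<in> X \<Longrightarrow> gen x \<in> free X"
  by (auto simp: free_def)

lemma submod_vimage: "linear_map g \<Longrightarrow> submod M \<Longrightarrow> submod {p. g p \<in> M}"
  by (simp add: submod_def linear_map_simps)

lemma submod_hull [simp]: "submod (submod hull B)"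
  by (rule hull_in) (auto simp: submod_def)

lemma submod_singleton_zero [simp]: "submod {0}"
  by (simp add: submod_def)

lemma hull_linear_image:
  assumes "linear_map g" "submod M" "\<And>b. b \<in> B \<Longrightarrow> g b \<in> M" "p \<in> submod hull B"
  shows "g p \<in> M"
proof -
  have "submod hull B \<subseteq> {p. g p \<in> M}"
    using assms by (intro hull_minimal submod_vimage) auto
  then show ?thesis using assms(4) by auto
qed

lemma hull_linear_kernel:
  assumes "linear_map g" "\<And>b. b \<in> B \<Longrightarrow> g b = 0" "p \<in> submod hull B"
  shows "g p = 0"
  using hull_linear_image[of g "{0}" B p] assms by auto

lemma hull_in_submod: "submod M \<Longrightarrow> B \<subseteq> M \<Longrightarrow> submod hull B \<subseteq> M"
  by (rule hull_minimal)

lemma free_linear_image: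
  assumes "linear_map g" "submod M" "\<And>x. x \<in> X \<Longrightarrow> g (gen x) \<in> M" "p \<in> free X"
  shows "g p \<in> M"
proof -
  have "g p = (\<Sum>x\<in>Poly_Mapping.keys p. cscale (Poly_Mapping.lookup p x) (g (gen x)))"
    by (subst chain_expansion) (simp add: linear_map_simps[OF assms(1)])
  also have "\<dots> \<in> M"
    using assms(2-4) by (intro submod_sum submod_cscale) (auto simp: free_def)
  finally show ?thesis .
qed

lemma lin_in_submod:
  assumes "submod M" "\<And>x. x \<in> X \<Longrightarrow> f x \<in> M" "p \<in> free X"
  shows "lin f p \<in> M"
  using free_linear_image[of "lin f" M X p] assms by simp

lemma coset_self: "submod M \<Longrightarrow> p \<in> coset M p"
  by (simp add: coset_def submod_zero)

lemma coset_eq_iff: "submod M \<Longrightarrow> coset M p = coset M q \<longleftrightarrow> p - q \<in> M"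
proof
  assume M: "submod M" and "coset M p = coset M q"
  then show "p - q \<in> M" using coset_self[of M p] by (auto simp: coset_def)
next
  assume M: "submod M" and pq: "p - q \<in> M"
  show "coset M p = coset M q"
  proof (rule set_eqI)
    fix r
    have "r - p \<in> M \<longleftrightarrow> r - q \<in> M"
      using submod_add[OF M _ pq, of "r - p"] submod_diff[OF M _ pq, of "r - q"] by auto
    then show "r \<in> coset M p \<longleftrightarrow> r \<in> coset M q" by (simp add: coset_def)
  qed
qed

lemma in_coset_iff: "q \<in> coset M p \<longleftrightarrow> q - p \<in> M"
  by (simp add: coset_def)

lemma linear_map_bilin_left [simp]: "linear_map (\<lambda>p. bilin f p q)"
  by (simp add: bilin_def)

lemma linear_map_bilin_right [simp]: "linear_map (bilin f p)"
proof -
  have "lin (\<lambda>x. lin (f x) (q + r)) p = lin (\<lambda>x. lin (f x) q) p + lin (\<lambda>x. lin (f x) r) p" for q r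
    by (simp add: lin_def[of _ p] lin_simps cscale_add_right sum.distrib)
  moreover have "lin (\<lambda>x. lin (f x) (cscale c q)) p = cscale c (lin (\<lambda>x. lin (f x) q) p)" for c q
    by (simp add: lin_def[of _ p] lin_simps cscale_sum mult.commute)
  ultimately show ?thesis by (auto simp: linear_map_def bilin_def)
qed

lemma bilin_gen [simp]: "bilin f (gen x) (gen y) = f x y"
  by (simp add: bilin_def)

lemma bilin_gen_left: "bilin f (gen x) q = lin (f x) q"
  by (simp add: bilin_def)

lemma bilin_in_submod:
  assumes "submod M" "\<And>x y. x \<in> X \<Longrightarrow> y \<in> Y \<Longrightarrow> f x y \<in> M" "p \<in> free X" "q \<in> free Y"
  shows "bilin f p q \<in> M"
  unfolding bilin_def using assms by (intro lin_in_submod) auto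

subsection \<open>The concatenation product\<close>

abbreviation concat_product ::
    "('x list \<Rightarrow>\<^sub>0 'k::{comm_ring,comm_monoid_mult}) \<Rightarrow> ('x list \<Rightarrow>\<^sub>0 'k) \<Rightarrow> ('x list \<Rightarrow>\<^sub>0 'k)"
    (infixl "\<odot>" 70) where
  "p \<odot> q \<equiv> bilin (\<lambda>u v. gen (u @ v)) p q"

lemma linear_map_word_mult_left: "linear_map (\<lambda>p. p \<odot> q)"
  and linear_map_word_mult_right: "linear_map (\<lambda>q. p \<odot> q)"
  by simp_all

lemmas word_mult_left = linear_map_simps[OF linear_map_word_mult_left]
lemmas word_mult_right = linear_map_simps[OF linear_map_word_mult_right]

lemma word_mult_gen_gen [simp]: "gen u \<odot> gen v = gen (u @ v)"
  by simp

lemma linear_map_word_mult_comp_left: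
  "linear_map g \<Longrightarrow> linear_map (\<lambda>p. g p \<odot> q)"
  by (rule linear_map_comp[OF linear_map_word_mult_left])

lemma linear_map_word_mult_comp_right:
  "linear_map g \<Longrightarrow> linear_map (\<lambda>q. p \<odot> g q)"
  by (rule linear_map_comp[OF linear_map_word_mult_right])

lemmas linear_map_intros = linear_map_ident linear_map_lin linear_map_word_mult_comp_left
  linear_map_word_mult_comp_right linear_map_plus linear_map_difference linear_map_scaled

lemma word_mult_unit_left [simp]: "gen [] \<odot> p = p"
  by (rule linear_map_ext[of "\<lambda>p. gen [] \<odot> p"]) (auto intro: linear_map_intros)

lemma word_mult_unit_right [simp]: "p \<odot> gen [] = p"
  by (rule linear_map_ext[of "\<lambda>p. p \<odot> gen []"]) (auto intro: linear_map_intros)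

lemma word_mult_assoc: "(p \<odot> q) \<odot> r = p \<odot> (q \<odot> r)"
proof (rule linear_map_ext[of "\<lambda>p. (p \<odot> q) \<odot> r" "\<lambda>p. p \<odot> (q \<odot> r)"])
  fix u
  show "(gen u \<odot> q) \<odot> r = gen u \<odot> (q \<odot> r)"
  proof (rule linear_map_ext[of "\<lambda>q. (gen u \<odot> q) \<odot> r" "\<lambda>q. gen u \<odot> (q \<odot> r)"])
    fix v
    show "(gen u \<odot> gen v) \<odot> r = gen u \<odot> (gen v \<odot> r)"
      by (rule linear_map_ext[of "\<lambda>r. (gen u \<odot> gen v) \<odot> r" "\<lambda>r. gen u \<odot> (gen v \<odot> r)"])
         (auto intro!: linear_map_intros)
  qed (auto intro!: linear_map_intros)
qed (auto intro!: linear_map_intros)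

section \<open>Transport of differential graded algebra structures\<close>

lemma dga_isoD:
  assumes "dga_iso A B \<phi>"
  shows "bij_betw (\<phi> n) (gr A n) (gr B n)"
    and "a \<in> gr A n \<Longrightarrow> b \<in> gr A n \<Longrightarrow> \<phi> n (gadd A n a b) = gadd B n (\<phi> n a) (\<phi> n b)"
    and "a \<in> gr A n \<Longrightarrow> \<phi> n (gscale A n r a) = gscale B n r (\<phi> n a)"
    and "a \<in> gr A n \<Longrightarrow> 0 < n \<Longrightarrow> \<phi> (n - 1) (bd A n a) = bd B n (\<phi> n a)"
    and "a \<in> gr A m \<Longrightarrow> b \<in> gr A n \<Longrightarrow> \<phi> (m + n) (mult A m n a b) = mult B m n (\<phi> m a) (\<phi> n b)"
    and "\<phi> 0 (unit A) = unit B"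
proof -
  have *: "bij_betw (\<phi> n) (gr A n) (gr B n) \<and>
      (\<forall>a\<in>gr A n.
        (\<forall>b\<in>gr A n. \<phi> n (gadd A n a b) = gadd B n (\<phi> n a) (\<phi> n b)) \<and>
        (\<forall>r. \<phi> n (gscale A n r a) = gscale B n r (\<phi> n a)) \<and>
        (0 < n \<longrightarrow> \<phi> (n - 1) (bd A n a) = bd B n (\<phi> n a)))" for n
    by (rule assms[unfolded dga_iso_def, THEN conjunct1, THEN spec])
  show "bij_betw (\<phi> n) (gr A n) (gr B n)" using *[of n] by (rule conjunct1)
  show "a \<in> gr A n \<Longrightarrow> b \<in> gr A n \<Longrightarrow> \<phi> n (gadd A n a b) = gadd B n (\<phi> n a) (\<phi> n b)"
    using conjunct2[OF *[of n]] by (elim ballE conjE) auto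
  show "a \<in> gr A n \<Longrightarrow> \<phi> n (gscale A n r a) = gscale B n r (\<phi> n a)"
    using conjunct2[OF *[of n]] by simp
  show "a \<in> gr A n \<Longrightarrow> 0 < n \<Longrightarrow> \<phi> (n - 1) (bd A n a) = bd B n (\<phi> n a)"
    using conjunct2[OF *[of n]] by simp
  show "a \<in> gr A m \<Longrightarrow> b \<in> gr A n \<Longrightarrow> \<phi> (m + n) (mult A m n a b) = mult B m n (\<phi> m a) (\<phi> n b)"
    and "\<phi> 0 (unit A) = unit B"
    using assms unfolding dga_iso_def by simp_all
qed

lemma dg_algebraD:
  assumes "dg_algebra A"
  shows "gzero A n \<in> gr A n"
    and "a \<in> gr A n \<Longrightarrow> b \<in> gr A n \<Longrightarrow> gadd A n a b \<in> gr A n"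
    and "a \<in> gr A n \<Longrightarrow> b \<in> gr A n \<Longrightarrow> gadd A n a b = gadd A n b a"
    and "a \<in> gr A n \<Longrightarrow> b \<in> gr A n \<Longrightarrow> c \<in> gr A n \<Longrightarrow>
      gadd A n (gadd A n a b) c = gadd A n a (gadd A n b c)"
    and "a \<in> gr A n \<Longrightarrow> gadd A n (gzero A n) a = a"
    and "a \<in> gr A n \<Longrightarrow> \<exists>b\<in>gr A n. gadd A n a b = gzero A n"
    and "a \<in> gr A n \<Longrightarrow> gscale A n 1 a = a"
    and "a \<in> gr A n \<Longrightarrow> gscale A n r a \<in> gr A n"
    and "a \<in> gr A n \<Longrightarrow> gscale A n (r * s) a = gscale A n r (gscale A n s a)"
    and "a \<in> gr A n \<Longrightarrow> gscale A n (r + s) a = gadd A n (gscale A n r a) (gscale A n s a)"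
    and "a \<in> gr A n \<Longrightarrow> b \<in> gr A n \<Longrightarrow>
      gscale A n r (gadd A n a b) = gadd A n (gscale A n r a) (gscale A n r b)"
proof -
  have "graded_module A" using assms by (simp add: dg_algebra_def chain_complex_def)
  note this[unfolded graded_module_def, rule_format, of n]
  note * = this[THEN conjunct1] this[THEN conjunct2, THEN conjunct1]
    this[THEN conjunct2, THEN conjunct2, THEN conjunct1]
    this[THEN conjunct2, THEN conjunct2, THEN conjunct2, THEN conjunct1]
    this[THEN conjunct2, THEN conjunct2, THEN conjunct2, THEN conjunct2, THEN conjunct1]
    this[THEN conjunct2, THEN conjunct2, THEN conjunct2, THEN conjunct2, THEN conjunct2]
  show "gzero A n \<in> gr A n" by (rule *(1))
  show "a \<in> gr A n \<Longrightarrow> b \<in> gr A n \<Longrightarrow> gadd A n a b \<in> gr A n"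
    "a \<in> gr A n \<Longrightarrow> b \<in> gr A n \<Longrightarrow> gadd A n a b = gadd A n b a" using *(2) by blast+
  show "a \<in> gr A n \<Longrightarrow> b \<in> gr A n \<Longrightarrow> c \<in> gr A n \<Longrightarrow>
      gadd A n (gadd A n a b) c = gadd A n a (gadd A n b c)" using *(3) by blast
  show "a \<in> gr A n \<Longrightarrow> gadd A n (gzero A n) a = a"
    "a \<in> gr A n \<Longrightarrow> \<exists>b\<in>gr A n. gadd A n a b = gzero A n" using *(4) by blast+
  show "a \<in> gr A n \<Longrightarrow> gscale A n 1 a = a" "a \<in> gr A n \<Longrightarrow> gscale A n r a \<in> gr A n"
    "a \<in> gr A n \<Longrightarrow> gscale A n (r * s) a = gscale A n r (gscale A n s a)"
    "a \<in> gr A n \<Longrightarrow> gscale A n (r + s) a = gadd A n (gscale A n r a) (gscale A n s a)"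
    using *(5) by blast+
  show "a \<in> gr A n \<Longrightarrow> b \<in> gr A n \<Longrightarrow>
      gscale A n r (gadd A n a b) = gadd A n (gscale A n r a) (gscale A n r b)" using *(6) by blast
qed

lemma dg_algebraD2:
  assumes "dg_algebra A"
  shows "0 < n \<Longrightarrow> a \<in> gr A n \<Longrightarrow> bd A n a \<in> gr A (n - 1)"
    and "0 < n \<Longrightarrow> a \<in> gr A n \<Longrightarrow> b \<in> gr A n \<Longrightarrow>
      bd A n (gadd A n a b) = gadd A (n - 1) (bd A n a) (bd A n b)"
    and "0 < n \<Longrightarrow> a \<in> gr A n \<Longrightarrow> bd A n (gscale A n r a) = gscale A (n - 1) r (bd A n a)"
    and "1 < n \<Longrightarrow> a \<in> gr A n \<Longrightarrow> bd A (n - 1) (bd A n a) = gzero A (n - 2)"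
proof -
  have "chain_complex A" using assms by (simp add: dg_algebra_def)
  then have *: "\<forall>n>0. \<forall>a\<in>gr A n. bd A n a \<in> gr A (n - 1) \<and>
      (\<forall>b\<in>gr A n. bd A n (gadd A n a b) = gadd A (n - 1) (bd A n a) (bd A n b)) \<and>
      (\<forall>r. bd A n (gscale A n r a) = gscale A (n - 1) r (bd A n a))"
    and **: "\<forall>n>1. \<forall>a\<in>gr A n. bd A (n - 1) (bd A n a) = gzero A (n - 2)"
    unfolding chain_complex_def by simp_all
  show "0 < n \<Longrightarrow> a \<in> gr A n \<Longrightarrow> bd A n a \<in> gr A (n - 1)" using * by simp
  show "0 < n \<Longrightarrow> a \<in> gr A n \<Longrightarrow> b \<in> gr A n \<Longrightarrow>
      bd A n (gadd A n a b) = gadd A (n - 1) (bd A n a) (bd A n b)" using * by simp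
  show "0 < n \<Longrightarrow> a \<in> gr A n \<Longrightarrow> bd A n (gscale A n r a) = gscale A (n - 1) r (bd A n a)"
    using * by simp
  show "1 < n \<Longrightarrow> a \<in> gr A n \<Longrightarrow> bd A (n - 1) (bd A n a) = gzero A (n - 2)" using ** by simp
qed

lemma dg_algebraD3:
  assumes "dg_algebra A"
  shows "a \<in> gr A m \<Longrightarrow> b \<in> gr A n \<Longrightarrow> mult A m n a b \<in> gr A (m + n)"
    and "a \<in> gr A m \<Longrightarrow> a' \<in> gr A m \<Longrightarrow> b \<in> gr A n \<Longrightarrow>
      mult A m n (gadd A m a a') b = gadd A (m + n) (mult A m n a b) (mult A m n a' b)"
    and "a \<in> gr A m \<Longrightarrow> b \<in> gr A n \<Longrightarrow> b' \<in> gr A n \<Longrightarrow>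
      mult A m n a (gadd A n b b') = gadd A (m + n) (mult A m n a b) (mult A m n a b')"
    and "a \<in> gr A m \<Longrightarrow> b \<in> gr A n \<Longrightarrow>
      mult A m n (gscale A m r a) b = gscale A (m + n) r (mult A m n a b)"
    and "a \<in> gr A m \<Longrightarrow> b \<in> gr A n \<Longrightarrow>
      mult A m n a (gscale A n r b) = gscale A (m + n) r (mult A m n a b)"
    and "a \<in> gr A l \<Longrightarrow> b \<in> gr A m \<Longrightarrow> c \<in> gr A n \<Longrightarrow>
      mult A (l + m) n (mult A l m a b) c = mult A l (m + n) a (mult A m n b c)"
    and "unit A \<in> gr A 0"
    and "a \<in> gr A n \<Longrightarrow> mult A 0 n (unit A) a = a"
    and "a \<in> gr A n \<Longrightarrow> mult A n 0 a (unit A) = a"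
    and "0 < m + n \<Longrightarrow> a \<in> gr A m \<Longrightarrow> b \<in> gr A n \<Longrightarrow>
      bd A (m + n) (mult A m n a b) = gadd A (m + n - 1)
        (if m = 0 then gzero A (m + n - 1) else mult A (m - 1) n (bd A m a) b)
        (if n = 0 then gzero A (m + n - 1)
         else gscale A (m + n - 1) ((-1) ^ m) (mult A m (n - 1) a (bd A n b)))"
proof -
  note * = assms[unfolded dg_algebra_def, THEN conjunct2]
  note *(1)[THEN conjunct1, rule_format]
  note m = this
  show "a \<in> gr A m \<Longrightarrow> b \<in> gr A n \<Longrightarrow> mult A m n a b \<in> gr A (m + n)"
    using m[of a m b n] by simp
  show "a \<in> gr A m \<Longrightarrow> a' \<in> gr A m \<Longrightarrow> b \<in> gr A n \<Longrightarrow>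
      mult A m n (gadd A m a a') b = gadd A (m + n) (mult A m n a b) (mult A m n a' b)"
    using m[of a m b n] by simp
  show "a \<in> gr A m \<Longrightarrow> b \<in> gr A n \<Longrightarrow> b' \<in> gr A n \<Longrightarrow>
      mult A m n a (gadd A n b b') = gadd A (m + n) (mult A m n a b) (mult A m n a b')"
    using m[of a m b n] by simp
  show "a \<in> gr A m \<Longrightarrow> b \<in> gr A n \<Longrightarrow>
      mult A m n (gscale A m r a) b = gscale A (m + n) r (mult A m n a b)"
    using m[of a m b n] by simp
  show "a \<in> gr A m \<Longrightarrow> b \<in> gr A n \<Longrightarrow>
      mult A m n a (gscale A n r b) = gscale A (m + n) r (mult A m n a b)"
    using m[of a m b n] by simp
  note r = *(1)[THEN conjunct2]
  show "a \<in> gr A l \<Longrightarrow> b \<in> gr A m \<Longrightarrow> c \<in> gr A n \<Longrightarrow>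
      mult A (l + m) n (mult A l m a b) c = mult A l (m + n) a (mult A m n b c)"
    by (rule r[THEN conjunct1, rule_format])
  show "unit A \<in> gr A 0" by (rule r[THEN conjunct2, THEN conjunct1])
  note r = r[THEN conjunct2, THEN conjunct2]
  show "a \<in> gr A n \<Longrightarrow> mult A 0 n (unit A) a = a" "a \<in> gr A n \<Longrightarrow> mult A n 0 a (unit A) = a"
    using r[THEN conjunct1] by simp_all
  show "0 < m + n \<Longrightarrow> a \<in> gr A m \<Longrightarrow> b \<in> gr A n \<Longrightarrow>
      bd A (m + n) (mult A m n a b) = gadd A (m + n - 1)
        (if m = 0 then gzero A (m + n - 1) else mult A (m - 1) n (bd A m a) b)
        (if n = 0 then gzero A (m + n - 1)
         else gscale A (m + n - 1) ((-1) ^ m) (mult A m (n - 1) a (bd A n b)))"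
    by (rule r[THEN conjunct2, rule_format])
qed

text \<open>
  Every axiom of \<open>A\<close> is checked after applying \<open>\<phi>\<close>, which is injective on each component; for this the
  operations of \<open>A\<close> must stay inside its components, which is not part of the notion of isomorphism.
\<close>

lemma dg_algebra_transport:
  fixes A :: "('k::{comm_ring,comm_monoid_mult}, 'a) dga" and B :: "('k, 'b) dga"
  assumes iso: "dga_iso A B \<phi>" and B: "dg_algebra B"
    and zero: "\<And>n. gzero A n \<in> gr A n" "\<And>n. \<phi> n (gzero A n) = gzero B n"
    and add: "\<And>n a b. a \<in> gr A n \<Longrightarrow> b \<in> gr A n \<Longrightarrow> gadd A n a b \<in> gr A n"
    and scale: "\<And>n r a. a \<in> gr A n \<Longrightarrow> gscale A n r a \<in> gr A n"
    and bd: "\<And>n a. 0 < n \<Longrightarrow> a \<in> gr A n \<Longrightarrow> bd A n a \<in> gr A (n - 1)"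
    and mult: "\<And>m n a b. a \<in> gr A m \<Longrightarrow> b \<in> gr A n \<Longrightarrow> mult A m n a b \<in> gr A (m + n)"
    and unit: "unit A \<in> gr A 0"
  shows "dg_algebra A"
proof -
  note i = dga_isoD[OF iso]
  note closed = zero add scale bd mult unit
  have in_B: "\<phi> n a \<in> gr B n" if "a \<in> gr A n" for n a
    using i(1)[of n] that by (auto simp: bij_betw_def)
  have inj: "a = b" if "\<phi> n a = \<phi> n b" "a \<in> gr A n" "b \<in> gr A n" for n a b
    using i(1)[of n] that by (auto simp: bij_betw_def dest: inj_onD)
  note B1 = dg_algebraD[OF B] and B2 = dg_algebraD2[OF B] and B3 = dg_algebraD3[OF B]
  have neg: "\<exists>b\<in>gr A n. gadd A n a b = gzero A n" if a: "a \<in> gr A n" for n a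
  proof -
    obtain c where c: "c \<in> gr B n" "gadd B n (\<phi> n a) c = gzero B n"
      using B1(6)[OF in_B[OF a]] by blast
    then obtain b where "b \<in> gr A n" "c = \<phi> n b"
      using i(1)[of n] by (auto simp: bij_betw_def)
    then show ?thesis using a c by (auto intro!: bexI[of _ b] inj[of n] simp: i closed)
  qed
  have comm: "gadd A n a b = gadd A n b a" if "a \<in> gr A n" "b \<in> gr A n" for n a b
    using that by (intro inj[of n]) (simp_all add: i closed B1(3)[of "\<phi> n a" n "\<phi> n b"] in_B)
  have add_assoc: "gadd A n (gadd A n a b) c = gadd A n a (gadd A n b c)"
    if "a \<in> gr A n" "b \<in> gr A n" "c \<in> gr A n" for n a b c
    using that by (intro inj[of n]) (simp_all add: i closed B1(4) in_B)
  have add_zero: "gadd A n (gzero A n) a = a" if "a \<in> gr A n" for n a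
    using that by (intro inj[of n]) (simp_all add: i closed B1(5) in_B)
  have scale_one: "gscale A n 1 a = a" if "a \<in> gr A n" for n a
    using that by (intro inj[of n]) (simp_all add: i closed B1(7) in_B)
  have scale_scale: "gscale A n (r * s) a = gscale A n r (gscale A n s a)" if "a \<in> gr A n" for n a r s
    using that by (intro inj[of n]) (simp_all add: i closed B1(9) in_B)
  have scale_add: "gscale A n (r + s) a = gadd A n (gscale A n r a) (gscale A n s a)"
    if "a \<in> gr A n" for n a r s
    using that by (intro inj[of n]) (simp_all add: i closed B1(10) in_B)
  have add_scale: "gscale A n r (gadd A n a b) = gadd A n (gscale A n r a) (gscale A n r b)"
    if "a \<in> gr A n" "b \<in> gr A n" for n a b r
    using that by (intro inj[of n]) (simp_all add: i closed B1(11) in_B)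
  have gm: "graded_module A"
    unfolding graded_module_def
    by (intro allI conjI ballI closed neg comm add_assoc add_zero scale_one scale_scale scale_add
        add_scale)
  have bd_bd: "bd A (n - 1) (bd A n a) = gzero A (n - 2)" if "1 < n" "a \<in> gr A n" for n a
  proof (rule inj[of "n - 2"])
    have "bd A n a \<in> gr A (n - 1)" using bd that by simp
    then have "\<phi> (n - 1 - 1) (bd A (n - 1) (bd A n a)) = bd B (n - 1) (bd B n (\<phi> n a))"
      using that by (subst i(4)) (simp_all add: i(4) del: One_nat_def)
    moreover have "n - 1 - 1 = n - 2" by simp
    ultimately show "\<phi> (n - 2) (bd A (n - 1) (bd A n a)) = \<phi> (n - 2) (gzero A (n - 2))"
      using that B2(4)[of n "\<phi> n a"] by (simp add: in_B closed)
    show "bd A (n - 1) (bd A n a) \<in> gr A (n - 2)"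
      using bd[of "n - 1" "bd A n a"] bd[of n a] that by (simp add: numeral_2_eq_2)
  qed (simp add: closed)
  have bd_add: "bd A n (gadd A n a b) = gadd A (n - 1) (bd A n a) (bd A n b)"
    if n: "0 < n" and "a \<in> gr A n" "b \<in> gr A n" for n a b
    using that by (intro inj[of "n - 1"])
      (simp_all only: i(2) i(4)[OF _ n] add bd[OF n] B2(2)[OF n] in_B)
  have bd_scale: "bd A n (gscale A n r a) = gscale A (n - 1) r (bd A n a)"
    if n: "0 < n" and "a \<in> gr A n" for n a r
    using that by (intro inj[of "n - 1"])
      (simp_all only: i(3) i(4)[OF _ n] scale bd[OF n] B2(3)[OF n] in_B)
  have cc: "chain_complex A"
    unfolding chain_complex_def
    by (intro allI impI conjI ballI gm bd_bd bd bd_add bd_scale)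
  have leibniz: "bd A (m + n) (mult A m n a b) = gadd A (m + n - 1)
        (if m = 0 then gzero A (m + n - 1) else mult A (m - 1) n (bd A m a) b)
        (if n = 0 then gzero A (m + n - 1)
         else gscale A (m + n - 1) ((-1) ^ m) (mult A m (n - 1) a (bd A n b)))" (is "?l = gadd A _ ?r1 ?r2")
    if mn: "0 < m + n" and a: "a \<in> gr A m" and b: "b \<in> gr A n" for m n a b
  proof (rule inj[of "m + n - 1"])
    have r1: "?r1 \<in> gr A (m + n - 1)"
      using closed(1)[of "m + n - 1"] mult[of "bd A m a" "m - 1" b n] bd[of m a] a b by auto
    have f1: "\<phi> (m + n - 1) ?r1 =
        (if m = 0 then gzero B (m + n - 1) else mult B (m - 1) n (bd B m (\<phi> m a)) (\<phi> n b))"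
      using i(5)[of "bd A m a" "m - 1" b n] bd[of m a] a b by (auto simp: i(4) closed simp del: One_nat_def)
    have p2: "0 < n \<Longrightarrow> mult A m (n - 1) a (bd A n b) \<in> gr A (m + n - 1)"
      using mult[of a m "bd A n b" "n - 1"] bd[of n b] a b by auto
    then have r2: "?r2 \<in> gr A (m + n - 1)"
      using closed(1)[of "m + n - 1"] scale by auto
    have f2: "\<phi> (m + n - 1) ?r2 = (if n = 0 then gzero B (m + n - 1)
         else gscale B (m + n - 1) ((-1) ^ m) (mult B m (n - 1) (\<phi> m a) (bd B n (\<phi> n b))))"
      using i(5)[of a m "bd A n b" "n - 1"] bd[of n b] a b p2 i(3)[OF p2, of "(-1) ^ m"]
      by (auto simp: i(4) closed simp del: One_nat_def)
    show "\<phi> (m + n - 1) ?l = \<phi> (m + n - 1) (gadd A (m + n - 1) ?r1 ?r2)"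
      unfolding i(2)[OF r1 r2] f1 f2
      using mn a b i(4)[OF mult[OF a b] mn] by (simp add: i(5) B3(10) in_B)
    show "?l \<in> gr A (m + n - 1)" by (rule bd[OF mn mult[OF a b]])
    show "gadd A (m + n - 1) ?r1 ?r2 \<in> gr A (m + n - 1)" by (rule add[OF r1 r2])
  qed
  have assoc: "mult A (l + m) n (mult A l m a b) c = mult A l (m + n) a (mult A m n b c)"
    if "a \<in> gr A l" "b \<in> gr A m" "c \<in> gr A n" for l m n a b c
  proof (rule inj[of "l + m + n"])
    show "mult A (l + m) n (mult A l m a b) c \<in> gr A (l + m + n)"
      by (intro mult that)
    show "mult A l (m + n) a (mult A m n b c) \<in> gr A (l + m + n)"
      using mult[OF that(1) mult[OF that(2,3)]] by (simp add: add.assoc)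
    show "\<phi> (l + m + n) (mult A (l + m) n (mult A l m a b) c) =
        \<phi> (l + m + n) (mult A l (m + n) a (mult A m n b c))"
      using that i(5)[of "mult A l m a b" "l + m" c n] i(5)[of a l "mult A m n b c" "m + n"]
        B3(6)[of "\<phi> l a" l "\<phi> m b" m "\<phi> n c" n]
      by (simp add: mult i(5) in_B add.assoc)
  qed
  have u1: "mult A 0 n (unit A) a = a" and u2: "mult A n 0 a (unit A) = a" if "a \<in> gr A n" for n a
    using i(5)[OF unit that] i(5)[OF that unit] i(6) mult[OF unit that] mult[OF that unit]
    by (auto intro!: inj[of n] simp: that B3(8,9) in_B)
  have dist1: "mult A m n (gadd A m a a') b = gadd A (m + n) (mult A m n a b) (mult A m n a' b)"
    if "a \<in> gr A m" "a' \<in> gr A m" "b \<in> gr A n" for m n a a' b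
    using that by (intro inj[of "m + n"]) (simp_all only: i(2,5) add mult B3(2) in_B)
  have dist2: "mult A m n a (gadd A n b b') = gadd A (m + n) (mult A m n a b) (mult A m n a b')"
    if "a \<in> gr A m" "b \<in> gr A n" "b' \<in> gr A n" for m n a b b'
    using that by (intro inj[of "m + n"]) (simp_all only: i(2,5) add mult B3(3) in_B)
  have hom1: "mult A m n (gscale A m r a) b = gscale A (m + n) r (mult A m n a b)"
    if "a \<in> gr A m" "b \<in> gr A n" for m n a b r
    using that by (intro inj[of "m + n"]) (simp_all only: i(3,5) scale mult B3(4) in_B)
  have hom2: "mult A m n a (gscale A n r b) = gscale A (m + n) r (mult A m n a b)"
    if "a \<in> gr A m" "b \<in> gr A n" for m n a b r
    using that by (intro inj[of "m + n"]) (simp_all only: i(3,5) scale mult B3(5) in_B)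
  show ?thesis
    unfolding dg_algebra_def
    by (intro allI impI conjI ballI; (fact cc | rule leibniz | rule assoc | rule u1 | rule u2 | rule unit | rule mult |
        rule dist1 | rule dist2 | rule hom1 | rule hom2); (assumption)?)
qed

lemma dga_isomorphic_via:
  fixes A :: "('k::{comm_ring,comm_monoid_mult}, 'a) dga" and B :: "('k, 'b) dga" and M :: "('k, 'c) dga"
  assumes A: "dg_algebra A" "dga_iso A M \<phi>" and B: "dg_algebra B" "dga_iso B M \<psi>"
  shows "dga_isomorphic A B"
proof -
  define \<chi> where "\<chi> n = (\<lambda>a. inv_into (gr B n) (\<psi> n) (\<phi> n a))" for n
  note iA = dga_isoD[OF A(2)] and iB = dga_isoD[OF B(2)]
  have \<chi>: "\<chi> n a \<in> gr B n" "\<psi> n (\<chi> n a) = \<phi> n a" if "a \<in> gr A n" for n a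
  proof -
    have "\<phi> n a \<in> \<psi> n ` gr B n" using that iA(1)[of n] iB(1)[of n] by (auto simp: bij_betw_def)
    then show "\<chi> n a \<in> gr B n" "\<psi> n (\<chi> n a) = \<phi> n a"
      by (simp_all add: \<chi>_def inv_into_into f_inv_into_f)
  qed
  have eq: "\<chi> n a = b" if "a \<in> gr A n" "b \<in> gr B n" "\<phi> n a = \<psi> n b" for n a b
    using that \<chi>[OF that(1)] iB(1)[of n] by (auto simp: bij_betw_def dest: inj_onD)
  note cA = dg_algebraD(1,2,8)[OF A(1)] dg_algebraD2(1)[OF A(1)] dg_algebraD3(1,7)[OF A(1)]
  note cB = dg_algebraD(1,2,8)[OF B(1)] dg_algebraD2(1)[OF B(1)] dg_algebraD3(1,7)[OF B(1)]
  have bij: "bij_betw (\<chi> n) (gr A n) (gr B n)" for n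
    unfolding \<chi>_def using bij_betw_trans[OF iA(1) bij_betw_inv_into[OF iB(1)], of n]
    by (simp add: comp_def)
  have "\<chi> n (gadd A n a b) = gadd B n (\<chi> n a) (\<chi> n b)" if "a \<in> gr A n" "b \<in> gr A n" for n a b
    using that by (intro eq) (simp_all only: cA cB \<chi> iA(2) iB(2))
  moreover have "\<chi> n (gscale A n r a) = gscale B n r (\<chi> n a)" if "a \<in> gr A n" for n a r
    using that by (intro eq) (simp_all only: cA cB \<chi> iA(3) iB(3))
  moreover have "\<chi> (n - 1) (bd A n a) = bd B n (\<chi> n a)" if "a \<in> gr A n" "0 < n" for n a
    using that by (intro eq) (simp_all only: cA cB \<chi> iA(4) iB(4))
  moreover have "\<chi> (m + n) (mult A m n a b) = mult B m n (\<chi> m a) (\<chi> n b)"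
    if "a \<in> gr A m" "b \<in> gr A n" for m n a b
    using that by (intro eq) (simp_all only: cA cB \<chi> iA(5) iB(5))
  moreover have "\<chi> 0 (unit A) = unit B"
    by (intro eq) (simp_all only: cA cB iA(6) iB(6))
  ultimately have "dga_iso A B \<chi>"
    using bij unfolding dga_iso_def by blast
  then show ?thesis using A B by (auto simp: dga_isomorphic_def)
qed

section \<open>Word algebras\<close>

definition word_dga ::
    "(nat \<Rightarrow> 'x list set) \<Rightarrow> ('x list \<Rightarrow> ('x list \<Rightarrow>\<^sub>0 'k::{comm_ring,comm_monoid_mult})) \<Rightarrow>
     ('k, 'x list \<Rightarrow>\<^sub>0 'k) dga" where
  "word_dga Y D = \<lparr>gr = (\<lambda>n. free (Y n)), gzero = (\<lambda>n. 0), gadd = (\<lambda>n. (+)), gscale = (\<lambda>n. cscale),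
    bd = (\<lambda>n. lin D), mult = (\<lambda>m n. bilin (\<lambda>u v. gen (u @ v))), unit = gen []\<rparr>"

lemma word_leibniz:
  fixes D :: "'x list \<Rightarrow> ('x list \<Rightarrow>\<^sub>0 'k::{comm_ring,comm_monoid_mult})"
  assumes D: "\<And>u v. u \<in> U \<Longrightarrow> D (u @ v) = D u \<odot> gen v + cscale ((-1) ^ m) (gen u \<odot> D v)"
    and p: "p \<in> free U"
  shows "lin D (p \<odot> q) = lin D p \<odot> q + cscale ((-1) ^ m) (p \<odot> lin D q)"
proof (rule linear_map_eq_on_free[where f = "\<lambda>p. lin D (p \<odot> q)"
      and g = "\<lambda>p. lin D p \<odot> q + cscale ((-1) ^ m) (p \<odot> lin D q)", OF _ _ _ p])
  fix u assume u: "u \<in> U"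
  show "lin D (gen u \<odot> q) = lin D (gen u) \<odot> q + cscale ((-1) ^ m) (gen u \<odot> lin D q)"
    by (rule linear_map_ext[where f = "\<lambda>q. lin D (gen u \<odot> q)"
          and g = "\<lambda>q. lin D (gen u) \<odot> q + cscale ((-1) ^ m) (gen u \<odot> lin D q)"])
       (auto intro!: linear_map_intros linear_map_comp[of "lin D"] simp: D[OF u])
qed (auto intro!: linear_map_intros linear_map_comp[of "lin D"])

text \<open>
  As all operations are linear and \<open>D\<close> satisfies the Leibniz rule, it suffices to look at words.
\<close>

lemma dg_algebra_word_dga:
  fixes Y :: "nat \<Rightarrow> 'x list set" and D :: "'x list \<Rightarrow> ('x list \<Rightarrow>\<^sub>0 'k::{comm_ring,comm_monoid_mult})"
  assumes Y: "[] \<in> Y 0" "\<And>m n u v. u \<in> Y m \<Longrightarrow> v \<in> Y n \<Longrightarrow> u @ v \<in> Y (m + n)"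
    and D_in: "\<And>n w. 0 < n \<Longrightarrow> w \<in> Y n \<Longrightarrow> D w \<in> free (Y (n - 1))"
    and D0: "\<And>w. w \<in> Y 0 \<Longrightarrow> D w = 0"
    and D: "\<And>m u v. u \<in> Y m \<Longrightarrow> D (u @ v) = D u \<odot> gen v + cscale ((-1) ^ m) (gen u \<odot> D v)"
    and DD: "\<And>n w. 1 < n \<Longrightarrow> w \<in> Y n \<Longrightarrow> lin D (D w) = 0"
  shows "dg_algebra (word_dga Y D)"
proof -
  have bd_in: "lin D p \<in> free (Y (n - 1))" if "0 < n" "p \<in> free (Y n)" for n p
    by (rule lin_in_submod[OF submod_free _ that(2)]) (rule D_in[OF that(1)])
  have bd0: "lin D p = 0" if "p \<in> free (Y 0)" for p
    using lin_in_submod[OF submod_singleton_zero _ that] D0 by auto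
  have bd_bd: "lin D (lin D p) = 0" if "1 < n" "p \<in> free (Y n)" for n p
    by (rule linear_map_eq_on_free[OF _ linear_map_zero_map _ that(2)])
       (auto intro: linear_map_comp DD[OF that(1)])
  have mult_in: "p \<odot> q \<in> free (Y (m + n))" if "p \<in> free (Y m)" "q \<in> free (Y n)" for p q m n
    by (rule bilin_in_submod[OF submod_free _ that]) (rule gen_in_free[OF Y(2)])
  have unit_in: "gen [] \<in> free (Y 0)" by (rule gen_in_free[OF Y(1)])
  have "graded_module (word_dga Y D)"
    unfolding graded_module_def word_dga_def
    by (auto simp: submod_closed[OF submod_free] cscale_add_left cscale_add_right
        intro: bexI[of _ "- _"] simp: algebra_simps)
  then have "chain_complex (word_dga Y D)"
    unfolding chain_complex_def
    by (simp add: word_dga_def bd_in bd_bd lin_simps del: One_nat_def)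
  moreover have "lin D (p \<odot> q) =
      (if m = 0 then 0 else lin D p \<odot> q) +
      (if n = 0 then 0 else cscale ((-1) ^ m) (p \<odot> lin D q))"
    if "p \<in> free (Y m)" "q \<in> free (Y n)" for m n p q
    using word_leibniz[of "Y m" D m p q, OF D that(1)] bd0[of p] bd0[of q] that
    by (auto simp: word_mult_left(3) word_mult_right(3))
  ultimately show ?thesis
    unfolding dg_algebra_def
    by (simp add: word_dga_def mult_in unit_in word_mult_assoc word_mult_left word_mult_right)
qed

text \<open>Derivations of a word algebra are determined by their values on letters.\<close>

fun word_deriv :: "(nat \<Rightarrow> 'a \<Rightarrow> ('a word \<Rightarrow>\<^sub>0 'k::{comm_ring,comm_monoid_mult})) \<Rightarrow> 'a word \<Rightarrow>
    ('a word \<Rightarrow>\<^sub>0 'k)" where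
  "word_deriv B [] = 0"
| "word_deriv B ((i, c) # w) =
    B i c \<odot> gen w + cscale ((-1) ^ i) (gen [(i, c)] \<odot> word_deriv B w)"

lemma word_deriv_append:
  "word_deriv B (u @ v) = word_deriv B u \<odot> gen v +
    cscale ((-1) ^ sum_list (map fst u)) (gen u \<odot> word_deriv B v)"
proof (induction u)
  case (Cons a u)
  obtain i c where a: "a = (i, c)" by (cases a)
  have e1: "gen (u @ v) = (gen u \<odot> gen v :: 'a word \<Rightarrow>\<^sub>0 'b)"
    and e2: "gen ((i, c) # u) = (gen [(i, c)] \<odot> gen u :: 'a word \<Rightarrow>\<^sub>0 'b)" by simp_all
  show ?case
    by (simp only: a append_Cons word_deriv.simps Cons e1 e2 word_mult_left word_mult_right
        word_mult_assoc cscale_add_right cscale_cscale power_add list.map fst_conv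
        sum_list.Cons add.assoc)
qed (simp add: word_mult_left)

section \<open>Quotients presented by a word algebra\<close>

text \<open>
  The common shape of the cubical dg algebra \<open>Lambda\<close> and of the cobar construction.
\<close>

definition quot_dga ::
    "(nat \<Rightarrow> 'x set) \<Rightarrow> (nat \<Rightarrow> ('x \<Rightarrow>\<^sub>0 'k::{comm_ring,comm_monoid_mult}) set) \<Rightarrow>
     (nat \<Rightarrow> 'x \<Rightarrow> ('x \<Rightarrow>\<^sub>0 'k)) \<Rightarrow> (nat \<Rightarrow> nat \<Rightarrow> ('x \<Rightarrow>\<^sub>0 'k) \<Rightarrow> ('x \<Rightarrow>\<^sub>0 'k) \<Rightarrow> ('x \<Rightarrow>\<^sub>0 'k)) \<Rightarrow>
     ('x \<Rightarrow>\<^sub>0 'k) \<Rightarrow> ('k, ('x \<Rightarrow>\<^sub>0 'k) set) dga" where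
  "quot_dga X M d \<mu> e = cplx.extend (quot_cplx X M d)
    \<lparr>mult = (\<lambda>m n a b. \<Union>p\<in>a. \<Union>q\<in>b. coset (M (m + n)) (\<mu> m n p q)), unit = coset (M 0) e\<rparr>"

lemma UN_coset_const:
  assumes "\<And>p. p \<in> A \<Longrightarrow> f p = C" "a \<in> A"
  shows "(\<Union>p\<in>A. f p) = C"
  using assms by auto

text \<open>
  A coset of \<open>M n\<close> is the same as a value of \<open>F n\<close>. This shows that the operations on cosets, which are
  unions over all representatives, are well defined, and that they correspond to those of the words.
\<close>

lemma quot_dga_iso_word_dga:
  fixes X :: "nat \<Rightarrow> 'x set" and M :: "nat \<Rightarrow> ('x \<Rightarrow>\<^sub>0 'k::{comm_ring,comm_monoid_mult}) set"
    and Y :: "nat \<Rightarrow> 'y list set" and D :: "'y list \<Rightarrow> ('y list \<Rightarrow>\<^sub>0 'k)"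
    and F :: "nat \<Rightarrow> ('x \<Rightarrow>\<^sub>0 'k) \<Rightarrow> ('y list \<Rightarrow>\<^sub>0 'k)"
  assumes model: "dg_algebra (word_dga Y D)"
    and M: "\<And>n. submod (M n)" "\<And>n. M n \<subseteq> free (X n)"
    and F: "\<And>n. linear_map (F n)" "\<And>n x. x \<in> X n \<Longrightarrow> F n (gen x) \<in> free (Y n)"
    and ker: "\<And>n p. p \<in> free (X n) \<Longrightarrow> F n p = 0 \<longleftrightarrow> p \<in> M n"
    and surj: "\<And>n w. w \<in> Y n \<Longrightarrow> \<exists>p\<in>free (X n). F n p = gen w"
    and d: "\<And>n x. 0 < n \<Longrightarrow> x \<in> X n \<Longrightarrow> d n x \<in> free (X (n - 1))"
      "\<And>n x. 0 < n \<Longrightarrow> x \<in> X n \<Longrightarrow> F (n - 1) (d n x) = lin D (F n (gen x))"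
    and mu: "\<And>m n p q. p \<in> free (X m) \<Longrightarrow> q \<in> free (X n) \<Longrightarrow> \<mu> m n p q \<in> free (X (m + n))"
      "\<And>m n p q. p \<in> free (X m) \<Longrightarrow> q \<in> free (X n) \<Longrightarrow>
        F (m + n) (\<mu> m n p q) = F m p \<odot> F n q"
    and e: "e \<in> free (X 0)" "F 0 e = gen []"
  shows "dg_algebra (quot_dga X M d \<mu> e)"
    and "\<exists>\<phi>. dga_iso (quot_dga X M d \<mu> e) (word_dga Y D) \<phi>"
proof -
  define Q where "Q = quot_dga X M d \<mu> e"
  define \<phi> where "\<phi> n = (\<lambda>a. F n (SOME p. p \<in> a))" for n
  note Q_simps = Q_def quot_dga_def quot_cplx_def quot_mod_def gmod.defs cplx.defs
  have cos: "coset (M n) p = coset (M n) q \<longleftrightarrow> F n p = F n q"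
    if "p \<in> free (X n)" "q \<in> free (X n)" for n p q
    using ker[of "p - q" n] that
    by (simp add: coset_eq_iff M linear_map_diff[OF F(1)] submod_diff)
  have rep: "q \<in> free (X n) \<and> F n q = F n p" if "q \<in> coset (M n) p" "p \<in> free (X n)" for n p q
  proof -
    have "q - p \<in> M n" using that by (simp add: coset_def)
    then have "q - p \<in> free (X n)" "F n (q - p) = 0" using M(2)[of n] ker by auto
    then show ?thesis
      using submod_add[OF submod_free _ that(2), of "q - p"] by (simp add: linear_map_diff[OF F(1)])
  qed
  have self: "p \<in> coset (M n) p" for p n by (rule coset_self[OF M(1)])
  have \<phi>: "\<phi> n (coset (M n) p) = F n p" if "p \<in> free (X n)" for n p
  proof -
    have "(SOME q. q \<in> coset (M n) p) \<in> coset (M n) p" using self[of p n] by (rule someI)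
    then show ?thesis using rep that by (auto simp: \<phi>_def)
  qed
  have gr: "gr Q n = coset (M n) ` free (X n)" for n by (simp add: Q_simps)
  have zero: "gzero Q n = coset (M n) 0" for n by (simp add: Q_simps)
  have ops: "gadd Q n a b = (\<Union>p\<in>a. \<Union>q\<in>b. coset (M n) (p + q))"
      "gscale Q n r a = (\<Union>p\<in>a. coset (M n) (cscale r p))"
      "bd Q n a = (\<Union>p\<in>a. coset (M (n - 1)) (lin (d n) p))"
      "mult Q m n a b = (\<Union>p\<in>a. \<Union>q\<in>b. coset (M (m + n)) (\<mu> m n p q))" for m n a b r
    by (simp_all add: Q_simps)
  have add: "gadd Q n (coset (M n) p) (coset (M n) q) = coset (M n) (p + q)"
    if pq: "p \<in> free (X n)" "q \<in> free (X n)" for n p q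
  proof -
    have "coset (M n) (p' + q') = coset (M n) (p + q)"
      if "p' \<in> coset (M n) p" "q' \<in> coset (M n) q" for p' q'
      using rep[OF that(1) pq(1)] rep[OF that(2) pq(2)] pq
      by (simp add: cos submod_add[OF submod_free] linear_map_add[OF F(1)])
    then show ?thesis unfolding ops by (rule UN_coset_const[OF UN_coset_const[OF _ self] self])
  qed
  have scale: "gscale Q n r (coset (M n) p) = coset (M n) (cscale r p)"
    if p: "p \<in> free (X n)" for n p r
  proof -
    have "coset (M n) (cscale r p') = coset (M n) (cscale r p)" if "p' \<in> coset (M n) p" for p'
      using rep[OF that p] p
      by (simp add: cos submod_cscale[OF submod_free] linear_map_cscale[OF F(1)])
    then show ?thesis unfolding ops by (rule UN_coset_const[OF _ self])
  qed
  have d_lin: "lin (d n) p \<in> free (X (n - 1))" "F (n - 1) (lin (d n) p) = lin D (F n p)"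
    if "0 < n" "p \<in> free (X n)" for n p
  proof -
    show "lin (d n) p \<in> free (X (n - 1))"
      by (rule lin_in_submod[OF submod_free d(1)[OF that(1)] that(2)])
    show "F (n - 1) (lin (d n) p) = lin D (F n p)"
      by (rule linear_map_eq_on_free[OF linear_map_comp[OF F(1) linear_map_lin]
            linear_map_comp[OF linear_map_lin F(1)] _ that(2)])
         (simp only: lin_gen d(2)[OF that(1)])
  qed
  have bd: "bd Q n (coset (M n) p) = coset (M (n - 1)) (lin (d n) p)"
    if n: "0 < n" and p: "p \<in> free (X n)" for n p
  proof -
    have "coset (M (n - 1)) (lin (d n) p') = coset (M (n - 1)) (lin (d n) p)"
      if "p' \<in> coset (M n) p" for p'
      using rep[OF that p] by (simp only: cos d_lin[OF n] p)
    then show ?thesis unfolding ops by (rule UN_coset_const[OF _ self])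
  qed
  have mult: "mult Q m n (coset (M m) p) (coset (M n) q) = coset (M (m + n)) (\<mu> m n p q)"
    if pq: "p \<in> free (X m)" "q \<in> free (X n)" for m n p q
  proof -
    have "coset (M (m + n)) (\<mu> m n p' q') = coset (M (m + n)) (\<mu> m n p q)"
      if "p' \<in> coset (M m) p" "q' \<in> coset (M n) q" for p' q'
      using rep[OF that(1) pq(1)] rep[OF that(2) pq(2)] pq by (simp only: cos mu)
    then show ?thesis unfolding ops by (rule UN_coset_const[OF UN_coset_const[OF _ self] self])
  qed
  have unit: "unit Q = coset (M 0) e" by (simp add: Q_simps)
  have surj': "\<exists>p\<in>free (X n). F n p = y" if y: "y \<in> free (Y n)" for n y
  proof -
    define s where "s w = (SOME p. p \<in> free (X n) \<and> F n p = gen w)" for w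
    have s: "s w \<in> free (X n) \<and> F n (s w) = gen w" if "w \<in> Y n" for w
      unfolding s_def by (rule someI_ex) (use surj[OF that] in blast)
    have "lin s y \<in> free (X n)" by (rule lin_in_submod[OF submod_free _ y]) (simp add: s)
    moreover have "F n (lin s y) = y"
      by (rule linear_map_eq_on_free[OF linear_map_comp[OF F(1) linear_map_lin] linear_map_ident _ y])
         (simp add: s)
    ultimately show ?thesis by blast
  qed
  have F_in: "F n p \<in> free (Y n)" if "p \<in> free (X n)" for n p
    by (rule free_linear_image[OF F(1) submod_free F(2) that])
  have bij: "bij_betw (\<phi> n) (gr Q n) (free (Y n))" for n
    unfolding bij_betw_def
  proof
    show "inj_on (\<phi> n) (gr Q n)" by (auto simp: gr inj_on_def \<phi> cos)
    have "\<phi> n ` gr Q n = F n ` free (X n)" by (simp add: gr image_image \<phi> cong: image_cong)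
    also have "\<dots> = free (Y n)"
    proof
      show "F n ` free (X n) \<subseteq> free (Y n)" using F_in by blast
      show "free (Y n) \<subseteq> F n ` free (X n)" using surj' by blast
    qed
    finally show "\<phi> n ` gr Q n = free (Y n)" .
  qed
  have W: "gr (word_dga Y D) n = free (Y n)" "gzero (word_dga Y D) n = 0"
    "gadd (word_dga Y D) n = (+)" "gscale (word_dga Y D) n = cscale"
    "bd (word_dga Y D) n = lin D" "mult (word_dga Y D) m n = bilin (\<lambda>u v. gen (u @ v))"
    "unit (word_dga Y D) = gen []" for m n
    by (simp_all add: word_dga_def)
  have elt: "\<exists>p\<in>free (X n). a = coset (M n) p" if "a \<in> gr Q n" for a n
    using that by (auto simp: gr)
  have in_gr: "coset (M n) p \<in> gr Q n" if "p \<in> free (X n)" for p n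
    using that by (auto simp: gr)
  have phi_add: "\<phi> n (gadd Q n a b) = gadd (word_dga Y D) n (\<phi> n a) (\<phi> n b)" and "gadd Q n a b \<in> gr Q n"
    if "a \<in> gr Q n" "b \<in> gr Q n" for a b n
    using elt[OF that(1)] elt[OF that(2)]
    by (auto simp: W add \<phi> in_gr submod_add[OF submod_free] linear_map_add[OF F(1)])
  moreover have "\<phi> n (gscale Q n r a) = gscale (word_dga Y D) n r (\<phi> n a)" and "gscale Q n r a \<in> gr Q n"
    if "a \<in> gr Q n" for a n r
    using elt[OF that]
    by (auto simp: W scale \<phi> in_gr submod_cscale[OF submod_free] linear_map_cscale[OF F(1)])
  moreover have "\<phi> (n - 1) (bd Q n a) = bd (word_dga Y D) n (\<phi> n a)" and "bd Q n a \<in> gr Q (n - 1)"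
    if "a \<in> gr Q n" "0 < n" for a n
    using elt[OF that(1)] that(2)
    by (auto simp: W bd \<phi> in_gr d_lin simp del: One_nat_def)
  moreover have "\<phi> (m + n) (mult Q m n a b) = mult (word_dga Y D) m n (\<phi> m a) (\<phi> n b)"
      and "mult Q m n a b \<in> gr Q (m + n)"
    if "a \<in> gr Q m" "b \<in> gr Q n" for a b m n
    using elt[OF that(1)] elt[OF that(2)] by (auto simp: W mult \<phi> in_gr mu)
  moreover have "\<phi> 0 (unit Q) = unit (word_dga Y D)" and "unit Q \<in> gr Q 0"
    by (simp_all add: W unit \<phi> e in_gr)
  moreover have "gzero Q n \<in> gr Q n" "\<phi> n (gzero Q n) = gzero (word_dga Y D) n" for n
    by (simp_all add: W zero \<phi> in_gr submod_zero[OF submod_free] linear_map_zero[OF F(1)])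
  moreover have "bij_betw (\<phi> n) (gr Q n) (gr (word_dga Y D) n)" for n
    by (simp only: bij W)
  ultimately have iso: "dga_iso Q (word_dga Y D) \<phi>" and "dg_algebra Q"
    using dg_algebra_transport[OF _ model, of Q \<phi>]
    by (simp_all add: dga_iso_def del: One_nat_def)
  then show "\<exists>\<phi>. dga_iso (quot_dga X M d \<mu> e) (word_dga Y D) \<phi>" "dg_algebra (quot_dga X M d \<mu> e)"
    by (auto simp: Q_def)
qed

section \<open>Morphisms of cubes\<close>

lemma in_cube [simp]: "v \<in> cube n \<longleftrightarrow> length v = n"
  by (simp add: cube_def)

lemma pts_Box [simp]: "pts Box n = cube n" and hom_Box [simp]: "u \<in> hom Box m n \<longleftrightarrow> box_hom m n u"
  by (simp_all add: Box_def)

text \<open>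
  The effect of cofaces, codegeneracies and coconnections on the vertices of a cube, with coordinates
  counted from 0 as list positions.
\<close>

definition insert_at :: "nat \<Rightarrow> bool \<Rightarrow> bool list \<Rightarrow> bool list" where
  "insert_at j e v = take j v @ e # drop j v"

definition delete_at :: "nat \<Rightarrow> bool list \<Rightarrow> bool list" where
  "delete_at j v = take j v @ drop (Suc j) v"

definition merge_at :: "nat \<Rightarrow> bool list \<Rightarrow> bool list" where
  "merge_at j v = take j v @ max (v ! j) (v ! Suc j) # drop (Suc (Suc j)) v"

lemma length_insert_at [simp]: "length (insert_at j e v) = Suc (length v)"
  and length_delete_at [simp]: "j < length v \<Longrightarrow> length (delete_at j v) = length v - 1"
  and length_merge_at [simp]: "Suc j < length v \<Longrightarrow> length (merge_at j v) = length v - 1"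
  by (auto simp: insert_at_def delete_at_def merge_at_def)

lemma nth_insert_at:
  "j \<le> length v \<Longrightarrow> i \<le> length v \<Longrightarrow>
    insert_at j e v ! i = (if i < j then v ! i else if i = j then e else v ! (i - 1))"
  by (auto simp: insert_at_def nth_append min_def nth_Cons')

lemma nth_delete_at:
  "j < length v \<Longrightarrow> i < length v - 1 \<Longrightarrow> delete_at j v ! i = (if i < j then v ! i else v ! Suc i)"
  by (auto simp: delete_at_def nth_append min_def)

lemma nth_merge_at:
  "Suc j < length v \<Longrightarrow> i < length v - 1 \<Longrightarrow>
    merge_at j v ! i = (if i < j then v ! i else if i = j then v ! j \<or> v ! Suc j else v ! Suc i)"
  by (auto simp: merge_at_def nth_append min_def nth_Cons' max_def)

lemma delete_insert_at [simp]: "j \<le> length v \<Longrightarrow> delete_at j (insert_at j e v) = v"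
  by (simp add: delete_at_def insert_at_def)

lemma box_face_apply: "length v = n \<Longrightarrow> box_face n (Suc j) e v = insert_at j e v"
  and box_degen_apply: "length v = n \<Longrightarrow> box_degen n (Suc j) v = delete_at j v"
  and box_conn_apply: "length v = n \<Longrightarrow> box_conn n (Suc j) v = merge_at j v"
  by (simp_all add: box_face_def box_degen_def box_conn_def insert_at_def delete_at_def merge_at_def)

definition support :: "bool list \<Rightarrow> nat set" where
  "support v = {i. i < length v \<and> v ! i}"

lemma support_eq_iff: "length v = length w \<Longrightarrow> support v = support w \<longleftrightarrow> v = w"
  by (auto simp: support_def list_eq_iff_nth_eq)

lemma finite_support [simp]: "finite (support v)" by (simp add: support_def)

lemma support_replicate_False [simp]: "support (replicate n False) = {}"
  by (auto simp: support_def)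

lemma support_replicate_True [simp]: "support (replicate n True) = {..<n}"
  by (auto simp: support_def)

text \<open>
  A normal form of the morphisms of cubes. Identifying a vertex of a cube with its set of nonzero
  coordinates, \<open>u\<close> is the map \<open>V \<mapsto> X \<union> c ` V\<close>, where \<open>X\<close> is the image of the least vertex and \<open>c\<close> is a
  monotone partial map: it is undefined at the coordinates that a codegeneracy forgets, and equal at
  coordinates that a coconnection merges.
\<close>

definition represents ::
    "nat \<Rightarrow> nat \<Rightarrow> (bool list \<Rightarrow> bool list) \<Rightarrow> nat set \<Rightarrow> (nat \<Rightarrow> nat option) \<Rightarrow> bool" where
  "represents n N u X c \<longleftrightarrow> u \<in> extensional (cube n) \<and>
    (\<forall>v. length v = n \<longrightarrow> length (u v) = N \<and> (\<forall>i<N. u v ! i \<longleftrightarrow> i \<in> X \<or> (\<exists>j<n. v ! j \<and> c j = Some i))) \<and>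
    X \<subseteq> {..<N} \<and> (\<forall>j<n. \<forall>i. c j = Some i \<longrightarrow> i < N \<and> i \<notin> X) \<and>
    (\<forall>j k i l. j < k \<longrightarrow> k < n \<longrightarrow> c j = Some i \<longrightarrow> c k = Some l \<longrightarrow> i \<le> l)"

lemma representsD:
  assumes "represents n N u X c"
  shows "u \<in> extensional (cube n)"
    and "length v = n \<Longrightarrow> length (u v) = N"
    and "length v = n \<Longrightarrow> i < N \<Longrightarrow> u v ! i \<longleftrightarrow> i \<in> X \<or> (\<exists>j<n. v ! j \<and> c j = Some i)"
    and "X \<subseteq> {..<N}"
    and "j < n \<Longrightarrow> c j = Some i \<Longrightarrow> i < N"
    and "j < n \<Longrightarrow> c j = Some i \<Longrightarrow> i \<notin> X"
    and "j < k \<Longrightarrow> k < n \<Longrightarrow> c j = Some i \<Longrightarrow> c k = Some l \<Longrightarrow> i \<le> l"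
proof -
  note * = assms[unfolded represents_def]
  show "u \<in> extensional (cube n)" by (rule *[THEN conjunct1])
  note ** = *[THEN conjunct2, THEN conjunct1, rule_format]
  show "length v = n \<Longrightarrow> length (u v) = N" by (rule **[THEN conjunct1])
  show "length v = n \<Longrightarrow> i < N \<Longrightarrow> u v ! i \<longleftrightarrow> i \<in> X \<or> (\<exists>j<n. v ! j \<and> c j = Some i)"
    by (rule **[THEN conjunct2, rule_format])
  note * = *[THEN conjunct2, THEN conjunct2]
  show "X \<subseteq> {..<N}" by (rule *[THEN conjunct1])
  note * = *[THEN conjunct2]
  show "j < n \<Longrightarrow> c j = Some i \<Longrightarrow> i < N" "j < n \<Longrightarrow> c j = Some i \<Longrightarrow> i \<notin> X"
    using *[THEN conjunct1] by simp_all
  show "j < k \<Longrightarrow> k < n \<Longrightarrow> c j = Some i \<Longrightarrow> c k = Some l \<Longrightarrow> i \<le> l"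
    by (rule *[THEN conjunct2, rule_format])
qed

lemma representsI:
  assumes "u \<in> extensional (cube n)" "\<And>v. length v = n \<Longrightarrow> length (u v) = N"
    "\<And>v i. length v = n \<Longrightarrow> i < N \<Longrightarrow> u v ! i \<longleftrightarrow> i \<in> X \<or> (\<exists>j<n. v ! j \<and> c j = Some i)"
    "X \<subseteq> {..<N}" "\<And>j i. j < n \<Longrightarrow> c j = Some i \<Longrightarrow> i < N \<and> i \<notin> X"
    "\<And>j k i l. j < k \<Longrightarrow> k < n \<Longrightarrow> c j = Some i \<Longrightarrow> c k = Some l \<Longrightarrow> i \<le> l"
  shows "represents n N u X c"
  unfolding represents_def by (intro conjI allI impI; (rule assms | simp add: assms); (assumption)?)

lemma ex_coordinate:
  assumes "\<And>k. k < n \<Longrightarrow> g k = i \<longleftrightarrow> k = k0" "k0 < n"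
  shows "(\<exists>k<n. P k \<and> g k = i) \<longleftrightarrow> P k0"
  using assms by blast

lemma represents_face:
  assumes "j \<le> n"
  shows "represents n (n + 1) (box_face n (Suc j) e) (if e then {j} else {})
    (\<lambda>k. Some (if k < j then k else Suc k))"
proof -
  have val: "insert_at j e v ! i \<longleftrightarrow> i \<in> (if e then {j} else {}) \<or>
      (\<exists>k<n. v ! k \<and> Some (if k < j then k else Suc k) = Some i)" if v: "length v = n" and i: "i < n + 1" for v i
  proof -
    consider "i < j" | "i = j" | "j < i" by linarith
    then show ?thesis
    proof cases
      case 1
      then show ?thesis using v assms by (subst ex_coordinate[of _ _ _ i]) (auto simp: nth_insert_at)
    next
      case 2
      then show ?thesis using v assms by (simp add: nth_insert_at)
    next
      case 3
      then show ?thesis using v i assms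
        by (subst ex_coordinate[of _ _ _ "i - 1"]) (auto simp: nth_insert_at)
    qed
  qed
  have ext: "box_face n (Suc j) e \<in> extensional (cube n)" by (simp add: box_face_def)
  have len: "length (insert_at j e v) = n + 1" if "length v = n" for v
    using that assms by simp
  show ?thesis
  proof (rule representsI)
    fix v :: "bool list" and i assume "length v = n" "i < n + 1"
    then show "box_face n (Suc j) e v ! i \<longleftrightarrow> i \<in> (if e then {j} else {}) \<or>
        (\<exists>k<n. v ! k \<and> Some (if k < j then k else Suc k) = Some i)"
      by (simp only: box_face_apply val)
  qed (use assms ext in \<open>auto simp: box_face_apply split: if_splits\<close>)
qed

lemma represents_degen:
  assumes "j < n"
  shows "represents n (n - 1) (box_degen n (Suc j)) {}
    (\<lambda>k. if k < j then Some k else if k = j then None else Some (k - 1))"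
proof -
  have val: "delete_at j v ! i \<longleftrightarrow> i \<in> {} \<or>
      (\<exists>k<n. v ! k \<and> (if k < j then Some k else if k = j then None else Some (k - 1)) = Some i)"
    if v: "length v = n" and i: "i < n - 1" for v i
  proof (cases "i < j")
    case True
    then show ?thesis using v assms i by (subst ex_coordinate[of _ _ _ i]) (auto simp: nth_delete_at)
  next
    case False
    then show ?thesis using v assms i
      by (subst ex_coordinate[of _ _ _ "Suc i"]) (auto simp: nth_delete_at)
  qed
  have ext: "box_degen n (Suc j) \<in> extensional (cube n)" by (simp add: box_degen_def)
  have len: "length (delete_at j v) = n - 1" if "length v = n" for v
    using that assms by simp
  show ?thesis
  proof (rule representsI)
    fix v :: "bool list" and i assume "length v = n" "i < n - 1"
    then show "box_degen n (Suc j) v ! i \<longleftrightarrow> i \<in> {} \<or>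
        (\<exists>k<n. v ! k \<and> (if k < j then Some k else if k = j then None else Some (k - 1)) = Some i)"
      by (simp only: box_degen_apply val)
  qed (use assms ext in \<open>auto simp: box_degen_apply split: if_splits\<close>)
qed

lemma represents_conn:
  assumes "Suc j < n"
  shows "represents n (n - 1) (box_conn n (Suc j)) {} (\<lambda>k. Some (if k \<le> j then k else k - 1))"
proof -
  have val: "merge_at j v ! i \<longleftrightarrow> i \<in> {} \<or> (\<exists>k<n. v ! k \<and> Some (if k \<le> j then k else k - 1) = Some i)"
    if v: "length v = n" and i: "i < n - 1" for v i
  proof -
    consider "i < j" | "i = j" | "j < i" by linarith
    then show ?thesis
    proof cases
      case 1
      then show ?thesis using v assms i by (subst ex_coordinate[of _ _ _ i]) (auto simp: nth_merge_at)
    next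
      case 2
      have "(\<exists>k<n. v ! k \<and> Some (if k \<le> j then k else k - 1) = Some j) \<longleftrightarrow> v ! j \<or> v ! Suc j"
      proof
        assume "\<exists>k<n. v ! k \<and> Some (if k \<le> j then k else k - 1) = Some j"
        then obtain k where k: "v ! k" "(if k \<le> j then k else k - 1) = j" by auto
        then have "k = j \<or> k = Suc j" by (auto split: if_splits)
        then show "v ! j \<or> v ! Suc j" using k(1) by auto
      next
        assume "v ! j \<or> v ! Suc j"
        then show "\<exists>k<n. v ! k \<and> Some (if k \<le> j then k else k - 1) = Some j"
        proof
          assume "v ! j"
          then show ?thesis using assms by (intro exI[of _ j]) simp
        next
          assume "v ! Suc j"
          then show ?thesis using assms by (intro exI[of _ "Suc j"]) simp
        qed
      qed
      then show ?thesis using v assms 2 by (simp only: nth_merge_at i) simp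
    next
      case 3
      then show ?thesis using v i assms
        by (subst ex_coordinate[of _ _ _ "Suc i"]) (auto simp: nth_merge_at)
    qed
  qed
  have ext: "box_conn n (Suc j) \<in> extensional (cube n)" by (simp add: box_conn_def)
  have len: "length (merge_at j v) = n - 1" if "length v = n" for v
    using that assms by simp
  show ?thesis
  proof (rule representsI)
    fix v :: "bool list" and i assume "length v = n" "i < n - 1"
    then show "box_conn n (Suc j) v ! i \<longleftrightarrow> i \<in> {} \<or>
        (\<exists>k<n. v ! k \<and> Some (if k \<le> j then k else k - 1) = Some i)"
      by (simp only: box_conn_apply val)
  qed (use assms ext in \<open>auto simp: box_conn_apply split: if_splits\<close>)
qed

text \<open>
  A coordinate that \<open>d\<close> sends into \<open>Z\<close> has no effect on the composite, so it has to be forgotten.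
\<close>

lemma represents_comp:
  assumes f: "represents l m f X c" and g: "represents m n g Y d"
  defines "Z \<equiv> Y \<union> {i. \<exists>j\<in>X. d j = Some i}"
  defines "e \<equiv> \<lambda>k. case c k of None \<Rightarrow> None | Some j \<Rightarrow>
    (case d j of None \<Rightarrow> None | Some i \<Rightarrow> if i \<in> Z then None else Some i)"
  shows "represents l n (compose (cube l) g f) Z e"
proof -
  have e: "e k = Some i \<longleftrightarrow> (\<exists>j. c k = Some j \<and> d j = Some i) \<and> i \<notin> Z" for k i
    by (auto simp: e_def split: option.splits)
  have val: "g (f v) ! i \<longleftrightarrow> i \<in> Z \<or> (\<exists>k<l. v ! k \<and> e k = Some i)"
    if v: "length v = l" and i: "i < n" for v i
  proof -
    have fv: "length (f v) = m" "\<And>j. j < m \<Longrightarrow> f v ! j \<longleftrightarrow> j \<in> X \<or> (\<exists>k<l. v ! k \<and> c k = Some j)"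
      and X: "X \<subseteq> {..<m}" and c: "\<And>k j. k < l \<Longrightarrow> c k = Some j \<Longrightarrow> j < m"
      using f v by (auto simp: represents_def)
    have "g (f v) ! i \<longleftrightarrow> i \<in> Y \<or> (\<exists>j<m. f v ! j \<and> d j = Some i)"
      using g fv(1) i by (auto simp: represents_def)
    also have "(\<exists>j<m. f v ! j \<and> d j = Some i) \<longleftrightarrow>
        (\<exists>j<m. (j \<in> X \<or> (\<exists>k<l. v ! k \<and> c k = Some j)) \<and> d j = Some i)"
      using fv(2) by blast
    also have "\<dots> \<longleftrightarrow> (\<exists>j\<in>X. d j = Some i) \<or> (\<exists>k<l. v ! k \<and> (\<exists>j. c k = Some j \<and> d j = Some i))"
      using X c by blast
    also have "i \<in> Y \<or> \<dots> \<longleftrightarrow> i \<in> Z \<or> (\<exists>k<l. v ! k \<and> e k = Some i)"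
      unfolding Z_def e by blast
    finally show ?thesis .
  qed
  have len: "length (g (f v)) = n" if "length v = l" for v
    using f g that by (auto simp: represents_def)
  have "Z \<subseteq> {..<n}"
    using f g by (auto simp: represents_def Z_def subset_iff)
  moreover have "i < n" if k: "k < l" "e k = Some i" for k i
  proof -
    obtain j where j: "c k = Some j" "d j = Some i" using k(2) unfolding e by blast
    then have "j < m" using f k(1) unfolding represents_def by blast
    then show ?thesis using g j(2) unfolding represents_def by blast
  qed
  moreover have "i \<le> i'" if jk: "j < k" "k < l" "e j = Some i" "e k = Some i'" for j k i i'
  proof -
    obtain a b where ab: "c j = Some a" "d a = Some i" "c k = Some b" "d b = Some i'"
      using jk(3,4) unfolding e by blast
    then have "a \<le> b" "b < m" using f jk(1,2) unfolding represents_def by blast+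
    moreover have "a < b \<Longrightarrow> i \<le> i'" using g ab \<open>b < m\<close> unfolding represents_def by blast
    ultimately show ?thesis using ab by (cases "a = b") auto
  qed
  ultimately show ?thesis
    by (auto simp: represents_def compose_def val len e)
qed

lemma box_hom_represents: "box_hom n N u \<Longrightarrow> \<exists>X c. represents n N u X c"
proof (induction rule: box_hom.induct)
  case (ident n)
  have "represents n n (restrict id (cube n)) {} Some" by (auto simp: represents_def)
  then show ?case by blast
next
  case (face j n e)
  then obtain j' where "j = Suc j'" "j' \<le> n" by (cases j) auto
  then show ?case using represents_face[of j' n e] by blast
next
  case (degen j n)
  then obtain j' where "j = Suc j'" "j' < n" by (cases j) auto
  then show ?case using represents_degen[of j' n] by blast
next
  case (conn j n)
  then obtain j' where "j = Suc j'" "Suc j' < n" by (cases j) auto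
  then show ?case using represents_conn[of j' n] by blast
next
  case (comp l m f n g)
  then show ?case using represents_comp by blast
qed

lemma represents_support:
  assumes "represents n N u X c" "length v = n"
  shows "support (u v) = X \<union> {i. \<exists>j\<in>support v. c j = Some i}"
proof (rule set_eqI)
  fix i
  note r = representsD[OF assms(1)]
  have "i \<in> support (u v) \<longleftrightarrow> i < N \<and> (i \<in> X \<or> (\<exists>j<n. v ! j \<and> c j = Some i))"
    using r(2)[OF assms(2)] r(3)[OF assms(2), of i] by (auto simp: support_def)
  also have "\<dots> \<longleftrightarrow> i \<in> X \<or> (\<exists>j<n. v ! j \<and> c j = Some i)"
    using r(4,5) by blast
  finally show "i \<in> support (u v) \<longleftrightarrow> i \<in> X \<union> {i. \<exists>j\<in>support v. c j = Some i}"
    using assms(2) by (auto simp: support_def)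
qed

lemma box_hom_extensional: "box_hom n N u \<Longrightarrow> u \<in> extensional (cube n)"
  by (auto dest!: box_hom_represents intro: representsD)

lemma box_hom_length: "box_hom n N u \<Longrightarrow> length v = n \<Longrightarrow> length (u v) = N"
  by (auto dest!: box_hom_represents simp: representsD)

lemma box_hom_id [simp]: "box_hom n n (idm Box n)"
  using box_hom.ident[of n] by simp

text \<open>
  The coordinates of the target that are not constant.
\<close>

definition rank :: "nat \<Rightarrow> (bool list \<Rightarrow> bool list) \<Rightarrow> nat set" where
  "rank n u = support (u (replicate n True)) - support (u (replicate n False))"

lemma rank_represents:
  assumes "represents n N u X c"
  shows "support (u (replicate n False)) = X"
    and "support (u (replicate n True)) = X \<union> {i. \<exists>j<n. c j = Some i}"
    and "rank n u = {i. \<exists>j<n. c j = Some i}"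
proof -
  show 1: "support (u (replicate n False)) = X"
    and 2: "support (u (replicate n True)) = X \<union> {i. \<exists>j<n. c j = Some i}"
    using represents_support[OF assms] by auto
  show "rank n u = {i. \<exists>j<n. c j = Some i}"
    using representsD(6)[OF assms] unfolding rank_def 1 2 by blast
qed

lemma card_rank_le:
  assumes "box_hom n N u"
  shows "card (rank n u) \<le> n"
proof -
  obtain X c where c: "represents n N u X c" using box_hom_represents[OF assms] by blast
  have "rank n u \<subseteq> (\<lambda>j. the (c j)) ` {..<n}"
    unfolding rank_represents(3)[OF c] by force
  then have "card (rank n u) \<le> card ((\<lambda>j. the (c j)) ` {..<n})" by (intro card_mono) auto
  also have "\<dots> \<le> n" using card_image_le[of "{..<n}" "\<lambda>j. the (c j)"] by simp
  finally show ?thesis .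
qed

lemma box_hom_mono: "box_hom n N u \<Longrightarrow> support (u (replicate n False)) \<subseteq> support (u (replicate n True))"
proof -
  assume "box_hom n N u"
  then obtain X c where c: "represents n N u X c" using box_hom_represents by blast
  show ?thesis unfolding rank_represents(1,2)[OF c] by blast
qed

text \<open>
  At full rank no coordinate is forgotten and no two are merged, so the monotone map \<open>c\<close> enumerates the
  rank: a morphism of full rank is a composite of cofaces, determined by its extreme values.
\<close>

lemma represents_full_rank:
  assumes c: "represents n N u X c" and full: "card (rank n u) = n"
  shows "j < n \<Longrightarrow> c j = Some (sorted_list_of_set (rank n u) ! j)"
proof -
  have sub: "rank n u \<subseteq> (\<lambda>j. the (c j)) ` {..<n}"
    unfolding rank_represents(3)[OF c] by force
  have le: "card ((\<lambda>j. the (c j)) ` {..<n}) \<le> n"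
    using card_image_le[of "{..<n}" "\<lambda>j. the (c j)"] by simp
  have eq: "rank n u = (\<lambda>j. the (c j)) ` {..<n}"
    using card_subset_eq[OF _ sub] card_mono[OF _ sub] full le by simp
  then have "card ((\<lambda>j. the (c j)) ` {..<n}) = card {..<n}" using full by simp
  then have inj: "inj_on (\<lambda>j. the (c j)) {..<n}" by (intro eq_card_imp_inj_on) auto
  have total: "c j \<noteq> None" if "j < n" for j
  proof
    assume j: "c j = None"
    have "rank n u \<subseteq> (\<lambda>j. the (c j)) ` ({..<n} - {j})"
    proof
      fix i assume "i \<in> rank n u"
      then obtain k where "k < n" "c k = Some i" unfolding rank_represents(3)[OF c] by blast
      then show "i \<in> (\<lambda>j. the (c j)) ` ({..<n} - {j})" using j by force
    qed
    then have "card (rank n u) \<le> card ((\<lambda>j. the (c j)) ` ({..<n} - {j}))" by (intro card_mono) auto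
    also have "\<dots> \<le> card ({..<n} - {j})" by (intro card_image_le) auto
    also have "\<dots> < n" using that by simp
    finally show False using full by simp
  qed
  have mono: "the (c j) < the (c k)" if "j < k" "k < n" for j k
  proof -
    have "the (c j) \<le> the (c k)"
      using representsD(7)[OF c that, of "the (c j)" "the (c k)"] total[of j] total[of k] that by simp
    moreover have "the (c j) \<noteq> the (c k)" using inj that by (auto dest: inj_onD)
    ultimately show ?thesis by simp
  qed
  have "sorted_wrt (<) (map (\<lambda>j. the (c j)) [0..<n])"
    using mono by (auto simp: sorted_wrt_iff_nth_less)
  then have "map (\<lambda>j. the (c j)) [0..<n] = sorted_list_of_set (rank n u)"
    by (intro sorted_distinct_set_unique)
       (auto simp: strict_sorted_iff eq atLeast0LessThan)
  then have "the (c j) = sorted_list_of_set (rank n u) ! j" if "j < n" for j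
    using that by (metis add_0 nth_map_upt diff_zero)
  then show "j < n \<Longrightarrow> c j = Some (sorted_list_of_set (rank n u) ! j)"
    using total[of j] by (metis option.exhaust_sel)
qed

lemma support_full_rank:
  assumes u: "box_hom n N u" and full: "card (rank n u) = n" and v: "length v = n"
  shows "support (u v) = support (u (replicate n False)) \<union>
    (\<lambda>j. sorted_list_of_set (rank n u) ! j) ` support v"
proof -
  obtain X c where c: "represents n N u X c" using box_hom_represents[OF u] by blast
  show ?thesis
    unfolding represents_support[OF c v] rank_represents(1)[OF c]
    using represents_full_rank[OF c full] v by (auto simp: support_def)
qed

definition factors_degenerate :: "nat \<Rightarrow> nat \<Rightarrow> (bool list \<Rightarrow> bool list) \<Rightarrow> bool" where
  "factors_degenerate n N u \<longleftrightarrow> (\<exists>u'. box_hom (n - 1) N u' \<and>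
    ((\<exists>j\<in>{1..n}. u = compose (cube n) u' (box_degen n j)) \<or>
     (\<exists>j\<in>{1..n - 1}. u = compose (cube n) u' (box_conn n j))))"

lemma insert_False_delete: "j < length v \<Longrightarrow> insert_at j False (delete_at j v) = v[j := False]"
  by (simp add: insert_at_def delete_at_def upd_conv_take_nth_drop min_def)

lemma insert_False_merge:
  assumes "Suc j < length v"
  shows "insert_at j False (merge_at j v) = v[j := False, Suc j := v ! j \<or> v ! Suc j]"
proof -
  define w where "w = merge_at j v"
  have lw: "length w = length v - 1" using assms by (simp add: w_def)
  have w: "w ! i = (if i < j then v ! i else if i = j then v ! j \<or> v ! Suc j else v ! Suc i)"
    if "i < length v - 1" for i
    unfolding w_def by (rule nth_merge_at[OF assms that])
  have "insert_at j False w = v[j := False, Suc j := v ! j \<or> v ! Suc j]"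
  proof (rule nth_equalityI)
    fix i assume "i < length (insert_at j False w)"
    then have i: "i < length v" using assms lw by auto
    then show "insert_at j False w ! i = v[j := False, Suc j := v ! j \<or> v ! Suc j] ! i"
      using assms lw by (subst nth_insert_at) (auto simp: w nth_list_update)
  qed (use assms lw in auto)
  then show ?thesis by (simp add: w_def)
qed

text \<open>
  The other factor is the restriction of \<open>u\<close> to the face on which coordinate \<open>j\<close> vanishes.
\<close>

lemma factors_degen:
  assumes u: "box_hom n N u" and j: "j < n"
    and ind: "\<And>v. length v = n \<Longrightarrow> u (v[j := False]) = u v"
  shows "factors_degenerate n N u"
proof -
  define u' where "u' = compose (cube (n - 1)) u (box_face (n - 1) (Suc j) False)"
  have "box_hom (n - 1) (n - 1 + 1) (box_face (n - 1) (Suc j) False)"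
    using j by (intro box_hom.face) auto
  then have "box_hom (n - 1) N u'" using u j unfolding u'_def by (intro box_hom.comp) auto
  moreover have "u = compose (cube n) u' (box_degen n (Suc j))"
  proof (rule extensionalityI[OF box_hom_extensional[OF u]])
    fix v assume v: "v \<in> cube n"
    have l: "length (delete_at j v) = n - 1" using v j by auto
    show "u v = compose (cube n) u' (box_degen n (Suc j)) v"
      using v ind[of v] j l insert_False_delete[of j v]
      by (simp add: compose_def u'_def box_degen_apply box_face_apply)
  qed simp
  ultimately show ?thesis using j unfolding factors_degenerate_def
    by (intro exI[of _ u'] conjI disjI1 bexI[of _ "Suc j"]) auto
qed

lemma factors_conn:
  assumes u: "box_hom n N u" and j: "Suc j < n"
    and ind: "\<And>v. length v = n \<Longrightarrow> u (v[j := False, Suc j := v ! j \<or> v ! Suc j]) = u v"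
  shows "factors_degenerate n N u"
proof -
  define u' where "u' = compose (cube (n - 1)) u (box_face (n - 1) (Suc j) False)"
  have "box_hom (n - 1) (n - 1 + 1) (box_face (n - 1) (Suc j) False)"
    using j by (intro box_hom.face) auto
  then have "box_hom (n - 1) N u'" using u j unfolding u'_def by (intro box_hom.comp) auto
  moreover have "u = compose (cube n) u' (box_conn n (Suc j))"
  proof (rule extensionalityI[OF box_hom_extensional[OF u]])
    fix v assume v: "v \<in> cube n"
    have l: "length (merge_at j v) = n - 1" using v j by auto
    show "u v = compose (cube n) u' (box_conn n (Suc j)) v"
      using v ind[of v] j l insert_False_merge[of j v]
      by (simp add: compose_def u'_def box_conn_apply box_face_apply)
  qed simp
  ultimately show ?thesis using j unfolding factors_degenerate_def
    by (intro exI[of _ u'] conjI disjI2 bexI[of _ "Suc j"]) auto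
qed

text \<open>
  In a monotone partial map that is not injective and total, some coordinate is forgotten or two
  neighbouring ones have the same image.
\<close>

lemma factors_degenerate_if_rank:
  assumes u: "box_hom n N u" and deg: "card (rank n u) < n"
  shows "factors_degenerate n N u"
proof -
  obtain X c where c: "represents n N u X c" using box_hom_represents[OF u] by blast
  have len: "length (u v) = N" if "length v = n" for v using box_hom_length[OF u that] .
  consider (forget) "\<exists>j<n. c j = None"
    | (merge) "\<forall>j<n. c j \<noteq> None" "\<exists>j. Suc j < n \<and> c j = c (Suc j)"
    | (strict) "\<forall>j<n. c j \<noteq> None" "\<forall>j. Suc j < n \<longrightarrow> c j \<noteq> c (Suc j)"
    by (cases "\<exists>j<n. c j = None"; cases "\<exists>j. Suc j < n \<and> c j = c (Suc j)") simp_all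
  then show ?thesis
  proof cases
    case forget
    then obtain j where forget: "j < n" "c j = None" by blast
    show ?thesis
    proof (rule factors_degen[OF u forget(1)])
      fix v :: "bool list" assume v: "length v = n"
      have w: "length (v[j := False]) = n" using v by simp
      have s: "k \<in> support (v[j := False]) \<longleftrightarrow> k \<noteq> j \<and> k \<in> support v" for k
        using v by (cases "k = j") (auto simp: support_def nth_list_update)
      have "support (u (v[j := False])) = support (u v)"
        unfolding represents_support[OF c w] represents_support[OF c v] Bex_def s
        using forget(2) by (intro arg_cong2[where f = "(\<union>)"] refl Collect_cong) (metis option.distinct(1))
      then show "u (v[j := False]) = u v" using v len by (simp add: support_eq_iff)
    qed
  next
    case merge
    then obtain j where merge: "Suc j < n" "c j = c (Suc j)" by blast
    show ?thesis
    proof (rule factors_conn[OF u merge(1)])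
      fix v :: "bool list" assume v: "length v = n"
      let ?w = "v[j := False, Suc j := v ! j \<or> v ! Suc j]"
      have w: "length ?w = n" using v by simp
      have s: "k \<in> support ?w \<longleftrightarrow>
          (if k = j then False else if k = Suc j then j \<in> support v \<or> k \<in> support v else k \<in> support v)" for k
        using v merge by (auto simp: support_def nth_list_update)
      have "support (u ?w) = support (u v)"
        unfolding represents_support[OF c w] represents_support[OF c v] Bex_def s
      proof (intro arg_cong2[where f = "(\<union>)"] refl Collect_cong iffI)
        fix i
        assume "\<exists>k. (if k = j then False else if k = Suc j then j \<in> support v \<or> k \<in> support v
          else k \<in> support v) \<and> c k = Some i"
        then obtain k where k: "if k = j then False else if k = Suc j then j \<in> support v \<or> k \<in> support v
          else k \<in> support v" "c k = Some i" by blast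
        then have "k = Suc j \<and> j \<in> support v \<or> k \<in> support v" by (simp split: if_splits)
        then show "\<exists>k. k \<in> support v \<and> c k = Some i" using merge(2) k(2) by metis
      next
        fix i assume "\<exists>k. k \<in> support v \<and> c k = Some i"
        then obtain k where k: "k \<in> support v" "c k = Some i" by blast
        show "\<exists>k. (if k = j then False else if k = Suc j then j \<in> support v \<or> k \<in> support v
          else k \<in> support v) \<and> c k = Some i"
        proof (cases "k = j")
          case True
          then show ?thesis using k merge(2) by (intro exI[of _ "Suc j"]) simp
        next
          case False
          then show ?thesis using k by (intro exI[of _ k]) auto
        qed
      qed
      then show "u ?w = u v" using v w len by (simp add: support_eq_iff)
    qed
  next
    case strict
    note strict = strict[rule_format]
    have mono: "j < k \<Longrightarrow> k < n \<Longrightarrow> the (c j) < the (c k)" for j k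
    proof (induction k)
      case (Suc k)
      have "the (c k) \<le> the (c (Suc k))"
        using representsD(7)[OF c lessI, of k "the (c k)" "the (c (Suc k))"]
          Suc.prems strict(1)[of k] strict(1)[of "Suc k"] by simp
      moreover have "the (c k) \<noteq> the (c (Suc k))"
        using strict(1)[of k] strict(1)[of "Suc k"] strict(2)[of k] Suc.prems by (auto simp: option.expand)
      ultimately show ?case using Suc by (cases "j = k") auto
    qed simp
    have "inj_on (\<lambda>j. the (c j)) {..<n}"
    proof (rule linorder_inj_onI)
      fix x y :: nat assume "x < y" "x \<in> {..<n}" "y \<in> {..<n}"
      then show "the (c x) \<noteq> the (c y)" using mono[of x y] by simp
    qed auto
    moreover have "rank n u = (\<lambda>j. the (c j)) ` {..<n}"
      unfolding rank_represents(3)[OF c] using strict(1) by force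
    ultimately have "card (rank n u) = n" by (simp add: card_image)
    then show ?thesis using deg by simp
  qed
qed

lemma box_face_box_face:
  assumes "1 \<le> k" "k < j" "j \<le> n"
  shows "compose (cube (n - 2)) (box_face (n - 1) j e) (box_face (n - 2) k e') =
    compose (cube (n - 2)) (box_face (n - 1) k e') (box_face (n - 2) (j - 1) e)"
proof (rule extensionalityI[of _ "cube (n - 2)"])
  fix v assume "v \<in> cube (n - 2)"
  then have v: "length v = n - 2" by simp
  obtain j' k' where jk: "j = Suc j'" "k = Suc k'" "k' < j'" "j' < n"
    using assms by (cases j; cases k) auto
  obtain j'' where j'': "j' = Suc j''" using jk by (cases j') auto
  have l: "length (insert_at i d v) = n - 1" for i d using v jk by auto
  have "insert_at j' e (insert_at k' e' v) = insert_at k' e' (insert_at j'' e v)"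
  proof (rule nth_equalityI)
    fix i assume "i < length (insert_at j' e (insert_at k' e' v))"
    then have i: "i < n" using v jk by simp
    have v1: "insert_at j' e (insert_at k' e' v) ! i = (if i < j' then insert_at k' e' v ! i
        else if i = j' then e else insert_at k' e' v ! (i - 1))"
      using i jk v by (subst nth_insert_at) auto
    have v2: "insert_at k' e' (insert_at j'' e v) ! i = (if i < k' then insert_at j'' e v ! i
        else if i = k' then e' else insert_at j'' e v ! (i - 1))"
      using i jk j'' v by (subst nth_insert_at) auto
    have fst3: "insert_at k' e' v ! i' = (if i' < k' then v ! i' else if i' = k' then e' else v ! (i' - 1))"
      if "i' < n - 1" for i'
      using that v jk by (subst nth_insert_at) auto
    have fst4: "insert_at j'' e v ! i' =
        (if i' < j'' then v ! i' else if i' = j'' then e else v ! (i' - 1))"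
      if "i' < n - 1" for i'
      using that v jk j'' by (subst nth_insert_at) auto
    have bounds: "i - 1 < n - 1" "i < k' \<Longrightarrow> i < n - 1" "i < j' \<Longrightarrow> i < n - 1" using i jk by auto
    show "insert_at j' e (insert_at k' e' v) ! i = insert_at k' e' (insert_at j'' e v) ! i"
    proof -
      consider "i < k'" | "i = k'" | "k' < i" "i < j'" | "i = j'" | "j' < i" by linarith
      then show ?thesis
      proof cases
        case 1
        then show ?thesis using jk j'' fst3[of i] fst4[of i] bounds unfolding v1 v2 by simp
      next
        case 2
        then show ?thesis using jk j'' fst3[of i] bounds unfolding v1 v2 by simp
      next
        case 3
        then show ?thesis using jk j'' fst3[of i] fst4[of "i - 1"] bounds unfolding v1 v2 by simp
      next
        case 4
        then show ?thesis using jk j'' fst4[of "i - 1"] bounds unfolding v1 v2 by simp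
      next
        case 5
        then have "\<not> i - 1 < k'" "i - 1 \<noteq> k'" "\<not> i - 1 < j''" "i - 1 \<noteq> j''"
          "\<not> i < j'" "i \<noteq> j'" "\<not> i < k'" "i \<noteq> k'" using jk j'' by auto
        then show ?thesis using jk j'' fst3[of "i - 1"] fst4[of "i - 1"] bounds unfolding v1 v2 by simp
      qed
    qed
  qed (use v jk j'' in auto)
  then show "compose (cube (n - 2)) (box_face (n - 1) j e) (box_face (n - 2) k e') v =
      compose (cube (n - 2)) (box_face (n - 1) k e') (box_face (n - 2) (j - 1) e) v"
    using v l jk by (simp add: compose_def box_face_apply j'')
qed simp_all

section \<open>Normalized chains of a cubical set\<close>

locale cubical_set =
  fixes K :: "(bool list, 'a) psh"
  assumes presheaf: "presheaf Box K"
begin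

lemma act_in: "box_hom m n u \<Longrightarrow> \<sigma> \<in> cells K n \<Longrightarrow> act K m n u \<sigma> \<in> cells K m"
  by (rule funcset_mem[OF presheaf[unfolded presheaf_def, THEN conjunct1, rule_format]]) simp_all

lemma act_comp: "box_hom l m u \<Longrightarrow> box_hom m n v \<Longrightarrow> \<sigma> \<in> cells K n \<Longrightarrow>
    act K l m u (act K m n v \<sigma>) = act K l n (compose (cube l) v u) \<sigma>"
  by (rule presheaf[unfolded presheaf_def, THEN conjunct2, THEN conjunct2, rule_format,
        unfolded pts_Box, symmetric]) simp_all

lemma act_id: "\<sigma> \<in> cells K n \<Longrightarrow> act K n n (idm Box n) \<sigma> = \<sigma>"
  by (rule presheaf[unfolded presheaf_def, THEN conjunct2, THEN conjunct1, rule_format])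

lemma face_hom: "1 \<le> j \<Longrightarrow> j \<le> n \<Longrightarrow> box_hom (n - 1) n (box_face (n - 1) j e)"
  using box_hom.face[of j "n - 1" e] by simp

lemma face_in: "1 \<le> j \<Longrightarrow> j \<le> n \<Longrightarrow> \<sigma> \<in> cells K n \<Longrightarrow>
    act K (n - 1) n (box_face (n - 1) j e) \<sigma> \<in> cells K (n - 1)"
  by (intro act_in face_hom)

lemma boundary_in_free: "\<sigma> \<in> cells K n \<Longrightarrow> box_boundary K n \<sigma> \<in> free (cells K (n - 1))"
  unfolding box_boundary_def
  by (intro submod_sum submod_cscale submod_diff submod_free gen_in_free face_in) auto

lemma degenerate_cells: "box_degenerate K n \<subseteq> cells K n"
  unfolding box_degenerate_def
  by (auto intro!: act_in box_hom.degen box_hom.conn simp del: One_nat_def)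

lemma act_degenerate:
  assumes "\<sigma> \<in> cells K N" "factors_degenerate n N u"
  shows "act K n N u \<sigma> \<in> box_degenerate K n"
proof -
  obtain u' where u': "box_hom (n - 1) N u'" "(\<exists>j\<in>{1..n}. u = compose (cube n) u' (box_degen n j)) \<or>
     (\<exists>j\<in>{1..n - 1}. u = compose (cube n) u' (box_conn n j))"
    using assms(2) unfolding factors_degenerate_def by blast
  have tau: "act K (n - 1) N u' \<sigma> \<in> cells K (n - 1)" by (rule act_in[OF u'(1) assms(1)])
  from u'(2) show ?thesis
  proof
    assume "\<exists>j\<in>{1..n}. u = compose (cube n) u' (box_degen n j)"
    then obtain j where j: "j \<in> {1..n}" "u = compose (cube n) u' (box_degen n j)" by blast
    then have "act K n N u \<sigma> = act K n (n - 1) (box_degen n j) (act K (n - 1) N u' \<sigma>)"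
      using act_comp[OF _ u'(1) assms(1), of n "box_degen n j"] box_hom.degen[of j n] by simp
    then show ?thesis using j tau unfolding box_degenerate_def by blast
  next
    assume "\<exists>j\<in>{1..n - 1}. u = compose (cube n) u' (box_conn n j)"
    then obtain j where j: "j \<in> {1..n - 1}" "u = compose (cube n) u' (box_conn n j)" by blast
    then have "act K n N u \<sigma> = act K n (n - 1) (box_conn n j) (act K (n - 1) N u' \<sigma>)"
      using act_comp[OF _ u'(1) assms(1), of n "box_conn n j"] box_hom.conn[of j n] by simp
    then show ?thesis using j tau unfolding box_degenerate_def by blast
  qed
qed

lemma degenerate_cases:
  assumes "\<sigma> \<in> box_degenerate K n"
  obtains (degen) j \<tau> where "j < n" "\<tau> \<in> cells K (n - 1)" "\<sigma> = act K n (n - 1) (box_degen n (Suc j)) \<tau>"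
    | (conn) j \<tau> where "Suc j < n" "\<tau> \<in> cells K (n - 1)" "\<sigma> = act K n (n - 1) (box_conn n (Suc j)) \<tau>"
proof -
  consider j \<tau> where "j \<in> {1..n}" "\<tau> \<in> cells K (n - 1)" "\<sigma> = act K n (n - 1) (box_degen n j) \<tau>"
    | j \<tau> where "j \<in> {1..n - 1}" "\<tau> \<in> cells K (n - 1)" "\<sigma> = act K n (n - 1) (box_conn n j) \<tau>"
    using assms unfolding box_degenerate_def by blast
  then show thesis
  proof cases
    case (1 j \<tau>)
    then show ?thesis using degen[of "j - 1" \<tau>] by (cases j) auto
  next
    case (2 j \<tau>)
    then show ?thesis using conn[of "j - 1" \<tau>] by (cases j) auto
  qed
qed

text \<open>
  For a degeneracy, the two faces in its own direction are equal and cancel. For a connection, the faces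
  in the two merged directions are equal in pairs, and these occur with opposite signs. All other faces
  are degenerate. So the degenerate cells span a subcomplex, without their boundaries being added.
\<close>

lemma degenerate_boundary:
  assumes "\<sigma> \<in> box_degenerate K n"
  shows "(box_boundary K n \<sigma> :: 'a \<Rightarrow>\<^sub>0 'k::{comm_ring,comm_monoid_mult}) \<in>
    submod hull (gen ` box_degenerate K (n - 1))" (is "_ \<in> ?H")
proof -
  define F where "F k e = act K (n - 1) n (box_face (n - 1) k e) \<sigma>" for k e
  have bd: "box_boundary K n \<sigma> =
      (\<Sum>k=1..n. cscale ((-1) ^ k) (gen (F k True) - gen (F k False)) :: 'a \<Rightarrow>\<^sub>0 'k)"
    by (simp add: box_boundary_def F_def)
  have H: "gen x \<in> ?H" if "x \<in> box_degenerate K (n - 1)" for x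
    using that by (intro hull_inc) auto
  from assms show ?thesis
  proof (cases rule: degenerate_cases)
    case (degen j \<tau>)
    have F: "F k e = act K (n - 1) (n - 1) (compose (cube (n - 1)) (box_degen n (Suc j)) (box_face (n - 1) k e)) \<tau>"
      and hom: "box_hom (n - 1) (n - 1) (compose (cube (n - 1)) (box_degen n (Suc j)) (box_face (n - 1) k e))"
      if "k \<in> {1..n}" for k e
    proof -
      have f: "box_hom (n - 1) n (box_face (n - 1) k e)" using that by (intro face_hom) auto
      have d: "box_hom n (n - 1) (box_degen n (Suc j))" using degen by (intro box_hom.degen) auto
      show "F k e = act K (n - 1) (n - 1) (compose (cube (n - 1)) (box_degen n (Suc j)) (box_face (n - 1) k e)) \<tau>"
        unfolding F_def degen(3) by (rule act_comp[OF f d degen(2)])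
      show "box_hom (n - 1) (n - 1) (compose (cube (n - 1)) (box_degen n (Suc j)) (box_face (n - 1) k e))"
        by (rule box_hom.comp[OF f d])
    qed
    have "cscale ((-1) ^ k) (gen (F k True) - gen (F k False)) \<in> ?H" if k: "k \<in> {1..n}" for k
    proof (cases "k = Suc j")
      case True
      have "compose (cube (n - 1)) (box_degen n (Suc j)) (box_face (n - 1) (Suc j) True) v =
          compose (cube (n - 1)) (box_degen n (Suc j)) (box_face (n - 1) (Suc j) False) v" for v
      proof (cases "length v = n - 1")
        case True
        then have "length (insert_at j e v) = n" "delete_at j (insert_at j e v) = v" for e
          using degen(1) by auto
        then show ?thesis
          using True by (simp add: compose_def box_face_apply box_degen_apply)
      qed (simp add: compose_def)
      then have "compose (cube (n - 1)) (box_degen n (Suc j)) (box_face (n - 1) (Suc j) True) =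
          compose (cube (n - 1)) (box_degen n (Suc j)) (box_face (n - 1) (Suc j) False)"
        by (rule ext)
      then have "F k True = F k False"
        using F[OF k, of True] F[OF k, of False] by (simp only: True)
      then show ?thesis
        by (simp only: diff_self cscale_zero_right) (rule submod_zero[OF submod_hull])
    next
      case False
      obtain k' where k': "k = Suc k'" "k' < n" "k' \<noteq> j" using k False by (cases k) auto
      \<comment> \<open>the direction \<open>j\<close> as a coordinate of the face in direction \<open>k'\<close>\<close>
      define j' where "j' = (if k' < j then j - 1 else j)"
      have j': "j' < n - 1" using k' degen(1) by (auto simp: j'_def)
      have "F k e \<in> box_degenerate K (n - 1)" for e
        unfolding F[OF k]
      proof (rule act_degenerate[OF degen(2) factors_degen[OF hom[OF k] j']])
        fix v :: "bool list" assume v: "length v = n - 1"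
        have l: "length (insert_at k' e v) = n" if "length v = n - 1" for v :: "bool list"
          using that k' by auto
        have "delete_at j (insert_at k' e (v[j' := False])) = delete_at j (insert_at k' e v)"
        proof (rule nth_equalityI)
          fix i assume "i < length (delete_at j (insert_at k' e (v[j' := False])))"
          then have i: "i < n - 1" using v degen(1) k' by auto
          have d: "delete_at j (insert_at k' e w) ! i =
              (if i < j then insert_at k' e w ! i else insert_at k' e w ! Suc i)"
            if "length w = n - 1" for w
            using i degen(1) l[OF that] by (subst nth_delete_at) simp_all
          have s: "insert_at k' e w ! i' = (if i' < k' then w ! i' else if i' = k' then e else w ! (i' - 1))"
            if "length w = n - 1" "i' < n" for w i'
            using that k' by (subst nth_insert_at) auto
          show "delete_at j (insert_at k' e (v[j' := False])) ! i = delete_at j (insert_at k' e v) ! i"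
            using i v j' k' by (simp add: d s nth_list_update) (auto simp: j'_def)
        qed (use v degen(1) k' in simp)
        then show "compose (cube (n - 1)) (box_degen n (Suc j)) (box_face (n - 1) k e) (v[j' := False]) =
            compose (cube (n - 1)) (box_degen n (Suc j)) (box_face (n - 1) k e) v"
          using v l by (simp add: compose_def k' box_face_apply box_degen_apply)
      qed
      then show ?thesis by (intro submod_cscale submod_diff H submod_hull)
    qed
    then show ?thesis unfolding bd by (intro submod_sum submod_hull)
  next
    case (conn j \<tau>)
    have F: "F k e = act K (n - 1) (n - 1) (compose (cube (n - 1)) (box_conn n (Suc j)) (box_face (n - 1) k e)) \<tau>"
      and hom: "box_hom (n - 1) (n - 1) (compose (cube (n - 1)) (box_conn n (Suc j)) (box_face (n - 1) k e))"
      if "k \<in> {1..n}" for k e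
    proof -
      have f: "box_hom (n - 1) n (box_face (n - 1) k e)" using that by (intro face_hom) auto
      have d: "box_hom n (n - 1) (box_conn n (Suc j))" using conn by (intro box_hom.conn) auto
      show "F k e = act K (n - 1) (n - 1) (compose (cube (n - 1)) (box_conn n (Suc j)) (box_face (n - 1) k e)) \<tau>"
        unfolding F_def conn(3) by (rule act_comp[OF f d conn(2)])
      show "box_hom (n - 1) (n - 1) (compose (cube (n - 1)) (box_conn n (Suc j)) (box_face (n - 1) k e))"
        by (rule box_hom.comp[OF f d])
    qed
    have m: "merge_at j w ! i = (if i < j then w ! i else if i = j then w ! j \<or> w ! Suc j else w ! Suc i)"
      if "length w = n" "i < n - 1" for w i
      using that conn(1) by (subst nth_merge_at) simp_all
    have lm: "length (merge_at j w) = n - 1" if "length w = n" for w using that conn(1) by auto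
    have s: "insert_at k' e w ! i' = (if i' < k' then w ! i' else if i' = k' then e else w ! (i' - 1))"
      if "length w = n - 1" "i' < n" "k' < n" for w i' k' and e
      using that by (subst nth_insert_at) auto
    have l: "length (insert_at k' e w) = n" if "length w = n - 1" "k' < n" for w :: "bool list" and k' e
      using that by auto
    have "F (Suc j) e = F (Suc (Suc j)) e" for e
    proof -
      have "merge_at j (insert_at j e v) = merge_at j (insert_at (Suc j) e v)" if v: "length v = n - 1" for v
      proof (rule nth_equalityI)
        show "length (merge_at j (insert_at j e v)) = length (merge_at j (insert_at (Suc j) e v))"
          using v conn(1) by (simp only: lm l)
        fix i assume "i < length (merge_at j (insert_at j e v))"
        then have i: "i < n - 1" using v conn(1) by (simp only: lm l)
        show "merge_at j (insert_at j e v) ! i = merge_at j (insert_at (Suc j) e v) ! i"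
          using i v conn(1) by (simp add: m s l) auto
      qed
      then have "compose (cube (n - 1)) (box_conn n (Suc j)) (box_face (n - 1) (Suc j) e) v =
          compose (cube (n - 1)) (box_conn n (Suc j)) (box_face (n - 1) (Suc (Suc j)) e) v" for v
        using conn(1) l by (simp add: compose_def box_face_apply box_conn_apply)
      then have "compose (cube (n - 1)) (box_conn n (Suc j)) (box_face (n - 1) (Suc j) e) =
          compose (cube (n - 1)) (box_conn n (Suc j)) (box_face (n - 1) (Suc (Suc j)) e)"
        by (rule ext)
      then show ?thesis using conn(1) F[of "Suc j" e] F[of "Suc (Suc j)" e] by simp
    qed
    then have pair: "(\<Sum>k\<in>{Suc j, Suc (Suc j)}. cscale ((-1) ^ k) (gen (F k True) - gen (F k False))) =
        (0 :: 'a \<Rightarrow>\<^sub>0 'k)"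
      by simp
    have other: "cscale ((-1) ^ k) (gen (F k True) - gen (F k False)) \<in> ?H"
      if k: "k \<in> {1..n} - {Suc j, Suc (Suc j)}" for k
    proof -
      obtain k' where k': "k = Suc k'" "k' < n" "k' \<noteq> j" "k' \<noteq> Suc j" using k by (cases k) auto
      define j' where "j' = (if k' < j then j - 1 else j)"
      have j': "Suc j' < n - 1" using k' conn(1) by (auto simp: j'_def)
      have k1: "k \<in> {1..n}" using k by simp
      have "F k e \<in> box_degenerate K (n - 1)" for e
        unfolding F[OF k1]
      proof (rule act_degenerate[OF conn(2) factors_conn[OF hom[OF k1] j']])
        fix v :: "bool list" assume v: "length v = n - 1"
        define w where "w = v[j' := False, Suc j' := v ! j' \<or> v ! Suc j']"
        have w: "length w = n - 1" using v by (simp add: w_def)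
        have wn: "w ! i = (if i = Suc j' then v ! j' \<or> v ! Suc j' else if i = j' then False else v ! i)"
          if "i < n - 1" for i
          using that v j' by (simp add: w_def nth_list_update)
        have "merge_at j (insert_at k' e w) = merge_at j (insert_at k' e v)"
        proof (rule nth_equalityI)
          show "length (merge_at j (insert_at k' e w)) = length (merge_at j (insert_at k' e v))"
            using v w k' by (simp only: lm l)
          fix i assume "i < length (merge_at j (insert_at k' e w))"
          then have i: "i < n - 1" using w k' by (simp only: lm l)
          have sw: "insert_at k' e w ! p = (if p < k' then w ! p else if p = k' then e else w ! (p - 1))"
            and sv: "insert_at k' e v ! p = (if p < k' then v ! p else if p = k' then e else v ! (p - 1))"
            if "p < n" for p
            using s[OF w that k'(2)] s[OF v that k'(2)] .
          have cases: "(k' < j \<and> j' = j - 1) \<or> (Suc j < k' \<and> j' = j)"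
            using k'(3,4) unfolding j'_def by (cases "k' < j") simp_all
          have q1: "insert_at k' e w ! p = insert_at k' e v ! p" if p: "p < n" "p \<noteq> j" "p \<noteq> Suc j" for p
          proof -
            consider "p < k'" | "p = k'" | "k' < p" by linarith
            then show ?thesis
            proof cases
              case 1
              then have "p \<noteq> j'" "p \<noteq> Suc j'" "p < n - 1" using p cases k'(2) by auto
              then show ?thesis using 1 sw[OF p(1)] sv[OF p(1)] wn[of p] by simp
            next
              case 2
              then show ?thesis using sw[OF k'(2)] sv[OF k'(2)] by simp
            next
              case 3
              then have "p - 1 \<noteq> j'" "p - 1 \<noteq> Suc j'" "p - 1 < n - 1" "\<not> p < k'" "p \<noteq> k'"
                using p cases conn(1) by auto
              then show ?thesis using sw[OF p(1)] sv[OF p(1)] wn[of "p - 1"] by simp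
            qed
          qed
          have jn: "j < n" "Suc j < n" "j' < n - 1" using conn(1) j' by auto
          have q2: "insert_at k' e w ! j = False" "insert_at k' e w ! Suc j = (v ! j' \<or> v ! Suc j')"
            "insert_at k' e v ! j = v ! j'" "insert_at k' e v ! Suc j = v ! Suc j'"
          proof -
            have c: "(if j < k' then w ! j else if j = k' then e else w ! (j - 1)) = w ! j'"
              "(if Suc j < k' then w ! Suc j else if Suc j = k' then e else w ! (Suc j - 1)) = w ! Suc j'"
              "(if j < k' then v ! j else if j = k' then e else v ! (j - 1)) = v ! j'"
              "(if Suc j < k' then v ! Suc j else if Suc j = k' then e else v ! (Suc j - 1)) = v ! Suc j'"
              using cases by auto
            show "insert_at k' e w ! j = False" using sw[OF jn(1)] c(1) wn[OF jn(3)] by simp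
            show "insert_at k' e w ! Suc j = (v ! j' \<or> v ! Suc j')" using sw[OF jn(2)] c(2) wn[OF j'] by simp
            show "insert_at k' e v ! j = v ! j'" using sv[OF jn(1)] c(3) by simp
            show "insert_at k' e v ! Suc j = v ! Suc j'" using sv[OF jn(2)] c(4) by simp
          qed
          show "merge_at j (insert_at k' e w) ! i = merge_at j (insert_at k' e v) ! i"
            unfolding m[OF l[OF w k'(2)] i] m[OF l[OF v k'(2)] i]
            using i q1[of i] q1[of "Suc i"] by (simp add: q2)
        qed
        then show "compose (cube (n - 1)) (box_conn n (Suc j)) (box_face (n - 1) k e)
              (v[j' := False, Suc j' := v ! j' \<or> v ! Suc j']) =
            compose (cube (n - 1)) (box_conn n (Suc j)) (box_face (n - 1) k e) v"
          using v w l k' unfolding w_def[symmetric]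
          by (simp add: compose_def box_face_apply box_conn_apply)
      qed
      then show ?thesis by (intro submod_cscale submod_diff H submod_hull)
    qed
    have "box_boundary K n \<sigma> = (\<Sum>k\<in>{1..n} - {Suc j, Suc (Suc j)}.
        cscale ((-1) ^ k) (gen (F k True) - gen (F k False)) :: 'a \<Rightarrow>\<^sub>0 'k)"
      unfolding bd using conn(1) pair by (subst sum.subset_diff[of "{Suc j, Suc (Suc j)}"]) auto
    moreover have "\<dots> \<in> ?H" by (intro submod_sum submod_hull other)
    ultimately show ?thesis by (simp only:)
  qed
qed

end

text \<open>
  The summand of \<open>(j, k)\<close> with \<open>k < j\<close> cancels the one of \<open>(k, j - 1)\<close>.
\<close>

lemma alternating_sum_cancel:
  fixes A :: "nat \<Rightarrow> nat \<Rightarrow> ('x \<Rightarrow>\<^sub>0 'k::{comm_ring,comm_monoid_mult})"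
  assumes A: "\<And>j k. 1 \<le> k \<Longrightarrow> k < j \<Longrightarrow> j \<le> n \<Longrightarrow> A j k = A k (j - 1)"
  shows "(\<Sum>j=1..n. \<Sum>k=1..n-1. cscale ((-1) ^ (j + k)) (A j k)) = 0"
proof -
  let ?f = "\<lambda>(j, k). cscale ((-1) ^ (j + k)) (A j k)"
  let ?L = "{(j, k). 1 \<le> k \<and> k < j \<and> j \<le> n}" and ?U = "{(j, k). 1 \<le> j \<and> j \<le> k \<and> k \<le> n - 1}"
  have "(\<Sum>j=1..n. \<Sum>k=1..n-1. cscale ((-1) ^ (j + k)) (A j k)) = sum ?f ({1..n} \<times> {1..n-1})"
    by (simp add: sum.cartesian_product)
  also have "{1..n} \<times> {1..n-1} = ?L \<union> ?U" by auto
  also have "sum ?f (?L \<union> ?U) = sum ?f ?L + sum ?f ?U"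
  proof (rule sum.union_disjoint)
    show "finite ?L" by (rule finite_subset[of _ "{1..n} \<times> {1..n}"]) auto
    show "finite ?U" by (rule finite_subset[of _ "{1..n} \<times> {1..n}"]) auto
  qed auto
  also have "sum ?f ?U = (\<Sum>(j, k)\<in>?L. - ?f (j, k))"
  proof (rule sum.reindex_bij_witness[where i = "\<lambda>(j, k). (k, j - 1)" and j = "\<lambda>(j, k). (Suc k, j)"])
    fix a assume "a \<in> ?U"
    then obtain j k where a: "a = (j, k)" "1 \<le> j" "j \<le> k" "k \<le> n - 1" by auto
    then have "A (Suc k) j = A j k" using A[of j "Suc k"] by auto
    then show "(case (case a of (j, k) \<Rightarrow> (Suc k, j)) of (j, k) \<Rightarrow> - ?f (j, k)) = ?f a"
      by (simp add: a add.commute)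
  qed auto
  also have "(\<Sum>(j, k)\<in>?L. - ?f (j, k)) = - sum ?f ?L"
    by (simp add: sum_negf case_prod_unfold)
  finally show ?thesis by simp
qed

context cubical_set
begin

lemma boundary_boundary:
  assumes \<sigma>: "\<sigma> \<in> cells K n"
  shows "lin (box_boundary K (n - 1)) (box_boundary K n \<sigma>) = (0 :: 'a \<Rightarrow>\<^sub>0 'k::{comm_ring,comm_monoid_mult})"
proof -
  define G :: "nat \<Rightarrow> bool \<Rightarrow> nat \<Rightarrow> bool \<Rightarrow> 'a \<Rightarrow>\<^sub>0 'k" where "G j e k e' = gen (act K (n - 2) n
    (compose (cube (n - 2)) (box_face (n - 1) j e) (box_face (n - 2) k e')) \<sigma>)" for j e k e'
  define A where "A j k = (G j True k True - G j True k False) - (G j False k True - G j False k False)" for j k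
  have G: "gen (act K (n - 1 - 1) (n - 1) (box_face (n - 1 - 1) k e') (act K (n - 1) n (box_face (n - 1) j e) \<sigma>)) =
      G j e k e'" if "j \<in> {1..n}" "k \<in> {1..n - 1}" for j k e e'
    using that act_comp[OF face_hom face_hom \<sigma>, of k j e' e]
    by (simp add: G_def numeral_2_eq_2)
  have "lin (box_boundary K (n - 1)) (box_boundary K n \<sigma> :: 'a \<Rightarrow>\<^sub>0 'k) =
      (\<Sum>j=1..n. cscale ((-1) ^ j) (\<Sum>k=1..n-1. cscale ((-1) ^ k) (A j k)))"
    unfolding box_boundary_def[of K n] lin_simps lin_gen
  proof (intro sum.cong refl arg_cong[where f = "cscale _"])
    fix j assume j: "j \<in> {1..n}"
    have inner: "box_boundary K (n - 1) (act K (n - 1) n (box_face (n - 1) j e) \<sigma>) =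
        (\<Sum>k=1..n-1. cscale ((-1) ^ k) (G j e k True - G j e k False))" for e
      unfolding box_boundary_def by (intro sum.cong refl) (simp only: G[OF j])
    show "box_boundary K (n - 1) (act K (n - 1) n (box_face (n - 1) j True) \<sigma>) -
        box_boundary K (n - 1) (act K (n - 1) n (box_face (n - 1) j False) \<sigma>) =
        (\<Sum>k=1..n-1. cscale ((-1) ^ k) (A j k))"
      unfolding inner A_def by (simp only: cscale_diff_right sum_subtractf)
  qed
  also have "\<dots> = (\<Sum>j=1..n. \<Sum>k=1..n-1. cscale ((-1) ^ (j + k)) (A j k))"
    by (simp add: cscale_sum power_add)
  also have "\<dots> = 0"
  proof (rule alternating_sum_cancel)
    fix j k :: nat assume jk: "1 \<le> k" "k < j" "j \<le> n"
    then have "G j e k e' = G k e' (j - 1) e" for e e'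
      unfolding G_def by (simp only: box_face_box_face)
    then show "A j k = A k (j - 1)" by (simp add: A_def algebra_simps)
  qed
  finally show ?thesis .
qed

end

section \<open>Simplices\<close>

lemma pts_Simplex [simp]: "pts Simplex n = {..n}"
  by (simp add: Simplex_def)

lemma hom_Simplex_iff: "u \<in> hom Simplex m n \<longleftrightarrow>
    u \<in> extensional {..m} \<and> (\<forall>i\<le>m. u i \<le> n) \<and> mono_on {..m} u"
  by (auto simp: Simplex_def PiE_def Pi_iff)

lemma hom_SimplexI:
  assumes "u \<in> extensional {..m}" "\<And>i. i \<le> m \<Longrightarrow> u i \<le> n" "\<And>i j. i \<le> j \<Longrightarrow> j \<le> m \<Longrightarrow> u i \<le> u j"
  shows "u \<in> hom Simplex m n"
  using assms by (auto simp: hom_Simplex_iff monotone_on_def)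

lemma hom_SimplexD:
  assumes "u \<in> hom Simplex m n"
  shows "u \<in> extensional {..m}" "i \<le> m \<Longrightarrow> u i \<le> n" "i \<le> j \<Longrightarrow> j \<le> m \<Longrightarrow> u i \<le> u j"
  using assms by (auto simp: hom_Simplex_iff monotone_on_def)

lemma coface_hom: "0 < n \<Longrightarrow> i \<le> n \<Longrightarrow> coface n i \<in> hom Simplex (n - 1) n"
  by (rule hom_SimplexI) (auto simp: coface_def)

lemma codegen_hom: "i \<le> n \<Longrightarrow> codegen n i \<in> hom Simplex (Suc n) n"
  by (rule hom_SimplexI) (auto simp: codegen_def)

locale simplicial =
  fixes S :: "(nat, 'a) psh"
  assumes simplicial: "simplicial_set S"
begin

lemma simp_act_in: "u \<in> hom Simplex m n \<Longrightarrow> \<sigma> \<in> cells S n \<Longrightarrow> act S m n u \<sigma> \<in> cells S m"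
  by (rule funcset_mem[OF simplicial[unfolded presheaf_def, THEN conjunct1, rule_format]]) simp_all

lemma simp_act_comp: "u \<in> hom Simplex l m \<Longrightarrow> v \<in> hom Simplex m n \<Longrightarrow> \<sigma> \<in> cells S n \<Longrightarrow>
    act S l m u (act S m n v \<sigma>) = act S l n (compose {..l} v u) \<sigma>"
  by (rule simplicial[unfolded presheaf_def, THEN conjunct2, THEN conjunct2, rule_format,
        unfolded pts_Simplex, symmetric]) simp_all

lemma simp_act_id: "\<sigma> \<in> cells S n \<Longrightarrow> act S n n (restrict id {..n}) \<sigma> = \<sigma>"
  by (rule simplicial[unfolded presheaf_def, THEN conjunct2, THEN conjunct1, rule_format,
        unfolded pts_Simplex])

lemma simp_degenerate_cells: "simp_degenerate S n \<subseteq> cells S n"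
proof
  fix \<sigma> assume s: "\<sigma> \<in> simp_degenerate S n"
  then have n: "0 < n" by (auto simp: simp_degenerate_def split: if_splits)
  obtain i \<tau> where i: "i \<le> n - 1" "\<tau> \<in> cells S (n - 1)" "\<sigma> = act S n (n - 1) (codegen (n - 1) i) \<tau>"
    using s n unfolding simp_degenerate_def by auto
  then show "\<sigma> \<in> cells S n"
    using simp_act_in[of "codegen (n - 1) i" n "n - 1" \<tau>] codegen_hom[of i "n - 1"] n by simp
qed

text \<open>
  If a monotone map identifies two vertices, then it identifies two neighbouring ones, and so it factors
  through a codegeneracy.
\<close>

lemma degenerate_if_not_inj:
  assumes u: "u \<in> hom Simplex m l" and \<tau>: "\<tau> \<in> cells S l" and ninj: "\<not> inj_on u {..m}"
  shows "act S m l u \<tau> \<in> simp_degenerate S m"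
proof -
  note u' = hom_SimplexD[OF u]
  obtain a b where ab: "a < b" "b \<le> m" "u a = u b"
    using ninj unfolding inj_on_def by (metis atMost_iff linorder_neqE_nat)
  then have k: "u a = u (Suc a)" using u'(3)[of a "Suc a"] u'(3)[of "Suc a" b] by simp
  have m: "0 < m" "a \<le> m - 1" "Suc (m - 1) = m" using ab by auto
  define v where "v = compose {..m - 1} u (coface m a)"
  have v: "v \<in> hom Simplex (m - 1) l"
    using u' ab m by (intro hom_SimplexI) (auto simp: v_def compose_def coface_def)
  have "u = compose {..m} v (codegen (m - 1) a)"
  proof (rule extensionalityI[OF u'(1)])
    fix i assume "i \<in> {..m}"
    then show "u i = compose {..m} v (codegen (m - 1) a) i"
      using k ab m by (cases "i = a") (auto simp: compose_def v_def codegen_def coface_def)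
  qed simp
  then have "act S m l u \<tau> = act S m (m - 1) (codegen (m - 1) a) (act S (m - 1) l v \<tau>)"
    using simp_act_comp[OF codegen_hom[OF m(2), unfolded m(3)] v \<tau>] by simp
  moreover have "act S (m - 1) l v \<tau> \<in> cells S (m - 1)" by (rule simp_act_in[OF v \<tau>])
  ultimately show ?thesis using m unfolding simp_degenerate_def by auto
qed

text \<open>
  The faces \<open>k\<close> and \<open>k + 1\<close> of a degeneracy in direction \<open>k\<close> are equal and cancel; all others are pulled
  back along a map that identifies two vertices.
\<close>

lemma simp_degenerate_boundary:
  assumes "\<sigma> \<in> simp_degenerate S n"
  shows "simp_boundary S n \<sigma> \<in> submod hull (gen ` simp_degenerate S (n - 1))" (is "_ \<in> ?H")
proof -
  have n: "0 < n" "Suc (n - 1) = n" using assms by (auto simp: simp_degenerate_def split: if_splits)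
  obtain k \<tau> where k: "k \<le> n - 1" "\<tau> \<in> cells S (n - 1)" "\<sigma> = act S n (n - 1) (codegen (n - 1) k) \<tau>"
    using assms n unfolding simp_degenerate_def by auto
  let ?c = "\<lambda>j. compose {..n - 1} (codegen (n - 1) k) (coface n j)"
  let ?d = "\<lambda>j. act S (n - 1) n (coface n j) \<sigma>"
  have cg: "codegen (n - 1) k \<in> hom Simplex n (n - 1)" using codegen_hom[OF k(1)] n by simp
  have d: "?d j = act S (n - 1) (n - 1) (?c j) \<tau>" if "j \<le> n" for j
    unfolding k(3) using that n by (intro simp_act_comp coface_hom cg k(2)) auto
  have c_hom: "?c j \<in> hom Simplex (n - 1) (n - 1)" if "j \<le> n" for j
    using that n k(1) by (intro hom_SimplexI) (auto simp: compose_def codegen_def coface_def)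
  have deg: "?d j \<in> simp_degenerate S (n - 1)" if j: "j \<le> n" "j \<noteq> k" "j \<noteq> Suc k" for j
    unfolding d[OF j(1)]
  proof (rule degenerate_if_not_inj[OF c_hom[OF j(1)] k(2)])
    let ?a = "if j < k then k - 1 else k"
    have "?c j ?a = ?c j (Suc ?a)" "?a \<in> {..n - 1}" "Suc ?a \<in> {..n - 1}" "?a \<noteq> Suc ?a"
      using j k(1) n by (auto simp: compose_def codegen_def coface_def)
    then show "\<not> inj_on (?c j) {..n - 1}" using inj_onD[of "?c j" "{..n - 1}" ?a "Suc ?a"] by blast
  qed
  have "?c k = ?c (Suc k)"
    by (rule ext) (auto simp: compose_def codegen_def coface_def)
  then have eq: "?d k = ?d (Suc k)" using d[of k] d[of "Suc k"] k(1) n by simp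
  let ?f = "\<lambda>j. cscale ((-1) ^ j) (gen (?d j))"
  have "simp_boundary S n \<sigma> = (\<Sum>j\<in>{0..n}. ?f j)" using n by (simp add: simp_boundary_def)
  also have "\<dots> = (\<Sum>j\<in>{0..n} - {k, Suc k}. ?f j) + (\<Sum>j\<in>{k, Suc k}. ?f j)"
    using k(1) n by (intro sum.subset_diff) auto
  also have "(\<Sum>j\<in>{k, Suc k}. ?f j) = 0" by (simp add: eq del: One_nat_def)
  finally have "simp_boundary S n \<sigma> = (\<Sum>j\<in>{0..n} - {k, Suc k}. ?f j)" by simp
  also have "\<dots> \<in> ?H"
    using deg by (intro submod_sum submod_cscale submod_hull) (auto intro: hull_inc)
  finally show ?thesis .
qed

end

section \<open>Vertices and joints of necklaces\<close>

lemma joints_Nil [simp]: "joints [] = {0}"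
  by (simp add: joints_def)

lemma joints_Cons: "joints (n # T) = insert 0 ((+) n ` joints T)"
proof -
  have "{..length (n # T)} = insert 0 (Suc ` {..length T})"
    by (simp add: atMost_Suc_eq_insert_0)
  then show ?thesis by (simp add: joints_def image_image)
qed

lemma joints_append: "joints (T @ U) = joints T \<union> (+) (sum_list T) ` joints U"
proof (induction T)
  case Nil
  have "0 \<in> joints U" by (cases U) (auto simp: joints_Cons)
  then show ?case by auto
next
  case (Cons n T)
  then show ?case by (simp add: joints_Cons image_Un image_image add.assoc)
qed

lemma finite_joints [simp]: "finite (joints T)" by (simp add: joints_def)

lemma zero_in_joints [simp]: "0 \<in> joints T"
  by (cases T) (auto simp: joints_Cons)

lemma last_in_joints [simp]: "sum_list T \<in> joints T"
  by (induction T) (auto simp: joints_Cons)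

lemma joints_le: "j \<in> joints T \<Longrightarrow> j \<le> sum_list T"
  by (induction T arbitrary: j) (auto simp: joints_Cons)

lemma joints_subset_verts: "joints T \<subseteq> neck_verts T"
  using joints_le by (auto simp: neck_verts_def)

text \<open>
  A necklace is contained in the standard simplex on its vertices. Its simplices are those whose first
  and last vertex are not separated by a joint, and this turns membership into a condition on two
  vertices.
\<close>

lemma neck_cell_iff: "u \<in> cells (neck T) m \<longleftrightarrow> u \<in> extensional {..m} \<and> mono_on {..m} u \<and>
    u m \<le> sum_list T \<and> (\<forall>j\<in>joints T. \<not> (u 0 < j \<and> j < u m))"
proof -
  have "(\<exists>B\<in>beads T. u ` {..m} \<subseteq> B) \<longleftrightarrow> u m \<le> sum_list T \<and> (\<forall>j\<in>joints T. \<not> (u 0 < j \<and> j < u m))"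
    if mono: "mono_on {..m} u"
  proof -
    have bd: "u ` {..m} \<subseteq> {a..b} \<longleftrightarrow> a \<le> u 0 \<and> u m \<le> b" for a b
    proof
      assume "u ` {..m} \<subseteq> {a..b}"
      then show "a \<le> u 0 \<and> u m \<le> b" by (auto simp: image_subset_iff)
    next
      assume ab: "a \<le> u 0 \<and> u m \<le> b"
      have "u 0 \<le> u i \<and> u i \<le> u m" if "i \<le> m" for i
        using mono that by (auto simp: monotone_on_def)
      then show "u ` {..m} \<subseteq> {a..b}" using ab by (auto simp: image_subset_iff) (meson order_trans)+
    qed
    show ?thesis
    proof (cases "T = []")
      case True
      have "(\<exists>B\<in>beads T. u ` {..m} \<subseteq> B) \<longleftrightarrow> u ` {..m} \<subseteq> {0..0}" using True by (simp add: beads_def)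
      also have "\<dots> \<longleftrightarrow> u m \<le> 0" unfolding bd by simp
      finally show ?thesis using True by simp
    next
      case False
      define s where "s i = sum_list (take i T)" for i
      have s_mono: "s i \<le> s k" if "i \<le> k" for i k
        using that by (metis le_add1 le_Suc_ex s_def sum_list_append take_add)
      have s_len: "s (length T) = sum_list T" "s 0 = 0" by (simp_all add: s_def)
      have J: "joints T = s ` {..length T}" by (simp add: joints_def s_def)
      have "(\<exists>B\<in>beads T. u ` {..m} \<subseteq> B) \<longleftrightarrow> (\<exists>i<length T. u ` {..m} \<subseteq> {s i..s (Suc i)})"
        using False by (auto simp: beads_def s_def)
      also have "\<dots> \<longleftrightarrow> (\<exists>i<length T. s i \<le> u 0 \<and> u m \<le> s (Suc i))" by (simp only: bd)
      also have "\<dots> \<longleftrightarrow> u m \<le> sum_list T \<and> (\<forall>j\<in>joints T. \<not> (u 0 < j \<and> j < u m))"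
      proof
        assume "\<exists>i<length T. s i \<le> u 0 \<and> u m \<le> s (Suc i)"
        then obtain i where i: "i < length T" "s i \<le> u 0" "u m \<le> s (Suc i)" by blast
        have "u m \<le> sum_list T" using i(1,3) s_mono[of "Suc i" "length T"] s_len by simp
        moreover have "\<not> (u 0 < s k \<and> s k < u m)" for k
          using s_mono[of k i] s_mono[of "Suc i" k] i by (cases "k \<le> i") auto
        ultimately show "u m \<le> sum_list T \<and> (\<forall>j\<in>joints T. \<not> (u 0 < j \<and> j < u m))" by (auto simp: J)
      next
        assume r: "u m \<le> sum_list T \<and> (\<forall>j\<in>joints T. \<not> (u 0 < j \<and> j < u m))"
        define i where "i = Max {i. i < length T \<and> s i \<le> u 0}"
        have fin: "finite {i. i < length T \<and> s i \<le> u 0}" by simp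
        have "0 \<in> {i. i < length T \<and> s i \<le> u 0}" using False s_len by simp
        then have i: "i < length T" "s i \<le> u 0" using Max_in[OF fin] unfolding i_def by blast+
        have "u m \<le> s (Suc i)"
        proof (cases "Suc i = length T")
          case True
          then show ?thesis using r s_len by simp
        next
          case False
          then have l: "Suc i < length T" using i by simp
          have "\<not> s (Suc i) \<le> u 0"
          proof
            assume "s (Suc i) \<le> u 0"
            then have "Suc i \<in> {i. i < length T \<and> s i \<le> u 0}" using l by simp
            from Max_ge[OF fin this] show False unfolding i_def[symmetric] by simp
          qed
          moreover have "s (Suc i) \<in> joints T" using l by (auto simp: J)
          ultimately show ?thesis using r by force
        qed
        then show "\<exists>i<length T. s i \<le> u 0 \<and> u m \<le> s (Suc i)" using i by blast
      qed
      finally show ?thesis .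
    qed
  qed
  then show ?thesis unfolding neck_cells_iff by blast
qed

lemma neck_cellI:
  assumes "u \<in> extensional {..m}" "\<And>i j. i \<le> j \<Longrightarrow> j \<le> m \<Longrightarrow> u i \<le> u j" "u m \<le> sum_list T"
    "\<And>j. j \<in> joints T \<Longrightarrow> u 0 < j \<Longrightarrow> j < u m \<Longrightarrow> False"
  shows "u \<in> cells (neck T) m"
  using assms by (auto simp: neck_cell_iff monotone_on_def)

lemma neck_cellD:
  assumes "u \<in> cells (neck T) m"
  shows "u \<in> extensional {..m}" "i \<le> j \<Longrightarrow> j \<le> m \<Longrightarrow> u i \<le> u j" "i \<le> m \<Longrightarrow> u i \<le> sum_list T"
    "j \<in> joints T \<Longrightarrow> u 0 < j \<Longrightarrow> j < u m \<Longrightarrow> False"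
proof -
  show mono: "i \<le> j \<Longrightarrow> j \<le> m \<Longrightarrow> u i \<le> u j" for i j
    using assms by (auto simp: neck_cell_iff monotone_on_def)
  show "i \<le> m \<Longrightarrow> u i \<le> sum_list T"
    using mono[of i m] assms by (auto simp: neck_cell_iff)
qed (use assms in \<open>auto simp: neck_cell_iff\<close>)

lemma act_neck [simp]: "act (neck T) l m f u = compose {..l} u f"
  by (simp add: neck_def yoneda_def)

lemma vertex_cell_in: "v \<le> sum_list T \<Longrightarrow> vertex_cell v \<in> cells (neck T) 0"
  by (rule neck_cellI) (auto simp: vertex_cell_def)

lemma neck_act_in:
  assumes "u \<in> cells (neck T) m" "f \<in> hom Simplex l m"
  shows "compose {..l} u f \<in> cells (neck T) l"
proof (rule neck_cellI)
  note u = neck_cellD[OF assms(1)] and f = hom_SimplexD[OF assms(2)]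
  show "compose {..l} u f i \<le> compose {..l} u f j" if "i \<le> j" "j \<le> l" for i j
    using that u(2) f by (simp add: compose_def)
  show "compose {..l} u f l \<le> sum_list T" using u(3) f by (simp add: compose_def)
  fix j assume j: "j \<in> joints T" "compose {..l} u f 0 < j" "j < compose {..l} u f l"
  then have "u 0 < j" "j < u m"
    using u(2)[of 0 "f 0"] u(2)[of "f l" m] f(2)[of 0] f(2)[of l] by (auto simp: compose_def)
  then show False by (rule u(4)[OF j(1)])
qed simp

lemma psh_hom_neckD:
  assumes "f \<in> psh_hom Simplex (neck T) X"
  shows "f n \<in> extensional (cells (neck T) n)"
    and "u \<in> cells (neck T) n \<Longrightarrow> f n u \<in> cells X n"
    and "w \<in> hom Simplex m n \<Longrightarrow> u \<in> cells (neck T) n \<Longrightarrow> f m (compose {..m} u w) = act X m n w (f n u)"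
  using assms by (auto simp: psh_hom_def PiE_def)

lemma psh_hom_neckI:
  assumes "\<And>n. f n \<in> extensional (cells (neck T) n)"
    and "\<And>n u. u \<in> cells (neck T) n \<Longrightarrow> f n u \<in> cells X n"
    and "\<And>m n w u. w \<in> hom Simplex m n \<Longrightarrow> u \<in> cells (neck T) n \<Longrightarrow>
      f m (compose {..m} u w) = act X m n w (f n u)"
  shows "f \<in> psh_hom Simplex (neck T) X"
  using assms by (auto simp: psh_hom_def PiE_def)

subsection \<open>Maps of necklaces\<close>

lemma on_verts_cell:
  assumes h: "h \<in> psh_hom Simplex (neck T) (neck U)" and u: "u \<in> cells (neck T) m"
  shows "h m u = (\<lambda>i\<in>{..m}. on_verts h (u i))"
proof (rule extensionalityI[of _ "{..m}"])
  show "h m u \<in> extensional {..m}" using psh_hom_neckD(2)[OF h u] by (rule neck_cellD)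
  fix i assume i: "i \<in> {..m}"
  have v: "vertex_cell i \<in> hom Simplex 0 m" using i by (intro hom_SimplexI) (auto simp: vertex_cell_def)
  have "compose {..0} u (vertex_cell i) = vertex_cell (u i)"
    by (auto simp: compose_def vertex_cell_def)
  then have "h 0 (vertex_cell (u i)) = compose {..0} (h m u) (vertex_cell i)"
    using psh_hom_neckD(3)[OF h v u] by simp
  then show "h m u i = (\<lambda>i\<in>{..m}. on_verts h (u i)) i"
    using i by (simp add: on_verts_def compose_def vertex_cell_def)
qed simp

lemma edge_cell:
  assumes "a \<le> b" "b \<le> sum_list T" "\<And>j. j \<in> joints T \<Longrightarrow> a < j \<Longrightarrow> j < b \<Longrightarrow> False"
  shows "(\<lambda>i\<in>{..1}. if i = 0 then a else b) \<in> cells (neck T) 1"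
  using assms by (intro neck_cellI) auto

text \<open>
  A map of necklaces is determined by its effect on vertices. Two consecutive joints of \<open>T\<close> span an edge,
  and the image of this edge cannot jump over a joint of \<open>U\<close>; hence every joint of \<open>U\<close> is the image of a
  joint of \<open>T\<close>.
\<close>

lemma nec_homD:
  assumes "h \<in> nec_hom T U"
  shows "u \<in> cells (neck T) m \<Longrightarrow> h m u = (\<lambda>i\<in>{..m}. on_verts h (u i))"
    and "on_verts h 0 = 0" and "on_verts h (sum_list T) = sum_list U"
    and "a \<le> b \<Longrightarrow> b \<le> sum_list T \<Longrightarrow> on_verts h a \<le> on_verts h b"
    and "joints U \<subseteq> on_verts h ` joints T"
proof -
  have h: "h \<in> psh_hom Simplex (neck T) (neck U)" using assms by (simp add: nec_hom_def)
  show cell: "u \<in> cells (neck T) m \<Longrightarrow> h m u = (\<lambda>i\<in>{..m}. on_verts h (u i))" for m u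
    by (rule on_verts_cell[OF h])
  show 0: "on_verts h 0 = 0" and N: "on_verts h (sum_list T) = sum_list U"
    using assms by (simp_all add: nec_hom_def)
  have edge: "(\<lambda>i\<in>{..1}. on_verts h (if i = 0 then a else b)) \<in> cells (neck U) 1"
    if "a \<le> b" "b \<le> sum_list T" "\<And>j. j \<in> joints T \<Longrightarrow> a < j \<Longrightarrow> j < b \<Longrightarrow> False" for a b
  proof -
    note e = edge_cell[OF that]
    have "h 1 (\<lambda>i\<in>{..1}. if i = 0 then a else b) =
        (\<lambda>i\<in>{..1}. on_verts h ((\<lambda>i\<in>{..1}. if i = 0 then a else b) i))" by (rule cell[OF e])
    also have "\<dots> = (\<lambda>i\<in>{..1}. on_verts h (if i = 0 then a else b))" by (rule ext) simp
    finally show ?thesis using psh_hom_neckD(2)[OF h e] by (simp only:)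
  qed
  have step: "on_verts h a \<le> on_verts h (Suc a)" if "Suc a \<le> sum_list T" for a
    using neck_cellD(2)[OF edge[of a "Suc a"], of 0 1] that by auto
  have mono: "on_verts h a \<le> on_verts h b" if "a \<le> b" "b \<le> sum_list T" for a b
    using that
  proof (induction b rule: dec_induct)
    case (step n)
    then show ?case using \<open>\<And>a. Suc a \<le> sum_list T \<Longrightarrow> on_verts h a \<le> on_verts h (Suc a)\<close>[of n] by simp
  qed simp
  then show "a \<le> b \<Longrightarrow> b \<le> sum_list T \<Longrightarrow> on_verts h a \<le> on_verts h b" .
  show "joints U \<subseteq> on_verts h ` joints T"
  proof
    fix c assume c: "c \<in> joints U"
    define a where "a = Max {j \<in> joints T. on_verts h j \<le> c}"
    have fin: "finite {j \<in> joints T. on_verts h j \<le> c}" by simp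
    have "0 \<in> {j \<in> joints T. on_verts h j \<le> c}" by (simp add: 0)
    then have a: "a \<in> joints T" "on_verts h a \<le> c" using Max_in[OF fin] unfolding a_def by blast+
    have after: "c < on_verts h j" if "j \<in> joints T" "a < j" for j
      using that Max_ge[OF fin, of j] unfolding a_def[symmetric] by force
    show "c \<in> on_verts h ` joints T"
    proof (cases "a = sum_list T")
      case True
      then have "on_verts h a = c" using a(2) joints_le[OF c] N by simp
      then show ?thesis using a(1) by blast
    next
      case False
      then have lt: "a < sum_list T" using joints_le[OF a(1)] by simp
      \<comment> \<open>the last joint \<open>a\<close> not mapped beyond \<open>c\<close> and its successor \<open>b\<close> bound the edge in question\<close>
      define b where "b = Min {j \<in> joints T. a < j}"
      have finb: "finite {j \<in> joints T. a < j}" by simp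
      have "sum_list T \<in> {j \<in> joints T. a < j}" using lt by simp
      then have b: "b \<in> joints T" "a < b" using Min_in[OF finb] unfolding b_def by blast+
      have between: False if "j \<in> joints T" "a < j" "j < b" for j
        using Min_le[OF finb, of j] that unfolding b_def[symmetric] by auto
      have "\<not> (on_verts h a < c \<and> c < on_verts h b)"
        using neck_cellD(4)[OF edge[of a b, OF _ joints_le[OF b(1)] between] c] b(2) by auto
      then have "on_verts h a = c" using a(2) after[OF b] by simp
      then show ?thesis using a(1) by blast
    qed
  qed
qed

text \<open>
  The converse of \<open>nec_homD\<close>: monotone maps of vertices that preserve the ends and under which every joint
  is the image of a joint are maps of necklaces.
\<close>

definition nec_map_of :: "necklace \<Rightarrow> (nat \<Rightarrow> nat) \<Rightarrow> nat \<Rightarrow> (nat \<Rightarrow> nat) \<Rightarrow> (nat \<Rightarrow> nat)" where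
  "nec_map_of T p = (\<lambda>m. \<lambda>u\<in>cells (neck T) m. \<lambda>i\<in>{..m}. p (u i))"

lemma on_verts_nec_map_of: "v \<le> sum_list T \<Longrightarrow> on_verts (nec_map_of T p) v = p v"
  by (simp add: on_verts_def nec_map_of_def vertex_cell_in) (simp add: vertex_cell_def)

lemma nec_map_of_in:
  assumes mono: "\<And>a b. a \<le> b \<Longrightarrow> b \<le> sum_list T \<Longrightarrow> p a \<le> p b"
    and ends: "p 0 = 0" "p (sum_list T) = sum_list U"
    and joints: "joints U \<subseteq> p ` joints T"
  shows "nec_map_of T p \<in> nec_hom T U"
proof -
  have cell: "(\<lambda>i\<in>{..m}. p (u i)) \<in> cells (neck U) m" if u: "u \<in> cells (neck T) m" for u m
  proof (rule neck_cellI)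
    note u' = neck_cellD[OF u]
    show "(\<lambda>i\<in>{..m}. p (u i)) i \<le> (\<lambda>i\<in>{..m}. p (u i)) j" if "i \<le> j" "j \<le> m" for i j
      using that u' mono by simp
    show "(\<lambda>i\<in>{..m}. p (u i)) m \<le> sum_list U" using mono[OF u'(3)] ends by simp
    fix j assume j: "j \<in> joints U" "(\<lambda>i\<in>{..m}. p (u i)) 0 < j" "j < (\<lambda>i\<in>{..m}. p (u i)) m"
    then obtain k where k: "k \<in> joints T" "j = p k" using joints by blast
    have "u 0 < k" using j(2) k mono[of k "u 0"] u'(3)[of 0] by (force simp: not_less[symmetric])
    moreover have "k < u m" using j(3) k mono[of "u m" k] joints_le[OF k(1)] by (force simp: not_less[symmetric])
    ultimately show False by (rule u'(4)[OF k(1)])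
  qed simp
  have "nec_map_of T p \<in> psh_hom Simplex (neck T) (neck U)"
  proof (rule psh_hom_neckI)
    fix m n w u assume w: "w \<in> hom Simplex m n" and u: "u \<in> cells (neck T) n"
    then show "nec_map_of T p m (compose {..m} u w) = act (neck U) m n w (nec_map_of T p n u)"
      using neck_act_in[OF u w] hom_SimplexD(2)[OF w]
      by (simp add: nec_map_of_def) (auto simp: compose_def)
  next
    show "nec_map_of T p n u \<in> cells (neck U) n" if "u \<in> cells (neck T) n" for n u
      using that cell[OF that] by (simp add: nec_map_of_def)
  qed (simp add: nec_map_of_def)
  then show ?thesis
    by (simp add: nec_hom_def on_verts_nec_map_of ends)
qed

subsection \<open>The cube of a necklace\<close>

definition free_verts :: "necklace \<Rightarrow> nat list" where
  "free_verts T = sorted_list_of_set (neck_verts T - joints T)"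

lemma set_free_verts: "set (free_verts T) = neck_verts T - joints T"
  and distinct_free_verts [simp]: "distinct (free_verts T)"
  and sorted_free_verts: "sorted_wrt (<) (free_verts T)"
  and length_free_verts [simp]: "length (free_verts T) = neck_dim T"
  by (simp_all add: free_verts_def neck_verts_def neck_dim_def)

text \<open>
  The inverse of the isomorphism from the poset of vertex sets to the cube. In terms of vertex sets, the
  functor from necklaces to cubes is the direct image, so its values never have to be computed in
  coordinates.
\<close>

definition vertex_set :: "necklace \<Rightarrow> bool list \<Rightarrow> nat set" where
  "vertex_set T v = joints T \<union> (\<lambda>i. free_verts T ! i) ` support v"

lemma nth_free_verts: "i < neck_dim T \<Longrightarrow> free_verts T ! i \<in> neck_verts T - joints T"
  using nth_mem[of i "free_verts T"] by (simp add: set_free_verts)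

lemma support_less: "length v = n \<Longrightarrow> i \<in> support v \<Longrightarrow> i < n"
  by (auto simp: support_def)

lemma vertex_set_subset: "length v = neck_dim T \<Longrightarrow> vertex_set T v \<subseteq> neck_verts T"
  and joints_subset_vertex_set: "joints T \<subseteq> vertex_set T v"
proof -
  show "joints T \<subseteq> vertex_set T v" by (simp add: vertex_set_def)
  assume v: "length v = neck_dim T"
  have "free_verts T ! i \<in> neck_verts T" if "i \<in> support v" for i
    using nth_free_verts[OF support_less[OF v that]] by simp
  then show "vertex_set T v \<subseteq> neck_verts T"
    using joints_subset_verts[of T] by (auto simp: vertex_set_def)
qed

lemma nth_free_verts_in_vertex_set:
  assumes "length v = neck_dim T" "i < neck_dim T"
  shows "free_verts T ! i \<in> vertex_set T v \<longleftrightarrow> v ! i"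
proof -
  have "free_verts T ! i \<in> vertex_set T v \<longleftrightarrow> (\<exists>k\<in>support v. free_verts T ! i = free_verts T ! k)"
    using nth_free_verts[OF assms(2)] unfolding vertex_set_def by blast
  also have "\<dots> \<longleftrightarrow> i \<in> support v"
    using assms nth_eq_iff_index_eq[OF distinct_free_verts, of i T] support_less[OF assms(1)] by auto
  finally show ?thesis using assms by (simp add: support_def)
qed

lemma neck_coords_vertex_set: "length v = neck_dim T \<Longrightarrow> neck_coords T (vertex_set T v) = v"
  unfolding neck_coords_def free_verts_def[symmetric]
  by (rule nth_equalityI) (simp_all add: nth_free_verts_in_vertex_set)

lemma length_neck_coords [simp]: "length (neck_coords T X) = neck_dim T"
  unfolding neck_coords_def free_verts_def[symmetric] by simp

lemma vertex_set_neck_coords: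
  assumes "joints T \<subseteq> X" "X \<subseteq> neck_verts T"
  shows "vertex_set T (neck_coords T X) = X"
proof -
  have "support (neck_coords T X) = {i. i < neck_dim T \<and> free_verts T ! i \<in> X}"
    unfolding neck_coords_def free_verts_def[symmetric] by (auto simp: support_def)
  then have "(\<lambda>i. free_verts T ! i) ` support (neck_coords T X) = set (free_verts T) \<inter> X"
    by (auto simp: set_conv_nth)
  then show ?thesis using assms by (auto simp: vertex_set_def set_free_verts)
qed

lemma vertex_set_inj:
  "length v = neck_dim T \<Longrightarrow> length w = neck_dim T \<Longrightarrow> vertex_set T v = vertex_set T w \<Longrightarrow> v = w"
  by (metis neck_coords_vertex_set)

lemma inv_neck_coords:
  assumes "length v = neck_dim T"
  shows "inv_into (neck_poset T) (neck_coords T) v = vertex_set T v"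
proof (rule inv_into_f_eq)
  show "inj_on (neck_coords T) (neck_poset T)"
    by (rule inj_on_inverseI[of _ "vertex_set T"]) (auto simp: neck_poset_def vertex_set_neck_coords)
  show "vertex_set T v \<in> neck_poset T"
    using assms vertex_set_subset joints_subset_vertex_set by (auto simp: neck_poset_def)
qed (simp add: assms neck_coords_vertex_set)

lemma neck_cube_map_apply:
  assumes h: "h \<in> nec_hom T U" and v: "length v = neck_dim T"
  shows "length (neck_cube_map T U h v) = neck_dim U"
    and "vertex_set U (neck_cube_map T U h v) = on_verts h ` vertex_set T v"
proof -
  note h' = nec_homD[OF h]
  have eq: "neck_cube_map T U h v = neck_coords U (on_verts h ` vertex_set T v)"
    using v by (simp add: neck_cube_map_def inv_neck_coords)
  show "length (neck_cube_map T U h v) = neck_dim U" by (simp add: eq)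
  have "joints U \<subseteq> on_verts h ` vertex_set T v"
    using h'(5) joints_subset_vertex_set[of T v] by blast
  moreover have "on_verts h ` vertex_set T v \<subseteq> neck_verts U"
    using vertex_set_subset[OF v] h'(3) h'(4)[of _ "sum_list T"] by (auto simp: neck_verts_def)
  ultimately show "vertex_set U (neck_cube_map T U h v) = on_verts h ` vertex_set T v"
    unfolding eq by (rule vertex_set_neck_coords)
qed

lemma neck_cube_map_extensional: "neck_cube_map T U h \<in> extensional (cube (neck_dim T))"
  by (simp add: neck_cube_map_def)

section \<open>The colimit defining the rigidification\<close>

lemma equivclp_map:
  assumes "\<And>s t. r s t \<Longrightarrow> equivclp r' (G s) (G t)" "equivclp r s t"
  shows "equivclp r' (G s) (G t)"
  using assms(2)
proof (induction rule: equivclp_induct)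
  case (step y z)
  have "equivclp r' (G y) (G z)"
    using step(2) assms(1)[of y z] equivclp_sym[OF assms(1)[of z y]] by blast
  then show ?case by (rule equivclp_trans[OF step(3)])
qed simp

text \<open>
  The relation that generates the identifications in a colimit; an invariant of the colimit is a function
  that is constant along these steps.
\<close>

definition colim_step where
  "colim_step I H D Dm n s t \<longleftrightarrow> (\<exists>i\<in>I. \<exists>j\<in>I. \<exists>h\<in>H i j. \<exists>a\<in>cells (D i) n. s = (i, a) \<and> t = (j, Dm i j h n a))"

lemma colim_rel_iff: "(s, t) \<in> colim_rel I H D Dm n \<longleftrightarrow> s \<in> Sigma I (\<lambda>i. cells (D i) n) \<and>
    t \<in> Sigma I (\<lambda>i. cells (D i) n) \<and> equivclp (colim_step I H D Dm n) s t"
  unfolding colim_rel_def colim_step_def[abs_def] by simp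

lemma colim_rel_class_eq:
  assumes "s \<in> Sigma I (\<lambda>i. cells (D i) n)" "t \<in> Sigma I (\<lambda>i. cells (D i) n)"
    "equivclp (colim_step I H D Dm n) s t"
  shows "colim_rel I H D Dm n `` {s} = colim_rel I H D Dm n `` {t}"
proof (rule set_eqI)
  fix r
  have "equivclp (colim_step I H D Dm n) s r \<longleftrightarrow> equivclp (colim_step I H D Dm n) t r"
    using equivclp_trans[OF assms(3), of r] equivclp_trans[OF equivclp_sym[OF assms(3)], of r] by blast
  then show "r \<in> colim_rel I H D Dm n `` {s} \<longleftrightarrow> r \<in> colim_rel I H D Dm n `` {t}"
    using assms(1,2) by (simp only: Image_singleton_iff colim_rel_iff)
qed

lemma colim_rel_self:
  "s \<in> Sigma I (\<lambda>i. cells (D i) n) \<Longrightarrow> s \<in> colim_rel I H D Dm n `` {s}"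
  by (simp only: Image_singleton_iff colim_rel_iff) simp

locale reduced_simplicial = simplicial S for S :: "(nat, 'a) psh" +
  fixes x :: 'a
  assumes reduced: "cells S 0 = {x}"
begin

text \<open>
  The objects of the category of necklaces over \<open>S\<close>. As \<open>S\<close> has only one vertex, nothing has to be said
  about the images of the end points.
\<close>

definition over :: "necklace \<Rightarrow> (nat \<Rightarrow> (nat \<Rightarrow> nat) \<Rightarrow> 'a) \<Rightarrow> bool" where
  "over T f \<longleftrightarrow> T \<in> necklaces \<and> f \<in> psh_hom Simplex (neck T) S"

lemma over_iff: "(T, f) \<in> nec_over S x x \<longleftrightarrow> over T f"
proof -
  have "f 0 (vertex_cell v) = x" if "f \<in> psh_hom Simplex (neck T) S" "v \<le> sum_list T" for v
    using psh_hom_neckD(2)[OF that(1) vertex_cell_in[OF that(2)]] reduced by simp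
  then show ?thesis by (auto simp: nec_over_def over_def)
qed

definition triangle where
  "triangle T f U g h \<longleftrightarrow> h \<in> nec_hom T U \<and> (\<forall>n. \<forall>u\<in>cells (neck T) n. g n (h n u) = f n u)"

lemma nec_over_hom_iff: "h \<in> nec_over_hom (T, f) (U, g) \<longleftrightarrow> triangle T f U g h"
  by (simp add: nec_over_hom_def triangle_def)

abbreviation rig_rel where
  "rig_rel \<equiv> colim_rel (nec_over S x x) nec_over_hom nec_obj nec_map"

abbreviation rig_step where
  "rig_step \<equiv> colim_step (nec_over S x x) nec_over_hom nec_obj nec_map"

abbreviation rig_points where
  "rig_points n \<equiv> Sigma (nec_over S x x) (\<lambda>i. cells (nec_obj i) n)"

abbreviation K where "K \<equiv> rig S x x"

abbreviation cl where "cl n T f u \<equiv> rig_class S x x n (T, f) u"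

lemma in_rig_points: "((T, f), u) \<in> rig_points n \<longleftrightarrow> over T f \<and> box_hom n (neck_dim T) u"
  by (simp add: over_iff nec_obj_def yoneda_def Box_def)

lemma rig_stepI:
  assumes "over T f" "over U g" "triangle T f U g h" "box_hom n (neck_dim T) u"
  shows "rig_step n ((T, f), u) ((U, g), compose (cube n) (neck_cube_map T U h) u)"
  unfolding colim_step_def
proof (intro bexI conjI)
  show "((U, g), compose (cube n) (neck_cube_map T U h) u) =
      ((U, g), nec_map (T, f) (U, g) h n u)" by (simp add: nec_map_def)
  show "u \<in> cells (nec_obj (T, f)) n" using assms(4) by (simp add: nec_obj_def yoneda_def)
  show "h \<in> nec_over_hom (T, f) (U, g)" using assms(3) by (simp add: nec_over_hom_iff)
qed (simp_all add: over_iff assms)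

lemma rig_stepE:
  assumes "rig_step n s t"
  obtains T f U g h u where "over T f" "over U g" "triangle T f U g h" "box_hom n (neck_dim T) u"
    "s = ((T, f), u)" "t = ((U, g), compose (cube n) (neck_cube_map T U h) u)"
proof -
  obtain i j h a where *: "i \<in> nec_over S x x" "j \<in> nec_over S x x" "h \<in> nec_over_hom i j"
      "a \<in> cells (nec_obj i) n" "s = (i, a)" "t = (j, nec_map i j h n a)"
    using assms unfolding colim_step_def by blast
  obtain T f where i: "i = (T, f)" by (cases i)
  obtain U g where j: "j = (U, g)" by (cases j)
  show thesis
  proof (rule that)
    show "over T f" "over U g" using *(1,2) by (simp_all add: i j over_iff)
    show "triangle T f U g h" using *(3) by (simp add: i j nec_over_hom_iff)
    show "box_hom n (neck_dim T) a" using *(4) by (simp add: i nec_obj_def yoneda_def)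
    show "s = ((T, f), a)" "t = ((U, g), compose (cube n) (neck_cube_map T U h) a)"
      using *(5,6) by (simp_all add: i j nec_map_def)
  qed
qed

lemma cl_eqI:
  assumes "over T f" "box_hom n (neck_dim T) u" "over U g" "box_hom n (neck_dim U) v"
    "equivclp (rig_step n) ((T, f), u) ((U, g), v)"
  shows "cl n T f u = cl n U g v"
  unfolding rig_class_def
  by (rule colim_rel_class_eq) (use assms in \<open>simp_all only: in_rig_points simp_thms\<close>)

lemma cl_triangle:
  assumes "over T f" "over U g" "triangle T f U g h" "box_hom n (neck_dim T) u"
    "v = compose (cube n) (neck_cube_map T U h) u" "box_hom n (neck_dim U) v"
  shows "cl n T f u = cl n U g v"
  using rig_stepI[OF assms(1-4)] assms by (intro cl_eqI r_into_equivclp) simp_all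

lemma in_cl_iff: "((U, g), v) \<in> cl n T f u \<longleftrightarrow> over T f \<and> box_hom n (neck_dim T) u \<and>
    over U g \<and> box_hom n (neck_dim U) v \<and> equivclp (rig_step n) ((T, f), u) ((U, g), v)"
  unfolding rig_class_def Image_singleton_iff colim_rel_iff in_rig_points by blast

lemma cl_self: "over T f \<Longrightarrow> box_hom n (neck_dim T) u \<Longrightarrow> ((T, f), u) \<in> cl n T f u"
  by (simp add: in_cl_iff)

lemma cells_K: "A \<in> cells K n \<longleftrightarrow> (\<exists>T f u. over T f \<and> box_hom n (neck_dim T) u \<and> A = cl n T f u)"
proof -
  have "A \<in> cells K n \<longleftrightarrow> (\<exists>s\<in>rig_points n. A = rig_rel n `` {s})"
    by (simp only: rig_def colim_def psh.simps) (auto simp: quotient_def)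
  also have "\<dots> \<longleftrightarrow> (\<exists>T f u. over T f \<and> box_hom n (neck_dim T) u \<and> A = cl n T f u)"
    unfolding rig_class_def using in_rig_points by (metis surj_pair)
  finally show ?thesis .
qed

lemma cl_in: "over T f \<Longrightarrow> box_hom n (neck_dim T) u \<Longrightarrow> cl n T f u \<in> cells K n"
  by (auto simp: cells_K)

lemma compose_assoc_cube:
  assumes "box_hom l m f"
  shows "compose (cube l) (compose (cube m) h g) f = compose (cube l) h (compose (cube l) g f)"
  using box_hom_length[OF assms] by (auto simp: compose_def)

lemma rig_step_precompose:
  assumes "rig_step n ((T, f), u) ((U, g), v)" and w: "box_hom m n w"
  shows "rig_step m ((T, f), compose (cube m) u w) ((U, g), compose (cube m) v w)"
  using assms(1)
proof (cases rule: rig_stepE)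
  case (1 T' f' U' g' h u')
  then show ?thesis
    using rig_stepI[OF 1(1-3) box_hom.comp[OF w 1(4)]] by (simp add: compose_assoc_cube[OF w])
qed

lemma act_K:
  assumes T: "over T f" "box_hom n (neck_dim T) u" and w: "box_hom m n w"
  shows "act K m n w (cl n T f u) = cl m T f (compose (cube m) u w)"
proof -
  define G where "G = (\<lambda>(i, a). (i :: 'a neck_over, compose (cube m) (a :: bool list \<Rightarrow> bool list) w))"
  have "equivclp (rig_step m) (G s) (G t)" if "equivclp (rig_step n) s t" for s t
    by (rule equivclp_map[OF _ that])
       (auto simp: G_def intro!: r_into_equivclp rig_step_precompose[OF _ w])
  then have eq: "cl m U g (compose (cube m) v w) = cl m T f (compose (cube m) u w)"
    if "((U, g), v) \<in> cl n T f u" for U g v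
    using that equivclp_sym[of "rig_step m"] unfolding in_cl_iff
    by (intro cl_eqI box_hom.comp[OF w]) (auto simp: G_def)
  have "act K m n w (cl n T f u) =
      (\<Union>(i, a)\<in>cl n T f u. rig_rel m `` {(i, act (nec_obj i) m n w a)})"
    by (simp add: rig_def colim_def)
  also have "\<dots> = cl m T f (compose (cube m) u w)"
  proof (rule UN_coset_const[OF _ cl_self[OF T]])
    fix p assume p: "p \<in> cl n T f u"
    obtain U g v where "p = ((U, g), v)" by (metis surj_pair)
    then show "(case p of (i, a) \<Rightarrow> rig_rel m `` {(i, act (nec_obj i) m n w a)}) =
        cl m T f (compose (cube m) u w)"
      using eq[of U g v] p by (simp add: rig_class_def nec_obj_def yoneda_def)
  qed
  finally show ?thesis .
qed

lemma compose_id_right: "u \<in> extensional A \<Longrightarrow> compose A u (restrict id A) = u"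
  by (rule ext) (auto simp: compose_def extensional_def)

lemma presheaf_K: "presheaf Box K"
  unfolding presheaf_def
proof (intro conjI allI ballI)
  fix m n w assume "w \<in> hom Box m n"
  then have w: "box_hom m n w" by simp
  show "act K m n w \<in> cells K n \<rightarrow> cells K m"
  proof (rule funcsetI)
    fix A assume "A \<in> cells K n"
    then obtain T f u where A: "over T f" "box_hom n (neck_dim T) u" "A = cl n T f u"
      by (auto simp: cells_K)
    show "act K m n w A \<in> cells K m"
      unfolding A(3) act_K[OF A(1,2) w] by (rule cl_in[OF A(1) box_hom.comp[OF w A(2)]])
  qed
next
  fix n A assume "A \<in> cells K n"
  then obtain T f u where A: "over T f" "box_hom n (neck_dim T) u" "A = cl n T f u"
    by (auto simp: cells_K)
  show "act K n n (idm Box n) A = A"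
    using A act_K[OF A(1,2) box_hom_id] by (simp add: compose_id_right box_hom_extensional)
next
  fix l m n v w A assume "v \<in> hom Box l m" "w \<in> hom Box m n" "A \<in> cells K n"
  moreover then obtain T f u where A: "over T f" "box_hom n (neck_dim T) u" "A = cl n T f u"
    by (auto simp: cells_K)
  ultimately show "act K l n (compose (pts Box l) w v) A = act K l m v (act K m n w A)"
    by (simp add: act_K compose_assoc_cube box_hom.comp)
qed

sublocale cubical_set K
  by unfold_locales (rule presheaf_K)

section \<open>The value of a cell of the rigidification\<close>

text \<open>
  The cell given by a necklace \<open>T\<close> over \<open>S\<close> and a morphism of cubes of full rank is determined by the
  vertex sets \<open>Y \<subseteq> X\<close> that correspond to the extreme values of the morphism: it is the cell of the
  subnecklace with vertices \<open>X\<close> and joints \<open>Y\<close>. Its value \<open>val\<close> is the word of the simplices of the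
  beads, in which degenerate edges are dropped; it is zero if a bead of higher dimension is degenerate.
  The number of elements of \<open>X - Y\<close> is the rank, and a cell of smaller rank has value zero.
\<close>

definition letter :: "nat \<Rightarrow> 'a \<Rightarrow> ('a word \<Rightarrow>\<^sub>0 'k::{comm_ring,comm_monoid_mult})" where
  "letter i \<sigma> = (if \<sigma> \<in> simp_degenerate S (Suc i) then if i = 0 then gen [] else 0 else gen [(i, \<sigma>)])"

text \<open>
  The increasing enumeration of \<open>A\<close>, as a map from the simplex of dimension \<open>card A - 1\<close>.
\<close>

definition enum :: "nat set \<Rightarrow> nat \<Rightarrow> nat" where
  "enum A = (\<lambda>i\<in>{..card A - 1}. sorted_list_of_set A ! i)"

definition bead :: "(nat \<Rightarrow> (nat \<Rightarrow> nat) \<Rightarrow> 'a) \<Rightarrow> nat set \<Rightarrow> ('a word \<Rightarrow>\<^sub>0 'k::{comm_ring,comm_monoid_mult})" where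
  "bead f A = letter (card A - 2) (f (card A - 1) (enum A))"

text \<open>
  Here \<open>X\<close> are the vertices and the list enumerates the joints of a subnecklace, so the bead between two
  consecutive joints \<open>a\<close> and \<open>b\<close> has the vertices \<open>X \<inter> {a..b}\<close>.
\<close>

fun bead_product :: "(nat \<Rightarrow> (nat \<Rightarrow> nat) \<Rightarrow> 'a) \<Rightarrow> nat set \<Rightarrow> nat list \<Rightarrow>
    ('a word \<Rightarrow>\<^sub>0 'k::{comm_ring,comm_monoid_mult})" where
  "bead_product f X (a # b # xs) = bead f (X \<inter> {a..b}) \<odot> bead_product f X (b # xs)"
| "bead_product f X _ = gen []"

definition lower :: "nat \<Rightarrow> necklace \<Rightarrow> (bool list \<Rightarrow> bool list) \<Rightarrow> nat set" where
  "lower n T u = vertex_set T (u (replicate n False))"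

definition upper :: "nat \<Rightarrow> necklace \<Rightarrow> (bool list \<Rightarrow> bool list) \<Rightarrow> nat set" where
  "upper n T u = vertex_set T (u (replicate n True))"

definition val :: "nat \<Rightarrow> 'a neck_over \<times> (bool list \<Rightarrow> bool list) \<Rightarrow>
    ('a word \<Rightarrow>\<^sub>0 'k::{comm_ring,comm_monoid_mult})" where
  "val n = (\<lambda>((T, f), u). if card (upper n T u - lower n T u) = n
    then bead_product f (upper n T u) (sorted_list_of_set (lower n T u)) else 0)"

lemma bead_product_append:
  "bead_product f X (xs @ c # ys) = bead_product f X (xs @ [c]) \<odot> bead_product f X (c # ys)"
proof (induction xs)
  case (Cons a xs)
  then show ?case by (cases xs) (simp_all add: word_mult_assoc del: bilin_gen)
qed simp

lemma enum_le: "finite A \<Longrightarrow> i \<le> j \<Longrightarrow> j \<le> card A - 1 \<Longrightarrow> enum A i \<le> enum A j"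
  unfolding enum_def by (cases "card A") (auto intro!: sorted_nth_mono)

lemma enum_in: "finite A \<Longrightarrow> A \<noteq> {} \<Longrightarrow> i \<le> card A - 1 \<Longrightarrow> enum A i \<in> A"
  using nth_mem[of i "sorted_list_of_set A"] card_gt_0_iff[of A]
  by (simp add: enum_def)

lemma ex_enum: "finite A \<Longrightarrow> a \<in> A \<Longrightarrow> \<exists>i\<le>card A - 1. enum A i = a"
proof -
  assume A: "finite A" "a \<in> A"
  then obtain i where "i < card A" "sorted_list_of_set A ! i = a"
    using in_set_conv_nth[of a "sorted_list_of_set A"] by auto
  then show ?thesis by (intro exI[of _ i]) (auto simp: enum_def)
qed

lemma enum_inj: "finite A \<Longrightarrow> A \<noteq> {} \<Longrightarrow> inj_on (enum A) {..card A - 1}"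
  using card_gt_0_iff[of A] nth_eq_iff_index_eq[OF distinct_sorted_list_of_set, of _ A]
  by (auto simp: inj_on_def enum_def)

lemma enum_cell:
  assumes A: "finite A" "A \<noteq> {}" "A \<subseteq> {..sum_list T}"
    and J: "\<And>j a b. j \<in> joints T \<Longrightarrow> a \<in> A \<Longrightarrow> b \<in> A \<Longrightarrow> a < j \<Longrightarrow> j < b \<Longrightarrow> False"
  shows "enum A \<in> cells (neck T) (card A - 1)"
proof (rule neck_cellI)
  show "enum A \<in> extensional {..card A - 1}" by (simp add: enum_def)
  show "enum A i \<le> enum A j" if "i \<le> j" "j \<le> card A - 1" for i j
    by (rule enum_le[OF A(1) that])
  have last: "enum A (card A - 1) \<in> A" and first: "enum A 0 \<in> A" by (rule enum_in[OF A(1,2)]; simp)+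
  show "enum A (card A - 1) \<le> sum_list T" using last A(3) by auto
  show False if "j \<in> joints T" "enum A 0 < j" "j < enum A (card A - 1)" for j
    by (rule J[OF that(1) first last that(2,3)])
qed

lemma enum_image:
  assumes A: "finite A" "A \<noteq> {}" and mono: "\<And>a b. a \<in> A \<Longrightarrow> b \<in> A \<Longrightarrow> a \<le> b \<Longrightarrow> p a \<le> p b"
    and inj: "inj_on p A"
  shows "card (p ` A) = card A" "enum (p ` A) = (\<lambda>i\<in>{..card A - 1}. p (enum A i))"
proof -
  show card: "card (p ` A) = card A" by (rule card_image[OF inj])
  have "sorted_list_of_set (p ` A) = map p (sorted_list_of_set A)"
  proof (rule sorted_distinct_set_unique)
    show "sorted (map p (sorted_list_of_set A))"
      using A mono by (simp add: sorted_map) (auto intro!: sorted_wrt_mono_rel[OF _ sorted_sorted_list_of_set])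
    show "distinct (map p (sorted_list_of_set A))" using A inj by (simp add: distinct_map)
  qed (use A in simp_all)
  then show "enum (p ` A) = (\<lambda>i\<in>{..card A - 1}. p (enum A i))"
    using card_gt_0_iff[of A] A by (auto simp: enum_def card restrict_def fun_eq_iff)
qed

lemma neck_cell_not_inj:
  assumes g: "g \<in> psh_hom Simplex (neck U) S" and c: "c \<in> cells (neck U) k" and ninj: "\<not> inj_on c {..k}"
  shows "g k c \<in> simp_degenerate S k"
proof -
  note c' = neck_cellD[OF c]
  obtain a b where ab: "a < b" "b \<le> k" "c a = c b"
    using ninj unfolding inj_on_def by (metis atMost_iff linorder_neqE_nat)
  then have eq: "c (Suc a) = c a" using c'(2)[of a "Suc a"] c'(2)[of "Suc a" b] by simp
  define w where "w = (\<lambda>i\<in>{..k}. if i = Suc a then a else i)"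
  have w: "w \<in> hom Simplex k k" using ab by (intro hom_SimplexI) (auto simp: w_def)
  have "compose {..k} c w = c"
    by (rule extensionalityI[of _ "{..k}"]) (use c'(1) eq ab in \<open>auto simp: compose_def w_def\<close>)
  then have "g k c = act S k k w (g k c)" using psh_hom_neckD(3)[OF g w c] by simp
  moreover have "\<not> inj_on w {..k}"
  proof
    assume "inj_on w {..k}"
    from inj_onD[OF this, of a "Suc a"] show False using ab by (simp add: w_def)
  qed
  ultimately show ?thesis
    using degenerate_if_not_inj[OF w psh_hom_neckD(2)[OF g c]] by simp
qed

lemma sorted_hd_le: "sorted xs \<Longrightarrow> y \<in> set xs \<Longrightarrow> hd xs \<le> (y :: nat)"
  by (cases xs) auto

lemma sorted_le_last: "sorted xs \<Longrightarrow> y \<in> set xs \<Longrightarrow> (y :: nat) \<le> last xs"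
  by (induction xs) auto

lemma sorted_consecutive:
  fixes y :: nat
  assumes "sorted_wrt (<) (us @ a # b # vs)" "y \<in> set (us @ a # b # vs)"
  shows "\<not> (a < y \<and> y < b)"
proof -
  have "y \<le> a \<or> b \<le> y" using assms by (auto simp: sorted_wrt_append less_imp_le)
  then show ?thesis by auto
qed

lemma ex_consecutive:
  fixes y :: nat
  assumes "sorted_wrt (<) xs" "xs \<noteq> []" "hd xs < y" "y < last xs" "y \<notin> set xs"
  shows "\<exists>us a b vs. xs = us @ a # b # vs \<and> a < y \<and> y < b"
  using assms
proof (induction xs)
  case (Cons a xs)
  then obtain b vs where xs: "xs = b # vs" by (cases xs) auto
  show ?case
  proof (cases "y < b")
    case True
    then show ?thesis using Cons.prems xs by (intro exI[of _ "[]"]) auto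
  next
    case False
    then have "b < y" using Cons.prems xs by auto
    then obtain us a' b' vs' where "xs = us @ a' # b' # vs'" "a' < y" "y < b'"
      using Cons.IH Cons.prems xs by auto
    then show ?thesis by (intro exI[of _ "a # us"]) auto
  qed
qed simp

lemma sorted_remdups_adj_strict: "sorted xs \<Longrightarrow> sorted_wrt (<) (remdups_adj (xs :: nat list))"
  by (induction xs rule: remdups_adj.induct) auto

text \<open>
  A map of necklaces over \<open>S\<close> either preserves the number of free vertices, and then it collapses at
  most degenerate edges, or it identifies a vertex that is not a joint with another one, and then
  some bead of dimension at least 2 is degenerate. Hence the value is constant on colimit classes.
\<close>

context
  fixes T f U g h X Y p
  assumes f: "over T f" and g: "over U g" and tri: "triangle T f U g h"
    and Y: "joints T \<subseteq> Y" "Y \<subseteq> X" "X \<subseteq> {..sum_list T}"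
  defines "p \<equiv> on_verts h"
begin

lemma h_hom: "h \<in> nec_hom T U" using tri by (simp add: triangle_def)

lemma p_mono: "a \<le> b \<Longrightarrow> b \<le> sum_list T \<Longrightarrow> p a \<le> p b"
  unfolding p_def by (rule nec_homD(4)[OF h_hom])

lemma finite_XY: "finite X" "finite Y"
proof -
  show "finite X" by (rule finite_subset[OF Y(3)]) simp
  then show "finite Y" by (rule finite_subset[OF Y(2)])
qed

lemma bead_simplex:
  assumes ab: "a \<in> Y" "b \<in> Y" "a < b" "\<And>y. y \<in> Y \<Longrightarrow> \<not> (a < y \<and> y < b)"
  defines "A \<equiv> X \<inter> {a..b}"
  shows "finite A" "A \<noteq> {}" "A \<subseteq> {..sum_list T}" "{a, b} \<subseteq> A" "enum A \<in> cells (neck T) (card A - 1)"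
    "f (card A - 1) (enum A) = g (card A - 1) (\<lambda>i\<in>{..card A - 1}. p (enum A i))"
    "(\<lambda>i\<in>{..card A - 1}. p (enum A i)) \<in> cells (neck U) (card A - 1)"
proof -
  show A: "finite A" "A \<subseteq> {..sum_list T}" using finite_XY Y by (auto simp: A_def)
  show sub: "{a, b} \<subseteq> A" using ab(1-3) Y(2) by (auto simp: A_def)
  then show ne: "A \<noteq> {}" by auto
  show c: "enum A \<in> cells (neck T) (card A - 1)"
  proof (rule enum_cell[OF A(1) ne A(2)])
    fix j c d assume j: "j \<in> joints T" "c \<in> A" "d \<in> A" "c < j" "j < d"
    have "j \<in> Y" using Y(1) j(1) by blast
    then show False using ab(4)[of j] j by (auto simp: A_def)
  qed
  have hc: "h (card A - 1) (enum A) = (\<lambda>i\<in>{..card A - 1}. p (enum A i))"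
    unfolding p_def by (rule nec_homD(1)[OF h_hom c])
  show "f (card A - 1) (enum A) = g (card A - 1) (\<lambda>i\<in>{..card A - 1}. p (enum A i))"
    using tri c unfolding hc[symmetric] triangle_def by simp
  show "(\<lambda>i\<in>{..card A - 1}. p (enum A i)) \<in> cells (neck U) (card A - 1)"
    unfolding hc[symmetric] by (rule psh_hom_neckD(2)[OF _ c]) (use h_hom in \<open>simp add: nec_hom_def\<close>)
qed

lemma bead_degenerate:
  assumes ab: "a \<in> Y" "b \<in> Y" "a < b" "\<And>y. y \<in> Y \<Longrightarrow> \<not> (a < y \<and> y < b)"
    and cd: "c \<in> X" "d \<in> X" "a \<le> c" "c < d" "d \<le> b" "p c = p d"
  defines "A \<equiv> X \<inter> {a..b}"
  shows "f (card A - 1) (enum A) \<in> simp_degenerate S (card A - 1)"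
proof -
  note A = bead_simplex[OF ab, folded A_def]
  have cdA: "c \<in> A" "d \<in> A" using cd by (auto simp: A_def)
  obtain i where i: "i \<le> card A - 1" "enum A i = c" using ex_enum[OF A(1) cdA(1)] by blast
  obtain j where j: "j \<le> card A - 1" "enum A j = d" using ex_enum[OF A(1) cdA(2)] by blast
  have "\<not> inj_on (\<lambda>i\<in>{..card A - 1}. p (enum A i)) {..card A - 1}"
  proof
    assume "inj_on (\<lambda>i\<in>{..card A - 1}. p (enum A i)) {..card A - 1}"
    from inj_onD[OF this, of i j] have "i = j" using i j cd(6) by simp
    then show False using i j cd(4) by simp
  qed
  moreover have "g \<in> psh_hom Simplex (neck U) S" using g by (simp add: over_def)
  ultimately have "g (card A - 1) (\<lambda>i\<in>{..card A - 1}. p (enum A i)) \<in> simp_degenerate S (card A - 1)"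
    using neck_cell_not_inj[OF _ A(7)] by blast
  then show ?thesis using A(6) by (simp only:)
qed

text \<open>
  By monotonicity, a vertex next to \<open>y\<close> in the same bead, on the side of \<open>z\<close>, is identified with \<open>y\<close> as
  well. So this bead is degenerate, and it has at least three vertices as \<open>y\<close> is not a joint.
\<close>

lemma bead_product_collapse:
  assumes y: "y \<in> X" "y \<notin> Y" and z: "z \<in> X" "z \<noteq> y" "p z = p y"
  shows "bead_product f X (sorted_list_of_set Y) = (0 :: 'a word \<Rightarrow>\<^sub>0 'k::{comm_ring,comm_monoid_mult})"
proof -
  let ?xs = "sorted_list_of_set Y"
  have sorted: "sorted_wrt (<) ?xs" by simp
  have set: "set ?xs = Y" using finite_XY by simp
  have ends: "0 \<in> Y" "sum_list T \<in> Y" using Y(1) zero_in_joints[of T] last_in_joints[of T] by blast+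
  have ne: "?xs \<noteq> []" using ends(1) set by force
  have y_le: "y \<le> sum_list T" using y Y(3) by auto
  have "hd ?xs \<le> 0" using sorted_hd_le[of ?xs 0] ends(1) set by simp
  moreover have "y \<noteq> 0"
  proof
    assume "y = 0"
    then show False using y(2) ends(1) by simp
  qed
  moreover have "y \<noteq> sum_list T"
  proof
    assume "y = sum_list T"
    then show False using y(2) ends(2) by simp
  qed
  moreover have "sum_list T \<le> last ?xs"
    using sorted_le_last[of ?xs "sum_list T"] ends(2) set by simp
  ultimately have "hd ?xs < y" "y < last ?xs" "y \<notin> set ?xs" using y_le y(2) set by auto
  from ex_consecutive[OF sorted ne this] obtain us a b vs
    where xs: "?xs = us @ a # b # vs" "a < y" "y < b" by blast
  have abY: "a \<in> Y" "b \<in> Y" using arg_cong[OF xs(1), of set] set by auto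
  have ab: "a < b" using xs by simp
  have consec: "\<not> (a < y' \<and> y' < b)" if "y' \<in> Y" for y'
    using sorted_consecutive[of us a b vs y'] sorted that set unfolding xs(1) by blast
  \<comment> \<open>the identified pair, with \<open>z\<close> replaced by the joint \<open>a\<close> or \<open>b\<close> if it lies outside the bead of \<open>y\<close>\<close>
  define c d where "c = (if z < y then max a z else y)" and "d = (if z < y then y else min b z)"
  have abX: "a \<in> X" "b \<in> X" using abY Y(2) by auto
  have le: "b \<le> sum_list T" "z \<le> sum_list T" using abX z(1) Y(3) by auto
  have cd: "c \<in> X" "d \<in> X" "a \<le> c" "c < d" "d \<le> b"
    using abX y z xs(2,3) by (auto simp: c_def d_def max_def min_def)
  have "p c = p d"
  proof (cases "z < y")
    case True
    then have "p z \<le> p c" "p c \<le> p y" using p_mono[of z c] p_mono[of c y] y_le xs(2)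
      by (auto simp: c_def max_def)
    then show ?thesis using z(3) True by (simp add: d_def)
  next
    case False
    then have "p y \<le> p d" "p d \<le> p z" using p_mono[of y d] p_mono[of d z] le xs(3) z(2)
      by (auto simp: d_def min_def)
    then show ?thesis using z(3) False by (simp add: c_def)
  qed
  note deg = bead_degenerate[OF abY ab consec cd this]
  have "{a, y, b} \<subseteq> X \<inter> {a..b}" using abX y xs(2,3) by auto
  then have "card {a, y, b} \<le> card (X \<inter> {a..b})" using finite_XY by (intro card_mono) auto
  then have card: "3 \<le> card (X \<inter> {a..b})" using xs(2,3) by simp
  have "bead f (X \<inter> {a..b}) = (0 :: 'a word \<Rightarrow>\<^sub>0 'k)"
    using deg card by (simp add: bead_def letter_def numeral_2_eq_2 numeral_3_eq_3 Suc_diff_Suc)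
  then show ?thesis
    unfolding xs(1) bead_product_append[of f X us a "b # vs"]
    by (simp add: word_mult_left(3) word_mult_right(3) del: bilin_gen)
qed

text \<open>
  If two consecutive joints become equal, then there is no vertex between them by the hypotheses, and the
  bead is a degenerate edge of value 1: this corresponds to dropping a repeated joint in the target. All
  other beads are mapped injectively onto a bead of the target.
\<close>

lemma bead_product_map:
  assumes inj: "inj_on p (X - Y)" and disj: "p ` (X - Y) \<inter> p ` Y = {}"
  shows "bead_product f X (sorted_list_of_set Y) =
    (bead_product g (p ` X) (sorted_list_of_set (p ` Y)) :: 'a word \<Rightarrow>\<^sub>0 'k::{comm_ring,comm_monoid_mult})"
proof -
  let ?xs = "sorted_list_of_set Y"
  have sorted: "sorted_wrt (<) ?xs" by simp
  have set: "set ?xs = Y" using finite_XY by simp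
  have bead_map: "bead f (X \<inter> {a..b}) = (if p a = p b then gen [] else bead g (p ` X \<inter> {p a..p b}) :: 'a word \<Rightarrow>\<^sub>0 'k)"
    if abY: "a \<in> Y" "b \<in> Y" and ab: "a < b" and consec: "\<And>y. y \<in> Y \<Longrightarrow> \<not> (a < y \<and> y < b)" for a b
  proof -
    define A where "A = X \<inter> {a..b}"
    note A = bead_simplex[OF abY ab consec, folded A_def]
    have bX: "b \<le> sum_list T" using abY Y by auto
    have inner: "c \<in> X - Y" if "c \<in> A" "c \<noteq> a" "c \<noteq> b" for c
    proof -
      have "a < c" "c < b" using that by (auto simp: A_def)
      then show ?thesis using consec[of c] that(1) by (auto simp: A_def)
    qed
    have noteq: "p c \<noteq> p e" if "c \<in> X - Y" "e \<in> X" "c \<noteq> e" for c e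
      using that inj disj by (cases "e \<in> Y") (auto dest: inj_onD)
    show ?thesis
    proof (cases "p a = p b")
      case True
      have "c = a \<or> c = b" if c: "c \<in> A" for c
      proof (rule ccontr)
        assume "\<not> (c = a \<or> c = b)"
        then have "p c \<noteq> p a" "p c \<noteq> p b" using noteq[OF inner[OF c], of a] noteq[OF inner[OF c], of b] abY Y(2) by auto
        moreover have "p a \<le> p c" "p c \<le> p b" using p_mono[of a c] p_mono[of c b] bX c by (auto simp: A_def)
        ultimately show False using True by simp
      qed
      then have "A = {a, b}" using A(4) by auto
      then have card: "card A = 2" using ab by simp
      have "f (card A - 1) (enum A) \<in> simp_degenerate S (card A - 1)"
        unfolding A_def by (rule bead_degenerate[OF abY ab consec _ _ order_refl ab order_refl True])
          (use abY Y(2) in auto)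
      then show ?thesis using True card by (simp add: bead_def letter_def A_def[symmetric])
    next
      case False
      have ne: "p c \<noteq> p e" if "c \<in> A" "e \<in> A" "c \<noteq> e" for c e
      proof (cases "c = a \<or> c = b")
        case True
        show ?thesis
        proof (cases "e = a \<or> e = b")
          case True
          then show ?thesis using \<open>c = a \<or> c = b\<close> that(3) False by auto
        next
          case False
          then show ?thesis using noteq[OF inner[OF that(2)], of c] that by (auto simp: A_def)
        qed
      next
        case False
        then show ?thesis using noteq[OF inner[OF that(1)], of e] that by (auto simp: A_def)
      qed
      have "inj_on p A" by (rule inj_onI) (use ne in blast)
      note injA = this
      have monoA: "p c \<le> p e" if "c \<in> A" "e \<in> A" "c \<le> e" for c e
        using that A(3) by (intro p_mono) auto
      note img = enum_image[OF A(1,2) monoA injA]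
      have "p ` X \<inter> {p a..p b} = p ` A"
      proof (intro equalityI subsetI)
        fix q assume "q \<in> p ` X \<inter> {p a..p b}"
        then obtain z where z: "z \<in> X" "q = p z" "p a \<le> p z" "p z \<le> p b" by auto
        have zle: "z \<le> sum_list T" using z(1) Y(3) by auto
        consider "z < a" | "z \<in> A" | "b < z" using z(1) by (force simp: A_def)
        then show "q \<in> p ` A"
        proof cases
          case 1
          then have "p z = p a" using p_mono[of z a] z(3) bX ab by simp
          then show ?thesis using z(2) A(4) by auto
        next
          case 3
          then have "p z = p b" using p_mono[of b z] z(4) zle by simp
          then show ?thesis using z(2) A(4) by auto
        qed (use z in auto)
      next
        fix q assume "q \<in> p ` A"
        then obtain c where c: "c \<in> A" "q = p c" by auto
        have "p a \<le> p c" "p c \<le> p b" using p_mono[of a c] p_mono[of c b] bX c by (auto simp: A_def)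
        then show "q \<in> p ` X \<inter> {p a..p b}" using c by (auto simp: A_def)
      qed
      then show ?thesis
        using False A(6) img by (simp add: bead_def A_def[symmetric])
    qed
  qed
  have "bead_product f X xs = (bead_product g (p ` X) (remdups_adj (map p xs)) :: 'a word \<Rightarrow>\<^sub>0 'k)"
    if "?xs = us @ xs" for us xs
    using that
  proof (induction xs arbitrary: us)
    case (Cons a xs)
    show ?case
    proof (cases xs)
      case (Cons b vs)
      note Cons' = this
      have xs: "?xs = us @ a # b # vs" using Cons.prems Cons' by simp
      have ab: "a \<in> Y" "b \<in> Y" using arg_cong[OF xs, of set] set by auto
      have lt: "a < b" using sorted unfolding xs by (simp add: sorted_wrt_append)
      have consec: "\<not> (a < y \<and> y < b)" if "y \<in> Y" for y
        using sorted_consecutive[of us a b vs y] sorted that set unfolding xs by blast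
      have IH: "bead_product f X (b # vs) = (bead_product g (p ` X) (remdups_adj (map p (b # vs))) :: 'a word \<Rightarrow>\<^sub>0 'k)"
        using Cons.IH[of "us @ [a]"] Cons.prems Cons' by simp
      obtain ws where ws: "remdups_adj (map p (b # vs)) = p b # ws"
        by (metis list.simps(9) remdups_adj_Cons_alt)
      show ?thesis
      proof (cases "p a = p b")
        case True
        then have "remdups_adj (map p (a # b # vs)) = remdups_adj (map p (b # vs))" by simp
        then show ?thesis using IH bead_map[OF ab lt consec] True Cons' by simp
      next
        case False
        then have "remdups_adj (map p (a # b # vs)) = p a # remdups_adj (map p (b # vs))" by simp
        then show ?thesis
          using IH[unfolded ws] bead_map[OF ab lt consec] False Cons' by (simp only: ws bead_product.simps if_False)
      qed
    qed simp
  qed simp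
  from this[of "[]" ?xs] have "bead_product f X ?xs =
      (bead_product g (p ` X) (remdups_adj (map p ?xs)) :: 'a word \<Rightarrow>\<^sub>0 'k)" by simp
  also have "remdups_adj (map p ?xs) = sorted_list_of_set (p ` Y)"
  proof -
    have "sorted (map p ?xs)"
      unfolding sorted_map
    proof (rule sorted_wrt_mono_rel[OF _ sorted])
      fix a b assume "a \<in> set ?xs" "b \<in> set ?xs" "a < b"
      then show "p a \<le> p b" using set Y by (intro p_mono) auto
    qed
    from sorted_remdups_adj_strict[OF this] show ?thesis
      using finite_XY set by (intro sorted_distinct_set_unique) (auto simp: strict_sorted_iff)
  qed
  finally show ?thesis .
qed

end

text \<open>
  The two cases of the preceding lemmas are told apart by the rank of the image. If it is smaller, then the
  value of the image is zero by definition, and the value of the source is zero because a bead collapses.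
\<close>

lemma val_step:
  assumes "rig_step n s t"
  shows "val n s = (val n t :: 'a word \<Rightarrow>\<^sub>0 'k::{comm_ring,comm_monoid_mult})"
  using assms
proof (cases rule: rig_stepE)
  case (1 T f U g h u)
  let ?p = "on_verts h" and ?X = "upper n T u" and ?Y = "lower n T u"
  let ?v = "compose (cube n) (neck_cube_map T U h) u"
  have h: "h \<in> nec_hom T U" using 1(3) by (simp add: triangle_def)
  have len: "length (u v) = neck_dim T" if "length v = n" for v using box_hom_length[OF 1(4) that] .
  have X': "upper n U ?v = ?p ` ?X" and Y': "lower n U ?v = ?p ` ?Y"
    using neck_cube_map_apply(2)[OF h] len by (simp_all add: upper_def lower_def compose_def)
  have Y: "joints T \<subseteq> ?Y" "?Y \<subseteq> ?X" "?X \<subseteq> {..sum_list T}"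
    using joints_subset_vertex_set[of T] vertex_set_subset[OF len[of "replicate n True"]] box_hom_mono[OF 1(4)]
    by (auto simp: upper_def lower_def vertex_set_def neck_verts_def)
  have finX: "finite ?X" by (rule finite_subset[OF Y(3)]) simp
  note fin = finX finite_subset[OF Y(2) finX]
  have "?X - ?Y \<subseteq> (\<lambda>i. free_verts T ! i) ` rank n u"
    by (auto simp: upper_def lower_def vertex_set_def rank_def)
  then have "card (?X - ?Y) \<le> card ((\<lambda>i. free_verts T ! i) ` rank n u)"
    by (intro card_mono) (auto simp: rank_def)
  also have "\<dots> \<le> card (rank n u)" by (intro card_image_le) (auto simp: rank_def)
  also have "\<dots> \<le> n" by (rule card_rank_le[OF 1(4)])
  finally have le_n: "card (?X - ?Y) \<le> n" .
  have sub: "?p ` ?X - ?p ` ?Y \<subseteq> ?p ` (?X - ?Y)" by auto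
  have le1: "card (?p ` ?X - ?p ` ?Y) \<le> card (?p ` (?X - ?Y))" using fin by (intro card_mono sub) auto
  have le2: "card (?p ` (?X - ?Y)) \<le> card (?X - ?Y)" using fin by (intro card_image_le) auto
  show ?thesis
  proof (cases "inj_on ?p (?X - ?Y) \<and> ?p ` (?X - ?Y) \<inter> ?p ` ?Y = {}")
    case True
    then have "?p ` ?X - ?p ` ?Y = ?p ` (?X - ?Y)" by auto
    then have card: "card (?p ` ?X - ?p ` ?Y) = card (?X - ?Y)" using True by (simp add: card_image)
    have "bead_product f ?X (sorted_list_of_set ?Y) =
        (bead_product g (?p ` ?X) (sorted_list_of_set (?p ` ?Y)) :: 'a word \<Rightarrow>\<^sub>0 'k)"
      using bead_product_map[OF 1(1-3) Y] True by blast
    then show ?thesis unfolding 1(5,6) val_def by (simp add: X' Y' card)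
  next
    case False
    have "card (?p ` ?X - ?p ` ?Y) < card (?X - ?Y)"
    proof (cases "inj_on ?p (?X - ?Y)")
      case True
      then have "?p ` ?X - ?p ` ?Y \<subset> ?p ` (?X - ?Y)" using False by auto
      then have "card (?p ` ?X - ?p ` ?Y) < card (?p ` (?X - ?Y))" using fin by (intro psubset_card_mono) auto
      then show ?thesis using le2 by simp
    next
      case False
      then have "card (?p ` (?X - ?Y)) \<noteq> card (?X - ?Y)" using fin eq_card_imp_inj_on[of "?X - ?Y" ?p] by auto
      then show ?thesis using le1 le2 by simp
    qed
    then have "card (?p ` ?X - ?p ` ?Y) \<noteq> n" using le_n by simp
    moreover have "\<exists>y\<in>?X - ?Y. \<exists>z\<in>?X. z \<noteq> y \<and> ?p z = ?p y"
    proof (cases "inj_on ?p (?X - ?Y)")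
      case True
      then obtain y z where "y \<in> ?X - ?Y" "z \<in> ?Y" "?p z = ?p y" using False by force
      then show ?thesis using Y(2) by (intro bexI[of _ y] bexI[of _ z]) auto
    next
      case False
      then show ?thesis unfolding inj_on_def by auto
    qed
    then have "bead_product f ?X (sorted_list_of_set ?Y) = (0 :: 'a word \<Rightarrow>\<^sub>0 'k)"
      using bead_product_collapse[OF 1(1-3) Y] by blast
    ultimately show ?thesis unfolding 1(5,6) val_def by (simp add: X' Y')
  qed
qed

lemma val_equivclp:
  assumes "equivclp (rig_step n) s t"
  shows "val n s = (val n t :: 'a word \<Rightarrow>\<^sub>0 'k::{comm_ring,comm_monoid_mult})"
  using assms
proof (induction rule: equivclp_induct)
  case (step y z)
  have "val n y = (val n z :: 'a word \<Rightarrow>\<^sub>0 'k)"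
    using step(2)
  proof
    assume "rig_step n y z"
    then show ?thesis by (rule val_step)
  next
    assume "rig_step n z y"
    then show ?thesis by (rule val_step[symmetric])
  qed
  then show ?case using step(3) by simp
qed simp

definition cell_value :: "nat \<Rightarrow> 'a rig_cell \<Rightarrow> ('a word \<Rightarrow>\<^sub>0 'k::{comm_ring,comm_monoid_mult})" where
  "cell_value n A = val n (SOME s. s \<in> A)"

lemma cell_value_cl:
  assumes "over T f" "box_hom n (neck_dim T) u"
  shows "cell_value n (cl n T f u) = (val n ((T, f), u) :: 'a word \<Rightarrow>\<^sub>0 'k::{comm_ring,comm_monoid_mult})"
proof -
  have "(SOME s. s \<in> cl n T f u) \<in> cl n T f u" using cl_self[OF assms] by (rule someI)
  moreover have "equivclp (rig_step n) ((T, f), u) s" if "s \<in> cl n T f u" for s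
    using that unfolding rig_class_def Image_singleton_iff colim_rel_iff by (elim conjE)
  ultimately have "equivclp (rig_step n) ((T, f), u) (SOME s. s \<in> cl n T f u)" by blast
  then have "val n ((T, f), u) = (val n (SOME s. s \<in> cl n T f u) :: 'a word \<Rightarrow>\<^sub>0 'k)"
    by (rule val_equivclp)
  then show ?thesis by (simp add: cell_value_def)
qed

end

section \<open>Products of cubes\<close>

lemma box_prod_append: "length a = m \<Longrightarrow> length b = n \<Longrightarrow> box_prod m n u v (a @ b) = u a @ v b"
  by (simp add: box_prod_def)

lemma box_prod_ext:
  assumes "F \<in> extensional (cube (m + n))" "\<And>a b. length a = m \<Longrightarrow> length b = n \<Longrightarrow> F (a @ b) = u a @ v b"
  shows "F = box_prod m n u v"
proof (rule extensionalityI[OF assms(1)])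
  show "box_prod m n u v \<in> extensional (cube (m + n))" by (simp add: box_prod_def)
  fix w assume "w \<in> cube (m + n)"
  then have w: "length (take m w) = m" "length (drop m w) = n" by auto
  show "F w = box_prod m n u v w"
    using assms(2)[OF w] box_prod_append[OF w, of u v] by simp
qed

lemma box_prod_compose:
  assumes "box_hom l m a" "box_hom l' m' b"
  shows "compose (cube (l + l')) (box_prod m m' u v) (box_prod l l' a b) =
    box_prod l l' (compose (cube l) u a) (compose (cube l') v b)"
proof (rule box_prod_ext)
  fix p q :: "bool list" assume p: "length p = l" "length q = l'"
  have "compose (cube (l + l')) (box_prod m m' u v) (box_prod l l' a b) (p @ q) =
      box_prod m m' u v (box_prod l l' a b (p @ q))" using p by (simp add: compose_def)
  also have "\<dots> = u (a p) @ v (b q)"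
    using box_hom_length[OF assms(1) p(1)] box_hom_length[OF assms(2) p(2)]
    by (simp add: box_prod_append p)
  finally show "compose (cube (l + l')) (box_prod m m' u v) (box_prod l l' a b) (p @ q) =
      compose (cube l) u a p @ compose (cube l') v b q" using p by (simp add: compose_def)
qed (simp add: compose_def)

lemma box_prod_id: "box_prod m n (idm Box m) (idm Box n) = idm Box (m + n)"
  by (rule box_prod_ext[symmetric]) simp_all

lemma box_face_prod_left: "j \<le> Suc m \<Longrightarrow> 1 \<le> j \<Longrightarrow> box_face (m + n) j e = box_prod m n (box_face m j e) (idm Box n)"
  by (rule box_prod_ext) (auto simp: box_face_def)

lemma box_face_prod_right: "1 \<le> j \<Longrightarrow> box_face (m + n) (m + j) e = box_prod m n (idm Box m) (box_face n j e)"
  by (rule box_prod_ext) (auto simp: box_face_def)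

lemma box_degen_prod_left: "j \<le> m \<Longrightarrow> 1 \<le> j \<Longrightarrow> box_degen (m + n) j = box_prod m n (box_degen m j) (idm Box n)"
  by (rule box_prod_ext) (auto simp: box_degen_def)

lemma box_degen_prod_right: "1 \<le> j \<Longrightarrow> box_degen (m + n) (m + j) = box_prod m n (idm Box m) (box_degen n j)"
  by (rule box_prod_ext) (auto simp: box_degen_def)

lemma box_conn_prod_left: "1 \<le> j \<Longrightarrow> j \<le> m - 1 \<Longrightarrow> box_conn (m + n) j = box_prod m n (box_conn m j) (idm Box n)"
  by (rule box_prod_ext) (auto simp: box_conn_def nth_append)

lemma box_conn_prod_right: "1 \<le> j \<Longrightarrow> box_conn (m + n) (m + j) = box_prod m n (idm Box m) (box_conn n j)"
  by (rule box_prod_ext) (auto simp: box_conn_def nth_append)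

text \<open>
  The product of a generating morphism and an identity is a generating morphism.
\<close>

lemma box_hom_prod_left: "box_hom m M u \<Longrightarrow> box_hom (m + n) (M + n) (box_prod m n u (idm Box n))"
proof (induction rule: box_hom.induct)
  case (ident m)
  have "box_hom (m + n) (m + n) (box_prod m n (idm Box m) (idm Box n))"
    unfolding box_prod_id by (rule box_hom_id)
  then show ?case by (simp only: pts_Box)
next
  case (face j m e)
  have "box_hom (m + n) (m + n + 1) (box_face (m + n) (j) e)"
    using face by (intro box_hom.face) auto
  moreover have "box_face (m + n) (j) e = box_prod m n (box_face m j e) (idm Box n)"
    using face by (intro box_face_prod_left) auto
  moreover have "m + n + 1 = m + 1 + n" using face by auto
  ultimately show ?case by (simp only: pts_Box)
next
  case (degen j m)
  have "box_hom (m + n) (m + n - 1) (box_degen (m + n) (j) )"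
    using degen by (intro box_hom.degen) auto
  moreover have "box_degen (m + n) (j)  = box_prod m n (box_degen m j ) (idm Box n)"
    using degen by (intro box_degen_prod_left) auto
  moreover have "m + n - 1 = m - 1 + n" using degen by auto
  ultimately show ?case by (simp only: pts_Box)
next
  case (conn j m)
  have "box_hom (m + n) (m + n - 1) (box_conn (m + n) (j) )"
    using conn by (intro box_hom.conn) auto
  moreover have "box_conn (m + n) (j)  = box_prod m n (box_conn m j ) (idm Box n)"
    using conn by (intro box_conn_prod_left) auto
  moreover have "m + n - 1 = m - 1 + n" using conn by auto
  ultimately show ?case by (simp only: pts_Box)
next
  case (comp k l f m g)
  have "box_hom (k + n) (m + n) (compose (cube (k + n)) (box_prod l n g (idm Box n)) (box_prod k n f (idm Box n)))"
    by (rule box_hom.comp[OF comp.IH])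
  moreover have "compose (cube n) (idm Box n) (idm Box n) = idm Box n" by (rule ext) (simp add: compose_def)
  ultimately show ?case by (simp only: box_prod_compose[OF comp.hyps(1) box_hom_id])
qed

lemma box_hom_prod_right: "box_hom n N v \<Longrightarrow> box_hom (m + n) (m + N) (box_prod m n (idm Box m) v)"
proof (induction rule: box_hom.induct)
  case (ident n)
  have "box_hom (m + n) (m + n) (box_prod m n (idm Box m) (idm Box n))"
    unfolding box_prod_id by (rule box_hom_id)
  then show ?case by (simp only: pts_Box)
next
  case (face j n e)
  have "box_hom (m + n) (m + n + 1) (box_face (m + n) (m + j) e)"
    using face by (intro box_hom.face) auto
  moreover have "box_face (m + n) (m + j) e = box_prod m n (idm Box m) (box_face n j e)"
    using face by (intro box_face_prod_right) auto
  moreover have "m + n + 1 = m + (n + 1)" using face by auto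
  ultimately show ?case by (simp only: pts_Box)
next
  case (degen j n)
  have "box_hom (m + n) (m + n - 1) (box_degen (m + n) (m + j) )"
    using degen by (intro box_hom.degen) auto
  moreover have "box_degen (m + n) (m + j)  = box_prod m n (idm Box m) (box_degen n j )"
    using degen by (intro box_degen_prod_right) auto
  moreover have "m + n - 1 = m + (n - 1)" using degen by auto
  ultimately show ?case by (simp only: pts_Box)
next
  case (conn j n)
  have "box_hom (m + n) (m + n - 1) (box_conn (m + n) (m + j) )"
    using conn by (intro box_hom.conn) auto
  moreover have "box_conn (m + n) (m + j)  = box_prod m n (idm Box m) (box_conn n j )"
    using conn by (intro box_conn_prod_right) auto
  moreover have "m + n - 1 = m + (n - 1)" using conn by auto
  ultimately show ?case by (simp only: pts_Box)
next
  case (comp k l f n g)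
  have "box_hom (m + k) (m + n) (compose (cube (m + k)) (box_prod m l (idm Box m) g) (box_prod m k (idm Box m) f))"
    by (rule box_hom.comp[OF comp.IH])
  moreover have "compose (cube m) (idm Box m) (idm Box m) = idm Box m" by (rule ext) (simp add: compose_def)
  ultimately show ?case by (simp only: box_prod_compose[OF box_hom_id comp.hyps(1)])
qed

lemma compose_id_left:
  assumes "box_hom m n u"
  shows "compose (cube m) (idm Box n) u = u"
  by (rule extensionalityI[OF _ box_hom_extensional[OF assms]])
     (use box_hom_length[OF assms] in \<open>simp_all add: compose_def\<close>)

lemma compose_id_right_box:
  assumes "box_hom m n u"
  shows "compose (cube m) u (idm Box m) = u"
  by (rule extensionalityI[OF _ box_hom_extensional[OF assms]]) (simp_all add: compose_def)

lemma box_hom_prod: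
  assumes "box_hom m M u" "box_hom n N v"
  shows "box_hom (m + n) (M + N) (box_prod m n u v)"
proof -
  have "box_hom (m + n) (M + N) (compose (cube (m + n)) (box_prod m N u (idm Box N)) (box_prod m n (idm Box m) v))"
    by (rule box_hom.comp[OF box_hom_prod_right[OF assms(2)] box_hom_prod_left[OF assms(1)]])
  then show ?thesis
    by (simp only: box_prod_compose[OF box_hom_id assms(2)] compose_id_left[OF assms(2)]
        compose_id_right_box[OF assms(1)])
qed

section \<open>Wedges of necklaces\<close>

lemma necklaces_append: "T \<in> necklaces \<Longrightarrow> U \<in> necklaces \<Longrightarrow> T @ U \<in> necklaces"
  by (auto simp: necklaces_def)

lemma cell_append_left: "u \<in> cells (neck T) n \<Longrightarrow> u \<in> cells (neck (T @ U)) n"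
proof (rule neck_cellI)
  assume u: "u \<in> cells (neck T) n"
  note u' = neck_cellD[OF u]
  show "u \<in> extensional {..n}" by (rule u')
  show "u i \<le> u j" if "i \<le> j" "j \<le> n" for i j by (rule u'(2)[OF that])
  show "u n \<le> sum_list (T @ U)" using u'(3)[of n] by simp
  show False if "j \<in> joints (T @ U)" "u 0 < j" "j < u n" for j
    using that u'(3)[of n] u'(4)[of j] by (auto simp: joints_append)
qed

lemma cell_append_right: "u \<in> cells (neck U) n \<Longrightarrow> (\<lambda>i\<in>{..n}. sum_list T + u i) \<in> cells (neck (T @ U)) n"
proof (rule neck_cellI)
  assume u: "u \<in> cells (neck U) n"
  note u' = neck_cellD[OF u]
  show "(\<lambda>i\<in>{..n}. sum_list T + u i) i \<le> (\<lambda>i\<in>{..n}. sum_list T + u i) j" if "i \<le> j" "j \<le> n" for i j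
    using u'(2)[OF that] that by simp
  show "(\<lambda>i\<in>{..n}. sum_list T + u i) n \<le> sum_list (T @ U)" using u'(3)[of n] by simp
  show False if "j \<in> joints (T @ U)" "(\<lambda>i\<in>{..n}. sum_list T + u i) 0 < j"
      "j < (\<lambda>i\<in>{..n}. sum_list T + u i) n" for j
    using that(1) unfolding joints_append
  proof
    assume "j \<in> joints T"
    then show False using joints_le[of j T] that(2) by simp
  next
    assume "j \<in> (+) (sum_list T) ` joints U"
    then show False using u'(4)[of "j - sum_list T"] that(2,3) by auto
  qed
qed simp

lemma cell_append_cases:
  assumes u: "u \<in> cells (neck (T @ U)) n"
  obtains (left) "u ` {..n} \<subseteq> {..sum_list T}" "u \<in> cells (neck T) n"
  | (right) w where "\<not> u ` {..n} \<subseteq> {..sum_list T}" "w \<in> cells (neck U) n"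
      "w = (\<lambda>i\<in>{..n}. u i - sum_list T)" "u = (\<lambda>i\<in>{..n}. sum_list T + w i)"
proof (cases "u ` {..n} \<subseteq> {..sum_list T}")
  case True
  note u' = neck_cellD[OF u]
  have "u \<in> cells (neck T) n"
  proof (rule neck_cellI)
    show "u \<in> extensional {..n}" by (rule u')
    show "u i \<le> u j" if "i \<le> j" "j \<le> n" for i j by (rule u'(2)[OF that])
    show "u n \<le> sum_list T" using True by auto
    show False if "j \<in> joints T" "u 0 < j" "j < u n" for j
      by (rule u'(4)[OF _ that(2,3)]) (simp add: joints_append that(1))
  qed
  then show thesis by (rule left[OF True])
next
  case False
  note u' = neck_cellD[OF u]
  obtain k where k: "k \<le> n" "sum_list T < u k"
    using False unfolding image_subset_iff by (auto simp del: not_le simp: not_le[symmetric])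
  then have "sum_list T < u n" using u'(2)[of k n] by simp
  then have ge0: "sum_list T \<le> u 0" using u'(4)[of "sum_list T"] by (force simp: joints_append)
  have ge: "sum_list T \<le> u i" if "i \<le> n" for i using u'(2)[of 0 i] that ge0 by simp
  define w where "w = (\<lambda>i\<in>{..n}. u i - sum_list T)"
  have uw: "u = (\<lambda>i\<in>{..n}. sum_list T + w i)"
    by (rule extensionalityI[OF u'(1)]) (use ge in \<open>simp_all add: w_def\<close>)
  have "w \<in> cells (neck U) n"
  proof (rule neck_cellI)
    show "w \<in> extensional {..n}" by (simp add: w_def)
    show "w i \<le> w j" if "i \<le> j" "j \<le> n" for i j using u'(2)[OF that] that by (simp add: w_def)
    show "w n \<le> sum_list U" using u'(3)[of n] by (simp add: w_def)
    show False if "j \<in> joints U" "w 0 < j" "j < w n" for j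
    proof (rule u'(4)[of "sum_list T + j"])
      show "sum_list T + j \<in> joints (T @ U)" using that(1) by (simp add: joints_append)
      show "u 0 < sum_list T + j" "sum_list T + j < u n" using that(2,3) ge[of 0] ge[of n]
        by (simp_all add: w_def)
    qed
  qed
  then show thesis using right False uw w_def by blast
qed

lemma free_verts_append: "free_verts (T @ U) = free_verts T @ map ((+) (sum_list T)) (free_verts U)"
proof -
  have set: "set (free_verts T @ map ((+) (sum_list T)) (free_verts U)) = neck_verts (T @ U) - joints (T @ U)"
  proof (rule set_eqI)
    fix v
    show "v \<in> set (free_verts T @ map ((+) (sum_list T)) (free_verts U)) \<longleftrightarrow>
        v \<in> neck_verts (T @ U) - joints (T @ U)"
    proof (cases "v < sum_list T")
      case True
      then show ?thesis by (auto simp: set_free_verts neck_verts_def joints_append)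
    next
      case False
      then obtain w where w: "v = sum_list T + w" using le_Suc_ex[of "sum_list T" v] by auto
      have J: "v \<in> joints T \<longleftrightarrow> w = 0"
        using joints_le[of v T] last_in_joints[of T] w by (cases "w = 0") auto
      moreover have "v \<in> neck_verts T - joints T \<longleftrightarrow> False"
        using J w by (auto simp: neck_verts_def)
      ultimately show ?thesis
        using zero_in_joints[of U] w by (auto simp: set_free_verts neck_verts_def joints_append image_iff)
    qed
  qed
  have "sorted_wrt (<) (free_verts T @ map ((+) (sum_list T)) (free_verts U))"
    using sorted_free_verts[of T] sorted_free_verts[of U]
    by (auto simp: sorted_wrt_append sorted_wrt_map set_free_verts neck_verts_def)
       (metis add.right_neutral add_less_cancel_left gr_zeroI last_in_joints le_neq_implies_less trans_less_add1 zero_in_joints)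
  then have "sorted (free_verts T @ map ((+) (sum_list T)) (free_verts U))"
    and "distinct (free_verts T @ map ((+) (sum_list T)) (free_verts U))"
    by (simp_all add: strict_sorted_iff)
  then show ?thesis
    unfolding free_verts_def[of "T @ U"]
    by (intro sorted_distinct_set_unique) (simp_all add: set del: set_append distinct_append, simp_all add: neck_verts_def)
qed

lemma neck_dim_append: "neck_dim (T @ U) = neck_dim T + neck_dim U"
  using arg_cong[OF free_verts_append[of T U], of length] by simp

lemma support_append: "support (v @ w) = support v \<union> (+) (length v) ` support w"
proof (rule set_eqI)
  fix i
  show "i \<in> support (v @ w) \<longleftrightarrow> i \<in> support v \<union> (+) (length v) ` support w"
  proof (cases "i < length v")
    case True
    then show ?thesis by (auto simp: support_def nth_append)
  next
    case False
    then obtain k where "i = length v + k" using le_Suc_ex[of "length v" i] by auto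
    then show ?thesis by (auto simp: support_def nth_append)
  qed
qed

lemma vertex_set_append:
  assumes "length v = neck_dim T" "length w = neck_dim U"
  shows "vertex_set (T @ U) (v @ w) = vertex_set T v \<union> (+) (sum_list T) ` vertex_set U w"
proof -
  have "(\<lambda>i. free_verts (T @ U) ! i) ` support (v @ w) =
      (\<lambda>i. free_verts T ! i) ` support v \<union> (\<lambda>i. sum_list T + free_verts U ! i) ` support w"
    unfolding support_append image_Un image_image free_verts_append
    using support_less[OF assms(1)] support_less[OF assms(2)] assms
    by (intro arg_cong2[where f = "(\<union>)"] image_cong) (auto simp: nth_append)
  then show ?thesis by (auto simp: vertex_set_def joints_append image_Un image_image)
qed

context reduced_simplicial
begin

lemma value_at_constant:
  assumes "f \<in> psh_hom Simplex (neck T) S" "v \<le> sum_list T"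
  shows "f n (\<lambda>i\<in>{..n}. v) = act S n 0 (\<lambda>i\<in>{..n}. 0) x"
proof -
  have w: "(\<lambda>i\<in>{..n}. 0) \<in> hom Simplex n 0" by (rule hom_SimplexI) auto
  have "compose {..n} (vertex_cell v) (\<lambda>i\<in>{..n}. 0) = (\<lambda>i\<in>{..n}. v)"
    by (rule ext) (simp add: compose_def vertex_cell_def)
  then show ?thesis
    using psh_hom_neckD(3)[OF assms(1) w vertex_cell_in[OF assms(2)]]
      psh_hom_neckD(2)[OF assms(1) vertex_cell_in[OF assms(2)]] reduced by simp
qed

lemma wedge_map_left: "u \<in> cells (neck T) n \<Longrightarrow> wedge_map T U f g n u = f n u"
  using cell_append_left[of u T n U] neck_cellD(3)[of u T n] by (auto simp: wedge_map_def)

lemma wedge_map_right: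
  assumes "over T f" "over U g" "u \<in> cells (neck U) n"
  shows "wedge_map T U f g n (\<lambda>i\<in>{..n}. sum_list T + u i) = g n u" (is "?l = _")
proof (cases "\<forall>i\<le>n. u i = 0")
  case True
  have c: "(\<lambda>i\<in>{..n}. sum_list T + u i) = (\<lambda>i\<in>{..n}. sum_list T)"
    by (rule ext) (use True in simp)
  have u: "u = (\<lambda>i\<in>{..n}. 0)"
    by (rule extensionalityI[OF neck_cellD(1)[OF assms(3)]]) (use True in simp_all)
  have "?l = f n (\<lambda>i\<in>{..n}. sum_list T)"
    using cell_append_right[OF assms(3), of T] unfolding c by (simp add: wedge_map_def image_subset_iff)
  also have "\<dots> = act S n 0 (\<lambda>i\<in>{..n}. 0) x"
    using assms(1) by (intro value_at_constant[of f T]) (simp_all add: over_def)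
  also have "\<dots> = g n u"
    unfolding u using assms(2) by (intro value_at_constant[of g U, symmetric]) (simp_all add: over_def)
  finally show ?thesis .
next
  case False
  then have "\<not> (\<lambda>i\<in>{..n}. sum_list T + u i) ` {..n} \<subseteq> {..sum_list T}" by (auto simp: image_subset_iff)
  moreover have "(\<lambda>i\<in>{..n}. (\<lambda>i\<in>{..n}. sum_list T + u i) i - sum_list T) = u"
    by (rule extensionalityI[OF _ neck_cellD(1)[OF assms(3)]]) simp_all
  ultimately show ?thesis using cell_append_right[OF assms(3), of T] by (simp add: wedge_map_def)
qed

lemma over_wedge:
  assumes f: "over T f" and g: "over U g"
  shows "over (T @ U) (wedge_map T U f g)"
proof -
  have f': "f \<in> psh_hom Simplex (neck T) S" and g': "g \<in> psh_hom Simplex (neck U) S"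
    using f g by (simp_all add: over_def)
  have "wedge_map T U f g \<in> psh_hom Simplex (neck (T @ U)) S"
  proof (rule psh_hom_neckI)
    show "wedge_map T U f g n \<in> extensional (cells (neck (T @ U)) n)" for n
      by (simp add: wedge_map_def)
    show "wedge_map T U f g n u \<in> cells S n" if "u \<in> cells (neck (T @ U)) n" for n u
      using that
    proof (cases rule: cell_append_cases)
      case left
      then show ?thesis using psh_hom_neckD(2)[OF f' left(2)] by (simp add: wedge_map_left)
    next
      case (right w)
      show ?thesis unfolding right(4) wedge_map_right[OF f g right(2)]
        by (rule psh_hom_neckD(2)[OF g' right(2)])
    qed
    fix m n w u assume w: "w \<in> hom Simplex m n" and u: "u \<in> cells (neck (T @ U)) n"
    show "wedge_map T U f g m (compose {..m} u w) = act S m n w (wedge_map T U f g n u)"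
      using u
    proof (cases rule: cell_append_cases)
      case left
      show ?thesis
        using psh_hom_neckD(3)[OF f' w left(2)] neck_act_in[OF left(2) w]
        by (simp add: wedge_map_left left(2))
    next
      case (right v)
      have "compose {..m} u w = (\<lambda>i\<in>{..m}. sum_list T + compose {..m} v w i)"
        unfolding right(4) using hom_SimplexD(2)[OF w] by (auto simp: compose_def)
      then have "wedge_map T U f g m (compose {..m} u w) = g m (compose {..m} v w)"
        using wedge_map_right[OF f g neck_act_in[OF right(2) w]] by (simp only:)
      also have "\<dots> = act S m n w (g n v)" by (rule psh_hom_neckD(3)[OF g' w right(2)])
      also have "g n v = wedge_map T U f g n u"
        using wedge_map_right[OF f g right(2)] unfolding right(4)[symmetric] by (rule sym)
      finally show ?thesis .
    qed
  qed
  then show ?thesis using f g by (simp add: over_def necklaces_append)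
qed

lemma triangle_id:
  assumes "over T f"
  shows "triangle T f T f (nec_map_of T id)" "neck_cube_map T T (nec_map_of T id) = idm Box (neck_dim T)"
proof -
  have h: "nec_map_of T id \<in> nec_hom T T" by (rule nec_map_of_in) auto
  have "nec_map_of T id n u = u" if "u \<in> cells (neck T) n" for n u
    using that neck_cellD(1)[OF that] by (simp add: nec_map_of_def extensional_restrict)
  then show "triangle T f T f (nec_map_of T id)" using h by (simp add: triangle_def)
  show "neck_cube_map T T (nec_map_of T id) = idm Box (neck_dim T)"
  proof (rule extensionalityI[OF neck_cube_map_extensional])
    fix v assume "v \<in> cube (neck_dim T)"
    then have v: "length v = neck_dim T" by simp
    have "on_verts (nec_map_of T id) ` vertex_set T v = vertex_set T v"
      using vertex_set_subset[OF v] on_verts_nec_map_of[of _ T id]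
      by (intro image_cong[where g = id, simplified] refl) (auto simp: neck_verts_def)
    then have "vertex_set T (neck_cube_map T T (nec_map_of T id) v) = vertex_set T v"
      using neck_cube_map_apply(2)[OF h v] by simp
    then have "neck_cube_map T T (nec_map_of T id) v = v"
      by (rule vertex_set_inj[OF neck_cube_map_apply(1)[OF h v] v])
    then show "neck_cube_map T T (nec_map_of T id) v = idm Box (neck_dim T) v" using v by simp
  qed simp
qed

text \<open>
  On vertices, the map between the wedges is that of \<open>h\<close> up to the middle joint, and a shift of that of
  \<open>k\<close> after it.
\<close>

lemma triangle_wedge:
  assumes f: "over T f" "over T' f'" "triangle T f T' f' h" and g: "over U g" "over U' g'" "triangle U g U' g' k"
  obtains l where "triangle (T @ U) (wedge_map T U f g) (T' @ U') (wedge_map T' U' f' g') l"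
    "neck_cube_map (T @ U) (T' @ U') l = box_prod (neck_dim T) (neck_dim U) (neck_cube_map T T' h) (neck_cube_map U U' k)"
proof -
  let ?N = "sum_list T" and ?N' = "sum_list T'"
  let ?a = "on_verts h" and ?b = "on_verts k"
  have h: "h \<in> nec_hom T T'" and k: "k \<in> nec_hom U U'" using f g by (simp_all add: triangle_def)
  note h' = nec_homD[OF h] and k' = nec_homD[OF k]
  define p where "p v = (if v \<le> ?N then ?a v else ?N' + ?b (v - ?N))" for v
  have p_right: "p (?N + v) = ?N' + ?b v" for v
    using h'(3) k'(2) by (cases "v = 0") (simp_all add: p_def)
  have p_left: "p v = ?a v" if "v \<le> ?N" for v using that by (simp add: p_def)
  define l where "l = nec_map_of (T @ U) p"
  have l: "l \<in> nec_hom (T @ U) (T' @ U')"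
    unfolding l_def
  proof (rule nec_map_of_in)
    show "p 0 = 0" using h'(2) by (simp add: p_def)
    show "p (sum_list (T @ U)) = sum_list (T' @ U')" using p_right[of "sum_list U"] k'(3) by simp
    show "p a \<le> p b" if "a \<le> b" "b \<le> sum_list (T @ U)" for a b
    proof (cases "b \<le> ?N")
      case True
      then show ?thesis using that h'(4)[of a b] by (simp add: p_def)
    next
      case False
      show ?thesis
      proof (cases "a \<le> ?N")
        case True
        then show ?thesis using False h'(4)[of a ?N] h'(3) by (simp add: p_def)
      next
        case False
        then show ?thesis using that k'(4)[of "a - ?N" "b - ?N"] by (simp add: p_def)
      qed
    qed
    show "joints (T' @ U') \<subseteq> p ` joints (T @ U)"
    proof
      fix j assume "j \<in> joints (T' @ U')"
      then consider "j \<in> joints T'" | i where "i \<in> joints U'" "j = ?N' + i" by (auto simp: joints_append)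
      then show "j \<in> p ` joints (T @ U)"
      proof cases
        case 1
        then obtain i where i: "i \<in> joints T" "j = ?a i" using h'(5) by blast
        then have "j = p i" using joints_le[of i T] by (simp add: p_def)
        then show ?thesis using i(1) by (simp add: joints_append)
      next
        case 2
        then obtain i' where i': "i' \<in> joints U" "i = ?b i'" using k'(5) by blast
        then have "j = p (?N + i')" using 2(2) p_right by simp
        then show ?thesis using i'(1) by (simp add: joints_append)
      qed
    qed
  qed
  have on_l: "on_verts l v = p v" if "v \<le> sum_list (T @ U)" for v
    unfolding l_def by (rule on_verts_nec_map_of[OF that])
  have "triangle (T @ U) (wedge_map T U f g) (T' @ U') (wedge_map T' U' f' g') l"
    unfolding triangle_def
  proof (intro conjI allI ballI l)
    fix n u assume u: "u \<in> cells (neck (T @ U)) n"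
    have lu: "l n u = (\<lambda>i\<in>{..n}. p (u i))" using u by (simp add: l_def nec_map_of_def)
    from u show "wedge_map T' U' f' g' n (l n u) = wedge_map T U f g n u"
    proof (cases rule: cell_append_cases)
      case left
      have "h n u = (\<lambda>i\<in>{..n}. ?a (u i))" by (rule h'(1)[OF left(2)])
      also have "\<dots> = l n u"
        unfolding lu by (rule restrict_ext) (use neck_cellD(3)[OF left(2)] in \<open>simp add: p_def\<close>)
      finally have e: "l n u = h n u" by (rule sym)
      have "h n u \<in> cells (neck T') n" using h left(2) by (auto simp: nec_hom_def dest: psh_hom_neckD(2))
      then have "wedge_map T' U' f' g' n (l n u) = f' n (h n u)" unfolding e by (rule wedge_map_left)
      also have "\<dots> = f n u" using f(3) left(2) by (simp add: triangle_def)
      also have "\<dots> = wedge_map T U f g n u" by (rule wedge_map_left[OF left(2), symmetric])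
      finally show ?thesis .
    next
      case (right w)
      have kw: "k n w = (\<lambda>i\<in>{..n}. ?b (w i))" by (rule k'(1)[OF right(2)])
      have e: "l n u = (\<lambda>i\<in>{..n}. ?N' + k n w i)"
        unfolding lu kw by (subst right(4)) (rule ext, simp add: p_right)
      have "k n w \<in> cells (neck U') n" using k right(2) by (auto simp: nec_hom_def dest: psh_hom_neckD(2))
      then have "wedge_map T' U' f' g' n (l n u) = g' n (k n w)"
        unfolding e by (rule wedge_map_right[OF f(2) g(2)])
      also have "\<dots> = g n w" using g(3) right(2) by (simp add: triangle_def)
      also have "\<dots> = wedge_map T U f g n u"
        by (subst right(4)) (rule wedge_map_right[OF f(1) g(1) right(2), symmetric])
      finally show ?thesis .
    qed
  qed
  moreover have "neck_cube_map (T @ U) (T' @ U') l = box_prod (neck_dim T) (neck_dim U) (neck_cube_map T T' h) (neck_cube_map U U' k)"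
  proof (rule box_prod_ext)
    show "neck_cube_map (T @ U) (T' @ U') l \<in> extensional (cube (neck_dim T + neck_dim U))"
      using neck_cube_map_extensional[of "T @ U"] by (simp add: neck_dim_append)
    fix a b :: "bool list" assume a: "length a = neck_dim T" and b: "length b = neck_dim U"
    have ab: "length (a @ b) = neck_dim (T @ U)" using a b by (simp add: neck_dim_append)
    note ca = neck_cube_map_apply[OF h a] and cb = neck_cube_map_apply[OF k b]
    have va: "v \<le> ?N" if "v \<in> vertex_set T a" for v
      using vertex_set_subset[OF a] that by (auto simp: neck_verts_def)
    have vb: "v \<le> sum_list U" if "v \<in> vertex_set U b" for v
      using vertex_set_subset[OF b] that by (auto simp: neck_verts_def)
    have "on_verts l ` vertex_set T a = ?a ` vertex_set T a"
      by (rule image_cong[OF refl]) (use va in \<open>force simp: on_l p_left\<close>)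
    moreover have "on_verts l ` (+) ?N ` vertex_set U b = (+) ?N' ` ?b ` vertex_set U b"
      unfolding image_image by (rule image_cong[OF refl]) (use vb in \<open>simp add: on_l p_right\<close>)
    ultimately have "on_verts l ` vertex_set (T @ U) (a @ b) =
        vertex_set (T' @ U') (neck_cube_map T T' h a @ neck_cube_map U U' k b)"
      unfolding vertex_set_append[OF a b] vertex_set_append[OF ca(1) cb(1)] image_Un ca(2) cb(2) by simp
    then have "vertex_set (T' @ U') (neck_cube_map (T @ U) (T' @ U') l (a @ b)) =
        vertex_set (T' @ U') (neck_cube_map T T' h a @ neck_cube_map U U' k b)"
      using neck_cube_map_apply(2)[OF l ab] by simp
    then show "neck_cube_map (T @ U) (T' @ U') l (a @ b) = neck_cube_map T T' h a @ neck_cube_map U U' k b"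
      by (rule vertex_set_inj[rotated 2]) (simp_all add: neck_cube_map_apply(1)[OF l ab] neck_dim_append ca cb)
  qed
  ultimately show thesis by (rule that)
qed

section \<open>Composition in the rigidification\<close>

text \<open>
  The juxtaposition of representatives, restricted along \<open>w\<close>. It turns a step in either argument into a
  step, which shows that composition is well defined on classes of the rigidification.
\<close>

definition prod_point where
  "prod_point m n d w = (\<lambda>((T, f), u) ((U, g), v).
    ((T @ U, wedge_map T U f g), compose (cube d) (box_prod m n u v) w))"

lemma prod_point_simp: "prod_point m n d w ((T, f), u) ((U, g), v) =
    ((T @ U, wedge_map T U f g), compose (cube d) (box_prod m n u v) w)"
  by (simp add: prod_point_def)

lemma compose_box_prod:
  assumes u: "box_hom m M u" and v: "box_hom n N v" and w: "box_hom d (m + n) w"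
  shows "compose (cube d) (box_prod M N a b) (compose (cube d) (box_prod m n u v) w) =
    compose (cube d) (box_prod m n (compose (cube m) a u) (compose (cube n) b v)) w"
  by (simp only: compose_assoc_cube[OF w, symmetric] box_prod_compose[OF u v])

lemma rig_step_prod_left:
  assumes st: "rig_step m s s'" and g: "over U g" and v: "box_hom n (neck_dim U) v" and w: "box_hom d (m + n) w"
  shows "rig_step d (prod_point m n d w s ((U, g), v)) (prod_point m n d w s' ((U, g), v))"
  using st
proof (cases rule: rig_stepE)
  case (1 T f T' f' h u)
  obtain l where l: "triangle (T @ U) (wedge_map T U f g) (T' @ U) (wedge_map T' U f' g) l"
    "neck_cube_map (T @ U) (T' @ U) l =
      box_prod (neck_dim T) (neck_dim U) (neck_cube_map T T' h) (neck_cube_map U U (nec_map_of U id))"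
    using triangle_wedge[OF 1(1-3) g g triangle_id(1)[OF g]] by blast
  have hom: "box_hom d (neck_dim (T @ U)) (compose (cube d) (box_prod m n u v) w)"
    unfolding neck_dim_append by (rule box_hom.comp[OF w box_hom_prod[OF 1(4) v]])
  have "compose (cube d) (neck_cube_map (T @ U) (T' @ U) l) (compose (cube d) (box_prod m n u v) w) =
      compose (cube d) (box_prod m n (compose (cube m) (neck_cube_map T T' h) u) v) w"
    unfolding l(2) compose_box_prod[OF 1(4) v w] triangle_id(2)[OF g] compose_id_left[OF v] ..
  then show ?thesis
    using rig_stepI[OF over_wedge[OF 1(1) g] over_wedge[OF 1(2) g] l(1) hom]
    unfolding 1(5,6) prod_point_simp by (simp only:)
qed

lemma rig_step_prod_right:
  assumes st: "rig_step n s s'" and f: "over T f" and u: "box_hom m (neck_dim T) u" and w: "box_hom d (m + n) w"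
  shows "rig_step d (prod_point m n d w ((T, f), u) s) (prod_point m n d w ((T, f), u) s')"
  using st
proof (cases rule: rig_stepE)
  case (1 U g U' g' h v)
  obtain l where l: "triangle (T @ U) (wedge_map T U f g) (T @ U') (wedge_map T U' f g') l"
    "neck_cube_map (T @ U) (T @ U') l =
      box_prod (neck_dim T) (neck_dim U) (neck_cube_map T T (nec_map_of T id)) (neck_cube_map U U' h)"
    using triangle_wedge[OF f f triangle_id(1)[OF f] 1(1-3)] by blast
  have hom: "box_hom d (neck_dim (T @ U)) (compose (cube d) (box_prod m n u v) w)"
    unfolding neck_dim_append by (rule box_hom.comp[OF w box_hom_prod[OF u 1(4)]])
  have "compose (cube d) (neck_cube_map (T @ U) (T @ U') l) (compose (cube d) (box_prod m n u v) w) =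
      compose (cube d) (box_prod m n u (compose (cube n) (neck_cube_map U U' h) v)) w"
    unfolding l(2) compose_box_prod[OF u 1(4) w] triangle_id(2)[OF f] compose_id_left[OF u] ..
  then show ?thesis
    using rig_stepI[OF over_wedge[OF f 1(1)] over_wedge[OF f 1(2)] l(1) hom]
    unfolding 1(5,6) prod_point_simp by (simp only:)
qed

lemma cl_prod_eq:
  assumes w: "box_hom d (m + n) w"
    and f: "over T f" "box_hom m (neck_dim T) u" "((T', f'), u') \<in> cl m T f u"
    and g: "over U g" "box_hom n (neck_dim U) v" "((U', g'), v') \<in> cl n U g v"
  shows "cl d (T' @ U') (wedge_map T' U' f' g') (compose (cube d) (box_prod m n u' v') w) =
    cl d (T @ U) (wedge_map T U f g) (compose (cube d) (box_prod m n u v) w)"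
proof -
  have f': "over T' f'" "box_hom m (neck_dim T') u'" "equivclp (rig_step m) ((T', f'), u') ((T, f), u)"
    using f(3) unfolding in_cl_iff by (auto intro: equivclp_sym)
  have g': "over U' g'" "box_hom n (neck_dim U') v'" "equivclp (rig_step n) ((U', g'), v') ((U, g), v)"
    using g(3) unfolding in_cl_iff by (auto intro: equivclp_sym)
  have 1: "equivclp (rig_step d) (prod_point m n d w ((T', f'), u') ((U', g'), v'))
      (prod_point m n d w ((T, f), u) ((U', g'), v'))"
    by (rule equivclp_map[where G = "\<lambda>s. prod_point m n d w s ((U', g'), v')", OF _ f'(3)])
       (rule r_into_equivclp, rule rig_step_prod_left[OF _ g'(1,2) w])
  have 2: "equivclp (rig_step d) (prod_point m n d w ((T, f), u) ((U', g'), v'))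
      (prod_point m n d w ((T, f), u) ((U, g), v))"
    by (rule equivclp_map[where G = "prod_point m n d w ((T, f), u)", OF _ g'(3)])
       (rule r_into_equivclp, rule rig_step_prod_right[OF _ f(1,2) w])
  show ?thesis
    by (rule cl_eqI[OF over_wedge[OF f'(1) g'(1)] _ over_wedge[OF f(1) g(1)]])
       (use equivclp_trans[OF 1 2] in \<open>simp_all only: prod_point_simp neck_dim_append
          box_hom.comp[OF w box_hom_prod[OF f'(2) g'(2)]] box_hom.comp[OF w box_hom_prod[OF f(2) g(2)]]\<close>)
qed

text \<open>
  The composition on representatives of cells of the tensor product. It is constant along the steps that
  generate the tensor product, so it may be evaluated on any representative.
\<close>

definition prod_value where
  "prod_value d = (\<lambda>(((m, A), (n, B)), w). \<Union>((T, f), u)\<in>A. \<Union>((U, g), v)\<in>B.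
    cl d (T @ U) (wedge_map T U f g) (compose (cube d) (box_prod m n u v) w))"

lemma prod_value_cl:
  assumes w: "box_hom d (m + n) w"
    and f: "over T f" "box_hom m (neck_dim T) u" and g: "over U g" "box_hom n (neck_dim U) v"
  shows "prod_value d (((m, cl m T f u), (n, cl n U g v)), w) =
    cl d (T @ U) (wedge_map T U f g) (compose (cube d) (box_prod m n u v) w)"
proof -
  have inner: "(\<Union>((U', g'), v')\<in>cl n U g v. cl d (T' @ U') (wedge_map T' U' f' g')
        (compose (cube d) (box_prod m n u' v') w)) =
      cl d (T @ U) (wedge_map T U f g) (compose (cube d) (box_prod m n u v) w)"
    if p: "((T', f'), u') \<in> cl m T f u" for T' f' u'
  proof (rule UN_coset_const[OF _ cl_self[OF g]])
    fix q assume q: "q \<in> cl n U g v"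
    obtain U' g' v' where q': "q = ((U', g'), v')" by (metis surj_pair)
    show "(case q of (a, v') \<Rightarrow> (case a of (U', g') \<Rightarrow> \<lambda>v'. cl d (T' @ U') (wedge_map T' U' f' g')
        (compose (cube d) (box_prod m n u' v') w)) v') =
      cl d (T @ U) (wedge_map T U f g) (compose (cube d) (box_prod m n u v) w)"
      unfolding q' prod.case by (rule cl_prod_eq[OF w f p g q[unfolded q']])
  qed
  show ?thesis
    unfolding prod_value_def prod.case
  proof (rule UN_coset_const[OF _ cl_self[OF f]])
    fix p assume p: "p \<in> cl m T f u"
    obtain T' f' u' where p': "p = ((T', f'), u')" by (metis surj_pair)
    show "(case p of (a, u') \<Rightarrow> (case a of (T', f') \<Rightarrow> \<lambda>u'. \<Union>((U', g'), v')\<in>cl n U g v.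
        cl d (T' @ U') (wedge_map T' U' f' g') (compose (cube d) (box_prod m n u' v') w)) u') =
      cl d (T @ U) (wedge_map T U f g) (compose (cube d) (box_prod m n u v) w)"
      unfolding p' prod.case by (rule inner[OF p[unfolded p']])
  qed
qed

abbreviation tensor_step where
  "tensor_step \<equiv> colim_step (box_elts K \<times> box_elts K) (tensor_hom K K) tensor_obj tensor_map"

lemma prod_value_step:
  assumes "tensor_step d s t"
  shows "prod_value d s = prod_value d t"
proof -
  obtain i j h w where *: "i \<in> box_elts K \<times> box_elts K" "j \<in> box_elts K \<times> box_elts K"
      "h \<in> tensor_hom K K i j" "w \<in> cells (tensor_obj i) d" "s = (i, w)" "t = (j, tensor_map i j h d w)"
    using assms unfolding colim_step_def by blast
  obtain m A n B where i: "i = ((m, A), (n, B))" by (metis surj_pair)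
  obtain m' A' n' B' where j: "j = ((m', A'), (n', B'))" by (metis surj_pair)
  obtain a b where h: "h = (a, b)" by (cases h)
  have ab: "box_hom m m' a" "act K m m' a A' = A" "box_hom n n' b" "act K n n' b B' = B"
    using *(3) by (simp_all add: i j h tensor_hom_def box_elts_hom_def)
  have "A' \<in> cells K m'" "B' \<in> cells K n'" using *(2) by (simp_all add: j box_elts_def)
  then obtain T f u U g v where A: "over T f" "box_hom m' (neck_dim T) u" "A' = cl m' T f u"
    and B: "over U g" "box_hom n' (neck_dim U) v" "B' = cl n' U g v"
    unfolding cells_K by blast
  have w: "box_hom d (m + n) w" using *(4) by (simp add: i tensor_obj_def yoneda_def)
  have t: "t = (((m', A'), (n', B')), compose (cube d) (box_prod m n a b) w)"
    using *(6) by (simp add: i j h tensor_map_def)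
  have A': "A = cl m T f (compose (cube m) u a)" using act_K[OF A(1,2) ab(1)] ab(2) A(3) by simp
  have B': "B = cl n U g (compose (cube n) v b)" using act_K[OF B(1,2) ab(3)] ab(4) B(3) by simp
  have "prod_value d s = cl d (T @ U) (wedge_map T U f g)
      (compose (cube d) (box_prod m n (compose (cube m) u a) (compose (cube n) v b)) w)"
    unfolding *(5) i A' B'
    by (rule prod_value_cl[OF w A(1) box_hom.comp[OF ab(1) A(2)] B(1) box_hom.comp[OF ab(3) B(2)]])
  also have "\<dots> = prod_value d t"
    unfolding t A(3) B(3)
    by (subst prod_value_cl[OF box_hom.comp[OF w box_hom_prod[OF ab(1,3)]] A(1,2) B(1,2)])
       (simp only: compose_box_prod[OF ab(1,3) w])
  finally show ?thesis .
qed

lemma prod_value_equivclp: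
  assumes "equivclp (tensor_step d) s t"
  shows "prod_value d s = prod_value d t"
  using assms
proof (induction rule: equivclp_induct)
  case (step y z)
  have "prod_value d y = prod_value d z"
    using step(2)
  proof
    assume "tensor_step d y z"
    then show ?thesis by (rule prod_value_step)
  next
    assume "tensor_step d z y"
    then show ?thesis by (rule prod_value_step[symmetric])
  qed
  then show ?case using step(3) by simp
qed simp

definition cell_mult :: "nat \<Rightarrow> nat \<Rightarrow> 'a rig_cell \<Rightarrow> 'a rig_cell \<Rightarrow> 'a rig_cell" where
  "cell_mult m n A B = rig_comp S x x x (m + n) (tensor_cell K K m n A B)"

text \<open>
  The composition may be computed on the representative of the tensor cell whose morphism of cubes is
  the identity.
\<close>

lemma cell_mult_cl:
  assumes f: "over T f" "box_hom m (neck_dim T) u" and g: "over U g" "box_hom n (neck_dim U) v"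
  shows "cell_mult m n (cl m T f u) (cl n U g v) = cl (m + n) (T @ U) (wedge_map T U f g) (box_prod m n u v)"
proof -
  let ?s = "(((m, cl m T f u), (n, cl n U g v)), idm Box (m + n))"
  let ?c = "tensor_cell K K m n (cl m T f u) (cl n U g v)"
  have "?s \<in> (SIGMA i:box_elts K \<times> box_elts K. cells (tensor_obj i) (m + n))"
    using cl_in[OF f] cl_in[OF g] by (simp add: box_elts_def tensor_obj_def yoneda_def del: pts_Box)
  then have self: "?s \<in> ?c"
    unfolding tensor_cell_def by (rule colim_rel_self)
  have "rig_comp S x x x (m + n) ?c = (\<Union>p\<in>?c. prod_value (m + n) p)"
    unfolding rig_comp_def prod_value_def by (simp only: case_prod_unfold)
  also have "\<dots> = prod_value (m + n) ?s"
  proof (rule UN_coset_const[OF _ self])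
    fix p assume p: "p \<in> ?c"
    from p have "equivclp (tensor_step (m + n)) ?s p"
      unfolding tensor_cell_def Image_singleton_iff colim_rel_iff by (elim conjE)
    then show "prod_value (m + n) p = prod_value (m + n) ?s"
      by (rule prod_value_equivclp[symmetric])
  qed
  also have "\<dots> = cl (m + n) (T @ U) (wedge_map T U f g) (box_prod m n u v)"
    unfolding prod_value_cl[OF box_hom_id f g] compose_id_right_box[OF box_hom_prod[OF f(2) g(2)]] ..
  finally show ?thesis by (simp only: cell_mult_def)
qed

lemma cell_mult_in:
  assumes "A \<in> cells K m" "B \<in> cells K n"
  shows "cell_mult m n A B \<in> cells K (m + n)"
proof -
  obtain T f u U g v where A: "over T f" "box_hom m (neck_dim T) u" "A = cl m T f u"
    and B: "over U g" "box_hom n (neck_dim U) v" "B = cl n U g v"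
    using assms unfolding cells_K by blast
  show ?thesis
    unfolding A(3) B(3) cell_mult_cl[OF A(1,2) B(1,2)]
    by (rule cl_in[OF over_wedge[OF A(1) B(1)]])
       (unfold neck_dim_append, rule box_hom_prod[OF A(2) B(2)])
qed

lemma act_cell_mult:
  assumes "A \<in> cells K m" "B \<in> cells K n" and a: "box_hom m' m a" and b: "box_hom n' n b"
  shows "act K (m' + n') (m + n) (box_prod m' n' a b) (cell_mult m n A B) =
    cell_mult m' n' (act K m' m a A) (act K n' n b B)"
proof -
  obtain T f u U g v where A: "over T f" "box_hom m (neck_dim T) u" "A = cl m T f u"
    and B: "over U g" "box_hom n (neck_dim U) v" "B = cl n U g v"
    using assms(1,2) unfolding cells_K by blast
  have hom: "box_hom (m + n) (neck_dim (T @ U)) (box_prod m n u v)"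
    unfolding neck_dim_append by (rule box_hom_prod[OF A(2) B(2)])
  show ?thesis
    unfolding A(3) B(3) cell_mult_cl[OF A(1,2) B(1,2)] act_K[OF over_wedge[OF A(1) B(1)] hom box_hom_prod[OF a b]]
      act_K[OF A(1,2) a] act_K[OF B(1,2) b]
      cell_mult_cl[OF A(1) box_hom.comp[OF a A(2)] B(1) box_hom.comp[OF b B(2)]]
      box_prod_compose[OF a b] ..
qed

lemma cell_mult_degenerate_left:
  assumes "A \<in> box_degenerate K m" "B \<in> cells K n"
  shows "cell_mult m n A B \<in> box_degenerate K (m + n)"
  using assms(1)
proof (cases rule: degenerate_cases)
  case (degen j \<tau>)
  have d: "box_hom m (m - 1) (box_degen m (Suc j))" using degen(1) by (intro box_hom.degen) auto
  have mn: "m + n - 1 = m - 1 + n" using degen(1) by simp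
  have "cell_mult m n A B = act K (m + n) (m + n - 1) (box_degen (m + n) (Suc j)) (cell_mult (m - 1) n \<tau> B)"
    using act_cell_mult[OF degen(2) assms(2) d box_hom_id] degen(1) box_degen_prod_left[of "Suc j" m n]
    unfolding degen(3) mn act_id[OF assms(2)] by simp
  moreover have "cell_mult (m - 1) n \<tau> B \<in> cells K (m + n - 1)"
    unfolding mn by (rule cell_mult_in[OF degen(2) assms(2)])
  ultimately show ?thesis using degen(1) unfolding box_degenerate_def
    by (intro UnI1 UN_I[of "Suc j"]) auto
next
  case (conn j \<tau>)
  have d: "box_hom m (m - 1) (box_conn m (Suc j))" using conn(1) by (intro box_hom.conn) auto
  have mn: "m + n - 1 = m - 1 + n" using conn(1) by simp
  have "box_conn (m + n) (Suc j) = box_prod m n (box_conn m (Suc j)) (idm Box n)"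
    using conn(1) by (intro box_conn_prod_left) auto
  then have "cell_mult m n A B = act K (m + n) (m + n - 1) (box_conn (m + n) (Suc j)) (cell_mult (m - 1) n \<tau> B)"
    using act_cell_mult[OF conn(2) assms(2) d box_hom_id]
    unfolding conn(3) mn act_id[OF assms(2)] by simp
  moreover have "cell_mult (m - 1) n \<tau> B \<in> cells K (m + n - 1)"
    unfolding mn by (rule cell_mult_in[OF conn(2) assms(2)])
  ultimately show ?thesis using conn(1) unfolding box_degenerate_def
    by (intro UnI2 UN_I[of "Suc j"]) auto
qed

lemma cell_mult_degenerate_right:
  assumes "A \<in> cells K m" "B \<in> box_degenerate K n"
  shows "cell_mult m n A B \<in> box_degenerate K (m + n)"
  using assms(2)
proof (cases rule: degenerate_cases)
  case (degen j \<tau>)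
  have d: "box_hom n (n - 1) (box_degen n (Suc j))" using degen(1) by (intro box_hom.degen) auto
  have mn: "m + n - 1 = m + (n - 1)" using degen(1) by simp
  have "cell_mult m n A B = act K (m + n) (m + n - 1) (box_degen (m + n) (m + Suc j)) (cell_mult m (n - 1) A \<tau>)"
    using act_cell_mult[OF assms(1) degen(2) box_hom_id d] box_degen_prod_right[of "Suc j" m n]
    unfolding degen(3) mn act_id[OF assms(1)] by simp
  moreover have "cell_mult m (n - 1) A \<tau> \<in> cells K (m + n - 1)"
    unfolding mn by (rule cell_mult_in[OF assms(1) degen(2)])
  ultimately show ?thesis using degen(1) unfolding box_degenerate_def
    by (intro UnI1 UN_I[of "m + Suc j"]) auto
next
  case (conn j \<tau>)
  have d: "box_hom n (n - 1) (box_conn n (Suc j))" using conn(1) by (intro box_hom.conn) auto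
  have mn: "m + n - 1 = m + (n - 1)" using conn(1) by simp
  have "box_conn (m + n) (m + Suc j) = box_prod m n (idm Box m) (box_conn n (Suc j))"
    by (intro box_conn_prod_right) auto
  then have "cell_mult m n A B = act K (m + n) (m + n - 1) (box_conn (m + n) (m + Suc j)) (cell_mult m (n - 1) A \<tau>)"
    using act_cell_mult[OF assms(1) conn(2) box_hom_id d]
    unfolding conn(3) mn act_id[OF assms(1)] by simp
  moreover have "cell_mult m (n - 1) A \<tau> \<in> cells K (m + n - 1)"
    unfolding mn by (rule cell_mult_in[OF assms(1) conn(2)])
  ultimately show ?thesis using conn(1) unfolding box_degenerate_def
    by (intro UnI2 UN_I[of "m + Suc j"]) auto
qed

text \<open>
  The faces in the first \<open>m\<close> directions act on the first factor and the others on the second one; the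
  shift of the index by \<open>m\<close> produces the sign.
\<close>

lemma boundary_cell_mult:
  assumes A: "A \<in> cells K m" and B: "B \<in> cells K n"
  shows "box_boundary K (m + n) (cell_mult m n A B) =
    lin (\<lambda>a. gen (cell_mult (m - 1) n a B)) (box_boundary K m A) +
    cscale ((-1) ^ m) (lin (\<lambda>b. gen (cell_mult m (n - 1) A b)) (box_boundary K n B) ::
      'a rig_cell \<Rightarrow>\<^sub>0 'k::{comm_ring,comm_monoid_mult})"
proof -
  let ?F = "\<lambda>j e. act K (m + n - 1) (m + n) (box_face (m + n - 1) j e) (cell_mult m n A B)"
  let ?f = "\<lambda>j. cscale ((-1) ^ j) (gen (?F j True) - gen (?F j False)) :: 'a rig_cell \<Rightarrow>\<^sub>0 'k"
  have left: "?F j e = cell_mult (m - 1) n (act K (m - 1) m (box_face (m - 1) j e) A) B"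
    if j: "j \<in> {1..m}" for j e
  proof -
    have mn: "m + n - 1 = m - 1 + n" using j by simp
    have "box_face (m - 1 + n) j e = box_prod (m - 1) n (box_face (m - 1) j e) (idm Box n)"
      using j by (intro box_face_prod_left) auto
    then show ?thesis
      using act_cell_mult[OF A B face_hom[of j m e] box_hom_id] j unfolding mn act_id[OF B] by simp
  qed
  have right: "?F (m + i) e = cell_mult m (n - 1) A (act K (n - 1) n (box_face (n - 1) i e) B)"
    if i: "i \<in> {1..n}" for i e
  proof -
    have mn: "m + n - 1 = m + (n - 1)" using i by simp
    have "box_face (m + (n - 1)) (m + i) e = box_prod m (n - 1) (idm Box m) (box_face (n - 1) i e)"
      using i by (intro box_face_prod_right) auto
    then show ?thesis
      using act_cell_mult[OF A B box_hom_id face_hom[of i n e]] i unfolding mn act_id[OF A] by simp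
  qed
  have "{1..m + n} = {1..m} \<union> (+) m ` {1..n}"
  proof (rule set_eqI)
    fix j
    show "j \<in> {1..m + n} \<longleftrightarrow> j \<in> {1..m} \<union> (+) m ` {1..n}"
    proof (cases "j \<le> m")
      case False
      then obtain i where "j = m + i" "0 < i" using less_imp_add_positive[of m j] by auto
      then show ?thesis by auto
    qed auto
  qed
  then have "(\<Sum>j=1..m+n. ?f j) = (\<Sum>j\<in>{1..m}. ?f j) + (\<Sum>j\<in>(+) m ` {1..n}. ?f j)"
    by (simp only:) (rule sum.union_disjoint, auto)
  also have "(\<Sum>j\<in>(+) m ` {1..n}. ?f j) = (\<Sum>i\<in>{1..n}. ?f (m + i))"
    by (subst sum.reindex) simp_all
  also have "(\<Sum>j\<in>{1..m}. ?f j) = lin (\<lambda>a. gen (cell_mult (m - 1) n a B)) (box_boundary K m A)"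
    unfolding box_boundary_def[of K m] lin_simps lin_gen by (rule sum.cong[OF refl]) (simp only: left)
  also have "(\<Sum>i\<in>{1..n}. ?f (m + i)) =
      cscale ((-1) ^ m) (lin (\<lambda>b. gen (cell_mult m (n - 1) A b)) (box_boundary K n B))"
    unfolding box_boundary_def[of K n] lin_simps lin_gen cscale_sum cscale_cscale
    by (rule sum.cong[OF refl]) (simp only: right power_add)
  finally show ?thesis unfolding box_boundary_def[of K "m + n"] .
qed

section \<open>The value of a product\<close>

lemma bead_product_cong:
  assumes "\<And>us a b vs. xs = us @ a # b # vs \<Longrightarrow> bead f (X \<inter> {p a..p b}) = (bead g (X' \<inter> {a..b}) :: 'a word \<Rightarrow>\<^sub>0 'k)"
  shows "bead_product f X (map p xs) =
    (bead_product g X' xs :: 'a word \<Rightarrow>\<^sub>0 'k::{comm_ring,comm_monoid_mult})"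
  using assms
proof (induction xs)
  case (Cons a xs)
  show ?case
  proof (cases xs)
    case (Cons b vs)
    have "bead_product f X (map p xs) = (bead_product g X' xs :: 'a word \<Rightarrow>\<^sub>0 'k)"
      by (rule Cons.IH) (use Cons.prems[of "a # _"] in simp)
    then show ?thesis using Cons.prems[of "[]" a b vs] Cons by simp
  qed simp
qed simp

lemma upper_lower:
  assumes "box_hom n (neck_dim T) u"
  shows "joints T \<subseteq> lower n T u" "lower n T u \<subseteq> upper n T u" "upper n T u \<subseteq> {..sum_list T}"
    "finite (lower n T u)" "finite (upper n T u)" "card (upper n T u - lower n T u) \<le> n"
proof -
  have len: "length (u v) = neck_dim T" if "length v = n" for v using box_hom_length[OF assms that] .
  show "joints T \<subseteq> lower n T u" "lower n T u \<subseteq> upper n T u"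
    using joints_subset_vertex_set[of T] box_hom_mono[OF assms]
    by (auto simp: upper_def lower_def vertex_set_def)
  show up: "upper n T u \<subseteq> {..sum_list T}"
    using vertex_set_subset[OF len[of "replicate n True"]] by (auto simp: upper_def neck_verts_def)
  show "finite (lower n T u)" "finite (upper n T u)"
    by (simp_all add: lower_def upper_def vertex_set_def)
  have "upper n T u - lower n T u \<subseteq> (\<lambda>i. free_verts T ! i) ` rank n u"
    by (auto simp: upper_def lower_def vertex_set_def rank_def)
  then have "card (upper n T u - lower n T u) \<le> card ((\<lambda>i. free_verts T ! i) ` rank n u)"
    by (intro card_mono) (auto simp: rank_def)
  also have "\<dots> \<le> card (rank n u)" by (intro card_image_le) (auto simp: rank_def)
  also have "\<dots> \<le> n" by (rule card_rank_le[OF assms])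
  finally show "card (upper n T u - lower n T u) \<le> n" .
qed

text \<open>
  The subnecklace of the product is the wedge of the two subnecklaces at the joint \<open>sum_list T\<close>. As ranks
  are bounded by the dimensions, the product has full rank only if both factors have.
\<close>

lemma cell_value_mult:
  assumes "A \<in> cells K m" "B \<in> cells K n"
  shows "cell_value (m + n) (cell_mult m n A B) =
    (cell_value m A \<odot> cell_value n B :: 'a word \<Rightarrow>\<^sub>0 'k::{comm_ring,comm_monoid_mult})"
proof -
  obtain T f u U g v where A: "over T f" "box_hom m (neck_dim T) u" "A = cl m T f u"
    and B: "over U g" "box_hom n (neck_dim U) v" "B = cl n U g v"
    using assms unfolding cells_K by blast
  let ?N = "sum_list T"
  let ?W = "wedge_map T U f g" and ?w = "box_prod m n u v"
  have hom: "box_hom (m + n) (neck_dim (T @ U)) ?w"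
    unfolding neck_dim_append by (rule box_hom_prod[OF A(2) B(2)])
  define XT YT XU YU where "XT = upper m T u" and "YT = lower m T u" and "XU = upper n U v" and "YU = lower n U v"
  note TT = upper_lower[OF A(2), folded XT_def YT_def] and UU = upper_lower[OF B(2), folded XU_def YU_def]
  define X Y where "X = XT \<union> (+) ?N ` XU" and "Y = YT \<union> (+) ?N ` YU"
  have vs: "vertex_set (T @ U) (?w (replicate (m + n) e)) =
      vertex_set T (u (replicate m e)) \<union> (+) ?N ` vertex_set U (v (replicate n e))" for e
    unfolding replicate_add
    by (simp add: box_prod_append box_hom_length[OF A(2)] box_hom_length[OF B(2)] vertex_set_append)
  have up: "upper (m + n) (T @ U) ?w = X" and lo: "lower (m + n) (T @ U) ?w = Y"
    using vs by (simp_all add: upper_def lower_def X_def Y_def XT_def XU_def YT_def YU_def)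
  have "?N \<in> YT" "0 \<in> YU"
    by (rule subsetD[OF TT(1) last_in_joints], rule subsetD[OF UU(1) zero_in_joints])
  then have ends: "?N \<in> YT" "?N \<in> XT" "0 \<in> YU" "0 \<in> XU"
    using subsetD[OF TT(2)] subsetD[OF UU(2)] by simp_all
  have "X - Y = (XT - YT) \<union> (+) ?N ` (XU - YU)"
  proof (rule set_eqI)
    fix z
    show "z \<in> X - Y \<longleftrightarrow> z \<in> (XT - YT) \<union> (+) ?N ` (XU - YU)"
    proof (cases "z \<le> ?N")
      case True
      then have "z \<in> (+) ?N ` Z \<longleftrightarrow> z = ?N \<and> 0 \<in> Z" for Z by auto
      then show ?thesis using ends by (auto simp: X_def Y_def)
    next
      case False
      then have "z \<notin> XT" "z \<notin> YT" using TT(2,3) by auto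
      then show ?thesis by (auto simp: X_def Y_def)
    qed
  qed
  moreover have "(XT - YT) \<inter> (+) ?N ` (XU - YU) = {}" using TT(3) ends by auto
  ultimately have card: "card (X - Y) = card (XT - YT) + card (XU - YU)"
    using TT(5) UU(5) by (simp add: card_Un_disjoint card_image)
  have valm: "cell_value (m + n) (cell_mult m n A B) = (if card (X - Y) = m + n
      then bead_product ?W X (sorted_list_of_set Y) else 0 :: 'a word \<Rightarrow>\<^sub>0 'k)"
    unfolding A(3) B(3) cell_mult_cl[OF A(1,2) B(1,2)] cell_value_cl[OF over_wedge[OF A(1) B(1)] hom]
    by (simp add: val_def up lo)
  have valA: "cell_value m A = (if card (XT - YT) = m then bead_product f XT (sorted_list_of_set YT) else 0 :: 'a word \<Rightarrow>\<^sub>0 'k)"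
    unfolding A(3) cell_value_cl[OF A(1,2)] by (simp add: val_def XT_def YT_def)
  have valB: "cell_value n B = (if card (XU - YU) = n then bead_product g XU (sorted_list_of_set YU) else 0 :: 'a word \<Rightarrow>\<^sub>0 'k)"
    unfolding B(3) cell_value_cl[OF B(1,2)] by (simp add: val_def XU_def YU_def)
  have sT: "set (sorted_list_of_set YT) = YT" and sU: "set (sorted_list_of_set YU) = YU" using TT(4) UU(4) by simp_all
  have strT: "sorted_wrt (<) (sorted_list_of_set YT)" and strU: "sorted_wrt (<) (sorted_list_of_set YU)" by simp_all
  obtain xs where xs: "sorted_list_of_set YT = xs @ [?N]"
  proof -
    have ne: "sorted_list_of_set YT \<noteq> []" using ends(1) sT by force
    have "last (sorted_list_of_set YT) \<in> YT" using last_in_set[OF ne] sT by simp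
    then have "last (sorted_list_of_set YT) \<le> ?N" using TT(2,3) by auto
    moreover have "?N \<le> last (sorted_list_of_set YT)" using sorted_le_last[of _ ?N] ends(1) sT by simp
    ultimately have "last (sorted_list_of_set YT) = ?N" by simp
    then show thesis using that append_butlast_last_id[OF ne] by metis
  qed
  obtain ys where ys: "sorted_list_of_set YU = 0 # ys"
  proof -
    have ne: "sorted_list_of_set YU \<noteq> []" using ends(3) sU by force
    have "hd (sorted_list_of_set YU) \<le> 0" using sorted_hd_le[of _ 0] ends(3) sU by simp
    then show thesis using that ne by (cases "sorted_list_of_set YU") auto
  qed
  have "sorted_list_of_set Y = xs @ ?N # map ((+) ?N) ys"
  proof -
    have sx: "sorted_wrt (<) xs" "\<And>a. a \<in> set xs \<Longrightarrow> a < ?N"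
      using strT[unfolded xs] by (simp_all add: sorted_wrt_append)
    have sy: "sorted_wrt (<) ys" "\<And>b. b \<in> set ys \<Longrightarrow> 0 < b"
      using strU[unfolded ys] by simp_all
    have "sorted_wrt (<) (map ((+) ?N) ys)" using sy(1) by (simp add: sorted_wrt_map)
    moreover have "a < c" if "a \<in> set xs" "c \<in> set (?N # map ((+) ?N) ys)" for a c
      using sx(2)[OF that(1)] that(2) by auto
    ultimately have str: "sorted_wrt (<) (xs @ ?N # map ((+) ?N) ys)"
      using sx(1) sy(2) by (simp add: sorted_wrt_append)
    have "Y = insert ?N (set xs) \<union> (+) ?N ` insert 0 (set ys)"
      using sT[unfolded xs] sU[unfolded ys] by (simp add: Y_def)
    then have set: "set (xs @ ?N # map ((+) ?N) ys) = Y" by auto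
    have "finite Y" using TT(4) UU(4) by (simp add: Y_def)
    then show ?thesis
      using str set by (intro sorted_distinct_set_unique) (simp_all only: strict_sorted_iff set_sorted_list_of_set
          sorted_sorted_list_of_set distinct_sorted_list_of_set)
  qed
  then have "bead_product ?W X (sorted_list_of_set Y) =
      (bead_product ?W X (xs @ [?N]) \<odot> bead_product ?W X (?N # map ((+) ?N) ys) :: 'a word \<Rightarrow>\<^sub>0 'k)"
    by (simp only:) (rule bead_product_append)
  also have "bead_product ?W X (xs @ [?N]) = (bead_product f XT (sorted_list_of_set YT) :: 'a word \<Rightarrow>\<^sub>0 'k)"
    unfolding xs[symmetric]
  proof (rule bead_product_cong[where p = "\<lambda>a. a" and xs = "sorted_list_of_set YT", simplified])
    fix us a b vs assume l: "sorted_list_of_set YT = us @ a # b # vs"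
    have ab: "a \<in> YT" "b \<in> YT" using arg_cong[OF l, of set] sT by auto
    have lt: "a < b" using strT unfolding l by (simp add: sorted_wrt_append)
    have consec: "\<not> (a < y \<and> y < b)" if "y \<in> YT" for y
      using sorted_consecutive[of us a b vs y] strT that sT unfolding l by blast
    have bN: "b \<le> ?N" using ab(2) TT(2,3) by auto
    have eq: "X \<inter> {a..b} = XT \<inter> {a..b}"
    proof (rule set_eqI)
      fix z show "z \<in> X \<inter> {a..b} \<longleftrightarrow> z \<in> XT \<inter> {a..b}"
      proof (cases "z \<in> (+) ?N ` XU")
        case True
        then have "z \<le> b \<longrightarrow> z = ?N" using bN by auto
        then show ?thesis using ends(2) by (auto simp: X_def)
      qed (auto simp: X_def)
    qed
    let ?A = "XT \<inter> {a..b}"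
    have "enum ?A \<in> cells (neck T) (card ?A - 1)"
    proof (rule enum_cell)
      show "finite ?A" "?A \<noteq> {}" "?A \<subseteq> {..sum_list T}" using TT ab lt by auto
      fix j c d assume j: "j \<in> joints T" "c \<in> ?A" "d \<in> ?A" "c < j" "j < d"
      then show False using consec[of j] TT(1) by auto
    qed
    then show "bead ?W (X \<inter> {a..b}) = (bead f ?A :: 'a word \<Rightarrow>\<^sub>0 'k)"
      unfolding eq by (simp add: bead_def wedge_map_left)
  qed
  also have "bead_product ?W X (?N # map ((+) ?N) ys) = (bead_product g XU (sorted_list_of_set YU) :: 'a word \<Rightarrow>\<^sub>0 'k)"
  proof -
    have "bead_product ?W X (map ((+) ?N) (sorted_list_of_set YU)) =
        (bead_product g XU (sorted_list_of_set YU) :: 'a word \<Rightarrow>\<^sub>0 'k)"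
    proof (rule bead_product_cong)
      fix us a b vs assume l: "sorted_list_of_set YU = us @ a # b # vs"
      have ab: "a \<in> YU" "b \<in> YU" using arg_cong[OF l, of set] sU by auto
      have lt: "a < b" using strU unfolding l by (simp add: sorted_wrt_append)
      have consec: "\<not> (a < y \<and> y < b)" if "y \<in> YU" for y
        using sorted_consecutive[of us a b vs y] strU that sU unfolding l by blast
      let ?A = "XU \<inter> {a..b}"
      have eq: "X \<inter> {?N + a..?N + b} = (+) ?N ` ?A"
      proof (rule set_eqI)
        fix z show "z \<in> X \<inter> {?N + a..?N + b} \<longleftrightarrow> z \<in> (+) ?N ` ?A"
        proof (cases "z \<in> XT")
          case True
          then have "?N + a \<le> z \<Longrightarrow> z = ?N \<and> a = 0" using TT(3) by auto
          then show ?thesis using ends(4) by (auto simp: X_def)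
        qed (auto simp: X_def)
      qed
      have fA: "finite ?A" "?A \<noteq> {}" "?A \<subseteq> {..sum_list U}" using UU ab lt by auto
      have c: "enum ?A \<in> cells (neck U) (card ?A - 1)"
      proof (rule enum_cell[OF fA])
        fix j c d assume j: "j \<in> joints U" "c \<in> ?A" "d \<in> ?A" "c < j" "j < d"
        then show False using consec[of j] UU(1) by auto
      qed
      have im: "card ((+) ?N ` ?A) = card ?A"
        "enum ((+) ?N ` ?A) = (\<lambda>i\<in>{..card ?A - 1}. ?N + enum ?A i)"
        by (rule enum_image[OF fA(1,2)]; simp)+
      show "bead ?W (X \<inter> {?N + a..?N + b}) = (bead g ?A :: 'a word \<Rightarrow>\<^sub>0 'k)"
        unfolding eq bead_def im wedge_map_right[OF A(1) B(1) c] ..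
    qed
    then show ?thesis by (simp add: ys)
  qed
  finally have prod: "bead_product ?W X (sorted_list_of_set Y) =
      (bead_product f XT (sorted_list_of_set YT) \<odot> bead_product g XU (sorted_list_of_set YU) :: 'a word \<Rightarrow>\<^sub>0 'k)" .
  have iff: "card (X - Y) = m + n \<longleftrightarrow> card (XT - YT) = m \<and> card (XU - YU) = n"
    using card TT(6) UU(6) by linarith
  show ?thesis
    unfolding valm valA valB iff prod by (auto simp: word_mult_left(3) word_mult_right(3) simp del: bilin_gen)
qed

end

section \<open>Necklaces with prescribed joints\<close>

lemma ex_necklace_joints:
  assumes "finite J" "0 \<in> J"
  shows "\<exists>T\<in>necklaces. joints T = J \<and> sum_list T = Max J"
  using assms
proof (induction "card J" arbitrary: J rule: less_induct)
  case less
  show ?case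
  proof (cases "J = {0}")
    case True
    then show ?thesis by (intro bexI[of _ "[]"]) (auto simp: necklaces_def)
  next
    case False
    define M where "M = Max J"
    have M: "M \<in> J" "\<And>j. j \<in> J \<Longrightarrow> j \<le> M"
      using Max_in[OF less.prems(1)] Max_ge[OF less.prems(1)] less.prems(2) by (auto simp: M_def)
    obtain k where "k \<in> J" "k \<noteq> 0" using False less.prems(2) by blast
    then have "0 < M" using M(2)[of k] by simp
    define J' where "J' = J - {M}"
    have J': "finite J'" "0 \<in> J'" "J = insert M J'" using less.prems \<open>0 < M\<close> M(1) by (auto simp: J'_def)
    have "card J' < card J" unfolding J'_def by (rule card_Diff1_less[OF less.prems(1) M(1)])
    then obtain T where T: "T \<in> necklaces" "joints T = J'" "sum_list T = Max J'"
      using less.hyps[OF _ J'(1,2)] by blast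
    have Max': "Max J' \<in> J'" using Max_in[OF J'(1)] J'(2) by auto
    then have "Max J' < M" using M(2)[of "Max J'"] by (auto simp: J'_def order_le_less)
    then have "T @ [M - Max J'] \<in> necklaces" using T(1) by (auto simp: necklaces_def)
    moreover have "joints (T @ [M - Max J']) = J"
      using \<open>Max J' < M\<close> Max' J'(3) by (auto simp: joints_append joints_Cons T)
    moreover have "sum_list (T @ [M - Max J']) = Max J"
      using \<open>Max J' < M\<close> by (simp add: T M_def)
    ultimately show ?thesis by blast
  qed
qed

lemma strict_sorted_map_enum:
  assumes "sorted_wrt (<) (xs :: nat list)" "set xs = A"
  shows "sorted_list_of_set A = xs"
  using assms by (intro sorted_distinct_set_unique) (auto simp: strict_sorted_iff)

context reduced_simplicial
begin

lemma enum_eqI: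
  assumes w: "w \<in> extensional {..k}" "\<And>i j. i < j \<Longrightarrow> j \<le> k \<Longrightarrow> w i < (w j :: nat)" and A: "w ` {..k} = A"
  shows "card A = Suc k" "enum A = w"
proof -
  have "sorted_wrt (<) (map w [0..<Suc k])" using w(2)
    by (auto simp: sorted_wrt_iff_nth_less simp del: upt_Suc)
  moreover have "set (map w [0..<Suc k]) = A"
    using A by (simp add: atLeast0LessThan lessThan_Suc_atMost del: upt_Suc)
  ultimately have l: "sorted_list_of_set A = map w [0..<Suc k]" by (rule strict_sorted_map_enum)
  show card: "card A = Suc k" using arg_cong[OF l, of length] by simp
  show "enum A = w"
  proof (rule extensionalityI[OF _ w(1)])
    show "enum A \<in> extensional {..k}" by (simp add: enum_def card)
    fix i assume "i \<in> {..k}"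
    then show "enum A i = w i" by (simp add: enum_def card l del: upt_Suc)
  qed
qed

lemma over_comp:
  assumes f: "over T f" and h: "h \<in> nec_hom T' T" and T': "T' \<in> necklaces"
  defines "f' \<equiv> \<lambda>n. \<lambda>c\<in>cells (neck T') n. f n (h n c)"
  shows "over T' f'" "triangle T' f' T f h"
proof -
  have f1: "f \<in> psh_hom Simplex (neck T) S" using f by (simp add: over_def)
  have h1: "h \<in> psh_hom Simplex (neck T') (neck T)" using h by (simp add: nec_hom_def)
  have "f' \<in> psh_hom Simplex (neck T') S"
  proof (rule psh_hom_neckI)
    show "f' n \<in> extensional (cells (neck T') n)" for n by (simp add: f'_def)
    show "f' n u \<in> cells S n" if "u \<in> cells (neck T') n" for n u
      using that psh_hom_neckD(2)[OF f1 psh_hom_neckD(2)[OF h1 that]] by (simp add: f'_def)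
    fix m n w u assume w: "w \<in> hom Simplex m n" and u: "u \<in> cells (neck T') n"
    show "f' m (compose {..m} u w) = act S m n w (f' n u)"
      using neck_act_in[OF u w] u psh_hom_neckD(3)[OF h1 w u]
        psh_hom_neckD(3)[OF f1 w psh_hom_neckD(2)[OF h1 u]]
      by (simp add: f'_def)
  qed
  then show "over T' f'" using T' by (simp add: over_def)
  show "triangle T' f' T f h" using h by (simp add: triangle_def f'_def)
qed

text \<open>
  A morphism of cubes of full rank is the inclusion of a face, and every face of the cube of a necklace
  is the cube of a subnecklace, which has as vertices the greatest and as joints the least value of the morphism.
\<close>

lemma cl_full_rank:
  assumes f: "over T f" and u: "box_hom n (neck_dim T) u" and full: "card (rank n u) = n"
  obtains T' f' where "over T' f'" "neck_dim T' = n" "cl n T f u = cl n T' f' (idm Box n)"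
proof -
  define X Y where "X = upper n T u" and "Y = lower n T u"
  note XY = upper_lower[OF u, folded X_def Y_def]
  have len: "length (u v) = neck_dim T" if "length v = n" for v using box_hom_length[OF u that] .
  have ends: "0 \<in> Y" "sum_list T \<in> Y"
    by (rule subsetD[OF XY(1) zero_in_joints], rule subsetD[OF XY(1) last_in_joints])
  then have ends': "0 \<in> X" "sum_list T \<in> X" using subsetD[OF XY(2)] by blast+
  have ne: "X \<noteq> {}" using ends' by auto
  define L where "L = card X - 1"
  define p where "p = enum X"
  have p_in: "p i \<in> X" if "i \<le> L" for i unfolding p_def by (rule enum_in[OF XY(5) ne that[unfolded L_def]])
  have p_surj: "\<exists>i\<le>L. p i = a" if "a \<in> X" for a unfolding p_def L_def by (rule ex_enum[OF XY(5) that])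
  have p_mono: "p i \<le> p j" if "i \<le> j" "j \<le> L" for i j
    unfolding p_def by (rule enum_le[OF XY(5) that(1) that(2)[unfolded L_def]])
  have p_inj: "inj_on p {..L}" unfolding p_def L_def by (rule enum_inj[OF XY(5) ne])
  have p_strict: "p i < p j" if "i < j" "j \<le> L" for i j
    using p_mono[of i j] inj_onD[OF p_inj, of i j] that by force
  have p0: "p 0 = 0"
  proof -
    obtain i where "i \<le> L" "p i = 0" using p_surj[OF ends'(1)] by blast
    then show ?thesis using p_mono[of 0 i] by simp
  qed
  have pL: "p L = sum_list T"
  proof -
    obtain i where "i \<le> L" "p i = sum_list T" using p_surj[OF ends'(2)] by blast
    then show ?thesis using p_mono[of i L] p_in[of L] XY(3) by auto
  qed
  define J where "J = {i. i \<le> L \<and> p i \<in> Y}"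
  have J0: "0 \<in> J" "L \<in> J" using p0 pL ends by (simp_all add: J_def)
  have "finite J" by (simp add: J_def)
  then obtain T' where T': "T' \<in> necklaces" "joints T' = J" "sum_list T' = Max J"
    using ex_necklace_joints[of J] J0 by blast
  have "Max J = L" using J0(2) \<open>finite J\<close> by (intro Max_eqI) (auto simp: J_def)
  then have sumT': "sum_list T' = L" using T' by simp
  have pJ: "p ` J = Y"
  proof
    show "p ` J \<subseteq> Y" by (auto simp: J_def)
    show "Y \<subseteq> p ` J"
    proof
      fix y assume y: "y \<in> Y"
      then obtain i where "i \<le> L" "p i = y" using p_surj[of y] XY(2) by blast
      then show "y \<in> p ` J" using y by (auto simp: J_def)
    qed
  qed
  define h where "h = nec_map_of T' p"
  have h: "h \<in> nec_hom T' T"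
    unfolding h_def
  proof (rule nec_map_of_in)
    show "p a \<le> p b" if "a \<le> b" "b \<le> sum_list T'" for a b using p_mono that sumT' by simp
    show "p 0 = 0" "p (sum_list T') = sum_list T" using p0 pL sumT' by simp_all
    show "joints T \<subseteq> p ` joints T'" unfolding T'(2) pJ by (rule XY(1))
  qed
  have on_h: "on_verts h v = p v" if "v \<le> L" for v
    unfolding h_def by (rule on_verts_nec_map_of) (simp add: that sumT')
  define f' where "f' = (\<lambda>n. \<lambda>c\<in>cells (neck T') n. f n (h n c))"
  note f' = over_comp[OF f h T'(1), folded f'_def]
  have verts: "neck_verts T' - joints T' = {..L} - J" by (simp add: neck_verts_def sumT' T'(2))
  have p_img: "p ` ({..L} - J) = X - Y"
  proof
    show "p ` ({..L} - J) \<subseteq> X - Y" using p_in by (auto simp: J_def)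
    show "X - Y \<subseteq> p ` ({..L} - J)"
    proof
      fix y assume y: "y \<in> X - Y"
      then obtain i where "i \<le> L" "p i = y" using p_surj[of y] by blast
      then show "y \<in> p ` ({..L} - J)" using y by (auto simp: J_def)
    qed
  qed
  let ?r = "sorted_list_of_set (rank n u)"
  have rank_less: "i < neck_dim T" if "i \<in> rank n u" for i
    using that support_less[OF len[of "replicate n True"]] by (auto simp: rank_def)
  have fin_rank: "finite (rank n u)" by (simp add: rank_def)
  have XYr: "X - Y = (\<lambda>i. free_verts T ! i) ` rank n u"
  proof -
    have lr: "length (replicate n b) = n" for b :: bool by simp
    have "free_verts T ! i \<in> vertex_set T (u (replicate n b)) \<longleftrightarrow> i \<in> support (u (replicate n b))"
      if "i < neck_dim T" for i b
      using nth_free_verts_in_vertex_set[OF len[OF lr] that] len[OF lr] that by (simp add: support_def)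
    then have iff: "i \<in> rank n u \<longleftrightarrow> free_verts T ! i \<in> X - Y" if "i < neck_dim T" for i
      using that by (simp add: rank_def X_def Y_def upper_def lower_def)
    have surj: "z \<in> (\<lambda>i. free_verts T ! i) ` {..<neck_dim T}" if "z \<in> X - Y" for z
    proof -
      have "z \<in> (\<lambda>i. free_verts T ! i) ` support (u (replicate n True))"
        using that joints_subset_vertex_set[of T "u (replicate n False)"]
        by (auto simp: X_def Y_def upper_def lower_def vertex_set_def)
      then show ?thesis using support_less[OF len[OF lr]] by auto
    qed
    show ?thesis
    proof (intro equalityI subsetI)
      fix z assume z: "z \<in> X - Y"
      then obtain i where "i < neck_dim T" "z = free_verts T ! i" using surj[OF z] by blast
      then show "z \<in> (\<lambda>i. free_verts T ! i) ` rank n u" using iff[of i] z by blast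
    next
      fix z assume "z \<in> (\<lambda>i. free_verts T ! i) ` rank n u"
      then obtain i where "i \<in> rank n u" "z = free_verts T ! i" by blast
      then show "z \<in> X - Y" using iff[OF rank_less] by blast
    qed
  qed
  \<comment> \<open>both lists enumerate \<open>X - Y\<close> in increasing order\<close>
  have mapeq: "map p (free_verts T') = map (\<lambda>i. free_verts T ! i) ?r"
  proof -
    have "sorted_wrt (<) (map p (free_verts T'))"
      unfolding sorted_wrt_map
    proof (rule sorted_wrt_mono_rel[OF _ sorted_free_verts])
      fix a b assume "a \<in> set (free_verts T')" "b \<in> set (free_verts T')" "a < b"
      then show "p a < p b" by (intro p_strict) (auto simp: set_free_verts verts)
    qed
    moreover have "set (map p (free_verts T')) = X - Y" by (simp add: set_free_verts verts p_img)
    ultimately have 1: "sorted_list_of_set (X - Y) = map p (free_verts T')" by (rule strict_sorted_map_enum)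
    have "sorted_wrt (<) (map (\<lambda>i. free_verts T ! i) ?r)"
      unfolding sorted_wrt_map
    proof (rule sorted_wrt_mono_rel[where P = "(<)"])
      show "sorted_wrt (<) ?r" by simp
      fix a b assume "a \<in> set ?r" "b \<in> set ?r" "a < b"
      then show "free_verts T ! a < free_verts T ! b"
        using sorted_free_verts[of T] rank_less[of b] fin_rank by (auto simp: sorted_wrt_iff_nth_less)
    qed
    moreover have "set (map (\<lambda>i. free_verts T ! i) ?r) = X - Y" using fin_rank by (simp add: XYr)
    ultimately have 2: "sorted_list_of_set (X - Y) = map (\<lambda>i. free_verts T ! i) ?r" by (rule strict_sorted_map_enum)
    show ?thesis using 1 2 by simp
  qed
  have dim: "neck_dim T' = n" using arg_cong[OF mapeq, of length] full fin_rank by simp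
  have "compose (cube n) (neck_cube_map T' T h) (idm Box n) = u"
  proof (rule extensionalityI[OF _ box_hom_extensional[OF u]])
    show "compose (cube n) (neck_cube_map T' T h) (idm Box n) \<in> extensional (cube n)" by simp
    fix v assume "v \<in> cube n"
    then have v: "length v = n" by simp
    then have v': "length v = neck_dim T'" by (simp add: dim)
    have nth: "p (free_verts T' ! j) = free_verts T ! (?r ! j)" if "j \<in> support v" for j
    proof -
      have j: "j < n" by (rule support_less[OF v that])
      then have "p (free_verts T' ! j) = map p (free_verts T') ! j" by (simp add: dim)
      also have "\<dots> = free_verts T ! (?r ! j)" unfolding mapeq using j full by simp
      finally show ?thesis .
    qed
    have "on_verts h ` vertex_set T' v = p ` vertex_set T' v"
      by (rule image_cong[OF refl], rule on_h)
         (use vertex_set_subset[OF v'] in \<open>auto simp: neck_verts_def sumT'\<close>)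
    also have "\<dots> = Y \<union> (\<lambda>j. p (free_verts T' ! j)) ` support v"
      by (simp add: vertex_set_def image_Un image_image T'(2) pJ)
    also have "\<dots> = Y \<union> (\<lambda>j. free_verts T ! (?r ! j)) ` support v"
      using nth by (simp cong: image_cong)
    also have "\<dots> = vertex_set T (u v)"
      unfolding vertex_set_def support_full_rank[OF u full v] Y_def lower_def by (simp add: image_Un image_image Un_assoc)
    finally have "vertex_set T (neck_cube_map T' T h v) = vertex_set T (u v)"
      using neck_cube_map_apply(2)[OF h v'] by simp
    then have "neck_cube_map T' T h v = u v"
      by (rule vertex_set_inj[OF neck_cube_map_apply(1)[OF h v'] len[OF v]])
    then show "compose (cube n) (neck_cube_map T' T h) (idm Box n) v = u v" using v by (simp add: compose_def)
  qed
  then have "cl n T' f' (idm Box n) = cl n T f u"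
    using box_hom_id[of n] by (intro cl_triangle[OF f'(1) f f'(2)]) (simp_all only: dim u)
  then show thesis using that[OF f'(1) dim] by simp
qed

section \<open>Beads\<close>

definition const_map :: "nat \<Rightarrow> (nat \<Rightarrow> nat) \<Rightarrow> 'a" where
  "const_map = (\<lambda>n. \<lambda>u\<in>cells (neck []) n. act S n 0 u x)"

lemma cells_neck_Nil: "u \<in> cells (neck []) n \<longleftrightarrow> u = (\<lambda>i\<in>{..n}. 0)"
proof
  assume u: "u \<in> cells (neck []) n"
  show "u = (\<lambda>i\<in>{..n}. 0)"
    by (rule extensionalityI[OF neck_cellD(1)[OF u]]) (use neck_cellD(3)[OF u] in auto)
qed (auto intro!: neck_cellI)

lemma over_Nil_eq:
  assumes "over [] f"
  shows "f = const_map"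
proof (rule ext)
  fix n
  have f: "f \<in> psh_hom Simplex (neck []) S" using assms by (simp add: over_def)
  show "f n = const_map n"
    by (rule extensionalityI[OF psh_hom_neckD(1)[OF f]])
       (auto simp: const_map_def cells_neck_Nil value_at_constant[OF f])
qed

lemma over_const_map: "over [] const_map"
proof -
  have c: "(\<lambda>i\<in>{..n}. 0) \<in> hom Simplex n 0" for n by (rule hom_SimplexI) auto
  have "const_map \<in> psh_hom Simplex (neck []) S"
  proof (rule psh_hom_neckI)
    show "const_map n u \<in> cells S n" if "u \<in> cells (neck []) n" for n u
      using that simp_act_in[OF c, of x n] reduced by (simp add: const_map_def cells_neck_Nil)
    fix m n w u assume w: "w \<in> hom Simplex m n" and u: "u \<in> cells (neck []) n"
    have "compose {..m} u w \<in> cells (neck []) m" by (rule neck_act_in[OF u w])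
    then have "compose {..m} u w = (\<lambda>i\<in>{..m}. 0)" by (simp add: cells_neck_Nil)
    moreover have "compose {..m} (\<lambda>i\<in>{..n}. 0 :: nat) w = (\<lambda>i\<in>{..m}. 0)"
      using hom_SimplexD(2)[OF w] by (auto simp: compose_def)
    ultimately show "const_map m (compose {..m} u w) = act S m n w (const_map n u)"
      using u simp_act_comp[OF w c, of x] reduced by (simp add: const_map_def cells_neck_Nil)
  qed (simp add: const_map_def)
  then show ?thesis by (simp add: over_def necklaces_def)
qed

lemma neck_dim_Nil [simp]: "neck_dim [] = 0"
  by (simp add: neck_dim_def neck_verts_def)

lemma joints_single: "joints [m] = {0, m}"
  by (auto simp: joints_Cons)

lemma free_verts_single: "free_verts [Suc i] = [1..<Suc i]"
  unfolding free_verts_def joints_single neck_verts_def by (rule strict_sorted_map_enum) (auto simp del: upt_Suc)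

lemma neck_dim_single [simp]: "neck_dim [Suc i] = i"
  using arg_cong[OF free_verts_single, of length] by simp

lemma cells_neck_single: "u \<in> cells (neck [m]) n \<longleftrightarrow> u \<in> hom Simplex n m"
  by (auto simp: neck_cell_iff joints_single hom_Simplex_iff monotone_on_def intro: order_trans)

definition bead_map :: "nat \<Rightarrow> 'a \<Rightarrow> nat \<Rightarrow> (nat \<Rightarrow> nat) \<Rightarrow> 'a" where
  "bead_map m \<sigma> = (\<lambda>n. \<lambda>u\<in>cells (neck [m]) n. act S n m u \<sigma>)"

lemma over_bead_map:
  assumes "\<sigma> \<in> cells S (Suc i)"
  shows "over [Suc i] (bead_map (Suc i) \<sigma>)"
proof -
  have "bead_map (Suc i) \<sigma> \<in> psh_hom Simplex (neck [Suc i]) S"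
  proof (rule psh_hom_neckI)
    show "bead_map (Suc i) \<sigma> n u \<in> cells S n" if "u \<in> cells (neck [Suc i]) n" for n u
      using that simp_act_in[of u n "Suc i" \<sigma>] assms by (simp add: bead_map_def cells_neck_single)
    fix m n w u assume w: "w \<in> hom Simplex m n" and u: "u \<in> cells (neck [Suc i]) n"
    show "bead_map (Suc i) \<sigma> m (compose {..m} u w) = act S m n w (bead_map (Suc i) \<sigma> n u)"
      using neck_act_in[OF u w] u simp_act_comp[OF w _ assms, of u]
      by (simp add: bead_map_def cells_neck_single)
  qed (simp add: bead_map_def)
  then show ?thesis by (simp add: over_def necklaces_def)
qed

text \<open>
  This is the Yoneda lemma for the standard simplex.
\<close>

lemma over_single_eq:
  assumes "over [Suc i] f"
  obtains \<sigma> where "\<sigma> \<in> cells S (Suc i)" "f = bead_map (Suc i) \<sigma>"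
proof -
  have f: "f \<in> psh_hom Simplex (neck [Suc i]) S" using assms by (simp add: over_def)
  define e where "e = restrict id {..Suc i}"
  have e: "e \<in> hom Simplex (Suc i) (Suc i)" by (rule hom_SimplexI) (auto simp: e_def)
  have ec: "e \<in> cells (neck [Suc i]) (Suc i)" using e by (simp only: cells_neck_single)
  have "f = bead_map (Suc i) (f (Suc i) e)"
  proof (rule ext)
    fix n
    show "f n = bead_map (Suc i) (f (Suc i) e) n"
    proof (rule extensionalityI[OF psh_hom_neckD(1)[OF f]])
      show "bead_map (Suc i) (f (Suc i) e) n \<in> extensional (cells (neck [Suc i]) n)"
        by (simp add: bead_map_def)
      fix u assume u: "u \<in> cells (neck [Suc i]) n"
      then have u': "u \<in> hom Simplex n (Suc i)" by (simp only: cells_neck_single)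
      have "compose {..n} e u = u"
        by (rule extensionalityI[OF _ hom_SimplexD(1)[OF u']])
           (use hom_SimplexD(2)[OF u'] in \<open>simp_all add: compose_def e_def\<close>)
      then show "f n u = bead_map (Suc i) (f (Suc i) e) n u"
        using psh_hom_neckD(3)[OF f u' ec] u by (simp add: bead_map_def)
    qed
  qed
  then show thesis using that psh_hom_neckD(2)[OF f ec] by blast
qed

lemma over_Cons_eq:
  assumes "over (m # T) f"
  obtains g h where "over [m] g" "over T h" "f = wedge_map [m] T g h"
proof -
  have nec: "[m] \<in> necklaces" "T \<in> necklaces" and f: "f \<in> psh_hom Simplex (neck ([m] @ T)) S"
    using assms by (auto simp: over_def necklaces_def)
  define g where "g n = (\<lambda>u\<in>cells (neck [m]) n. f n u)" for n
  define h where "h n = (\<lambda>u\<in>cells (neck T) n. f n (\<lambda>i\<in>{..n}. sum_list [m] + u i))" for n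
  have "g \<in> psh_hom Simplex (neck [m]) S"
  proof (rule psh_hom_neckI)
    show "g n u \<in> cells S n" if "u \<in> cells (neck [m]) n" for n u
      using that psh_hom_neckD(2)[OF f cell_append_left[OF that]] by (simp add: g_def)
    fix k n w u assume w: "w \<in> hom Simplex k n" and u: "u \<in> cells (neck [m]) n"
    show "g k (compose {..k} u w) = act S k n w (g n u)"
      using neck_act_in[OF u w] u psh_hom_neckD(3)[OF f w cell_append_left[OF u]] by (simp add: g_def)
  qed (simp add: g_def)
  then have g: "over [m] g" using nec by (simp add: over_def)
  have "h \<in> psh_hom Simplex (neck T) S"
  proof (rule psh_hom_neckI)
    show "h n u \<in> cells S n" if "u \<in> cells (neck T) n" for n u
      using that psh_hom_neckD(2)[OF f cell_append_right[OF that]] by (simp add: h_def)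
    fix k n w u assume w: "w \<in> hom Simplex k n" and u: "u \<in> cells (neck T) n"
    have "(\<lambda>i\<in>{..k}. sum_list [m] + compose {..k} u w i) = compose {..k} (\<lambda>i\<in>{..n}. sum_list [m] + u i) w"
      using hom_SimplexD(2)[OF w] by (auto simp: compose_def)
    then show "h k (compose {..k} u w) = act S k n w (h n u)"
      using neck_act_in[OF u w] u psh_hom_neckD(3)[OF f w cell_append_right[OF u]] by (simp add: h_def)
  qed (simp add: h_def)
  then have h: "over T h" using nec by (simp add: over_def)
  have "f = wedge_map [m] T g h"
  proof (rule ext)
    fix n
    show "f n = wedge_map [m] T g h n"
    proof (rule extensionalityI[OF psh_hom_neckD(1)[OF f]])
      show "wedge_map [m] T g h n \<in> extensional (cells (neck ([m] @ T)) n)" by (simp add: wedge_map_def)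
      fix u assume "u \<in> cells (neck ([m] @ T)) n"
      then show "f n u = wedge_map [m] T g h n u"
      proof (cases rule: cell_append_cases)
        case left
        then show ?thesis by (simp add: wedge_map_left g_def)
      next
        case (right w)
        show ?thesis
          unfolding right(4) wedge_map_right[OF g h right(2)] using right(2) by (simp add: h_def)
      qed
    qed
  qed
  then show thesis by (rule that[OF g h])
qed

definition unit_cell :: "'a rig_cell" where
  "unit_cell = cl 0 [] const_map (idm Box 0)"

definition bead_cell :: "nat \<Rightarrow> 'a \<Rightarrow> 'a rig_cell" where
  "bead_cell i \<sigma> = cl i [Suc i] (bead_map (Suc i) \<sigma>) (idm Box i)"

lemma unit_hom: "box_hom 0 (neck_dim []) (idm Box 0)"
  and bead_hom: "box_hom i (neck_dim [Suc i]) (idm Box i)"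
  using box_hom_id[of 0] box_hom_id[of i] by (simp_all only: neck_dim_Nil neck_dim_single)

lemma unit_cell_in: "unit_cell \<in> cells K 0"
  unfolding unit_cell_def by (rule cl_in[OF over_const_map unit_hom])

lemma bead_cell_in: "\<sigma> \<in> cells S (Suc i) \<Longrightarrow> bead_cell i \<sigma> \<in> cells K i"
  unfolding bead_cell_def by (rule cl_in[OF over_bead_map bead_hom])

lemma cell_mult_unit_left:
  assumes "B \<in> cells K n"
  shows "cell_mult 0 n unit_cell B = B"
proof -
  obtain U g v where B: "over U g" "box_hom n (neck_dim U) v" "B = cl n U g v"
    using assms unfolding cells_K by blast
  have "wedge_map [] U const_map g = g"
  proof (rule ext)
    fix k
    have g: "g \<in> psh_hom Simplex (neck U) S" using B(1) by (simp add: over_def)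
    show "wedge_map [] U const_map g k = g k"
    proof (rule extensionalityI[OF _ psh_hom_neckD(1)[OF g]])
      show "wedge_map [] U const_map g k \<in> extensional (cells (neck U) k)" by (simp add: wedge_map_def)
      fix u assume u: "u \<in> cells (neck U) k"
      have "(\<lambda>i\<in>{..k}. sum_list [] + u i) = u"
        by (rule extensionalityI[OF _ neck_cellD(1)[OF u]]) simp_all
      then show "wedge_map [] U const_map g k u = g k u"
        using wedge_map_right[OF over_const_map B(1) u] by simp
    qed
  qed
  moreover have "box_prod 0 n (idm Box 0) v = v"
    by (rule box_prod_ext[symmetric]) (use box_hom_extensional[OF B(2)] in simp_all)
  ultimately show ?thesis
    unfolding unit_cell_def B(3) cell_mult_cl[OF over_const_map unit_hom B(1,2)] by simp
qed

text \<open>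
  A degeneracy is a map from the bead to a smaller necklace. The bead of an edge is mapped to a point. In
  higher dimension, the codegeneracy that identifies the vertices \<open>k\<close> and \<open>k + 1\<close> induces a codegeneracy
  of cubes if one of them is an end point, and a coconnection otherwise.
\<close>

lemma bead_cell_degenerate:
  assumes "\<sigma> \<in> simp_degenerate S (Suc i)"
  shows "i = 0 \<Longrightarrow> bead_cell i \<sigma> = unit_cell" and "0 < i \<Longrightarrow> bead_cell i \<sigma> \<in> box_degenerate K i"
proof -
  obtain k \<tau> where k: "k \<le> i" "\<tau> \<in> cells S i" "\<sigma> = act S (Suc i) i (codegen i k) \<tau>"
    using assms unfolding simp_degenerate_def by auto
  have cg: "codegen i k \<in> hom Simplex (Suc i) i" by (rule codegen_hom[OF k(1)])
  have \<sigma>: "\<sigma> \<in> cells S (Suc i)" using assms simp_degenerate_cells by blast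
  define p where "p v = (if v \<le> k then v else v - 1)" for v
  have p_cg: "compose {..n} (codegen i k) u = (\<lambda>j\<in>{..n}. p (u j))" if "u \<in> hom Simplex n (Suc i)" for n u
    using hom_SimplexD(2)[OF that] by (auto simp: compose_def codegen_def p_def)
  have bead: "bead_map (Suc i) \<sigma> n u = act S n i (\<lambda>j\<in>{..n}. p (u j)) \<tau>" if "u \<in> cells (neck [Suc i]) n" for n u
    using that simp_act_comp[OF _ cg k(2), of u n] p_cg[of u n]
    by (simp add: bead_map_def k(3) cells_neck_single)
  {
    assume i: "i = 0"
    have h: "nec_map_of [Suc i] p \<in> nec_hom [Suc i] []"
      using k(1) i by (intro nec_map_of_in) (auto simp: p_def joints_single)
    have tri: "triangle [Suc i] (bead_map (Suc i) \<sigma>) [] const_map (nec_map_of [Suc i] p)"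
      unfolding triangle_def
    proof (intro conjI allI ballI h)
      fix n u assume u: "u \<in> cells (neck [Suc i]) n"
      have l: "nec_map_of [Suc i] p n u = (\<lambda>j\<in>{..n}. p (u j))" using u by (simp add: nec_map_of_def)
      have "nec_map_of [Suc i] p n u \<in> cells (neck []) n"
        using h u by (auto simp: nec_hom_def dest: psh_hom_neckD(2))
      then have "const_map n (nec_map_of [Suc i] p n u) = act S n 0 (nec_map_of [Suc i] p n u) x"
        by (simp add: const_map_def)
      also have "\<dots> = act S n i (\<lambda>j\<in>{..n}. p (u j)) \<tau>"
        unfolding l using i k(2) reduced by simp
      also have "\<dots> = bead_map (Suc i) \<sigma> n u" by (rule bead[OF u, symmetric])
      finally show "const_map n (nec_map_of [Suc i] p n u) = bead_map (Suc i) \<sigma> n u" .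
    qed
    have "idm Box i = compose (cube i) (neck_cube_map [Suc i] [] (nec_map_of [Suc i] p)) (idm Box i)"
      using neck_cube_map_apply(1)[OF h, of "[]"] i by (auto simp: compose_def fun_eq_iff)
    from cl_triangle[OF over_bead_map[OF \<sigma>] over_const_map tri bead_hom this]
    show "bead_cell i \<sigma> = unit_cell" using i box_hom_id[of 0] by (simp add: bead_cell_def unit_cell_def)
  next
    assume i: "0 < i"
    define l where "l = i - 1"
    have il: "i = Suc l" using i by (simp add: l_def)
    define h where "h = nec_map_of [Suc i] p"
    have h: "h \<in> nec_hom [Suc i] [i]"
      unfolding h_def using k(1) by (intro nec_map_of_in) (auto simp: p_def joints_single)
    have \<tau>: "\<tau> \<in> cells S (Suc l)" using k(2) il by simp
    have tri: "triangle [Suc i] (bead_map (Suc i) \<sigma>) [i] (bead_map i \<tau>) h"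
      unfolding triangle_def
    proof (intro conjI allI ballI h)
      fix n u assume u: "u \<in> cells (neck [Suc i]) n"
      have l: "h n u = (\<lambda>j\<in>{..n}. p (u j))" using u by (simp add: h_def nec_map_of_def)
      have "h n u \<in> cells (neck [i]) n" using h u by (auto simp: nec_hom_def dest: psh_hom_neckD(2))
      then show "bead_map i \<tau> n (h n u) = bead_map (Suc i) \<sigma> n u"
        using bead[OF u] by (simp add: bead_map_def[of i] l)
    qed
    \<comment> \<open>an inner vertex identified with an end point becomes a joint and its coordinate is forgotten\<close>
    define c where "c = (if k = 0 then box_degen i 1 else if k = i then box_degen i i else box_conn i k)"
    have c: "box_hom i l c"
      using i k(1) box_hom.degen[of 1 i] box_hom.degen[of i i] box_hom.conn[of k i]
      by (auto simp: c_def l_def)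
    have eq: "neck_cube_map [Suc i] [i] h = c"
    proof (rule extensionalityI)
      show "neck_cube_map [Suc i] [i] h \<in> extensional (cube i)"
        using neck_cube_map_extensional[of "[Suc i]"] by simp
      show "c \<in> extensional (cube i)" by (rule box_hom_extensional[OF c])
      fix v assume "v \<in> cube i"
      then have v: "length v = i" by simp
      then have v': "length v = neck_dim [Suc i]" by simp
      have on_h: "on_verts h a = p a" if "a \<le> Suc i" for a
        unfolding h_def by (rule on_verts_nec_map_of) (simp add: that)
      have nth1: "free_verts [Suc i] ! a = Suc a" if "a < i" for a using that by (simp add: free_verts_single del: upt_Suc)
      have nth2: "free_verts [i] ! a = Suc a" if "a < l" for a using that by (simp add: il free_verts_single del: upt_Suc)
      have vs1: "a \<in> vertex_set [Suc i] v \<longleftrightarrow> a = 0 \<or> a = Suc i \<or> (\<exists>b<i. v ! b \<and> a = Suc b)" for a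
        using v nth1 by (auto simp: vertex_set_def joints_single support_def)
      have lhs: "length (neck_cube_map [Suc i] [i] h v) = l"
        using neck_cube_map_apply(1)[OF h v'] il by simp
      show "neck_cube_map [Suc i] [i] h v = c v"
      proof (rule nth_equalityI)
        show "length (neck_cube_map [Suc i] [i] h v) = length (c v)" using lhs box_hom_length[OF c v] by simp
        fix a assume "a < length (neck_cube_map [Suc i] [i] h v)"
        then have a: "a < l" using lhs by simp
        have "neck_cube_map [Suc i] [i] h v ! a \<longleftrightarrow> Suc a \<in> vertex_set [i] (neck_cube_map [Suc i] [i] h v)"
          using nth_free_verts_in_vertex_set[of "neck_cube_map [Suc i] [i] h v" "[i]" a] lhs a nth2[OF a] il by simp
        also have "\<dots> \<longleftrightarrow> (\<exists>b\<in>vertex_set [Suc i] v. on_verts h b = Suc a)"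
          unfolding neck_cube_map_apply(2)[OF h v'] image_iff Bex_def by (simp only: eq_commute[of "Suc a"])
        also have "\<dots> \<longleftrightarrow> (\<exists>b\<in>vertex_set [Suc i] v. p b = Suc a)"
          by (rule bex_cong[OF refl]) (use vertex_set_subset[OF v'] on_h in \<open>auto simp: neck_verts_def\<close>)
        also have "\<dots> \<longleftrightarrow> p (Suc i) = Suc a \<or> (\<exists>b<i. v ! b \<and> p (Suc b) = Suc a)"
        proof -
          have "p 0 \<noteq> Suc a" by (simp add: p_def)
          then show ?thesis unfolding Bex_def vs1 by blast
        qed
        also have "p (Suc i) = Suc a \<longleftrightarrow> False" using k(1) a il by (auto simp: p_def)
        also have "False \<or> (\<exists>b<i. v ! b \<and> p (Suc b) = Suc a) \<longleftrightarrow> c v ! a"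
        proof -
          consider "k = 0" | "k \<noteq> 0" "k = i" | "k \<noteq> 0" "k < i" using k(1) by linarith
          then show ?thesis
          proof cases
            case 1
            have "(\<exists>b<i. v ! b \<and> p (Suc b) = Suc a) \<longleftrightarrow> v ! Suc a"
              by (rule ex_coordinate) (use 1 a il in \<open>auto simp: p_def\<close>)
            then show ?thesis using 1 a v il box_degen_apply[OF v, of 0] by (simp add: c_def nth_delete_at)
          next
            case 2
            have "(\<exists>b<i. v ! b \<and> p (Suc b) = Suc a) \<longleftrightarrow> v ! a"
              by (rule ex_coordinate) (use 2 a il in \<open>auto simp: p_def\<close>)
            then show ?thesis using 2 a v il box_degen_apply[OF v, of l] by (simp add: c_def nth_delete_at)
          next
            case 3
            obtain k' where k': "k = Suc k'" using 3 by (cases k) auto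
            have cv: "c v ! a = (if a < k' then v ! a else if a = k' then v ! k' \<or> v ! Suc k' else v ! Suc a)"
              using 3 a v il k' box_conn_apply[OF v, of k'] by (simp add: c_def nth_merge_at)
            consider "a < k'" | "a = k'" | "k' < a" by linarith
            then show ?thesis
            proof cases
              case 1
              have "(\<exists>b<i. v ! b \<and> p (Suc b) = Suc a) \<longleftrightarrow> v ! a"
                by (rule ex_coordinate) (use 1 k' a il in \<open>auto simp: p_def\<close>)
              then show ?thesis using 1 cv by simp
            next
              case 2
              have eqv: "p (Suc b) = Suc a \<longleftrightarrow> b = k' \<or> b = Suc k'" for b using 2 k' by (auto simp: p_def)
              have less: "k' < i" "Suc k' < i" using \<open>k < i\<close> k' by auto
              have "(\<exists>b<i. v ! b \<and> p (Suc b) = Suc a) \<longleftrightarrow> v ! k' \<or> v ! Suc k'"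
              proof
                assume "\<exists>b<i. v ! b \<and> p (Suc b) = Suc a"
                then show "v ! k' \<or> v ! Suc k'" unfolding eqv by auto
              next
                assume "v ! k' \<or> v ! Suc k'"
                then show "\<exists>b<i. v ! b \<and> p (Suc b) = Suc a"
                proof
                  assume "v ! k'"
                  then show ?thesis using less by (intro exI[of _ k']) (simp add: eqv)
                next
                  assume "v ! Suc k'"
                  then show ?thesis using less by (intro exI[of _ "Suc k'"]) (simp add: eqv)
                qed
              qed
              then show ?thesis using 2 cv by simp
            next
              case 3
              have "(\<exists>b<i. v ! b \<and> p (Suc b) = Suc a) \<longleftrightarrow> v ! Suc a"
                by (rule ex_coordinate) (use 3 k' a il in \<open>auto simp: p_def\<close>)
              then show ?thesis using 3 cv by simp
            qed
          qed
        qed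
        finally show "neck_cube_map [Suc i] [i] h v ! a = c v ! a" .
      qed
    qed
    have \<tau>_cell: "bead_cell l \<tau> \<in> cells K l" by (rule bead_cell_in[OF \<tau>])
    have cc: "box_hom i (neck_dim [i]) c" using c il by simp
    have "c = compose (cube i) (neck_cube_map [Suc i] [i] h) (idm Box i)"
      unfolding eq by (rule compose_id_right_box[OF c, symmetric])
    from cl_triangle[OF over_bead_map[OF \<sigma>] over_bead_map[OF \<tau>, folded il] tri bead_hom this cc]
    have "bead_cell i \<sigma> = cl i [i] (bead_map i \<tau>) c" by (simp only: bead_cell_def)
    also have "\<dots> = act K i l c (bead_cell l \<tau>)"
    proof -
      have "act K i l c (bead_cell l \<tau>) =
          cl i [Suc l] (bead_map (Suc l) \<tau>) (compose (cube i) (idm Box l) c)"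
        unfolding bead_cell_def by (rule act_K[OF over_bead_map[OF \<tau>] bead_hom c])
      then show ?thesis by (simp only: compose_id_left[OF c] il[symmetric])
    qed
    finally have "bead_cell i \<sigma> = act K i (i - 1) c (bead_cell l \<tau>)" by (simp add: l_def)
    moreover have "bead_cell l \<tau> \<in> cells K (i - 1)" using \<tau>_cell by (simp add: l_def)
    ultimately show "bead_cell i \<sigma> \<in> box_degenerate K i"
    proof -
      assume b: "bead_cell i \<sigma> = act K i (i - 1) c (bead_cell l \<tau>)" "bead_cell l \<tau> \<in> cells K (i - 1)"
      consider "k = 0" | "k \<noteq> 0" "k = i" | "k \<noteq> 0" "k < i" using k(1) by linarith
      then show ?thesis
      proof cases
        case 1
        then show ?thesis using b i unfolding box_degenerate_def c_def
          by (intro UnI1 UN_I[of 1]) auto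
      next
        case 2
        then show ?thesis using b i unfolding box_degenerate_def c_def
          by (intro UnI1 UN_I[of i]) auto
      next
        case 3
        then show ?thesis using b i unfolding box_degenerate_def c_def
          by (intro UnI2 UN_I[of k]) auto
      qed
    qed
  }
qed

section \<open>Normal forms of cells\<close>

definition letters :: "(nat \<times> 'a) set" where
  "letters = {(i, \<sigma>). \<sigma> \<in> cells S (Suc i) - simp_degenerate S (Suc i)}"

definition bead_words :: "nat \<Rightarrow> 'a word set" where
  "bead_words n = {w. set w \<subseteq> letters \<and> sum_list (map fst w) = n}"

fun word_cell :: "'a word \<Rightarrow> 'a rig_cell" where
  "word_cell [] = unit_cell"
| "word_cell ((i, \<sigma>) # w) = cell_mult i (sum_list (map fst w)) (bead_cell i \<sigma>) (word_cell w)"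

lemma bead_words_simps: "[] \<in> bead_words n \<longleftrightarrow> n = 0"
  "(i, \<sigma>) # w \<in> bead_words n \<longleftrightarrow> (i, \<sigma>) \<in> letters \<and> (\<exists>m. n = i + m \<and> w \<in> bead_words m)"
  by (auto simp: bead_words_def)

lemma bead_words_append: "u \<in> bead_words m \<Longrightarrow> v \<in> bead_words n \<Longrightarrow> u @ v \<in> bead_words (m + n)"
  by (auto simp: bead_words_def)

lemma word_cell_in: "w \<in> bead_words n \<Longrightarrow> word_cell w \<in> cells K n"
proof (induction w arbitrary: n)
  case (Cons a w)
  obtain i \<sigma> where a: "a = (i, \<sigma>)" by (cases a)
  have l: "\<sigma> \<in> cells S (Suc i)" "w \<in> bead_words (sum_list (map fst w))" "n = i + sum_list (map fst w)"
    using Cons.prems by (auto simp: a bead_words_def letters_def)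
  show ?case unfolding a word_cell.simps l(3) by (rule cell_mult_in[OF bead_cell_in[OF l(1)] Cons.IH[OF l(2)]])
qed (simp add: bead_words_simps unit_cell_in)

text \<open>
  A map from a necklace to \<open>S\<close> is the wedge of its beads, and factors that are units can be left out.
\<close>

lemma normal_form_id:
  assumes "over T f"
  shows "cl (neck_dim T) T f (idm Box (neck_dim T)) \<in> box_degenerate K (neck_dim T) \<union> word_cell ` bead_words (neck_dim T)"
  using assms
proof (induction T arbitrary: f)
  case Nil
  have "[] \<in> bead_words 0" by (simp add: bead_words_simps)
  moreover have "cl 0 [] f (idm Box 0) = word_cell []"
    unfolding word_cell.simps unit_cell_def over_Nil_eq[OF Nil] ..
  ultimately show ?case unfolding neck_dim_Nil by blast
next
  case (Cons m T)
  obtain g h where gh: "over [m] g" "over T h" "f = wedge_map [m] T g h"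
    using over_Cons_eq[OF Cons.prems] by blast
  have "1 \<le> m" using Cons.prems by (simp add: over_def necklaces_def)
  then obtain i where m: "m = Suc i" by (cases m) auto
  obtain \<sigma> where \<sigma>: "\<sigma> \<in> cells S (Suc i)" "g = bead_map (Suc i) \<sigma>"
    using over_single_eq gh(1) unfolding m by blast
  let ?n = "neck_dim T"
  let ?B = "cl ?n T h (idm Box ?n)"
  have dim: "neck_dim (m # T) = i + ?n" using neck_dim_append[of "[m]" T] by (simp add: m)
  have B: "?B \<in> cells K ?n" by (rule cl_in[OF gh(2) box_hom_id])
  have A: "bead_cell i \<sigma> \<in> cells K i" by (rule bead_cell_in[OF \<sigma>(1)])
  have prod: "cl (i + ?n) (m # T) f (idm Box (i + ?n)) = cell_mult i ?n (bead_cell i \<sigma>) ?B"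
    using cell_mult_cl[OF over_bead_map[OF \<sigma>(1)] bead_hom gh(2) box_hom_id]
    unfolding bead_cell_def box_prod_id gh(3) \<sigma>(2) m by (simp only: append_Cons append_Nil)
  show ?case
  proof (cases "?B \<in> box_degenerate K ?n")
    case True
    then show ?thesis unfolding dim prod using cell_mult_degenerate_right[OF A] by blast
  next
    case False
    then obtain w where w: "w \<in> bead_words ?n" "?B = word_cell w" using Cons.IH[OF gh(2)] by blast
    have wn: "sum_list (map fst w) = ?n" using w(1) by (simp add: bead_words_def)
    show ?thesis
    proof (cases "\<sigma> \<in> simp_degenerate S (Suc i)")
      case True
      show ?thesis
      proof (cases "i = 0")
        case i: True
        have "cell_mult i ?n (bead_cell i \<sigma>) ?B = ?B"
          using bead_cell_degenerate(1)[OF True i] cell_mult_unit_left[OF B] i by simp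
        then show ?thesis unfolding dim prod using w i by auto
      next
        case False
        then have "bead_cell i \<sigma> \<in> box_degenerate K i" using bead_cell_degenerate(2)[OF True] by simp
        then show ?thesis unfolding dim prod using cell_mult_degenerate_left[OF _ B] by blast
      qed
    next
      case False
      then have "(i, \<sigma>) # w \<in> bead_words (i + ?n)" using w(1) \<sigma>(1) by (auto simp: bead_words_simps letters_def)
      moreover have "cell_mult i ?n (bead_cell i \<sigma>) ?B = word_cell ((i, \<sigma>) # w)"
        using w(2) wn by simp
      ultimately show ?thesis unfolding dim prod by blast
    qed
  qed
qed

lemma cell_normal_form:
  assumes "A \<in> cells K n"
  shows "A \<in> box_degenerate K n \<or> (\<exists>w\<in>bead_words n. A = word_cell w)"
proof -
  obtain T f u where A: "over T f" "box_hom n (neck_dim T) u" "A = cl n T f u"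
    using assms unfolding cells_K by blast
  show ?thesis
  proof (cases "card (rank n u) = n")
    case True
    obtain T' f' where "over T' f'" "neck_dim T' = n" "A = cl n T' f' (idm Box n)"
      using cl_full_rank[OF A(1,2) True] A(3) by metis
    then show ?thesis using normal_form_id[of T' f'] by auto
  next
    case False
    then have "factors_degenerate n (neck_dim T) u"
      using factors_degenerate_if_rank[OF A(2)] card_rank_le[OF A(2)] by simp
    then have "act K n (neck_dim T) u (cl (neck_dim T) T f (idm Box (neck_dim T))) \<in> box_degenerate K n"
      by (rule act_degenerate[OF cl_in[OF A(1) box_hom_id]])
    then show ?thesis
      unfolding act_K[OF A(1) box_hom_id A(2)] compose_id_left[OF A(2)] A(3) ..
  qed
qed

text \<open>
  A morphism that factors through the cube of dimension \<open>n - 1\<close> has rank less than \<open>n\<close>.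
\<close>

lemma cell_value_degenerate:
  assumes "A \<in> box_degenerate K n"
  shows "cell_value n A = (0 :: 'a word \<Rightarrow>\<^sub>0 'k::{comm_ring,comm_monoid_mult})"
proof -
  have *: "cell_value n (act K n (n - 1) d \<tau>) = (0 :: 'a word \<Rightarrow>\<^sub>0 'k)"
    if \<tau>: "\<tau> \<in> cells K (n - 1)" and d: "box_hom n (n - 1) d" and n: "0 < n"
      and rep: "\<And>b. d (replicate n b) = replicate (n - 1) b" for \<tau> d
  proof -
    obtain T f u where T: "over T f" "box_hom (n - 1) (neck_dim T) u" "\<tau> = cl (n - 1) T f u"
      using \<tau> unfolding cells_K by blast
    have "lower n T (compose (cube n) u d) = lower (n - 1) T u" "upper n T (compose (cube n) u d) = upper (n - 1) T u"
      by (simp_all add: lower_def upper_def compose_def rep)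
    then have "card (upper n T (compose (cube n) u d) - lower n T (compose (cube n) u d)) \<noteq> n"
      using upper_lower(6)[OF T(2)] n by simp
    then show ?thesis
      unfolding T(3) act_K[OF T(1,2) d] cell_value_cl[OF T(1) box_hom.comp[OF d T(2)]] by (simp add: val_def)
  qed
  from assms show ?thesis
  proof (cases rule: degenerate_cases)
    case (degen j \<tau>)
    show ?thesis unfolding degen(3)
    proof (rule *[OF degen(2)])
      show "box_hom n (n - 1) (box_degen n (Suc j))" using degen(1) by (intro box_hom.degen) auto
      show "box_degen n (Suc j) (replicate n b) = replicate (n - 1) b" for b
        by (rule nth_equalityI) (use degen(1) in \<open>simp_all add: box_degen_apply nth_delete_at\<close>)
    qed (use degen(1) in simp)
  next
    case (conn j \<tau>)
    show ?thesis unfolding conn(3)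
    proof (rule *[OF conn(2)])
      show "box_hom n (n - 1) (box_conn n (Suc j))" using conn(1) by (intro box_hom.conn) auto
      show "box_conn n (Suc j) (replicate n b) = replicate (n - 1) b" for b
        by (rule nth_equalityI) (use conn(1) in \<open>simp_all add: box_conn_apply nth_merge_at\<close>)
    qed (use conn(1) in simp)
  qed
qed

lemma cell_value_unit: "cell_value 0 unit_cell = (gen [] :: 'a word \<Rightarrow>\<^sub>0 'k::{comm_ring,comm_monoid_mult})"
proof -
  have "vertex_set [] (idm Box 0 []) = {0}" by (simp add: vertex_set_def support_def)
  then have "lower 0 [] (idm Box 0) = {0}" "upper 0 [] (idm Box 0) = {0}"
    by (simp_all add: lower_def upper_def)
  then show ?thesis
    unfolding unit_cell_def cell_value_cl[OF over_const_map unit_hom] by (simp add: val_def)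
qed

lemma free_verts_single_nth: "a < i \<Longrightarrow> free_verts [Suc i] ! a = Suc a"
  by (simp add: free_verts_single del: upt_Suc)

lemma vertex_set_single:
  assumes "length v = i"
  shows "vertex_set [Suc i] v = {0, Suc i} \<union> Suc ` support v"
  using free_verts_single_nth support_less[OF assms]
  by (auto simp: vertex_set_def joints_single image_iff)

lemma bead_bead_map:
  assumes w: "w \<in> hom Simplex (Suc k) (Suc i)" "\<And>a b. a < b \<Longrightarrow> b \<le> Suc k \<Longrightarrow> w a < w b"
    and A: "w ` {..Suc k} = A"
  shows "bead (bead_map (Suc i) \<sigma>) A = (letter k (act S (Suc k) (Suc i) w \<sigma>) :: 'a word \<Rightarrow>\<^sub>0 'k::{comm_ring,comm_monoid_mult})"
  using enum_eqI[OF hom_SimplexD(1)[OF w(1)] w(2) A] w(1)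
  by (simp add: bead_def bead_map_def cells_neck_single)

lemma cell_value_bead:
  assumes "\<sigma> \<in> cells S (Suc i)"
  shows "cell_value i (bead_cell i \<sigma>) = (letter i \<sigma> :: 'a word \<Rightarrow>\<^sub>0 'k::{comm_ring,comm_monoid_mult})"
proof -
  have lo: "lower i [Suc i] (idm Box i) = {0, Suc i}" and up: "upper i [Suc i] (idm Box i) = {..Suc i}"
    by (auto simp: lower_def upper_def vertex_set_single image_iff less_Suc_eq_0_disj le_Suc_eq gr0_conv_Suc
        intro: less_imp_Suc_add) (metis lessThan_iff not0_implies_Suc less_Suc_eq_le Suc_le_eq)+
  have sl: "sorted_list_of_set {0, Suc i} = [0, Suc i]" by (rule strict_sorted_map_enum) auto
  have e: "restrict id {..Suc i} \<in> hom Simplex (Suc i) (Suc i)" by (rule hom_SimplexI) auto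
  have "{..Suc i} - {0, Suc i} = {1..i}" by auto
  then have "card ({..Suc i} - {0, Suc i}) = i" by simp
  then have "cell_value i (bead_cell i \<sigma>) = (bead (bead_map (Suc i) \<sigma>) ({..Suc i} \<inter> {0..Suc i}) :: 'a word \<Rightarrow>\<^sub>0 'k)"
    unfolding bead_cell_def cell_value_cl[OF over_bead_map[OF assms] bead_hom] val_def prod.case lo up sl
    by (simp del: bilin_gen)
  also have "\<dots> = letter i (act S (Suc i) (Suc i) (restrict id {..Suc i}) \<sigma>)"
    by (rule bead_bead_map[OF e]) auto
  finally show ?thesis by (simp only: simp_act_id[OF assms])
qed

text \<open>
  The alternating sum of the values of the faces of the bead of \<open>\<sigma>\<close>. The outer faces of \<open>\<sigma>\<close> are hidden in
  the summands for \<open>j = 1\<close> and \<open>j = i\<close>, in which one of the factors is an edge.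
\<close>

definition letter_deriv :: "nat \<Rightarrow> 'a \<Rightarrow> ('a word \<Rightarrow>\<^sub>0 'k::{comm_ring,comm_monoid_mult})" where
  "letter_deriv i \<sigma> = (\<Sum>j=1..i. cscale ((-1) ^ j)
    (letter (j - 1) (front_face S j (Suc i - j) \<sigma>) \<odot> letter (i - j) (last_face S j (Suc i - j) \<sigma>) -
     letter (i - 1) (act S i (Suc i) (coface (Suc i) j) \<sigma>)))"

text \<open>
  The face of the cube of a simplex on which the \<open>j\<close>-th inner vertex is a joint is the product of a front
  and a last face; the face on which this vertex is missing is the \<open>j\<close>-th face of the simplex.
\<close>

lemma cell_value_bead_face:
  assumes \<sigma>: "\<sigma> \<in> cells S (Suc i)" and j: "1 \<le> j" "j \<le> i"
  shows "cell_value (i - 1) (act K (i - 1) i (box_face (i - 1) j True) (bead_cell i \<sigma>)) =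
      (letter (j - 1) (front_face S j (Suc i - j) \<sigma>) \<odot> letter (i - j) (last_face S j (Suc i - j) \<sigma>) ::
        'a word \<Rightarrow>\<^sub>0 'k::{comm_ring,comm_monoid_mult})"
    and "cell_value (i - 1) (act K (i - 1) i (box_face (i - 1) j False) (bead_cell i \<sigma>)) =
      (letter (i - 1) (act S i (Suc i) (coface (Suc i) j) \<sigma>) :: 'a word \<Rightarrow>\<^sub>0 'k)"
proof -
  obtain k where k: "j = Suc k" using j by (cases j) auto
  have fh: "box_hom (i - 1) i (box_face (i - 1) j e)" for e by (rule face_hom[OF j])
  have face: "act K (i - 1) i (box_face (i - 1) j e) (bead_cell i \<sigma>) =
      cl (i - 1) [Suc i] (bead_map (Suc i) \<sigma>) (box_face (i - 1) j e)" for e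
    unfolding bead_cell_def act_K[OF over_bead_map[OF \<sigma>] bead_hom fh] compose_id_left[OF fh] ..
  have bh: "box_hom (i - 1) (neck_dim [Suc i]) (box_face (i - 1) j e)" for e using fh by simp
  have supp: "support (box_face (i - 1) j e (replicate (i - 1) b)) =
      (if e then {k} else {}) \<union> (if b then {..<i} - {k} else {})" for e b
  proof -
    have "a \<in> support (insert_at k e (replicate (i - 1) b)) \<longleftrightarrow>
        a \<in> (if e then {k} else {}) \<union> (if b then {..<i} - {k} else {})" for a
    proof (cases "a < i")
      case True
      then show ?thesis using j k by (auto simp: support_def nth_insert_at)
    next
      case False
      then show ?thesis using j k by (auto simp: support_def)
    qed
    then show ?thesis unfolding k by (simp add: box_face_apply set_eq_iff)
  qed
  have len: "length (box_face (i - 1) j e (replicate (i - 1) b)) = i" for e b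
    using box_hom_length[OF fh] by simp
  have img: "Suc ` ({..<i} - {k}) = {1..i} - {j}"
  proof
    show "{1..i} - {j} \<subseteq> Suc ` ({..<i} - {k})"
    proof
      fix z assume "z \<in> {1..i} - {j}"
      then show "z \<in> Suc ` ({..<i} - {k})" by (cases z) (auto simp: k)
    qed
  qed (auto simp: k)
  have lo: "lower (i - 1) [Suc i] (box_face (i - 1) j e) = (if e then {0, j, Suc i} else {0, Suc i})" for e
    unfolding lower_def vertex_set_single[OF len] supp by (auto simp: k)
  have up: "upper (i - 1) [Suc i] (box_face (i - 1) j e) = (if e then {..Suc i} else {..Suc i} - {j})" for e
    unfolding upper_def vertex_set_single[OF len] supp if_True image_Un img
    using j by (auto simp: k le_Suc_eq)
  have cT: "card ({..Suc i} - {0, j, Suc i}) = i - 1" and cF: "card ({..Suc i} - {j} - {0, Suc i}) = i - 1"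
  proof -
    have "{..Suc i} - {0, j, Suc i} = {1..i} - {j}" "{..Suc i} - {j} - {0, Suc i} = {1..i} - {j}" by auto
    then show "card ({..Suc i} - {0, j, Suc i}) = i - 1" "card ({..Suc i} - {j} - {0, Suc i}) = i - 1"
      using j by simp_all
  qed
  have slT: "sorted_list_of_set {0, j, Suc i} = [0, j, Suc i]" using j by (intro strict_sorted_map_enum) auto
  have slF: "sorted_list_of_set {0, Suc i} = [0, Suc i]" by (rule strict_sorted_map_enum) auto
  have "bead (bead_map (Suc i) \<sigma>) ({..Suc i} \<inter> {0..j}) =
      (letter k (act S (Suc k) (Suc i) (\<lambda>a\<in>{..Suc k}. a) \<sigma>) :: 'a word \<Rightarrow>\<^sub>0 'k)"
    by (rule bead_bead_map, rule hom_SimplexI) (use j k in auto)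
  moreover have "bead (bead_map (Suc i) \<sigma>) ({..Suc i} \<inter> {j..Suc i}) =
      (letter (i - j) (act S (Suc (i - j)) (Suc i) (\<lambda>a\<in>{..Suc (i - j)}. a + j) \<sigma>) :: 'a word \<Rightarrow>\<^sub>0 'k)"
  proof (rule bead_bead_map)
    show "(\<lambda>a\<in>{..Suc (i - j)}. a + j) \<in> hom Simplex (Suc (i - j)) (Suc i)"
      using j by (intro hom_SimplexI) auto
    show "(\<lambda>a\<in>{..Suc (i - j)}. a + j) ` {..Suc (i - j)} = {..Suc i} \<inter> {j..Suc i}"
    proof
      show "{..Suc i} \<inter> {j..Suc i} \<subseteq> (\<lambda>a\<in>{..Suc (i - j)}. a + j) ` {..Suc (i - j)}"
      proof
        fix z assume "z \<in> {..Suc i} \<inter> {j..Suc i}"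
        then show "z \<in> (\<lambda>a\<in>{..Suc (i - j)}. a + j) ` {..Suc (i - j)}"
          using j by (intro image_eqI[of _ _ "z - j"]) auto
      qed
    qed (use j in auto)
  qed auto
  moreover have "Suc i - j = Suc (i - j)" "j + (Suc i - j) = Suc i" using j by auto
  ultimately show "cell_value (i - 1) (act K (i - 1) i (box_face (i - 1) j True) (bead_cell i \<sigma>)) =
      (letter (j - 1) (front_face S j (Suc i - j) \<sigma>) \<odot> letter (i - j) (last_face S j (Suc i - j) \<sigma>) ::
        'a word \<Rightarrow>\<^sub>0 'k)"
    unfolding face cell_value_cl[OF over_bead_map[OF \<sigma>] bh] val_def prod.case lo up if_True slT cT
    by (simp add: front_face_def last_face_def k del: bilin_gen)
  obtain l where l: "i = Suc l" using j by (cases i) auto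
  have "bead (bead_map (Suc i) \<sigma>) (({..Suc i} - {j}) \<inter> {0..Suc i}) =
      (letter l (act S (Suc l) (Suc i) (coface (Suc i) j) \<sigma>) :: 'a word \<Rightarrow>\<^sub>0 'k)"
  proof (rule bead_bead_map)
    show "coface (Suc i) j \<in> hom Simplex (Suc l) (Suc i)" using coface_hom[of "Suc i" j] j l by simp
    show "coface (Suc i) j ` {..Suc l} = ({..Suc i} - {j}) \<inter> {0..Suc i}"
    proof
      show "({..Suc i} - {j}) \<inter> {0..Suc i} \<subseteq> coface (Suc i) j ` {..Suc l}"
      proof
        fix z assume z: "z \<in> ({..Suc i} - {j}) \<inter> {0..Suc i}"
        show "z \<in> coface (Suc i) j ` {..Suc l}"
        proof (cases "z < j")
          case True
          then show ?thesis using z j l by (intro image_eqI[of _ _ z]) (auto simp: coface_def)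
        next
          case False
          then show ?thesis using z j l by (intro image_eqI[of _ _ "z - 1"]) (auto simp: coface_def)
        qed
      qed
    qed (use l in \<open>auto simp: coface_def\<close>)
  qed (use l in \<open>auto simp: coface_def\<close>)
  then show "cell_value (i - 1) (act K (i - 1) i (box_face (i - 1) j False) (bead_cell i \<sigma>)) =
      (letter (i - 1) (act S i (Suc i) (coface (Suc i) j) \<sigma>) :: 'a word \<Rightarrow>\<^sub>0 'k)"
    unfolding face cell_value_cl[OF over_bead_map[OF \<sigma>] bh] val_def prod.case lo up if_False slF cF
    by (simp add: l del: bilin_gen)
qed

lemma cell_value_boundary_bead:
  assumes "\<sigma> \<in> cells S (Suc i)"
  shows "lin (cell_value (i - 1)) (box_boundary K i (bead_cell i \<sigma>)) =
    (letter_deriv i \<sigma> :: 'a word \<Rightarrow>\<^sub>0 'k::{comm_ring,comm_monoid_mult})"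
  unfolding box_boundary_def letter_deriv_def lin_simps lin_gen
  by (rule sum.cong[OF refl]) (simp only: cell_value_bead_face[OF assms] atLeastAtMost_iff)

lemma cell_value_boundary_degenerate:
  assumes "A \<in> box_degenerate K n"
  shows "lin (cell_value (n - 1)) (box_boundary K n A) = (0 :: 'a word \<Rightarrow>\<^sub>0 'k::{comm_ring,comm_monoid_mult})"
  by (rule hull_linear_kernel[OF linear_map_lin _ degenerate_boundary[OF assms]])
     (auto simp: cell_value_degenerate)

lemma letter_in: "\<sigma> \<in> cells S (Suc i) \<Longrightarrow> letter i \<sigma> \<in> free (bead_words i)"
  unfolding letter_def
  by (auto intro!: gen_in_free submod_zero[OF submod_free] simp: bead_words_simps letters_def)

text \<open>
  If \<open>\<sigma>\<close> is degenerate, its letter is a constant, and \<open>letter_deriv\<close> vanishes because the boundary of a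
  degenerate cell is a combination of degenerate cells.
\<close>

lemma lin_deriv_letter:
  assumes "\<sigma> \<in> cells S (Suc i)"
  shows "lin (word_deriv letter_deriv) (letter i \<sigma>) = (letter_deriv i \<sigma> :: 'a word \<Rightarrow>\<^sub>0 'k::{comm_ring,comm_monoid_mult})"
proof (cases "\<sigma> \<in> simp_degenerate S (Suc i)")
  case True
  have "letter_deriv i \<sigma> = (0 :: 'a word \<Rightarrow>\<^sub>0 'k)"
  proof (cases "i = 0")
    case True
    then show ?thesis by (simp add: letter_deriv_def)
  next
    case False
    then show ?thesis
      using cell_value_boundary_bead[OF assms] cell_value_boundary_degenerate bead_cell_degenerate(2)[OF True]
      by (metis gr0I)
  qed
  then show ?thesis using True by (simp add: letter_def lin_simps)
next
  case False
  then show ?thesis by (simp add: letter_def word_mult_right(3) del: bilin_gen)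
qed

lemma cell_value_word_cell:
  assumes "w \<in> bead_words n"
  shows "cell_value n (word_cell w) = (gen w :: 'a word \<Rightarrow>\<^sub>0 'k::{comm_ring,comm_monoid_mult})"
  using assms
proof (induction w arbitrary: n)
  case Nil
  then show ?case by (simp add: bead_words_simps cell_value_unit)
next
  case (Cons a w)
  obtain i \<sigma> where a: "a = (i, \<sigma>)" by (cases a)
  have l: "(i, \<sigma>) \<in> letters" "w \<in> bead_words (sum_list (map fst w))" "n = i + sum_list (map fst w)"
    using Cons.prems by (auto simp: a bead_words_def)
  have \<sigma>: "\<sigma> \<in> cells S (Suc i)" "\<sigma> \<notin> simp_degenerate S (Suc i)" using l(1) by (auto simp: letters_def)
  show ?case
    unfolding a word_cell.simps l(3) cell_value_mult[OF bead_cell_in[OF \<sigma>(1)] word_cell_in[OF l(2)]]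
      cell_value_bead[OF \<sigma>(1)] Cons.IH[OF l(2)]
    using \<sigma>(2) by (simp add: letter_def)
qed

lemma cell_value_in:
  assumes "A \<in> cells K n"
  shows "cell_value n A \<in> free (bead_words n)"
  using cell_normal_form[OF assms]
  by (auto simp: cell_value_degenerate cell_value_word_cell submod_zero[OF submod_free] intro!: gen_in_free)

lemma lin_cell_value_mult_left:
  assumes "p \<in> free (cells K m)" "B \<in> cells K n"
  shows "lin (cell_value (m + n)) (lin (\<lambda>a. gen (cell_mult m n a B)) p) =
    (lin (cell_value m) p \<odot> cell_value n B :: 'a word \<Rightarrow>\<^sub>0 'k::{comm_ring,comm_monoid_mult})"
  by (rule linear_map_eq_on_free[OF linear_map_comp[OF linear_map_lin linear_map_lin]
        linear_map_word_mult_comp_left[OF linear_map_lin] _ assms(1)])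
     (simp add: cell_value_mult assms(2) del: bilin_gen)

lemma lin_cell_value_mult_right:
  assumes "A \<in> cells K m" "q \<in> free (cells K n)"
  shows "lin (cell_value (m + n)) (lin (\<lambda>b. gen (cell_mult m n A b)) q) =
    (cell_value m A \<odot> lin (cell_value n) q :: 'a word \<Rightarrow>\<^sub>0 'k::{comm_ring,comm_monoid_mult})"
  by (rule linear_map_eq_on_free[OF linear_map_comp[OF linear_map_lin linear_map_lin]
        linear_map_word_mult_comp_right[OF linear_map_lin] _ assms(2)])
     (simp add: cell_value_mult assms(1) del: bilin_gen)

lemma cell_value_boundary_word_cell:
  assumes "w \<in> bead_words n"
  shows "lin (cell_value (n - 1)) (box_boundary K n (word_cell w)) =
    (word_deriv letter_deriv w :: 'a word \<Rightarrow>\<^sub>0 'k::{comm_ring,comm_monoid_mult})"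
  using assms
proof (induction w arbitrary: n)
  case Nil
  then show ?case by (simp add: bead_words_simps box_boundary_def lin_simps)
next
  case (Cons a w)
  obtain i \<sigma> where a: "a = (i, \<sigma>)" by (cases a)
  define k where "k = sum_list (map fst w)"
  have l: "(i, \<sigma>) \<in> letters" "w \<in> bead_words k" "n = i + k"
    using Cons.prems by (auto simp: a bead_words_def k_def)
  have \<sigma>: "\<sigma> \<in> cells S (Suc i)" "\<sigma> \<notin> simp_degenerate S (Suc i)" using l(1) by (auto simp: letters_def)
  let ?A = "bead_cell i \<sigma>" and ?B = "word_cell w"
  have A: "?A \<in> cells K i" by (rule bead_cell_in[OF \<sigma>(1)])
  have B: "?B \<in> cells K k" by (rule word_cell_in[OF l(2)])
  have valA: "cell_value i ?A = (gen [(i, \<sigma>)] :: 'a word \<Rightarrow>\<^sub>0 'k)"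
    unfolding cell_value_bead[OF \<sigma>(1)] using \<sigma>(2) by (simp add: letter_def)
  have valB: "cell_value k ?B = (gen w :: 'a word \<Rightarrow>\<^sub>0 'k)" by (rule cell_value_word_cell[OF l(2)])
  have 1: "lin (cell_value (n - 1)) (lin (\<lambda>a. gen (cell_mult (i - 1) k a ?B)) (box_boundary K i ?A)) =
      (letter_deriv i \<sigma> \<odot> gen w :: 'a word \<Rightarrow>\<^sub>0 'k)"
  proof (cases "i = 0")
    case True
    then show ?thesis by (simp add: box_boundary_def lin_simps letter_deriv_def word_mult_left(3) del: bilin_gen)
  next
    case False
    then have "n - 1 = i - 1 + k" using l(3) by simp
    then show ?thesis
      by (simp only: lin_cell_value_mult_left[OF boundary_in_free[OF A] B]
          cell_value_boundary_bead[OF \<sigma>(1)] valB)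
  qed
  have 2: "lin (cell_value (n - 1)) (lin (\<lambda>b. gen (cell_mult i (k - 1) ?A b)) (box_boundary K k ?B)) =
      (gen [(i, \<sigma>)] \<odot> word_deriv letter_deriv w :: 'a word \<Rightarrow>\<^sub>0 'k)"
  proof (cases "k = 0")
    case True
    then have "word_deriv letter_deriv w = (0 :: 'a word \<Rightarrow>\<^sub>0 'k)"
      using Cons.IH[OF l(2)] by (simp add: box_boundary_def lin_simps)
    then show ?thesis using True by (simp add: box_boundary_def lin_simps word_mult_right(3) del: bilin_gen)
  next
    case False
    then have "n - 1 = i + (k - 1)" using l(3) by simp
    then show ?thesis
      by (simp only: lin_cell_value_mult_right[OF A boundary_in_free[OF B]] Cons.IH[OF l(2)] valA)
  qed
  have "word_cell (a # w) = cell_mult i k ?A ?B" by (simp add: a k_def)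
  then have "box_boundary K n (word_cell (a # w)) = lin (\<lambda>a. gen (cell_mult (i - 1) k a ?B)) (box_boundary K i ?A) +
      cscale ((-1) ^ i) (lin (\<lambda>b. gen (cell_mult i (k - 1) ?A b)) (box_boundary K k ?B) :: 'a rig_cell \<Rightarrow>\<^sub>0 'k)"
    unfolding l(3) by (simp only: boundary_cell_mult[OF A B])
  then show ?case unfolding a word_deriv.simps by (simp only: lin_simps 1 2)
qed

lemma cell_value_boundary:
  assumes "A \<in> cells K n"
  shows "lin (cell_value (n - 1)) (box_boundary K n A) =
    lin (word_deriv letter_deriv) (cell_value n A :: 'a word \<Rightarrow>\<^sub>0 'k::{comm_ring,comm_monoid_mult})"
  using cell_normal_form[OF assms]
proof
  assume "A \<in> box_degenerate K n"
  then show ?thesis by (simp only: cell_value_boundary_degenerate cell_value_degenerate linear_map_zero[OF linear_map_lin])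
next
  assume "\<exists>w\<in>bead_words n. A = word_cell w"
  then obtain w where w: "w \<in> bead_words n" "A = word_cell w" by blast
  show ?thesis
    unfolding w(2) cell_value_word_cell[OF w(1)] lin_gen by (rule cell_value_boundary_word_cell[OF w(1)])
qed

section \<open>The dg algebra of bead words\<close>

abbreviation bead_dga :: "('k::{comm_ring,comm_monoid_mult}, 'a word \<Rightarrow>\<^sub>0 'k) dga" where
  "bead_dga \<equiv> word_dga bead_words (word_deriv letter_deriv)"

text \<open>
  Every word is the value of a cell, so the properties of the cubical boundary carry over.
\<close>

lemma deriv_bead_word:
  assumes "w \<in> bead_words n"
  shows "word_deriv letter_deriv w \<in> free (bead_words (n - 1))"
    and "n = 0 \<Longrightarrow> word_deriv letter_deriv w = (0 :: 'a word \<Rightarrow>\<^sub>0 'k::{comm_ring,comm_monoid_mult})"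
    and "lin (word_deriv letter_deriv) (word_deriv letter_deriv w) = (0 :: 'a word \<Rightarrow>\<^sub>0 'k)"
proof -
  let ?A = "word_cell w"
  have A: "?A \<in> cells K n" by (rule word_cell_in[OF assms])
  have bd: "box_boundary K n ?A \<in> free (cells K (n - 1))" by (rule boundary_in_free[OF A])
  show "word_deriv letter_deriv w \<in> free (bead_words (n - 1))"
    unfolding cell_value_boundary_word_cell[OF assms, symmetric]
    by (rule lin_in_submod[OF submod_free cell_value_in bd])
  show "n = 0 \<Longrightarrow> word_deriv letter_deriv w = (0 :: 'a word \<Rightarrow>\<^sub>0 'k)"
    unfolding cell_value_boundary_word_cell[OF assms, symmetric] by (simp add: box_boundary_def lin_simps)
  have "lin (word_deriv letter_deriv) (lin (cell_value (n - 1)) p) =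
      (lin (cell_value (n - 1 - 1)) (lin (box_boundary K (n - 1)) p) :: 'a word \<Rightarrow>\<^sub>0 'k)"
    if "p \<in> free (cells K (n - 1))" for p
    by (rule linear_map_eq_on_free[OF linear_map_comp[OF linear_map_lin linear_map_lin]
          linear_map_comp[OF linear_map_lin linear_map_lin] _ that])
       (simp only: lin_gen cell_value_boundary)
  from this[OF bd] show "lin (word_deriv letter_deriv) (word_deriv letter_deriv w) = (0 :: 'a word \<Rightarrow>\<^sub>0 'k)"
    unfolding cell_value_boundary_word_cell[OF assms] boundary_boundary[OF A] by (simp add: lin_simps)
qed

lemma dg_algebra_bead_dga: "dg_algebra (bead_dga :: ('k::{comm_ring,comm_monoid_mult}, 'a word \<Rightarrow>\<^sub>0 'k) dga)"
proof (rule dg_algebra_word_dga)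
  show "[] \<in> bead_words 0" by (simp add: bead_words_simps)
  show "word_deriv letter_deriv (u @ v) = word_deriv letter_deriv u \<odot> gen v +
      cscale ((-1) ^ m) (gen u \<odot> word_deriv letter_deriv v :: 'a word \<Rightarrow>\<^sub>0 'k)" if "u \<in> bead_words m" for u v m
    using that by (simp only: word_deriv_append) (simp add: bead_words_def)
qed (simp_all only: bead_words_append deriv_bead_word)

text \<open>
  The linear extension of \<open>word_cell\<close> splits that of \<open>cell_value\<close>, and by the normal form the two are
  inverse to each other modulo degenerate cells; hence the kernel consists of the degenerate chains.
\<close>

theorem Lambda_iso_bead_dga:
  shows "dg_algebra (Lambda S x :: ('k::{comm_ring,comm_monoid_mult}, ('a rig_cell \<Rightarrow>\<^sub>0 'k) set) dga)"
    and "\<exists>\<phi>. dga_iso (Lambda S x :: ('k, ('a rig_cell \<Rightarrow>\<^sub>0 'k) set) dga) bead_dga \<phi>"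
proof -
  let ?mu = "\<lambda>m n p q. lin (\<lambda>c. gen (rig_comp S x x x (m + n) c)) (bilin (\<lambda>\<sigma> \<tau>. gen (tensor_cell K K m n \<sigma> \<tau>)) p q) ::
    'a rig_cell \<Rightarrow>\<^sub>0 'k"
  let ?F = "\<lambda>n. lin (cell_value n) :: ('a rig_cell \<Rightarrow>\<^sub>0 'k) \<Rightarrow> ('a word \<Rightarrow>\<^sub>0 'k)"
  let ?M = "box_null K :: nat \<Rightarrow> ('a rig_cell \<Rightarrow>\<^sub>0 'k) set"
  have Lambda: "(Lambda S x :: ('k, ('a rig_cell \<Rightarrow>\<^sub>0 'k) set) dga) =
      quot_dga (cells K) ?M (box_boundary K) ?mu (gen unit_cell)"
    by (simp add: Lambda_def quot_dga_def Q_box_def Lambda_mult_def[abs_def] unit_cell_def const_neck_def const_map_def)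
  have mu: "?mu m n p q = bilin (\<lambda>\<sigma> \<tau>. gen (cell_mult m n \<sigma> \<tau>)) p q" for m n p q
  proof (rule linear_map_ext[where f = "\<lambda>p. ?mu m n p q" and g = "\<lambda>p. bilin (\<lambda>\<sigma> \<tau>. gen (cell_mult m n \<sigma> \<tau>)) p q"])
    show "?mu m n (gen \<sigma>) q = bilin (\<lambda>\<sigma> \<tau>. gen (cell_mult m n \<sigma> \<tau>)) (gen \<sigma>) q" for \<sigma>
      by (rule linear_map_ext[where f = "\<lambda>q. ?mu m n (gen \<sigma>) q"])
         (simp_all add: cell_mult_def linear_map_comp[OF linear_map_lin])
  qed (simp_all add: linear_map_comp[OF linear_map_lin])
  have null_hull: "?M n = submod hull (gen ` box_degenerate K n \<union> box_boundary K (Suc n) ` box_degenerate K (Suc n))" for n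
    by (simp add: gen_subcplx_def)
  have null_zero: "?F n p = 0" if "p \<in> ?M n" for n p
    using that unfolding null_hull
  proof (rule hull_linear_kernel[OF linear_map_lin, rotated])
    fix b :: "'a rig_cell \<Rightarrow>\<^sub>0 'k"
    assume "b \<in> gen ` box_degenerate K n \<union> box_boundary K (Suc n) ` box_degenerate K (Suc n)"
    then show "?F n b = 0"
      using cell_value_boundary_degenerate[of _ "Suc n"] by (auto simp: cell_value_degenerate)
  qed
  have splitting: "gen A - lin (\<lambda>w. gen (word_cell w)) (cell_value n A) \<in> ?M n" if "A \<in> cells K n" for A n
    using cell_normal_form[OF that]
  proof
    assume "A \<in> box_degenerate K n"
    then show ?thesis by (simp add: cell_value_degenerate lin_simps null_hull hull_inc)
  next
    assume "\<exists>w\<in>bead_words n. A = word_cell w"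
    then obtain w where w: "w \<in> bead_words n" "A = word_cell w" by blast
    then show ?thesis by (simp add: cell_value_word_cell[OF w(1)] null_hull submod_zero)
  qed
  have ker: "?F n p = 0 \<longleftrightarrow> p \<in> ?M n" if p: "p \<in> free (cells K n)" for n p
  proof
    assume F: "?F n p = 0"
    have "p - lin (\<lambda>w. gen (word_cell w)) (?F n p) \<in> ?M n"
      by (rule free_linear_image[OF linear_map_difference[OF linear_map_ident linear_map_comp[OF linear_map_lin linear_map_lin]] _ _ p])
         (simp only: null_hull submod_hull, unfold lin_gen, rule splitting)
    then show "p \<in> ?M n" by (simp add: F lin_simps)
  qed (rule null_zero)
  have F_mu: "?F (m + n) (bilin (\<lambda>\<sigma> \<tau>. gen (cell_mult m n \<sigma> \<tau>)) p q) = ?F m p \<odot> ?F n q"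
    if p: "p \<in> free (cells K m)" and q: "q \<in> free (cells K n)" for m n p q
  proof (rule linear_map_eq_on_free[where f = "\<lambda>p. ?F (m + n) (bilin (\<lambda>\<sigma> \<tau>. gen (cell_mult m n \<sigma> \<tau>)) p q)"
        and g = "\<lambda>p. ?F m p \<odot> ?F n q", OF _ _ _ p])
    show "?F (m + n) (bilin (\<lambda>\<sigma> \<tau>. gen (cell_mult m n \<sigma> \<tau>)) (gen A) q) = ?F m (gen A) \<odot> ?F n q" if "A \<in> cells K m" for A
      unfolding bilin_gen_left lin_gen by (rule lin_cell_value_mult_right[OF that q])
  qed (auto intro!: linear_map_intros linear_map_comp[OF linear_map_lin])
  have M: "submod (?M n)" "?M n \<subseteq> free (cells K n)" for n
  proof -
    show "submod (?M n)" by (simp only: null_hull submod_hull)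
    show "?M n \<subseteq> free (cells K n)"
      unfolding null_hull
    proof (rule hull_in_submod[OF submod_free])
      have "gen A \<in> (free (cells K n) :: ('a rig_cell \<Rightarrow>\<^sub>0 'k) set)" if "A \<in> box_degenerate K n" for A
        using degenerate_cells[of n] that by (intro gen_in_free) blast
      moreover have "box_boundary K (Suc n) A \<in> (free (cells K n) :: ('a rig_cell \<Rightarrow>\<^sub>0 'k) set)"
        if "A \<in> box_degenerate K (Suc n)" for A
      proof -
        have "A \<in> cells K (Suc n)" using degenerate_cells[of "Suc n"] that by blast
        from boundary_in_free[OF this] show ?thesis by simp
      qed
      ultimately show "gen ` box_degenerate K n \<union> box_boundary K (Suc n) ` box_degenerate K (Suc n)
          \<subseteq> (free (cells K n) :: ('a rig_cell \<Rightarrow>\<^sub>0 'k) set)" by blast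
    qed
  qed
  have F_in: "?F n (gen A) \<in> free (bead_words n)" if "A \<in> cells K n" for n A
    unfolding lin_gen by (rule cell_value_in[OF that])
  have surj: "\<exists>p\<in>free (cells K n). ?F n p = gen w" if w: "w \<in> bead_words n" for n w
    by (rule bexI[of _ "gen (word_cell w)"])
       (simp_all add: cell_value_word_cell[OF w] gen_in_free word_cell_in[OF w])
  have F_bd: "?F (n - 1) (box_boundary K n A) = lin (word_deriv letter_deriv) (?F n (gen A))"
    if "A \<in> cells K n" for n A
    unfolding lin_gen by (rule cell_value_boundary[OF that])
  have mu_in: "?mu m n p q \<in> free (cells K (m + n))"
    if "p \<in> free (cells K m)" "q \<in> free (cells K n)" for m n p q
    unfolding mu by (rule bilin_in_submod[OF submod_free gen_in_free[OF cell_mult_in] that])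
  have mu_F: "?F (m + n) (?mu m n p q) = ?F m p \<odot> ?F n q"
    if "p \<in> free (cells K m)" "q \<in> free (cells K n)" for m n p q
    unfolding mu by (rule F_mu[OF that])
  have unit_F: "?F 0 (gen unit_cell) = gen []" unfolding lin_gen by (rule cell_value_unit)
  note iso = quot_dga_iso_word_dga[where F = ?F and X = "cells K" and Y = bead_words and M = ?M,
      OF dg_algebra_bead_dga M linear_map_lin F_in ker surj boundary_in_free F_bd mu_in mu_F
        gen_in_free[OF unit_cell_in] unit_F]
  show "dg_algebra (Lambda S x :: ('k, ('a rig_cell \<Rightarrow>\<^sub>0 'k) set) dga)"
    and "\<exists>\<phi>. dga_iso (Lambda S x :: ('k, ('a rig_cell \<Rightarrow>\<^sub>0 'k) set) dga) bead_dga \<phi>"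
    unfolding Lambda by (rule iso; assumption)+
qed

end

section \<open>Words modulo multilinearity\<close>

text \<open>
  The multiplicative extension of \<open>\<rho>\<close> from letters to words.
\<close>

fun word_value ::
    "(nat \<Rightarrow> 'b \<Rightarrow> ('c list \<Rightarrow>\<^sub>0 'k::{comm_ring,comm_monoid_mult})) \<Rightarrow> 'b word \<Rightarrow> ('c list \<Rightarrow>\<^sub>0 'k)" where
  "word_value \<rho> [] = gen []"
| "word_value \<rho> ((i, c) # w) = \<rho> i c \<odot> word_value \<rho> w"

lemma word_value_append: "word_value \<rho> (u @ v) = word_value \<rho> u \<odot> word_value \<rho> v"
proof (induction u)
  case (Cons a u)
  then show ?case by (cases a) (simp only: append_Cons word_value.simps word_mult_assoc)
qed (simp del: bilin_gen)

lemma lin_word_value_mult: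
  "lin (word_value \<rho>) (p \<odot> q) = lin (word_value \<rho>) p \<odot> lin (word_value \<rho>) q"
proof (rule linear_map_ext[where f = "\<lambda>p. lin (word_value \<rho>) (p \<odot> q)" and
      g = "\<lambda>p. lin (word_value \<rho>) p \<odot> lin (word_value \<rho>) q"])
  fix u
  show "lin (word_value \<rho>) (gen u \<odot> q) = lin (word_value \<rho>) (gen u) \<odot> lin (word_value \<rho>) q"
    by (rule linear_map_ext[where f = "\<lambda>q. lin (word_value \<rho>) (gen u \<odot> q)"])
       (auto intro!: linear_map_intros linear_map_comp[OF linear_map_lin] simp: word_value_append)
qed (auto intro!: linear_map_intros linear_map_comp[OF linear_map_lin])

lemma words_middle: "u @ (p, a) # v \<in> words M n \<Longrightarrow> a \<in> gr M p"
  by (auto simp: words_def)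

lemma words_append: "u \<in> words M m \<Longrightarrow> v \<in> words M n \<Longrightarrow> u @ v \<in> words M (m + n)"
  by (auto simp: words_def)

lemma words_Nil: "[] \<in> words M n \<longleftrightarrow> n = 0"
  by (auto simp: words_def)

lemma words_Cons: "(i, c) # w \<in> words M n \<longleftrightarrow> c \<in> gr M i \<and> (\<exists>m. n = i + m \<and> w \<in> words M m)"
  by (auto simp: words_def)

lemma submod_multilin [simp]: "submod (multilin M W)"
  by (simp add: multilin_def)

lemma multilin_linear_image:
  fixes M :: "('k::{comm_ring,comm_monoid_mult}, 'm, 'z) gmod_scheme" and g :: "('m word \<Rightarrow>\<^sub>0 'k) \<Rightarrow> ('y \<Rightarrow>\<^sub>0 'k)"
  assumes g: "linear_map g" "submod N"
    and add: "\<And>u v p a b. u @ (p, a) # v \<in> W \<Longrightarrow> u @ (p, b) # v \<in> W \<Longrightarrow>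
      g (gen (u @ (p, gadd M p a b) # v)) - g (gen (u @ (p, a) # v)) - g (gen (u @ (p, b) # v)) \<in> N"
    and scale: "\<And>u v p r a. u @ (p, a) # v \<in> W \<Longrightarrow>
      g (gen (u @ (p, gscale M p r a) # v)) - cscale r (g (gen (u @ (p, a) # v))) \<in> N"
    and q: "q \<in> multilin M W"
  shows "g q \<in> N"
  using q unfolding multilin_def
proof (rule hull_linear_image[OF g, rotated])
  fix c :: "'m word \<Rightarrow>\<^sub>0 'k"
  assume "c \<in> {gen (u @ (p, gadd M p a b) # v) - gen (u @ (p, a) # v) - gen (u @ (p, b) # v) | u v p a b.
        u @ (p, a) # v \<in> W \<and> u @ (p, b) # v \<in> W} \<union>
     {gen (u @ (p, gscale M p r a) # v) - cscale r (gen (u @ (p, a) # v)) | u v p r a.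
        u @ (p, a) # v \<in> W}"
  then show "g c \<in> N"
    by (elim UnE CollectE exE conjE) (simp_all only: linear_map_simps[OF g(1)] add scale)
qed

text \<open>
  The factor \<open>s\<close> depends on the degrees of the letters only, and it accounts for the sign in the quadratic
  part of the cobar differential.
\<close>

lemma word_value_multilin:
  fixes \<rho> :: "nat \<Rightarrow> 'm \<Rightarrow> ('c list \<Rightarrow>\<^sub>0 'k::{comm_ring,comm_monoid_mult})"
  assumes add: "\<And>p a b. a \<in> gr M p \<Longrightarrow> b \<in> gr M p \<Longrightarrow> \<rho> p (gadd M p a b) = \<rho> p a + \<rho> p b"
    and scale: "\<And>p r a. a \<in> gr M p \<Longrightarrow> \<rho> p (gscale M p r a) = cscale r (\<rho> p a)"
    and W: "W \<subseteq> words M n" and q: "q \<in> multilin M W"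
  shows "lin (\<lambda>w. cscale (s (map fst w)) (word_value \<rho> w)) q = 0"
proof -
  have mid: "a \<in> gr M p" if "u @ (p, a) # v \<in> W" for u p a v
    by (rule words_middle[OF subsetD[OF W that]])
  have "lin (\<lambda>w. cscale (s (map fst w)) (word_value \<rho> w)) q \<in> {0}"
    using q
    by (rule multilin_linear_image[OF linear_map_lin submod_singleton_zero, rotated 2])
       (simp_all only: lin_gen word_value_append word_value.simps add[OF mid mid] scale[OF mid] map_append list.map fst_conv
          word_mult_left word_mult_right cscale_add_right cscale_cscale mult.commute mult.left_commute, simp_all)
  then show ?thesis by simp
qed

text \<open>
  Additivity and homogeneity hold one summand at a time; by induction on the number of generators, a
  letter that is the class of a chain may be expanded into the classes of the generators.
\<close>

lemma multilin_expansion: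
  fixes c :: "('x \<Rightarrow>\<^sub>0 'k::{comm_ring,comm_monoid_mult}) \<Rightarrow> 'm"
  assumes W: "\<And>p. p \<in> free X \<Longrightarrow> u @ (i, c p) # v \<in> W"
    and add: "\<And>p q. p \<in> free X \<Longrightarrow> q \<in> free X \<Longrightarrow> gadd M i (c p) (c q) = c (p + q)"
    and scale: "\<And>r p. p \<in> free X \<Longrightarrow> gscale M i r (c p) = c (cscale r p)"
    and p: "p \<in> free X"
  shows "gen (u @ (i, c p) # v) - lin (\<lambda>\<sigma>. gen (u @ (i, c (gen \<sigma>)) # v)) p \<in> multilin M W"
proof -
  let ?N = "multilin M W :: ('m word \<Rightarrow>\<^sub>0 'k) set"
  define g :: "('x \<Rightarrow>\<^sub>0 'k) \<Rightarrow> ('m word \<Rightarrow>\<^sub>0 'k)" where "g p = gen (u @ (i, c p) # v)" for p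
  have N_add: "g (p + q) - g p - g q \<in> ?N" if "p \<in> free X" "q \<in> free X" for p q
  proof -
    have "gen (u @ (i, gadd M i (c p) (c q)) # v) - gen (u @ (i, c p) # v) - gen (u @ (i, c q) # v) \<in> ?N"
      unfolding multilin_def using W[OF that(1)] W[OF that(2)] by (intro hull_inc UnI1) blast
    then show ?thesis by (simp only: g_def add[OF that])
  qed
  have N_scale: "g (cscale r p) - cscale r (g p) \<in> ?N" if "p \<in> free X" for r p
  proof -
    have "gen (u @ (i, gscale M i r (c p)) # v) - cscale r (gen (u @ (i, c p) # v)) \<in> ?N"
      unfolding multilin_def using W[OF that] by (intro hull_inc UnI2) blast
    then show ?thesis by (simp only: g_def scale[OF that])
  qed
  have sum: "g (\<Sum>\<sigma>\<in>A. cscale (a \<sigma>) (gen \<sigma>)) - (\<Sum>\<sigma>\<in>A. cscale (a \<sigma>) (g (gen \<sigma>))) \<in> ?N"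
    if "finite A" "A \<subseteq> X" for A a
    using that
  proof (induction A rule: finite_induct)
    case empty
    show ?case using N_scale[of 0 0] submod_zero[OF submod_free, of X] by simp
  next
    case (insert \<tau> A)
    let ?p = "\<Sum>\<sigma>\<in>A. cscale (a \<sigma>) (gen \<sigma>)"
    let ?s = "\<Sum>\<sigma>\<in>A. cscale (a \<sigma>) (g (gen \<sigma>))"
    have \<tau>: "gen \<tau> \<in> free X" using insert.prems by (intro gen_in_free) simp
    have a\<tau>: "cscale (a \<tau>) (gen \<tau>) \<in> free X" by (rule submod_cscale[OF submod_free \<tau>])
    have "gen \<sigma> \<in> free X" if "\<sigma> \<in> A" for \<sigma> using insert.prems that by (intro gen_in_free) auto
    then have A: "?p \<in> free X" by (intro submod_sum submod_cscale submod_free)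
    have "g ?p - ?s \<in> ?N" using insert.IH insert.prems by simp
    from submod_add[OF submod_multilin submod_add[OF submod_multilin N_add[OF a\<tau> A] N_scale[OF \<tau>, of "a \<tau>"]] this]
    show ?case using insert.hyps by (simp add: algebra_simps)
  qed
  have keys: "Poly_Mapping.keys p \<subseteq> X" using p by (simp add: free_def)
  have "gen (u @ (i, c p) # v) - lin (\<lambda>\<sigma>. gen (u @ (i, c (gen \<sigma>)) # v)) p =
      g (\<Sum>\<sigma>\<in>Poly_Mapping.keys p. cscale (Poly_Mapping.lookup p \<sigma>) (gen \<sigma>)) -
      (\<Sum>\<sigma>\<in>Poly_Mapping.keys p. cscale (Poly_Mapping.lookup p \<sigma>) (g (gen \<sigma>)))"
    unfolding chain_expansion[symmetric] g_def lin_def ..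
  also have "\<dots> \<in> ?N" by (rule sum[OF finite_keys keys])
  finally show ?thesis .
qed

lemma multilin_zero_letter:
  fixes c :: "('x \<Rightarrow>\<^sub>0 'k::{comm_ring,comm_monoid_mult}) \<Rightarrow> 'm"
  assumes "\<And>p. p \<in> free X \<Longrightarrow> u @ (i, c p) # v \<in> W"
    and "\<And>p q. p \<in> free X \<Longrightarrow> q \<in> free X \<Longrightarrow> gadd M i (c p) (c q) = c (p + q)"
    and "\<And>r p. p \<in> free X \<Longrightarrow> gscale M i r (c p) = c (cscale r p)"
  shows "gen (u @ (i, c 0) # v) \<in> (multilin M W :: ('m word \<Rightarrow>\<^sub>0 'k) set)"
  using multilin_expansion[where c = c and X = X and M = M and W = W and p = 0,
      OF assms submod_zero[OF submod_free]] by (simp only: lin_simps diff_zero)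

text \<open>
  The multilinearity relations form a two-sided ideal.
\<close>

lemma tens_null_mult:
  fixes M :: "('k::{comm_ring,comm_monoid_mult}, 'm, 'z) gmod_scheme"
  assumes r: "r \<in> tens_null M m"
  shows "q \<in> free (words M n) \<Longrightarrow> r \<odot> q \<in> tens_null M (m + n)"
    and "q \<in> free (words M n) \<Longrightarrow> q \<odot> r \<in> tens_null M (n + m)"
proof -
  have ideal: "gen y \<odot> r \<odot> gen z \<in> tens_null M k"
    if yz: "\<And>w. w \<in> words M m \<Longrightarrow> y @ w @ z \<in> words M k" for y z k
    using r
  proof (rule multilin_linear_image[where g = "\<lambda>r. gen y \<odot> r \<odot> gen z", rotated 4])
    fix u v p a b assume "u @ (p, a) # v \<in> words M m" "u @ (p, b) # v \<in> words M m"
    from yz[OF this(1)] yz[OF this(2)]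
    have "gen ((y @ u) @ (p, gadd M p a b) # (v @ z)) - gen ((y @ u) @ (p, a) # (v @ z)) -
        gen ((y @ u) @ (p, b) # (v @ z)) \<in> (tens_null M k :: ('m word \<Rightarrow>\<^sub>0 'k) set)"
      unfolding multilin_def
      by (intro hull_inc UnI1 CollectI exI conjI) (rule refl, simp_all)
    then show "gen y \<odot> gen (u @ (p, gadd M p a b) # v) \<odot> gen z - gen y \<odot> gen (u @ (p, a) # v) \<odot> gen z -
        gen y \<odot> gen (u @ (p, b) # v) \<odot> gen z \<in> tens_null M k" by simp
  next
    fix u v p t a assume "u @ (p, a) # v \<in> words M m"
    from yz[OF this]
    have "gen ((y @ u) @ (p, gscale M p t a) # (v @ z)) - cscale t (gen ((y @ u) @ (p, a) # (v @ z)))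
        \<in> (tens_null M k :: ('m word \<Rightarrow>\<^sub>0 'k) set)"
      unfolding multilin_def
      by (intro hull_inc UnI2 CollectI exI conjI) (rule refl, simp_all)
    then show "gen y \<odot> gen (u @ (p, gscale M p t a) # v) \<odot> gen z -
        cscale t (gen y \<odot> gen (u @ (p, a) # v) \<odot> gen z) \<in> tens_null M k" by simp
  qed (auto intro!: linear_map_intros)
  show "r \<odot> q \<in> tens_null M (m + n)" if "q \<in> free (words M n)"
  proof (rule free_linear_image[OF linear_map_word_mult_right submod_multilin _ that])
    show "r \<odot> gen w \<in> tens_null M (m + n)" if "w \<in> words M n" for w
      using ideal[of "[]" w "m + n"] words_append[OF _ that] by simp
  qed
  show "q \<odot> r \<in> tens_null M (n + m)" if "q \<in> free (words M n)"
  proof (rule free_linear_image[OF linear_map_word_mult_left submod_multilin _ that])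
    show "gen w \<odot> r \<in> tens_null M (n + m)" if "w \<in> words M n" for w
      using ideal[of w "[]" "n + m"] words_append[OF that] by simp
  qed
qed

lemma multilin_subset_free:
  fixes M :: "('k::{comm_ring,comm_monoid_mult}, 'm, 'z) gmod_scheme"
  assumes add: "\<And>p a b. a \<in> gr M p \<Longrightarrow> b \<in> gr M p \<Longrightarrow> gadd M p a b \<in> gr M p"
    and scale: "\<And>p r a. a \<in> gr M p \<Longrightarrow> gscale M p r a \<in> gr M p"
  shows "tens_null M n \<subseteq> free (words M n)"
proof
  fix q :: "'m word \<Rightarrow>\<^sub>0 'k" assume q: "q \<in> tens_null M n"
  show "q \<in> free (words M n)"
  proof (rule multilin_linear_image[where g = "\<lambda>q. q", OF linear_map_ident submod_free _ _ q])
    fix u v p a b assume w: "u @ (p, a) # v \<in> words M n" "u @ (p, b) # v \<in> words M n"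
    have "u @ (p, gadd M p a b) # v \<in> words M n" using w add by (simp add: words_def)
    then show "gen (u @ (p, gadd M p a b) # v) - gen (u @ (p, a) # v) - gen (u @ (p, b) # v) \<in>
        (free (words M n) :: ('m word \<Rightarrow>\<^sub>0 'k) set)"
      by (intro submod_diff[OF submod_free] gen_in_free w)
  next
    fix u v p r a assume w: "u @ (p, a) # v \<in> words M n"
    have "u @ (p, gscale M p r a) # v \<in> words M n" using w scale by (simp add: words_def)
    then show "gen (u @ (p, gscale M p r a) # v) - cscale r (gen (u @ (p, a) # v)) \<in>
        (free (words M n) :: ('m word \<Rightarrow>\<^sub>0 'k) set)"
      by (intro submod_diff[OF submod_free] submod_cscale[OF submod_free] gen_in_free w)
  qed
qed

section \<open>Normalized simplicial chains\<close>

text \<open>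
  A linear map that respects the submodules may be evaluated on any representative of a coset.
\<close>

lemma quot_linear:
  assumes "submod M" "submod N" "linear_map g" "\<And>q. q \<in> M \<Longrightarrow> g q \<in> N"
  shows "(\<Union>q\<in>coset M p. coset N (g q)) = coset N (g p)"
proof (rule UN_coset_const[OF _ coset_self[OF assms(1)]])
  fix q assume "q \<in> coset M p"
  then have "g (q - p) \<in> N" by (intro assms(4)) (simp only: in_coset_iff)
  then show "coset N (g q) = coset N (g p)"
    by (simp only: coset_eq_iff[OF assms(2)] linear_map_diff[OF assms(3)])
qed

lemma quot_add:
  assumes "submod M"
  shows "(\<Union>p'\<in>coset M p. \<Union>q'\<in>coset M q. coset M (p' + q')) = coset M (p + q)"
proof (rule UN_coset_const[OF UN_coset_const[OF _ coset_self[OF assms]] coset_self[OF assms]])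
  fix p' q' assume "p' \<in> coset M p" "q' \<in> coset M q"
  then have "p' - p + (q' - q) \<in> M" by (intro submod_add[OF assms]) (simp_all only: in_coset_iff)
  then show "coset M (p' + q') = coset M (p + q)" by (simp add: coset_eq_iff[OF assms] algebra_simps)
qed

context simplicial
begin

lemma simp_null_eq: "simp_null S n = submod hull (gen ` simp_degenerate S n)"
proof
  show "simp_null S n \<subseteq> submod hull (gen ` simp_degenerate S n)"
    unfolding gen_subcplx_def
  proof (rule hull_in_submod[OF submod_hull], rule Un_least)
    show "gen ` simp_degenerate S n \<subseteq> submod hull (gen ` simp_degenerate S n)" by (rule hull_subset)
    show "simp_boundary S (Suc n) ` simp_degenerate S (Suc n) \<subseteq> submod hull (gen ` simp_degenerate S n)"
      using simp_degenerate_boundary[of _ "Suc n"] by (intro image_subsetI) simp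
  qed
  show "submod hull (gen ` simp_degenerate S n) \<subseteq> simp_null S n"
    unfolding gen_subcplx_def by (rule hull_mono) (rule Un_upper1)
qed

lemma submod_simp_null [simp]: "submod (simp_null S n)"
  by (simp only: simp_null_eq submod_hull)

lemma simp_null_boundary: "p \<in> simp_null S n \<Longrightarrow> lin (simp_boundary S n) p \<in> simp_null S (n - 1)"
  unfolding simp_null_eq
  by (erule hull_linear_image[OF linear_map_lin submod_hull, rotated]) (auto intro: simp_degenerate_boundary simp del: One_nat_def)

lemma simp_boundary_in: "\<sigma> \<in> cells S n \<Longrightarrow> simp_boundary S n \<sigma> \<in> free (cells S (n - 1))"
  unfolding simp_boundary_def
  by (auto intro!: submod_zero[OF submod_free] submod_sum[OF submod_free] submod_cscale[OF submod_free]
      gen_in_free simp_act_in coface_hom simp del: One_nat_def)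

lemma simp_null_subset: "simp_null S n \<subseteq> free (cells S n)"
  unfolding simp_null_eq
  by (rule hull_in_submod[OF submod_free]) (use simp_degenerate_cells[of n] in \<open>auto intro!: gen_in_free\<close>)

abbreviation cls :: "nat \<Rightarrow> ('a \<Rightarrow>\<^sub>0 'k::{comm_ring,comm_monoid_mult}) \<Rightarrow> ('a \<Rightarrow>\<^sub>0 'k) set" where
  "cls n \<equiv> coset (simp_null S n)"

lemma chains_simps:
  fixes p q :: "'a \<Rightarrow>\<^sub>0 'k::{comm_ring,comm_monoid_mult}"
  shows "gr (Q_simp S) n = cls n ` (free (cells S n) :: ('a \<Rightarrow>\<^sub>0 'k) set)"
    and "gadd (Q_simp S) n (cls n p) (cls n q) = cls n (p + q)"
    and "gscale (Q_simp S) n r (cls n p) = cls n (cscale r p)"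
    and "bd (Q_simp S) n (cls n p) = cls (n - 1) (lin (simp_boundary S n) p)"
proof -
  note defs = Q_simp_def Q_simp_cplx_def quot_cplx_def quot_mod_def cplx.defs gmod.defs
  show "gr (Q_simp S) n = cls n ` (free (cells S n) :: ('a \<Rightarrow>\<^sub>0 'k) set)" by (simp add: defs)
  show "gadd (Q_simp S) n (cls n p) (cls n q) = cls n (p + q)"
    using quot_add[OF submod_simp_null, where p = p and q = q] by (simp add: defs)
  show "gscale (Q_simp S) n r (cls n p) = cls n (cscale r p)"
    using quot_linear[where g = "cscale r" and p = p, OF submod_simp_null submod_simp_null
        linear_map_cscale_self submod_cscale[OF submod_simp_null]] by (simp add: defs)
  show "bd (Q_simp S) n (cls n p) = cls (n - 1) (lin (simp_boundary S n) p)"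
    using quot_linear[where p = p, OF submod_simp_null submod_simp_null linear_map_lin simp_null_boundary]
    by (simp add: defs)
qed

lemma desusp_simps:
  "gr (desusp C) i = gr C (Suc i)" "gadd (desusp C) i = gadd C (Suc i)"
  "gscale (desusp C) i = gscale C (Suc i)"
  by (simp_all add: desusp_def)

lemma front_face_in: "\<sigma> \<in> cells S (p + q) \<Longrightarrow> front_face S p q \<sigma> \<in> cells S p"
  unfolding front_face_def by (rule simp_act_in) (auto intro!: hom_SimplexI)

lemma last_face_in: "\<sigma> \<in> cells S (p + q) \<Longrightarrow> last_face S p q \<sigma> \<in> cells S q"
  unfolding last_face_def by (rule simp_act_in) (auto intro!: hom_SimplexI)

lemma front_last_face_whole:
  assumes "\<sigma> \<in> cells S n"
  shows "front_face S n 0 \<sigma> = \<sigma>" "last_face S 0 n \<sigma> = \<sigma>"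
proof -
  have "(\<lambda>i\<in>{..n}. i) = restrict id {..n}" by (rule ext) simp
  then show "front_face S n 0 \<sigma> = \<sigma>" "last_face S 0 n \<sigma> = \<sigma>"
    using simp_act_id[OF assms] by (simp_all add: front_face_def last_face_def)
qed

lemma outer_faces:
  "act S i (Suc i) (coface (Suc i) 0) \<sigma> = last_face S 1 i \<sigma>"
  "act S i (Suc i) (coface (Suc i) (Suc i)) \<sigma> = front_face S i 1 \<sigma>"
proof -
  have "coface (Suc i) 0 = (\<lambda>v\<in>{..i}. v + 1)" "coface (Suc i) (Suc i) = (\<lambda>v\<in>{..i}. v)"
    by (auto simp: coface_def fun_eq_iff restrict_def)
  then show "act S i (Suc i) (coface (Suc i) 0) \<sigma> = last_face S 1 i \<sigma>"
    "act S i (Suc i) (coface (Suc i) (Suc i)) \<sigma> = front_face S i 1 \<sigma>"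
    by (simp_all add: last_face_def front_face_def)
qed

end

section \<open>Comparison of letters\<close>

context reduced_simplicial
begin

text \<open>
  The image of the generator \<open>s\<sigma>\<close> of the cobar construction. It vanishes for every degenerate \<open>\<sigma>\<close>, whereas
  the letter of a degenerate edge is 1.
\<close>

definition reduced_letter :: "nat \<Rightarrow> 'a \<Rightarrow> ('a word \<Rightarrow>\<^sub>0 'k::{comm_ring,comm_monoid_mult})" where
  "reduced_letter i \<sigma> = letter i \<sigma> - (if i = 0 then gen [] else 0)"

lemma letter_eq: "letter i \<sigma> = reduced_letter i \<sigma> + (if i = 0 then gen [] else 0)"
  by (simp add: reduced_letter_def)

lemma reduced_letter_degenerate: "\<sigma> \<in> simp_degenerate S (Suc i) \<Longrightarrow> reduced_letter i \<sigma> = 0"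
  by (simp add: reduced_letter_def letter_def)

lemma reduced_letter_in: "\<sigma> \<in> cells S (Suc i) \<Longrightarrow> reduced_letter i \<sigma> \<in> free (bead_words i)"
  unfolding reduced_letter_def
  by (intro submod_diff[OF submod_free] letter_in)
     (auto intro!: submod_zero[OF submod_free] gen_in_free simp: bead_words_simps)

lemma reduced_letter_null: "p \<in> simp_null S (Suc i) \<Longrightarrow>
    lin (reduced_letter i) p = (0 :: 'a word \<Rightarrow>\<^sub>0 'k::{comm_ring,comm_monoid_mult})"
  unfolding simp_null_eq
  by (erule hull_linear_kernel[OF linear_map_lin, rotated]) (auto simp: reduced_letter_degenerate)

definition class_value :: "nat \<Rightarrow> ('a \<Rightarrow>\<^sub>0 'k::{comm_ring,comm_monoid_mult}) set \<Rightarrow> ('a word \<Rightarrow>\<^sub>0 'k)" where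
  "class_value i c = lin (reduced_letter i) (SOME p. p \<in> c)"

lemma class_value_cls: "class_value i (cls (Suc i) p) = lin (reduced_letter i) p"
proof -
  have "(SOME q. q \<in> cls (Suc i) p) \<in> cls (Suc i) p" by (rule someI) (rule coset_self[OF submod_simp_null])
  then have "lin (reduced_letter i) ((SOME q. q \<in> cls (Suc i) p) - p) = (0 :: 'a word \<Rightarrow>\<^sub>0 'b)"
    unfolding in_coset_iff by (rule reduced_letter_null)
  then show ?thesis by (simp add: class_value_def lin_simps)
qed

lemma class_value_linear:
  assumes "a \<in> gr (Q_simp S) (Suc i)"
  shows "b \<in> gr (Q_simp S) (Suc i) \<Longrightarrow>
      class_value i (gadd (Q_simp S) (Suc i) a b) = class_value i a + class_value i b"
    and "class_value i (gscale (Q_simp S) (Suc i) r a) = cscale r (class_value i a)"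
proof -
  obtain p where p: "a = cls (Suc i) p" using assms by (auto simp: chains_simps(1))
  show "class_value i (gscale (Q_simp S) (Suc i) r a) = cscale r (class_value i a)"
    by (simp only: p chains_simps(3) class_value_cls lin_simps)
  assume "b \<in> gr (Q_simp S) (Suc i)"
  then obtain q where q: "b = cls (Suc i) q" by (auto simp: chains_simps(1))
  show "class_value i (gadd (Q_simp S) (Suc i) a b) = class_value i a + class_value i b"
    by (simp only: p q chains_simps(2) class_value_cls lin_simps)
qed

lemma class_value_in:
  assumes "c \<in> gr (Q_simp S) (Suc i)"
  shows "class_value i c \<in> free (bead_words i)"
proof -
  obtain p where p: "c = cls (Suc i) p" "p \<in> free (cells S (Suc i))" using assms by (auto simp: chains_simps(1))
  show ?thesis unfolding p(1) class_value_cls by (rule lin_in_submod[OF submod_free reduced_letter_in p(2)])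
qed

lemma word_value_class_in:
  "w \<in> words (desusp (Q_simp S)) n \<Longrightarrow> word_value class_value w \<in> free (bead_words n)"
proof (induction w arbitrary: n)
  case Nil
  then show ?case by (auto intro!: gen_in_free simp: words_Nil bead_words_simps)
next
  case (Cons a w)
  obtain i c where a: "a = (i, c)" by (cases a)
  obtain m where m: "c \<in> gr (Q_simp S) (Suc i)" "n = i + m" "w \<in> words (desusp (Q_simp S)) m"
    using Cons.prems by (auto simp: a words_Cons desusp_simps)
  show ?case unfolding a word_value.simps m(2)
    by (rule bilin_in_submod[OF submod_free gen_in_free[OF bead_words_append] class_value_in[OF m(1)] Cons.IH[OF m(3)]])
qed

text \<open>
  The substitution inverse to \<open>reduced_letter\<close>.
\<close>

definition bead_class :: "nat \<Rightarrow> 'a \<Rightarrow> (('a \<Rightarrow>\<^sub>0 'k::{comm_ring,comm_monoid_mult}) set word \<Rightarrow>\<^sub>0 'k)" where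
  "bead_class i \<sigma> = gen [(i, cls (Suc i) (gen \<sigma>))] + (if i = 0 then gen [] else 0)"

lemma cls_gen_in: "\<sigma> \<in> cells S n \<Longrightarrow> cls n (gen \<sigma>) \<in> gr (Q_simp S) n"
  unfolding chains_simps(1) by (intro imageI gen_in_free)

lemma bead_class_in:
  assumes "\<sigma> \<in> cells S (Suc i)"
  shows "bead_class i \<sigma> \<in> free (words (desusp (Q_simp S)) i)"
  unfolding bead_class_def
  by (intro submod_add[OF submod_free])
     (auto intro!: submod_zero[OF submod_free] gen_in_free simp: words_Nil words_Cons desusp_simps cls_gen_in[OF assms])

lemma word_value_bead_class_in:
  "w \<in> bead_words n \<Longrightarrow> word_value bead_class w \<in> free (words (desusp (Q_simp S)) n)"
proof (induction w arbitrary: n)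
  case Nil
  then show ?case by (auto intro!: gen_in_free simp: words_Nil bead_words_simps)
next
  case (Cons a w)
  obtain i \<sigma> where a: "a = (i, \<sigma>)" by (cases a)
  obtain m where m: "\<sigma> \<in> cells S (Suc i)" "n = i + m" "w \<in> bead_words m"
    using Cons.prems by (auto simp: a bead_words_simps letters_def)
  show ?case unfolding a word_value.simps m(2)
    by (rule bilin_in_submod[OF submod_free gen_in_free[OF words_append] bead_class_in[OF m(1)] Cons.IH[OF m(3)]])
qed

lemma class_value_bead_class:
  "w \<in> bead_words n \<Longrightarrow>
    lin (word_value class_value) (word_value bead_class w) = (gen w :: 'a word \<Rightarrow>\<^sub>0 'k::{comm_ring,comm_monoid_mult})"
proof (induction w arbitrary: n)
  case (Cons a w)
  obtain i \<sigma> where a: "a = (i, \<sigma>)" by (cases a)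
  obtain m where m: "\<sigma> \<in> cells S (Suc i)" "\<sigma> \<notin> simp_degenerate S (Suc i)" "w \<in> bead_words m"
    using Cons.prems by (auto simp: a bead_words_simps letters_def)
  have "lin (word_value class_value) (bead_class i \<sigma>) = (letter i \<sigma> :: 'a word \<Rightarrow>\<^sub>0 'k)"
    by (simp add: bead_class_def lin_simps class_value_cls letter_eq del: bilin_gen)
  also have "\<dots> = gen [(i, \<sigma>)]" using m(2) by (simp add: letter_def)
  finally show ?case unfolding a word_value.simps lin_word_value_mult Cons.IH[OF m(3)] by simp
qed simp

lemma bead_class_class_value:
  assumes "c \<in> gr (Q_simp S) (Suc i)"
  shows "lin (word_value bead_class) (class_value i c) - gen [(i, c)] \<in> tens_null (desusp (Q_simp S)) i"
proof -
  let ?N = "tens_null (desusp (Q_simp S)) i :: (('a \<Rightarrow>\<^sub>0 'b) set word \<Rightarrow>\<^sub>0 'b) set"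
  obtain p where p: "c = cls (Suc i) p" "p \<in> free (cells S (Suc i))" using assms by (auto simp: chains_simps(1))
  have W: "[] @ (i, cls (Suc i) q) # [] \<in> words (desusp (Q_simp S)) i"
    if "q \<in> free (cells S (Suc i))" for q :: "'a \<Rightarrow>\<^sub>0 'b"
    using that by (auto simp: words_Nil words_Cons desusp_simps chains_simps(1))
  have ops: "gadd (desusp (Q_simp S)) i (cls (Suc i) q) (cls (Suc i) q') = cls (Suc i) (q + q')"
      "gscale (desusp (Q_simp S)) i r (cls (Suc i) q) = cls (Suc i) (cscale r q)" for q q' :: "'a \<Rightarrow>\<^sub>0 'b" and r
    by (simp_all only: desusp_simps chains_simps)
  have 1: "gen [(i, c)] - lin (\<lambda>\<sigma>. gen [(i, cls (Suc i) (gen \<sigma>))]) p \<in> ?N"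
    using multilin_expansion[where c = "cls (Suc i)" and X = "cells S (Suc i)", OF W ops p(2)]
    unfolding p(1) append_Nil .
  have gen_case: "lin (word_value bead_class) (reduced_letter i \<sigma>) - gen [(i, cls (Suc i) (gen \<sigma>))] \<in> ?N"
    if "\<sigma> \<in> cells S (Suc i)" for \<sigma>
  proof (cases "\<sigma> \<in> simp_degenerate S (Suc i)")
    case True
    then have "gen \<sigma> - 0 \<in> (simp_null S (Suc i) :: ('a \<Rightarrow>\<^sub>0 'b) set)" unfolding simp_null_eq by (simp add: hull_inc)
    then have "cls (Suc i) (gen \<sigma>) = cls (Suc i) (0 :: 'a \<Rightarrow>\<^sub>0 'b)" by (simp only: coset_eq_iff[OF submod_simp_null])
    moreover have "gen [(i, cls (Suc i) 0)] \<in> ?N"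
      using multilin_zero_letter[where c = "cls (Suc i)" and X = "cells S (Suc i)", OF W ops]
      unfolding append_Nil .
    ultimately show ?thesis
      by (simp add: reduced_letter_degenerate[OF True] lin_simps submod_minus)
  next
    case False
    then have "lin (word_value bead_class) (reduced_letter i \<sigma>) = (gen [(i, cls (Suc i) (gen \<sigma>))] :: ('a \<Rightarrow>\<^sub>0 'b) set word \<Rightarrow>\<^sub>0 'b)"
      by (simp add: reduced_letter_def letter_def lin_simps bead_class_def del: bilin_gen)
    then show ?thesis by (simp add: submod_zero)
  qed
  have 2: "lin (word_value bead_class) (lin (reduced_letter i) p) - lin (\<lambda>\<sigma>. gen [(i, cls (Suc i) (gen \<sigma>))]) p \<in> ?N"
    by (rule free_linear_image[OF linear_map_difference[OF linear_map_comp[OF linear_map_lin linear_map_lin] linear_map_lin]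
          submod_multilin _ p(2)]) (unfold lin_gen, rule gen_case)
  show ?thesis
    using submod_diff[OF submod_multilin 2 1] by (simp add: p(1) class_value_cls)
qed

lemma bead_class_word_value:
  "w \<in> words (desusp (Q_simp S)) n \<Longrightarrow>
    lin (word_value bead_class) (word_value class_value w) - gen w \<in> tens_null (desusp (Q_simp S)) n"
proof (induction w arbitrary: n)
  case Nil
  show ?case by (simp add: submod_zero)
next
  case (Cons a w)
  obtain i c where a: "a = (i, c)" by (cases a)
  obtain m where m: "c \<in> gr (Q_simp S) (Suc i)" "n = i + m" "w \<in> words (desusp (Q_simp S)) m"
    using Cons.prems by (auto simp: a words_Cons desusp_simps)
  let ?G = "lin (word_value bead_class)"
  have G_in: "?G (word_value class_value w) \<in> free (words (desusp (Q_simp S)) m)"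
    by (rule lin_in_submod[OF submod_free word_value_bead_class_in word_value_class_in[OF m(3)]])
  have c_in: "gen [(i, c)] \<in> free (words (desusp (Q_simp S)) i)"
    using m(1) by (auto intro!: gen_in_free simp: words_Cons words_Nil desusp_simps)
  have "?G (word_value class_value (a # w)) - gen (a # w) =
      (?G (class_value i c) - gen [(i, c)]) \<odot> ?G (word_value class_value w) +
      gen [(i, c)] \<odot> (?G (word_value class_value w) - gen w)"
    unfolding a word_value.simps lin_word_value_mult
    by (simp only: word_mult_left word_mult_right word_mult_gen_gen append_Cons append_Nil diff_add_eq diff_diff_eq2
        diff_add_cancel) simp
  also have "\<dots> \<in> tens_null (desusp (Q_simp S)) n"
    unfolding m(2)
    by (rule submod_add[OF submod_multilin tens_null_mult(1)[OF bead_class_class_value[OF m(1)] G_in]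
          tens_null_mult(2)[OF Cons.IH[OF m(3)] c_in]])
  finally show ?case .
qed

end

section \<open>Comparison of differentials\<close>

context reduced_simplicial
begin

text \<open>
  The cobar differential in terms of \<open>letter_deriv\<close>. Substituting \<open>reduced_letter + 1\<close> for the letters of
  edges in the products, the summand \<open>j = 1\<close> contributes the last face of dimension \<open>i\<close>, which is the face
  \<open>0\<close>, and the summand \<open>j = i\<close> contributes the front face, which is the face \<open>i + 1\<close>. For \<open>i = 1\<close> both
  factors are edges, and the constant terms on the two sides cancel.
\<close>

lemma letter_deriv_reduced:
  assumes i: "0 < i"
  shows "letter_deriv i \<sigma> = - lin (reduced_letter (i - 1)) (simp_boundary S (Suc i) \<sigma>) +
    (\<Sum>j=1..i. cscale ((-1) ^ j) (reduced_letter (j - 1) (front_face S j (Suc i - j) \<sigma>) \<odot>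
      reduced_letter (i - j) (last_face S j (Suc i - j) \<sigma>)) :: 'a word \<Rightarrow>\<^sub>0 'k::{comm_ring,comm_monoid_mult})"
proof -
  let ?R = "reduced_letter :: nat \<Rightarrow> 'a \<Rightarrow> ('a word \<Rightarrow>\<^sub>0 'k)"
  let ?F = "\<lambda>j. front_face S j (Suc i - j) \<sigma>" and ?B = "\<lambda>j. last_face S j (Suc i - j) \<sigma>"
  let ?X = "\<lambda>j. act S i (Suc i) (coface (Suc i) j) \<sigma>"
  let ?s = "\<lambda>j. (-1) ^ j :: 'k"
  let ?first = "?R (i - 1) (?B 1)" and ?last = "?R (i - 1) (?F i)"
  have unit: "letter k \<tau> = ?R k \<tau> + (if k = 0 then gen [] else 0)" for k \<tau> by (rule letter_eq)
  have summand: "letter (j - 1) (?F j) \<odot> letter (i - j) (?B j) - letter (i - 1) (?X j) =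
      ?R (j - 1) (?F j) \<odot> ?R (i - j) (?B j) + (if j = 1 then ?first else 0) + (if j = i then ?last else 0) -
      ?R (i - 1) (?X j)" if "j \<in> {1..i}" for j
  proof (cases "j = 1"; cases "j = i")
    assume j: "j = 1" "j = i"
    show ?thesis unfolding unit using j by (simp add: word_mult_left word_mult_right algebra_simps del: bilin_gen)
  next
    assume j: "j = 1" "j \<noteq> i"
    then have "i - 1 \<noteq> 0" using that by simp
    then show ?thesis unfolding unit using j by (simp add: word_mult_left word_mult_right algebra_simps del: bilin_gen)
  next
    assume j: "j \<noteq> 1" "j = i"
    then have "i - 1 \<noteq> 0" using that by simp
    then show ?thesis unfolding unit using j by (simp add: word_mult_left word_mult_right algebra_simps del: bilin_gen)
  next
    assume j: "j \<noteq> 1" "j \<noteq> i"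
    then have "i - 1 \<noteq> 0" "j - 1 \<noteq> 0" "i - j \<noteq> 0" using that by auto
    then show ?thesis unfolding unit using j by (simp add: algebra_simps del: bilin_gen)
  qed
  have at: "(\<Sum>j=1..i. cscale (?s j) (if j = l then a else 0)) = cscale (?s l) a" if "l \<in> {1..i}" for l and a :: "'a word \<Rightarrow>\<^sub>0 'k"
  proof -
    have "(\<Sum>j=1..i. cscale (?s j) (if j = l then a else 0)) = (\<Sum>j\<in>{1..i}. if j = l then cscale (?s j) a else 0)"
      by (rule sum.cong) auto
    also have "\<dots> = cscale (?s l) a" using that by (simp del: One_nat_def)
    finally show ?thesis .
  qed
  have "letter_deriv i \<sigma> = (\<Sum>j=1..i. cscale (?s j) (?R (j - 1) (?F j) \<odot> ?R (i - j) (?B j) +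
      (if j = 1 then ?first else 0) + (if j = i then ?last else 0) - ?R (i - 1) (?X j)))"
    unfolding letter_deriv_def by (rule sum.cong[OF refl]) (simp only: summand)
  also have "\<dots> = (\<Sum>j=1..i. cscale (?s j) (?R (j - 1) (?F j) \<odot> ?R (i - j) (?B j))) +
      cscale (?s 1) ?first + cscale (?s i) ?last - (\<Sum>j=1..i. cscale (?s j) (?R (i - 1) (?X j)))"
    using at[of 1 ?first] at[of i ?last] i
    by (simp add: cscale_add_right cscale_diff_right sum.distrib sum_subtractf del: One_nat_def bilin_gen)
  finally have expand: "letter_deriv i \<sigma> = (\<Sum>j=1..i. cscale (?s j) (?R (j - 1) (?F j) \<odot> ?R (i - j) (?B j))) +
      cscale (?s 1) ?first + cscale (?s i) ?last - (\<Sum>j=1..i. cscale (?s j) (?R (i - 1) (?X j)))" .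
  have "lin (?R (i - 1)) (simp_boundary S (Suc i) \<sigma>) = (\<Sum>j=0..Suc i. cscale (?s j) (?R (i - 1) (?X j)))"
    by (simp add: simp_boundary_def lin_simps)
  also have "\<dots> = ?R (i - 1) (?X 0) + (\<Sum>j=1..i. cscale (?s j) (?R (i - 1) (?X j))) + cscale (?s (Suc i)) (?R (i - 1) (?X (Suc i)))"
    by (simp add: sum.atLeast_Suc_atMost)
  also have "?X 0 = ?B 1" using outer_faces(1)[of i \<sigma>] i by simp
  also have "?X (Suc i) = ?F i" using outer_faces(2)[of i \<sigma>] i by simp
  finally have bdry: "lin (?R (i - 1)) (simp_boundary S (Suc i) \<sigma>) = ?first +
      (\<Sum>j=1..i. cscale (?s j) (?R (i - 1) (?X j))) + cscale (?s (Suc i)) ?last" .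
  show ?thesis unfolding expand bdry by (simp add: algebra_simps del: bilin_gen One_nat_def)
qed

lemma lin_deriv_reduced:
  assumes "p \<in> free (cells S (Suc i))"
  shows "lin (word_deriv letter_deriv) (lin (reduced_letter i) p) =
    (lin (letter_deriv i) p :: 'a word \<Rightarrow>\<^sub>0 'k::{comm_ring,comm_monoid_mult})"
  by (rule linear_map_eq_on_free[OF linear_map_comp[OF linear_map_lin linear_map_lin] linear_map_lin _ assms])
     (simp add: reduced_letter_def lin_simps lin_deriv_letter)

lemma comult_chains:
  fixes a :: "('a \<Rightarrow>\<^sub>0 'k::{comm_ring,comm_monoid_mult}) set"
  shows "comult (Q_simp S) n a =
      (\<Union>p\<in>a. coset (multilin (Q_simp S) (words2 (Q_simp S) n)) (lin (alexander_whitney S n) p))"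
    and "counit_dual (Q_simp S) = cls 0 (gen x :: 'a \<Rightarrow>\<^sub>0 'k)"
proof -
  let ?C = "Q_simp S :: ('k, ('a \<Rightarrow>\<^sub>0 'k) set) dgc" and ?A = "Q_simp_cplx S :: ('k, ('a \<Rightarrow>\<^sub>0 'k) set) cplx"
  have ops: "gr ?C = gr ?A" "gadd ?C = gadd ?A" "gscale ?C = gscale ?A"
    by (simp_all add: Q_simp_def Q_simp_cplx_def quot_cplx_def quot_mod_def cplx.defs gmod.defs)
  have "words2 ?C = words2 ?A" by (simp add: words2_def words_def ops fun_eq_iff)
  moreover have "multilin ?C = multilin ?A" by (simp add: multilin_def ops fun_eq_iff)
  ultimately show "comult ?C n a =
      (\<Union>p\<in>a. coset (multilin ?C (words2 ?C n)) (lin (alexander_whitney S n) p))"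
    by (simp add: Q_simp_def cplx.defs)
  show "counit_dual ?C = cls 0 (gen x)" by (simp add: Q_simp_def cplx.defs reduced)
qed

text \<open>
  The summands \<open>p = 0\<close> and \<open>p = n\<close> of the Alexander-Whitney coproduct are the words for \<open>1 \<otimes> c\<close> and
  \<open>c \<otimes> 1\<close> up to multilinearity, because all vertices of a simplex are equal to \<open>x\<close>.
\<close>

lemma reduced_comult_ex:
  assumes c: "c \<in> gr (Q_simp S) (Suc i)"
  shows "\<exists>r. r \<in> reduced_comult (Q_simp S :: ('k::{comm_ring,comm_monoid_mult}, ('a \<Rightarrow>\<^sub>0 'k) set) dgc) (Suc i) c"
proof -
  let ?C = "Q_simp S :: ('k, ('a \<Rightarrow>\<^sub>0 'k) set) dgc"
  let ?n = "Suc i" and ?u = "(0, cls 0 (gen x)) :: nat \<times> ('a \<Rightarrow>\<^sub>0 'k) set"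
  let ?N = "multilin ?C (words2 ?C ?n)"
  obtain p where p: "c = cls ?n p" "p \<in> free (cells S ?n)" using c by (auto simp: chains_simps(1))
  define t where "t = (\<lambda>\<sigma> j. gen [(j, cls j (gen (front_face S j (?n - j) \<sigma>))),
    (?n - j, cls (?n - j) (gen (last_face S j (?n - j) \<sigma>)))] :: ('a \<Rightarrow>\<^sub>0 'k) set word \<Rightarrow>\<^sub>0 'k)"
  define r where "r = lin (\<lambda>\<sigma>. \<Sum>j=1..i. t \<sigma> j) p"
  have x: "x \<in> cells S 0" using reduced by simp
  have u: "cls 0 (gen x :: 'a \<Rightarrow>\<^sub>0 'k) \<in> gr ?C 0" by (rule cls_gen_in[OF x])
  have "r \<in> free {w \<in> words2 ?C ?n. \<forall>(p, b)\<in>set w. 0 < p}"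
    unfolding r_def t_def
  proof (rule lin_in_submod[OF submod_free _ p(2)], intro submod_sum submod_free gen_in_free)
    fix \<sigma> j assume \<sigma>: "\<sigma> \<in> cells S ?n" and j: "j \<in> {1..i}"
    have "\<sigma> \<in> cells S (j + (?n - j))" using \<sigma> j by simp
    from cls_gen_in[OF front_face_in[OF this]] cls_gen_in[OF last_face_in[OF this]]
    show "[(j, cls j (gen (front_face S j (?n - j) \<sigma>))), (?n - j, cls (?n - j) (gen (last_face S j (?n - j) \<sigma>)))] \<in>
        {w \<in> words2 ?C ?n. \<forall>(p, b)\<in>set w. 0 < p}"
      using j by (auto simp: words2_def words_def)
  qed
  moreover have "r + gen [(?n, c), (0, counit_dual ?C)] + gen [(0, counit_dual ?C), (?n, c)] \<in> comult ?C ?n c"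
  proof -
    have AW: "alexander_whitney S ?n \<sigma> = (\<Sum>j=1..i. t \<sigma> j) + gen [(?n, cls ?n (gen \<sigma>)), ?u] + gen [?u, (?n, cls ?n (gen \<sigma>))]"
      if \<sigma>: "\<sigma> \<in> cells S ?n" for \<sigma>
    proof -
      have "front_face S 0 ?n \<sigma> \<in> cells S 0" "last_face S ?n 0 \<sigma> \<in> cells S 0"
        using front_face_in[of \<sigma> 0 ?n] last_face_in[of \<sigma> ?n 0] \<sigma> by simp_all
      then have ends: "front_face S 0 ?n \<sigma> = x" "last_face S ?n 0 \<sigma> = x" using reduced by simp_all
      have "alexander_whitney S ?n \<sigma> = (\<Sum>j=0..?n. t \<sigma> j)" by (simp only: alexander_whitney_def t_def)
      also have "\<dots> = t \<sigma> 0 + (\<Sum>j=1..i. t \<sigma> j) + t \<sigma> ?n"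
        by (simp add: sum.atLeast_Suc_atMost)
      also have "t \<sigma> 0 = gen [?u, (?n, cls ?n (gen \<sigma>))]"
        by (simp add: t_def ends front_last_face_whole[OF \<sigma>])
      also have "t \<sigma> ?n = gen [(?n, cls ?n (gen \<sigma>)), ?u]"
        by (simp add: t_def ends front_last_face_whole[OF \<sigma>])
      finally show ?thesis by (simp add: algebra_simps)
    qed
    have AWp: "lin (alexander_whitney S ?n) p = lin (\<lambda>\<sigma>. \<Sum>j=1..i. t \<sigma> j) p +
        lin (\<lambda>\<sigma>. gen [(?n, cls ?n (gen \<sigma>)), ?u]) p + lin (\<lambda>\<sigma>. gen [?u, (?n, cls ?n (gen \<sigma>))]) p"
      by (rule linear_map_eq_on_free[OF linear_map_lin _ _ p(2)])
         (simp_all add: linear_map_plus AW)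
    have W: "[] @ (?n, cls ?n q) # [?u] \<in> words2 ?C ?n" "[?u] @ (?n, cls ?n q) # [] \<in> words2 ?C ?n"
      if "q \<in> free (cells S ?n)" for q :: "'a \<Rightarrow>\<^sub>0 'k"
    proof -
      have "cls ?n q \<in> gr ?C ?n" unfolding chains_simps(1) using that by (rule imageI)
      then show "[] @ (?n, cls ?n q) # [?u] \<in> words2 ?C ?n" "[?u] @ (?n, cls ?n q) # [] \<in> words2 ?C ?n"
        using u by (simp_all add: words2_def words_def)
    qed
    have N1: "gen [(?n, c), ?u] - lin (\<lambda>\<sigma>. gen [(?n, cls ?n (gen \<sigma>)), ?u]) p \<in> ?N"
      using multilin_expansion[where c = "cls ?n" and X = "cells S ?n", OF W(1) chains_simps(2,3) p(2)]
      unfolding p(1) append_Nil .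
    have N2: "gen [?u, (?n, c)] - lin (\<lambda>\<sigma>. gen [?u, (?n, cls ?n (gen \<sigma>))]) p \<in> ?N"
      using multilin_expansion[where c = "cls ?n" and X = "cells S ?n", OF W(2) chains_simps(2,3) p(2)]
      unfolding p(1) append_Nil append_Cons .
    from submod_add[OF submod_multilin N1 N2]
    have "r + gen [(?n, c), ?u] + gen [?u, (?n, c)] - lin (alexander_whitney S ?n) p \<in> ?N"
      unfolding AWp r_def by (simp add: algebra_simps)
    then have "r + gen [(?n, c), ?u] + gen [?u, (?n, c)] \<in> coset ?N (lin (alexander_whitney S ?n) p)"
      by (simp only: in_coset_iff)
    moreover have "p \<in> c" unfolding p(1) by (rule coset_self[OF submod_simp_null])
    ultimately show ?thesis unfolding comult_chains by (rule UN_I[rotated])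
  qed
  ultimately have "r \<in> reduced_comult ?C ?n c" by (simp only: reduced_comult_def mem_Collect_eq conj_assoc)
  then show ?thesis ..
qed

text \<open>
  The quadratic part of the cobar differential is given by an arbitrary representative \<open>r\<close>. Its value is
  found by means of the functional \<open>\<tau>\<close>, which extends the value to words with letters of degree 0 by zero
  and respects multilinearity. So \<open>\<tau>\<close> has the same value on \<open>r\<close>, on \<open>r + c \<otimes> 1 + 1 \<otimes> c\<close> and on the
  Alexander-Whitney coproduct of a chain that represents \<open>c\<close>.
\<close>

lemma cobar_gen_value:
  fixes c :: "('a \<Rightarrow>\<^sub>0 'k::{comm_ring,comm_monoid_mult}) set"
  assumes c: "c \<in> gr (Q_simp S) (Suc i)"
  shows "cobar_gen (Q_simp S) i c \<in> free (words (desusp (Q_simp S)) (i - 1))"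
    and "lin (word_value class_value) (cobar_gen (Q_simp S) i c) = lin (word_deriv letter_deriv) (class_value i c)"
proof -
  let ?C = "Q_simp S :: ('k, ('a \<Rightarrow>\<^sub>0 'k) set) dgc"
  let ?n = "Suc i" and ?V = "word_value class_value :: ('a \<Rightarrow>\<^sub>0 'k) set word \<Rightarrow> ('a word \<Rightarrow>\<^sub>0 'k)"
  let ?u = "(0, cls 0 (gen x)) :: nat \<times> ('a \<Rightarrow>\<^sub>0 'k) set"
  obtain p where p: "c = cls ?n p" "p \<in> free (cells S ?n)" using c by (auto simp: chains_simps(1))
  have "cobar_gen ?C i c \<in> free (words (desusp ?C) (i - 1)) \<and>
    lin ?V (cobar_gen ?C i c) = lin (word_deriv letter_deriv) (class_value i c)"
  proof (cases "i = 0")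
    case True
    have "lin (word_deriv letter_deriv) (class_value i c) = (lin (letter_deriv i) p :: 'a word \<Rightarrow>\<^sub>0 'k)"
      unfolding p(1) class_value_cls by (rule lin_deriv_reduced[OF p(2)])
    also have "\<dots> = lin (\<lambda>\<sigma>. 0) p" using True by (simp add: letter_deriv_def[abs_def])
    also have "\<dots> = 0" by (simp add: lin_def)
    finally show ?thesis using True by (simp add: cobar_gen_def lin_simps submod_zero)
  next
    case False
    define P where "P = {w \<in> words2 ?C ?n. \<forall>(p, b)\<in>set w. 0 < p}"
    define \<theta> where "\<theta> = (\<lambda>w :: ('a \<Rightarrow>\<^sub>0 'k) set word.
      cscale ((-1) ^ fst (w ! 0)) (gen (map (\<lambda>(p, b). (p - 1, b)) w)) :: ('a \<Rightarrow>\<^sub>0 'k) set word \<Rightarrow>\<^sub>0 'k)"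
    define r where "r = (SOME r. r \<in> reduced_comult ?C ?n c)"
    have cobar: "cobar_gen ?C i c = - gen [(i - 1, bd ?C ?n c)] + lin \<theta> r"
      using False by (simp add: cobar_gen_def \<theta>_def r_def)
    have "r \<in> reduced_comult ?C ?n c" unfolding r_def by (rule someI_ex) (rule reduced_comult_ex[OF c])
    then have r: "r \<in> free P" "r + gen [(?n, c), ?u] + gen [?u, (?n, c)] \<in> comult ?C ?n c"
      by (simp_all only: reduced_comult_def P_def mem_Collect_eq comult_chains(2))
    \<comment> \<open>the coproduct of \<open>c\<close> is a union over all representatives of \<open>c\<close>, so \<open>q\<close> may differ from \<open>p\<close>\<close>
    obtain q where q: "q \<in> c"
      "r + gen [(?n, c), ?u] + gen [?u, (?n, c)] - lin (alexander_whitney S ?n) q \<in> multilin ?C (words2 ?C ?n)"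
      using r(2) unfolding comult_chains(1) in_coset_iff[symmetric] by blast
    have qp: "q - p \<in> simp_null S ?n" using q(1) unfolding p(1) in_coset_iff .
    then have q_in: "q \<in> free (cells S ?n)"
      using submod_add[OF submod_free _ p(2), of "q - p"] simp_null_subset[of ?n] by auto
    have c_q: "c = cls ?n q"
      unfolding p(1) coset_eq_iff[OF submod_simp_null] using submod_minus[OF submod_simp_null qp] by simp
    have P: "\<exists>a b m k. w = [(Suc m, a), (Suc k, b)] \<and> a \<in> gr ?C (Suc m) \<and> b \<in> gr ?C (Suc k) \<and> Suc (m + k) = i"
      if "w \<in> P" for w
    proof -
      have "length w = 2" using that by (simp add: P_def words2_def)
      then obtain l1 l2 where w: "w = [l1, l2]" by (auto simp: numeral_2_eq_2 length_Suc_conv)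
      obtain d1 a d2 b where l: "l1 = (d1, a)" "l2 = (d2, b)" by (cases l1, cases l2) auto
      have "0 < d1" "0 < d2" "d1 + d2 = ?n" "a \<in> gr ?C d1" "b \<in> gr ?C d2"
        using that by (auto simp: P_def words2_def words_def w l)
      then show ?thesis by (cases d1; cases d2) (auto simp: w l)
    qed
    have \<theta>_in: "\<theta> w \<in> free (words (desusp ?C) (i - 1))" if "w \<in> P" for w
      using P[OF that]
      by (auto simp: \<theta>_def words_Cons words_Nil desusp_simps intro!: submod_cscale[OF submod_free] gen_in_free)
    have bd: "bd ?C ?n c = cls i (lin (simp_boundary S ?n) q)" by (simp only: c_q chains_simps(4) diff_Suc_1)
    have "lin (simp_boundary S ?n) q \<in> free (cells S i)"
      by (rule lin_in_submod[OF submod_free _ q_in]) (use simp_boundary_in[of _ ?n] in simp)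
    then have "bd ?C ?n c \<in> gr ?C (Suc (i - 1))" using False unfolding bd by (simp add: chains_simps(1))
    then have "gen [(i - 1, bd ?C ?n c)] \<in> free (words (desusp ?C) (i - 1))"
      by (intro gen_in_free) (simp add: words_Cons words_Nil desusp_simps)
    then have "cobar_gen ?C i c \<in> free (words (desusp ?C) (i - 1))"
      unfolding cobar by (intro submod_add submod_minus submod_free lin_in_submod[OF submod_free \<theta>_in r(1)])
    moreover have "lin ?V (cobar_gen ?C i c) = lin (word_deriv letter_deriv) (class_value i c)"
    proof -
      define \<rho> where "\<rho> d b = (if d = 0 then 0 else class_value (d - 1) b)"
        for d and b :: "('a \<Rightarrow>\<^sub>0 'k) set"
      define \<tau> where "\<tau> = (\<lambda>w :: ('a \<Rightarrow>\<^sub>0 'k) set word. cscale ((-1) ^ (map fst w ! 0)) (word_value \<rho> w))"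
      have \<rho>: "\<rho> d (gadd ?C d a b) = \<rho> d a + \<rho> d b" "\<rho> d (gscale ?C d t a) = cscale t (\<rho> d a)"
        if "a \<in> gr ?C d" "b \<in> gr ?C d" for d a b t
        using class_value_linear[of a "d - 1"] that by (auto simp: \<rho>_def)
      have "lin \<tau> (r + gen [(?n, c), ?u] + gen [?u, (?n, c)] - lin (alexander_whitney S ?n) q) = 0"
        unfolding \<tau>_def
        by (rule word_value_multilin[where s = "\<lambda>d. (-1) ^ (d ! 0)" and W = "words2 ?C ?n" and n = ?n, OF \<rho>(1) \<rho>(2) _ q(2)])
           (auto simp: words2_def)
      moreover have "lin \<tau> (gen [(?n, c), ?u]) = 0" "lin \<tau> (gen [?u, (?n, c)]) = 0"
        by (simp_all add: \<tau>_def \<rho>_def word_mult_left(3) word_mult_right(3) del: bilin_gen)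
      ultimately have \<tau>_r: "lin \<tau> r = lin \<tau> (lin (alexander_whitney S ?n) q)" by (simp add: lin_simps)
      have \<theta>_\<tau>: "lin ?V (lin \<theta> r) = lin \<tau> r"
      proof (rule linear_map_eq_on_free[OF linear_map_comp[OF linear_map_lin linear_map_lin] linear_map_lin _ r(1)])
        fix w assume "w \<in> P"
        from P[OF this] show "lin ?V (lin \<theta> (gen w)) = lin \<tau> (gen w)"
          by (auto simp: \<theta>_def \<tau>_def \<rho>_def lin_simps simp del: bilin_gen)
      qed
      have \<tau>_AW: "lin \<tau> (alexander_whitney S ?n \<sigma>) =
          (\<Sum>j=1..i. cscale ((-1) ^ j) (reduced_letter (j - 1) (front_face S j (?n - j) \<sigma>) \<odot>
            reduced_letter (i - j) (last_face S j (?n - j) \<sigma>)))" for \<sigma>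
      proof -
        let ?t = "\<lambda>j. cscale ((-1) ^ j) (\<rho> j (cls j (gen (front_face S j (?n - j) \<sigma>))) \<odot>
            \<rho> (?n - j) (cls (?n - j) (gen (last_face S j (?n - j) \<sigma>)))) :: 'a word \<Rightarrow>\<^sub>0 'k"
        have "lin \<tau> (alexander_whitney S ?n \<sigma>) = (\<Sum>j=0..?n. ?t j)"
          by (simp add: alexander_whitney_def lin_simps \<tau>_def del: bilin_gen sum.cl_ivl_Suc)
        also have "\<dots> = ?t 0 + (\<Sum>j=1..i. ?t j) + ?t ?n"
          by (simp add: sum.atLeast_Suc_atMost del: bilin_gen)
        also have "?t 0 = 0" by (simp add: \<rho>_def word_mult_left(3) del: bilin_gen)
        also have "?t ?n = 0" by (simp add: \<rho>_def word_mult_right(3) del: bilin_gen)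
        also have "0 + (\<Sum>j=1..i. ?t j) + 0 = (\<Sum>j=1..i. cscale ((-1) ^ j)
            (reduced_letter (j - 1) (front_face S j (?n - j) \<sigma>) \<odot>
              reduced_letter (i - j) (last_face S j (?n - j) \<sigma>)))"
          unfolding add_0_left add_0_right
        proof (rule sum.cong[OF refl])
          fix j assume j: "j \<in> {1..i}"
          have "\<rho> j (cls j (gen y)) = reduced_letter (j - 1) y" for y
            using class_value_cls[of "j - 1" "gen y :: 'a \<Rightarrow>\<^sub>0 'k"] j by (simp add: \<rho>_def)
          moreover have "\<rho> (?n - j) (cls (?n - j) (gen y)) = reduced_letter (i - j) y" for y
            using class_value_cls[of "i - j" "gen y :: 'a \<Rightarrow>\<^sub>0 'k"] j by (simp add: \<rho>_def Suc_diff_le)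
          ultimately show "?t j = cscale ((-1) ^ j) (reduced_letter (j - 1) (front_face S j (?n - j) \<sigma>) \<odot>
              reduced_letter (i - j) (last_face S j (?n - j) \<sigma>))" by simp
        qed
        finally show ?thesis .
      qed
      have "lin ?V (cobar_gen ?C i c) = - class_value (i - 1) (bd ?C ?n c) + lin \<tau> (lin (alexander_whitney S ?n) q)"
        unfolding cobar lin_simps lin_gen \<theta>_\<tau> \<tau>_r by simp
      also have "class_value (i - 1) (bd ?C ?n c) = lin (reduced_letter (i - 1)) (lin (simp_boundary S ?n) q)"
        using class_value_cls[of "i - 1"] False unfolding bd by simp
      also have "- lin (reduced_letter (i - 1)) (lin (simp_boundary S ?n) q) + lin \<tau> (lin (alexander_whitney S ?n) q) =
          lin (letter_deriv i) q"
      proof -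
        have "lin \<tau> (lin (alexander_whitney S ?n) q) - lin (reduced_letter (i - 1)) (lin (simp_boundary S ?n) q) =
            lin (letter_deriv i) q"
          by (rule linear_map_ext[OF linear_map_difference[OF linear_map_comp[OF linear_map_lin linear_map_lin]
                  linear_map_comp[OF linear_map_lin linear_map_lin]] linear_map_lin])
             (use False in \<open>simp add: letter_deriv_reduced \<tau>_AW del: bilin_gen\<close>)
        then show ?thesis by simp
      qed
      also have "\<dots> = lin (word_deriv letter_deriv) (class_value i c)"
        unfolding c_q class_value_cls by (rule lin_deriv_reduced[OF q_in, symmetric])
      finally show ?thesis .
    qed
    ultimately show ?thesis ..
  qed
  then show "cobar_gen ?C i c \<in> free (words (desusp ?C) (i - 1))"
    and "lin ?V (cobar_gen ?C i c) = lin (word_deriv letter_deriv) (class_value i c)" by blast+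
qed

lemma cobar_gen_zero: "cobar_gen C 0 c = 0"
  by (simp add: cobar_gen_def)

lemma cobar_word_in:
  assumes "w \<in> words (desusp (Q_simp S)) n"
  shows "cobar_word (Q_simp S) w \<in> free (words (desusp (Q_simp S)) (n - 1)) \<and>
    (n = 0 \<longrightarrow> cobar_word (Q_simp S) w = 0)"
  using assms
proof (induction w arbitrary: n)
  case Nil
  show ?case by (simp add: submod_zero)
next
  case (Cons a w)
  let ?W = "\<lambda>n. free (words (desusp (Q_simp S)) n) :: (('a \<Rightarrow>\<^sub>0 'b) set word \<Rightarrow>\<^sub>0 'b) set"
  obtain i c where a: "a = (i, c)" by (cases a)
  obtain m where m: "c \<in> gr (Q_simp S) (Suc i)" "n = i + m" "w \<in> words (desusp (Q_simp S)) m"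
    using Cons.prems by (auto simp: a words_Cons desusp_simps)
  have c_in: "gen [(i, c)] \<in> ?W i"
    using m(1) by (auto intro!: gen_in_free simp: words_Cons words_Nil desusp_simps)
  have prod: "q \<odot> q' \<in> ?W (k + l)" if "q \<in> ?W k" "q' \<in> ?W l" for q q' k l
    by (rule bilin_in_submod[OF submod_free gen_in_free[OF words_append] that])
  have 1: "cobar_gen (Q_simp S) i c \<odot> gen w \<in> ?W (n - 1)"
  proof (cases "i = 0")
    case True
    then show ?thesis by (simp add: cobar_gen_zero word_mult_left(3) submod_zero del: bilin_gen)
  next
    case False
    then have "n - 1 = i - 1 + m" using m(2) by simp
    then show ?thesis by (simp only: prod[OF cobar_gen_value(1)[OF m(1)] gen_in_free[OF m(3)]])
  qed
  have 2: "gen [(i, c)] \<odot> cobar_word (Q_simp S) w \<in> ?W (n - 1)"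
  proof (cases "m = 0")
    case True
    then show ?thesis using Cons.IH[OF m(3)] by (simp add: word_mult_right(3) submod_zero del: bilin_gen)
  next
    case False
    then have "n - 1 = i + (m - 1)" using m(2) by simp
    then show ?thesis using Cons.IH[OF m(3)] by (simp only: prod[OF c_in])
  qed
  show ?case
  proof
    show "cobar_word (Q_simp S) (a # w) \<in> ?W (n - 1)"
      unfolding a cobar_word.simps by (intro submod_add submod_cscale submod_free 1 2)
    show "n = 0 \<longrightarrow> cobar_word (Q_simp S) (a # w) = 0"
      using Cons.IH[OF m(3)] m(2)
      by (simp add: a cobar_gen_zero word_mult_left(3) word_mult_right(3) del: bilin_gen)
  qed
qed

lemma cobar_word_value:
  "w \<in> words (desusp (Q_simp S)) n \<Longrightarrow> lin (word_value class_value) (cobar_word (Q_simp S) w) =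
    (lin (word_deriv letter_deriv) (word_value class_value w) :: 'a word \<Rightarrow>\<^sub>0 'k::{comm_ring,comm_monoid_mult})"
proof (induction w arbitrary: n)
  case Nil
  show ?case by (simp add: lin_simps)
next
  case (Cons a w)
  obtain i c where a: "a = (i, c)" by (cases a)
  obtain m where m: "c \<in> gr (Q_simp S) (Suc i)" "w \<in> words (desusp (Q_simp S)) m"
    using Cons.prems by (auto simp: a words_Cons desusp_simps)
  let ?V = "word_value class_value :: ('a \<Rightarrow>\<^sub>0 'k) set word \<Rightarrow> ('a word \<Rightarrow>\<^sub>0 'k)"
  have leibniz: "lin (word_deriv letter_deriv) (class_value i c \<odot> ?V w) =
      lin (word_deriv letter_deriv) (class_value i c) \<odot> ?V w +
      cscale ((-1) ^ i) (class_value i c \<odot> lin (word_deriv letter_deriv) (?V w))"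
    by (rule word_leibniz[OF _ class_value_in[OF m(1)]], simp only: word_deriv_append) (simp add: bead_words_def)
  have V_letter: "lin ?V (gen [(i, c)]) = class_value i c" by simp
  show ?case
    unfolding a cobar_word.simps word_value.simps leibniz lin_simps lin_word_value_mult
      cobar_gen_value(2)[OF m(1)] Cons.IH[OF m(2)] V_letter lin_gen word_mult_unit_right ..
qed

text \<open>
  The substitutions \<open>reduced_letter\<close> and \<open>bead_class\<close> are inverse to each other modulo multilinearity,
  which determines the kernel.
\<close>

theorem cobar_iso_bead_dga:
  shows "dg_algebra (cobar (Q_simp S) :: ('k::{comm_ring,comm_monoid_mult}, (('a \<Rightarrow>\<^sub>0 'k) set word \<Rightarrow>\<^sub>0 'k) set) dga)"
    and "\<exists>\<phi>. dga_iso (cobar (Q_simp S) :: ('k, (('a \<Rightarrow>\<^sub>0 'k) set word \<Rightarrow>\<^sub>0 'k) set) dga) bead_dga \<phi>"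
proof -
  let ?C = "Q_simp S :: ('k, ('a \<Rightarrow>\<^sub>0 'k) set) dgc"
  let ?X = "words (desusp ?C)" and ?M = "tens_null (desusp ?C)"
  let ?F = "\<lambda>n :: nat. lin (word_value class_value) :: (('a \<Rightarrow>\<^sub>0 'k) set word \<Rightarrow>\<^sub>0 'k) \<Rightarrow> ('a word \<Rightarrow>\<^sub>0 'k)"
  have cobar: "cobar ?C = quot_dga ?X ?M (\<lambda>_. cobar_word ?C) (\<lambda>m n. word_mult) (gen [])"
    by (simp add: cobar_def quot_dga_def)
  have M: "?M n \<subseteq> free (?X n)" for n
  proof (rule multilin_subset_free)
    fix p :: nat and a b :: "('a \<Rightarrow>\<^sub>0 'k) set" and r :: 'k
    assume a: "a \<in> gr (desusp ?C) p"
    then obtain q where q: "a = cls (Suc p) q" "q \<in> free (cells S (Suc p))"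
      by (auto simp: desusp_simps chains_simps(1))
    show "gscale (desusp ?C) p r a \<in> gr (desusp ?C) p"
      using submod_cscale[OF submod_free q(2)]
      by (simp add: desusp_simps q(1) chains_simps(1,3))
    assume "b \<in> gr (desusp ?C) p"
    then obtain q' where q': "b = cls (Suc p) q'" "q' \<in> free (cells S (Suc p))"
      by (auto simp: desusp_simps chains_simps(1))
    show "gadd (desusp ?C) p a b \<in> gr (desusp ?C) p"
      using submod_add[OF submod_free q(2) q'(2)]
      by (simp add: desusp_simps q(1) q'(1) chains_simps(1,2))
  qed
  have F_in: "?F n (gen w) \<in> free (bead_words n)" if "w \<in> ?X n" for n w
    unfolding lin_gen by (rule word_value_class_in[OF that])
  have null_zero: "?F n p = 0" if "p \<in> ?M n" for n p
  proof -
    have "lin (\<lambda>w. cscale ((\<lambda>_. 1) (map fst w)) (word_value class_value w)) p = (0 :: 'a word \<Rightarrow>\<^sub>0 'k)"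
      by (rule word_value_multilin[OF _ _ subset_refl that]) (simp_all only: desusp_simps class_value_linear)
    then show ?thesis by simp
  qed
  have ker: "?F n p = 0 \<longleftrightarrow> p \<in> ?M n" if p: "p \<in> free (?X n)" for n p
  proof
    assume F: "?F n p = 0"
    have "lin (word_value bead_class) (?F n p) - p \<in> ?M n"
      by (rule free_linear_image[OF linear_map_difference[OF linear_map_comp[OF linear_map_lin linear_map_lin]
              linear_map_ident] submod_multilin _ p])
         (unfold lin_gen, rule bead_class_word_value)
    then have "- p \<in> ?M n" by (simp add: F lin_simps)
    then show "p \<in> ?M n" using submod_minus[OF submod_multilin] by fastforce
  qed (rule null_zero)
  have surj: "\<exists>p\<in>free (?X n). ?F n p = gen w" if w: "w \<in> bead_words n" for n w
    by (rule bexI[where x = "word_value bead_class w"]) (rule class_value_bead_class[OF w], rule word_value_bead_class_in[OF w])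
  have d_in: "cobar_word ?C w \<in> free (?X (n - 1))" if "w \<in> ?X n" for n w
    using cobar_word_in[OF that] ..
  have F_d: "?F (n - 1) (cobar_word ?C w) = lin (word_deriv letter_deriv) (?F n (gen w))"
    if "w \<in> ?X n" for n w
    unfolding lin_gen by (rule cobar_word_value[OF that])
  have mu_in: "word_mult p q \<in> free (?X (m + n))" if "p \<in> free (?X m)" "q \<in> free (?X n)" for m n p q
    by (rule bilin_in_submod[OF submod_free gen_in_free[OF words_append] that])
  have unit_in: "gen [] \<in> free (?X 0)" by (rule gen_in_free) (simp add: words_Nil)
  have F_unit: "?F 0 (gen []) = gen []" by simp
  note iso = quot_dga_iso_word_dga[where F = ?F and X = ?X and Y = bead_words and M = ?M,
      OF dg_algebra_bead_dga submod_multilin M linear_map_lin F_in ker surj d_in F_d mu_in lin_word_value_mult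
        unit_in F_unit]
  show "dg_algebra (cobar ?C)" and "\<exists>\<phi>. dga_iso (cobar ?C) bead_dga \<phi>"
    unfolding cobar by (rule iso; assumption)+
qed

end

theorem theorem7p1:
  fixes S :: "(nat, 'a) psh" and x :: 'a
  assumes "simplicial_set S" and "cells S 0 = {x}"
  shows "dga_isomorphic
    (Lambda S x :: ('k::{comm_ring,comm_monoid_mult}, ('a rig_cell \<Rightarrow>\<^sub>0 'k) set) dga)
    (cobar (Q_simp S))"
proof -
  interpret reduced_simplicial S x using assms by unfold_locales
  obtain \<phi> where \<phi>: "dga_iso (Lambda S x :: ('k, ('a rig_cell \<Rightarrow>\<^sub>0 'k) set) dga) bead_dga \<phi>"
    using Lambda_iso_bead_dga(2) by blast
  obtain \<psi> where \<psi>: "dga_iso (cobar (Q_simp S :: ('k, ('a \<Rightarrow>\<^sub>0 'k) set) dgc)) bead_dga \<psi>"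
    using cobar_iso_bead_dga(2) by blast
  show ?thesis
    by (rule dga_isomorphic_via[OF Lambda_iso_bead_dga(1) \<phi> cobar_iso_bead_dga(1) \<psi>])
qed

end
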